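(* $U_{\mathbf q}(\mathfrak g_A)$ is isomorphic, as a Hopf algebra, to the Drinfeld double $\mathcal D(U_{\mathbf q}^{\ge0},U_{\mathbf q}^{\le0},\langle\,,\,\rangle_{\mathbf q})$.
   Context: Let $A=(a_{ij})_{i,j\in I}$ be a symmetrizable generalized Cartan matrix ($I$ finite); $Q=\bigoplus_i\mathbb Z\alpha_i$. Let $q_{ij}$ ($i,j\in I$) be indeterminates over $\mathbb Q$ subject to $q_{ij}q_{ji}=q_{ii}^{a_{ij}}$, and $\mathbb K\supset\mathbb Q(q_{ij}\mid i,j\in I)$ a field containing $q_{ii}^{1/m}$ for all positive integers $m$. The $q_{ii}$ are not roots of unity. Notation: $(n)_v=\frac{v^n-1}{v-1}$, $(n)_v!=(n)_v\cdots(1)_v$, $(0)_v!=1$, $\binom nk_v=\frac{(n)_v!}{(k)_v!(n-k)_v!}$. $U_{\mathbf q}(\mathfrak g_A)$ is the associative unital $\mathbb K$-algebra generated by $e_i,f_i,\omega_i^{\pm1},\omega_i'^{\pm1}$ ($i\in I$) with relations: all $\omega_i^{\pm1},\omega_j'^{\pm1}$ commute with each other, $\omega_i\omega_i^{-1}=\omega_i'\omega_i'^{-1}=1$; $\omega_ie_j\omega_i^{-1}=q_{ij}e_j$, $\omega_i'e_j\omega_i'^{-1}=q_{ji}^{-1}e_j$; $\omega_if_j\omega_i^{-1}=q_{ij}^{-1}f_j$, $\omega_i'f_j\omega_i'^{-1}=q_{ji}f_j$; $e_if_j-f_je_i=\delta_{ij}\frac{q_{ii}}{q_{ii}-1}(\omega_i-\omega_i')$;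 and for $i\neq j$ $$\sum_{k=0}^{1-a_{ij}}(-1)^k\tbinom{1-a_{ij}}{k}_{q_{ii}}q_{ii}^{k(k-1)/2}q_{ij}^k e_i^{1-a_{ij}-k}e_je_i^k=0,\qquad \sum_{k=0}^{1-a_{ij}}(-1)^k\tbinom{1-a_{ij}}{k}_{q_{ii}}q_{ii}^{k(k-1)/2}q_{ij}^k f_i^kf_jf_i^{1-a_{ij}-k}=0.$$ It is a Hopf algebra with $\omega_i^{\pm1},\omega_i'^{\pm1}$ group-like, $\Delta(e_i)=e_i\otimes1+\omega_i\otimes e_i$, $\Delta(f_i)=1\otimes f_i+f_i\otimes\omega_i'$, $\varepsilon(e_i)=\varepsilon(f_i)=0$, $S(e_i)=-\omega_i^{-1}e_i$, $S(f_i)=-f_i\omega_i'^{-1}$. $U_{\mathbf q}^{\ge0}$ (resp. $U_{\mathbf q}^{\le0}$) is the Hopf subalgebra generated by all $e_i,\omega_i^{\pm1}$ (resp. all $f_i,\omega_i'^{\pm1}$). For $\mu=\sum\mu_i\alpha_i$, $\nu=\sum\nu_j\alpha_j\in Q$: $\omega_\mu=\prod\omega_i^{\mu_i}$, $\omega'_\mu=\prod\omega_i'^{\mu_i}$, $q_{\mu\nu}=\prod_{i,j}q_{ij}^{\mu_i\nu_j}$. The pairing $\langle\,,\,\rangle_{\mathbf q}:U_{\mathbf q}^{\le0}\times U_{\mathbf q}^{\ge0}\to\mathbb K$ is the unique bilinear pairing with $\langle y,xx'\rangle_{\mathbf q}=\langle\Delta(y),x'\otimes x\rangle_{\mathbf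 q}$, $\langle yy',x\rangle_{\mathbf q}=\langle y\otimes y',\Delta(x)\rangle_{\mathbf q}$, $\langle f_i,e_j\rangle_{\mathbf q}=\delta_{ij}\frac{q_{ii}}{1-q_{ii}}$, $\langle\omega'_\mu,\omega_\nu\rangle_{\mathbf q}=q_{\nu\mu}$, $\langle\omega'_\mu,e_i\rangle_{\mathbf q}=0=\langle f_i,\omega_\mu\rangle_{\mathbf q}$. For Hopf algebras $\mathcal A,\mathcal B$ with a skew-dual pairing $\langle\,,\,\rangle:\mathcal B\times\mathcal A\to\mathbb K$ (satisfying the first two identities above), the Drinfeld double $\mathcal D(\mathcal A,\mathcal B,\langle\,,\,\rangle)$ is the Hopf algebra with underlying space $\mathcal A\otimes\mathcal B$, tensor product coalgebra structure, multiplication $$(a\otimes b)(a'\otimes b')=\sum\langle S_{\mathcal B}(b_{(1)}),a'_{(1)}\rangle\langle b_{(3)},a'_{(3)}\rangle\,aa'_{(2)}\otimes b_{(2)}b',$$ and antipode $S(a\otimes b)=(1\otimes S_{\mathcal B}(b))(S_{\mathcal A}(a)\otimes1)$. *)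

theory Defs
  imports "HOL-Library.Poly_Mapping" "HOL-Algebra.Algebraic_Closure_Type" "HOL-Algebra.Algebra"
begin

text \<open>The ground field is a type \<open>'k\<close> of class \<^class>\<open>field\<close>; it is handed to the locales of
  HOL-Algebra as the ring \<^const>\<open>ring_of_type_algebra\<close>.\<close>

definition scalars :: "('k::field, 'k) module" where
  "scalars = ring.extend ring_of_type_algebra (module.fields (*))"

definition linear_maps ::
    "('k, 'a, 'm) module_scheme \<Rightarrow> ('k::field, 'b, 'n) module_scheme \<Rightarrow> ('a \<Rightarrow> 'b) set" where
  "linear_maps M N = {f \<in> carrier M \<rightarrow> carrier N.
     (\<forall>x\<in>carrier M. \<forall>y\<in>carrier M. f (x \<oplus>\<^bsub>M\<^esub> y) = f x \<oplus>\<^bsub>N\<^esub> f y) \<and>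
     (\<forall>k. \<forall>x\<in>carrier M. f (k \<odot>\<^bsub>M\<^esub> x) = k \<odot>\<^bsub>N\<^esub> f x)}"

definition algebra_homs ::
    "('k, 'a, 'm) module_scheme \<Rightarrow> ('k::field, 'b, 'n) module_scheme \<Rightarrow> ('a \<Rightarrow> 'b) set" where
  "algebra_homs M N = ring_hom M N \<inter> linear_maps M N"

definition submodule_span :: "('k::field, 'a, 'm) module_scheme \<Rightarrow> 'a set \<Rightarrow> 'a set" where
  "submodule_span M S = \<Inter>{N. submodule N (ring_of_type_algebra :: 'k ring) M \<and> S \<subseteq> N}"

text \<open>Quotient of a module by a submodule, and of an algebra by a two-sided ideal: the quotient
  ring of the library together with the induced scalar multiplication.\<close>

definition quot_module :: "('k::field, 'a, 'm) module_scheme \<Rightarrow> 'a set \<Rightarrow> ('k, 'a set) module" where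
  "quot_module M N = ring.extend (M Quot N)
     (module.fields (\<lambda>k \<xi>. \<Union>x\<in>\<xi>. N +>\<^bsub>M\<^esub> (k \<odot>\<^bsub>M\<^esub> x)))"

definition pm_scale :: "'k::field \<Rightarrow> ('x \<Rightarrow>\<^sub>0 'k) \<Rightarrow> ('x \<Rightarrow>\<^sub>0 'k)" where
  "pm_scale k = Poly_Mapping.map ((*) k)"

text \<open>The free vector space on a set. The ring multiplication of the record is irrelevant here.\<close>

definition free_module :: "'x set \<Rightarrow> ('k::field, 'x \<Rightarrow>\<^sub>0 'k) module" where
  "free_module S = \<lparr>carrier = {x. Poly_Mapping.keys x \<subseteq> S}, monoid.mult = (\<lambda>_ _. 0), one = 0,
     ring.zero = 0, add = (+), module.smult = pm_scale\<rparr>"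

definition bilinear_relations ::
    "('k::field, 'a, 'm) module_scheme \<Rightarrow> ('k, 'b, 'n) module_scheme \<Rightarrow> ('a \<times> 'b \<Rightarrow>\<^sub>0 'k) set" where
  "bilinear_relations A B =
     {Poly_Mapping.single (a \<oplus>\<^bsub>A\<^esub> a', b) 1 - Poly_Mapping.single (a, b) 1
        - Poly_Mapping.single (a', b) 1 | a a' b. a \<in> carrier A \<and> a' \<in> carrier A \<and> b \<in> carrier B} \<union>
     {Poly_Mapping.single (a, b \<oplus>\<^bsub>B\<^esub> b') 1 - Poly_Mapping.single (a, b) 1
        - Poly_Mapping.single (a, b') 1 | a b b'. a \<in> carrier A \<and> b \<in> carrier B \<and> b' \<in> carrier B} \<union>
     {Poly_Mapping.single (k \<odot>\<^bsub>A\<^esub> a, b) 1 - Poly_Mapping.single (a, b) k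
        | k a b. a \<in> carrier A \<and> b \<in> carrier B} \<union>
     {Poly_Mapping.single (a, k \<odot>\<^bsub>B\<^esub> b) 1 - Poly_Mapping.single (a, b) k
        | k a b. a \<in> carrier A \<and> b \<in> carrier B}"

definition tensor_null ::
    "('k::field, 'a, 'm) module_scheme \<Rightarrow> ('k, 'b, 'n) module_scheme \<Rightarrow> ('a \<times> 'b \<Rightarrow>\<^sub>0 'k) set" where
  "tensor_null A B =
     submodule_span (free_module (carrier A \<times> carrier B)) (bilinear_relations A B)"

definition tensor_module ::
    "('k::field, 'a, 'm) module_scheme \<Rightarrow> ('k, 'b, 'n) module_scheme \<Rightarrow>
     ('k, ('a \<times> 'b \<Rightarrow>\<^sub>0 'k) set) module" where
  "tensor_module A B = quot_module (free_module (carrier A \<times> carrier B)) (tensor_null A B)"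

text \<open>\<open>pure_tensor A B a b\<close> is \<open>a \<otimes> b \<in> A \<otimes> B\<close>.\<close>

definition pure_tensor ::
    "('k::field, 'a, 'm) module_scheme \<Rightarrow> ('k, 'b, 'n) module_scheme \<Rightarrow> 'a \<Rightarrow> 'b \<Rightarrow>
     ('a \<times> 'b \<Rightarrow>\<^sub>0 'k) set" where
  "pure_tensor A B a b =
     tensor_null A B +>\<^bsub>free_module (carrier A \<times> carrier B)\<^esub> Poly_Mapping.single (a, b) 1"

text \<open>\<open>tensor_lift V f\<close> is the linear map \<open>A \<otimes> B \<rightarrow> V\<close> induced by a bilinear map
  \<open>f : A \<times> B \<rightarrow> V\<close>; all representatives in a coset then have the same image.\<close>

definition tensor_lift ::
    "('k::field, 'v, 'm) module_scheme \<Rightarrow> ('a \<Rightarrow> 'b \<Rightarrow> 'v) \<Rightarrow> ('a \<times> 'b \<Rightarrow>\<^sub>0 'k) set \<Rightarrow> 'v" where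
  "tensor_lift V f T = the_elem
     ((\<lambda>t. \<Oplus>\<^bsub>V\<^esub>p\<in>Poly_Mapping.keys t. Poly_Mapping.lookup t p \<odot>\<^bsub>V\<^esub> f (fst p) (snd p)) ` T)"

definition tensor_algebra ::
    "('k::field, 'a, 'm) module_scheme \<Rightarrow> ('k, 'b, 'n) module_scheme \<Rightarrow>
     ('k, ('a \<times> 'b \<Rightarrow>\<^sub>0 'k) set) module" where
  "tensor_algebra A B = (tensor_module A B)
     \<lparr>monoid.mult := (\<lambda>\<xi> \<eta>. tensor_lift (tensor_module A B) (\<lambda>a b.
                  tensor_lift (tensor_module A B) (\<lambda>a' b'.
                    pure_tensor A B (a \<otimes>\<^bsub>A\<^esub> a') (b \<otimes>\<^bsub>B\<^esub> b')) \<eta>) \<xi>),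
      one := pure_tensor A B \<one>\<^bsub>A\<^esub> \<one>\<^bsub>B\<^esub>\<rparr>"

record (overloaded) ('k::zero, 'a) hopf = "('k, 'a) module" +
  comult :: "'a \<Rightarrow> ('a \<times> 'a \<Rightarrow>\<^sub>0 'k) set"
  counit :: "'a \<Rightarrow> 'k"
  antipode :: "'a \<Rightarrow> 'a"

text \<open>\<open>sweedler H V f x\<close> is \<open>\<Sum> f x\<^sub>(\<^sub>1\<^sub>) x\<^sub>(\<^sub>2\<^sub>)\<close> and \<open>sweedler3 H V f x\<close> is
  \<open>\<Sum> f x\<^sub>(\<^sub>1\<^sub>) x\<^sub>(\<^sub>2\<^sub>) x\<^sub>(\<^sub>3\<^sub>)\<close>, for multilinear \<open>f\<close> with values in \<open>V\<close>.\<close>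

definition sweedler ::
    "('k::field, 'a, 'm) hopf_scheme \<Rightarrow> ('k, 'v, 'n) module_scheme \<Rightarrow> ('a \<Rightarrow> 'a \<Rightarrow> 'v) \<Rightarrow> 'a \<Rightarrow> 'v" where
  "sweedler H V f x = tensor_lift V f (comult H x)"

definition sweedler3 ::
    "('k::field, 'a, 'm) hopf_scheme \<Rightarrow> ('k, 'v, 'n) module_scheme \<Rightarrow>
     ('a \<Rightarrow> 'a \<Rightarrow> 'a \<Rightarrow> 'v) \<Rightarrow> 'a \<Rightarrow> 'v" where
  "sweedler3 H V f x = sweedler H V (\<lambda>y c. sweedler H V (\<lambda>a b. f a b c) y) x"

locale hopf_algebra =
  ring H for H :: "('k::field, 'a, 'm) hopf_scheme" (structure) +
  assumes vector_space: "Module.module (ring_of_type_algebra :: 'k ring) H"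
    and smult_mult_left:
      "x \<in> carrier H \<Longrightarrow> y \<in> carrier H \<Longrightarrow> (k \<odot> x) \<otimes> y = k \<odot> (x \<otimes> y)"
    and smult_mult_right:
      "x \<in> carrier H \<Longrightarrow> y \<in> carrier H \<Longrightarrow> x \<otimes> (k \<odot> y) = k \<odot> (x \<otimes> y)"
    and comult_hom: "comult H \<in> algebra_homs H (tensor_algebra H H)"
    and counit_hom: "counit H \<in> algebra_homs H scalars"
    and antipode_linear: "antipode H \<in> linear_maps H H"
    and coassoc: "x \<in> carrier H \<Longrightarrow>
      sweedler H (tensor_algebra H (tensor_algebra H H)) (\<lambda>y c.
        sweedler H (tensor_algebra H (tensor_algebra H H)) (\<lambda>a b.
          pure_tensor H (tensor_algebra H H) a (pure_tensor H H b c)) y) x =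
      sweedler H (tensor_algebra H (tensor_algebra H H)) (\<lambda>a y.
        sweedler H (tensor_algebra H (tensor_algebra H H)) (\<lambda>b c.
          pure_tensor H (tensor_algebra H H) a (pure_tensor H H b c)) y) x"
    and counit_left: "x \<in> carrier H \<Longrightarrow> sweedler H H (\<lambda>a b. counit H a \<odot> b) x = x"
    and counit_right: "x \<in> carrier H \<Longrightarrow> sweedler H H (\<lambda>a b. counit H b \<odot> a) x = x"
    and antipode_left:
      "x \<in> carrier H \<Longrightarrow> sweedler H H (\<lambda>a b. antipode H a \<otimes> b) x = counit H x \<odot> \<one>"
    and antipode_right:
      "x \<in> carrier H \<Longrightarrow> sweedler H H (\<lambda>a b. a \<otimes> antipode H b) x = counit H x \<odot> \<one>"

definition hopf_iso ::
    "('k::field, 'a, 'm) hopf_scheme \<Rightarrow> ('k, 'b, 'n) hopf_scheme \<Rightarrow> ('a \<Rightarrow> 'b) set" where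
  "hopf_iso H H' = {\<phi> \<in> algebra_homs H H'. bij_betw \<phi> (carrier H) (carrier H') \<and>
     (\<forall>x\<in>carrier H. comult H' (\<phi> x) =
        sweedler H (tensor_algebra H' H') (\<lambda>a b. pure_tensor H' H' (\<phi> a) (\<phi> b)) x) \<and>
     (\<forall>x\<in>carrier H. counit H' (\<phi> x) = counit H x) \<and>
     (\<forall>x\<in>carrier H. \<phi> (antipode H x) = antipode H' (\<phi> x))}"

definition hopf_isomorphic ::
    "('k::field, 'a, 'm) hopf_scheme \<Rightarrow> ('k, 'b, 'n) hopf_scheme \<Rightarrow> bool" where
  "hopf_isomorphic H H' \<longleftrightarrow> hopf_algebra H \<and> hopf_algebra H' \<and> hopf_iso H H' \<noteq> {}"

text \<open>For subspaces \<open>C\<close>, \<open>C'\<close> of \<open>H\<close> the tensor product of \<open>C\<close> and \<open>C'\<close> is not a subset of the one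
  of \<open>H\<close> with itself, as the cosets differ; \<open>tensor_incl\<close> is the canonical map between them.\<close>

definition tensor_incl ::
    "('k::field, 'a, 'm) module_scheme \<Rightarrow> ('a \<times> 'a \<Rightarrow>\<^sub>0 'k) set \<Rightarrow> ('a \<times> 'a \<Rightarrow>\<^sub>0 'k) set" where
  "tensor_incl H = tensor_lift (tensor_module H H) (pure_tensor H H)"

definition hopf_subalgebra :: "'a set \<Rightarrow> ('k::field, 'a, 'm) hopf_scheme \<Rightarrow> bool" where
  "hopf_subalgebra C H \<longleftrightarrow> subring C H \<and> submodule C (ring_of_type_algebra :: 'k ring) H \<and>
     comult H ` C \<subseteq> tensor_incl H ` carrier (tensor_module (H\<lparr>carrier := C\<rparr>) (H\<lparr>carrier := C\<rparr>)) \<and>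
     antipode H ` C \<subseteq> C"

definition hopf_subalgebra_generated ::
    "('k::field, 'a, 'm) hopf_scheme \<Rightarrow> 'a set \<Rightarrow> 'a set" where
  "hopf_subalgebra_generated H S = \<Inter>{C. hopf_subalgebra C H \<and> S \<subseteq> C}"

text \<open>Over a field \<open>tensor_incl\<close> is injective on \<open>C \<otimes> C\<close>, so the coproduct of a Hopf subalgebra is
  the preimage of the ambient one.\<close>

definition restrict_hopf ::
    "('k::field, 'a, 'm) hopf_scheme \<Rightarrow> 'a set \<Rightarrow> ('k, 'a, 'm) hopf_scheme" where
  "restrict_hopf H C = H\<lparr>carrier := C,
     comult := (\<lambda>x. inv_into (carrier (tensor_module (H\<lparr>carrier := C\<rparr>) (H\<lparr>carrier := C\<rparr>)))
       (tensor_incl H) (comult H x))\<rparr>"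

definition skew_dual_pairing ::
    "('k::field, 'a, 'm) hopf_scheme \<Rightarrow> ('k, 'b, 'n) hopf_scheme \<Rightarrow> ('b \<Rightarrow> 'a \<Rightarrow> 'k) \<Rightarrow> bool" where
  "skew_dual_pairing A B p \<longleftrightarrow>
     (\<forall>b\<in>carrier B. p b \<in> linear_maps A scalars) \<and>
     (\<forall>a\<in>carrier A. (\<lambda>b. p b a) \<in> linear_maps B scalars) \<and>
     (\<forall>b\<in>carrier B. \<forall>a\<in>carrier A. \<forall>a'\<in>carrier A.
        p b (a \<otimes>\<^bsub>A\<^esub> a') = sweedler B scalars (\<lambda>b1 b2. p b1 a' * p b2 a) b) \<and>
     (\<forall>b\<in>carrier B. \<forall>b'\<in>carrier B. \<forall>a\<in>carrier A.
        p (b \<otimes>\<^bsub>B\<^esub> b') a = sweedler A scalars (\<lambda>a1 a2. p b a1 * p b' a2) a)"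

definition double_mult ::
    "('k::field, 'a, 'm) hopf_scheme \<Rightarrow> ('k, 'b, 'n) hopf_scheme \<Rightarrow> ('b \<Rightarrow> 'a \<Rightarrow> 'k) \<Rightarrow>
     ('a \<times> 'b \<Rightarrow>\<^sub>0 'k) set \<Rightarrow> ('a \<times> 'b \<Rightarrow>\<^sub>0 'k) set \<Rightarrow> ('a \<times> 'b \<Rightarrow>\<^sub>0 'k) set" where
  "double_mult A B p \<xi> \<eta> =
     (let T = tensor_module A B in
      tensor_lift T (\<lambda>a b. tensor_lift T (\<lambda>a' b'.
        sweedler3 B T (\<lambda>b1 b2 b3. sweedler3 A T (\<lambda>a1 a2 a3.
          (p (antipode B b1) a1 * p b3 a3) \<odot>\<^bsub>T\<^esub> pure_tensor A B (a \<otimes>\<^bsub>A\<^esub> a2) (b2 \<otimes>\<^bsub>B\<^esub> b')) a') b) \<eta>) \<xi>)"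

definition double_comult ::
    "('k::field, 'a, 'm) hopf_scheme \<Rightarrow> ('k, 'b, 'n) hopf_scheme \<Rightarrow>
     ('a \<times> 'b \<Rightarrow>\<^sub>0 'k) set \<Rightarrow> (('a \<times> 'b \<Rightarrow>\<^sub>0 'k) set \<times> ('a \<times> 'b \<Rightarrow>\<^sub>0 'k) set \<Rightarrow>\<^sub>0 'k) set" where
  "double_comult A B \<xi> =
     (let T = tensor_module A B; TT = tensor_module T T in
      tensor_lift TT (\<lambda>a b. sweedler A TT (\<lambda>a1 a2. sweedler B TT (\<lambda>b1 b2.
        pure_tensor T T (pure_tensor A B a1 b1) (pure_tensor A B a2 b2)) b) a) \<xi>)"

definition drinfeld_double ::
    "('k::field, 'a, 'm) hopf_scheme \<Rightarrow> ('k, 'b, 'n) hopf_scheme \<Rightarrow> ('b \<Rightarrow> 'a \<Rightarrow> 'k) \<Rightarrow>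
     ('k, ('a \<times> 'b \<Rightarrow>\<^sub>0 'k) set) hopf" where
  "drinfeld_double A B p =
     module.extend
       ((tensor_module A B)\<lparr>monoid.mult := double_mult A B p, one := pure_tensor A B \<one>\<^bsub>A\<^esub> \<one>\<^bsub>B\<^esub>\<rparr>)
       (hopf.fields
         (double_comult A B)
         (tensor_lift scalars (\<lambda>a b. counit A a * counit B b))
         (tensor_lift (tensor_module A B) (\<lambda>a b.
            double_mult A B p (pure_tensor A B \<one>\<^bsub>A\<^esub> (antipode B b))
                              (pure_tensor A B (antipode A a) \<one>\<^bsub>B\<^esub>))))"

text \<open>The free monoid, written additively so that \<open>'g word \<Rightarrow>\<^sub>0 'k\<close> becomes
  the monoid algebra (the free algebra) through the instances of the library.\<close>

datatype 'g word = Word (letters: "'g list")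

instantiation word :: (type) monoid_add
begin

definition zero_word :: "'g word" where "zero_word = Word []"

definition plus_word :: "'g word \<Rightarrow> 'g word \<Rightarrow> 'g word" where
  "plus_word u v = Word (letters u @ letters v)"

instance by standard (simp_all add: zero_word_def plus_word_def)

end

definition free_algebra :: "('k::field, 'g word \<Rightarrow>\<^sub>0 'k) module" where
  "free_algebra = ring.extend ring_of_type_algebra (module.fields pm_scale)"

definition letter :: "'g \<Rightarrow> ('g word \<Rightarrow>\<^sub>0 'k::field)" where
  "letter g = Poly_Mapping.single (Word [g]) 1"

definition mult_list :: "('a, 'm) monoid_scheme \<Rightarrow> 'a list \<Rightarrow> 'a" where
  "mult_list M xs = foldr (monoid.mult M) xs \<one>\<^bsub>M\<^esub>"

definition free_lift ::
    "('k::field, 'a, 'm) module_scheme \<Rightarrow> ('g \<Rightarrow> 'a) \<Rightarrow> ('g word \<Rightarrow>\<^sub>0 'k) \<Rightarrow> 'a" where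
  "free_lift M v x =
     (\<Oplus>\<^bsub>M\<^esub>w\<in>Poly_Mapping.keys x. Poly_Mapping.lookup x w \<odot>\<^bsub>M\<^esub> mult_list M (map v (letters w)))"

text \<open>The map induced on a quotient of the free algebra by an algebra homomorphism
  \<open>free_lift M v\<close> that kills the ideal: all elements of a coset have the same image.\<close>

definition quot_free_lift ::
    "('k::field, 'a, 'm) module_scheme \<Rightarrow> ('g \<Rightarrow> 'a) \<Rightarrow> ('g word \<Rightarrow>\<^sub>0 'k) set \<Rightarrow> 'a" where
  "quot_free_lift M v \<xi> = the_elem (free_lift M v ` \<xi>)"

definition opposite :: "('k::field, 'a) module \<Rightarrow> ('k, 'a) module" where
  "opposite M = M\<lparr>monoid.mult := (\<lambda>x y. y \<otimes>\<^bsub>M\<^esub> x)\<rparr>"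

definition symmetrizable_gcm :: "('i::finite \<Rightarrow> 'i \<Rightarrow> int) \<Rightarrow> bool" where
  "symmetrizable_gcm A \<longleftrightarrow>
     (\<forall>i. A i i = 2) \<and> (\<forall>i j. i \<noteq> j \<longrightarrow> A i j \<le> 0) \<and> (\<forall>i j. A i j = 0 \<longleftrightarrow> A j i = 0) \<and>
     (\<exists>d :: 'i \<Rightarrow> nat. (\<forall>i. d i > 0) \<and> (\<forall>i j. int (d i) * A i j = int (d j) * A j i))"

definition laurent_monomial :: "('i::finite \<Rightarrow> 'i \<Rightarrow> 'k::field) \<Rightarrow> ('i \<Rightarrow> 'i \<Rightarrow> int) \<Rightarrow> 'k" where
  "laurent_monomial q v = (\<Prod>i\<in>UNIV. \<Prod>j\<in>UNIV. q i j powi v i j)"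

text \<open>The exponent vector of \<open>q\<^sub>i\<^sub>j q\<^sub>j\<^sub>i q\<^sub>i\<^sub>i\<^bsup>-a\<^sub>i\<^sub>j\<^esup>\<close>.\<close>

definition relation_exponent :: "('i \<Rightarrow> 'i \<Rightarrow> int) \<Rightarrow> 'i \<Rightarrow> 'i \<Rightarrow> 'i \<Rightarrow> 'i \<Rightarrow> int" where
  "relation_exponent A i j k l =
     of_bool ((k, l) = (i, j)) + of_bool ((k, l) = (j, i)) - A i j * of_bool ((k, l) = (i, i))"

definition dependent_exponents ::
    "('i::finite \<Rightarrow> 'i \<Rightarrow> int) \<Rightarrow> ('i \<Rightarrow> 'i \<Rightarrow> int) \<Rightarrow> ('i \<Rightarrow> 'i \<Rightarrow> int) \<Rightarrow> bool" where
  "dependent_exponents A v w \<longleftrightarrow> (\<exists>n>0. \<exists>c :: 'i \<Rightarrow> 'i \<Rightarrow> int. \<forall>k l.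
     n * (v k l - w k l) = (\<Sum>i\<in>UNIV. \<Sum>j\<in>UNIV. c i j * relation_exponent A i j k l))"

text \<open>Indeterminates over \<open>\<rat>\<close> subject to \<open>q\<^sub>i\<^sub>j q\<^sub>j\<^sub>i = q\<^sub>i\<^sub>i\<^bsup>a\<^sub>i\<^sub>j\<^esup>\<close>: apart from these relations the
  \<open>q\<^sub>i\<^sub>j\<close> are algebraically independent. The exponent group modulo the relations can have torsion
  (for \<open>a\<^sub>1\<^sub>2 = a\<^sub>2\<^sub>1 = -2\<close> one gets \<open>q\<^sub>1\<^sub>1\<^bsup>2\<^esup> = q\<^sub>2\<^sub>2\<^bsup>2\<^esup>\<close>), whose elements become roots of unity in a field.
  Hence independence is required of monomials whose exponents differ modulo torsion.\<close>

definition constrained_indeterminates ::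
    "('i::finite \<Rightarrow> 'i \<Rightarrow> int) \<Rightarrow> ('i \<Rightarrow> 'i \<Rightarrow> 'k::field_char_0) \<Rightarrow> bool" where
  "constrained_indeterminates A q \<longleftrightarrow>
     (\<forall>i j. q i j \<noteq> 0) \<and> (\<forall>i j. q i j * q j i = q i i powi A i j) \<and>
     (\<forall>V (c :: _ \<Rightarrow> rat). finite V \<and> pairwise (\<lambda>v w. \<not> dependent_exponents A v w) V \<and>
        (\<Sum>v\<in>V. of_rat (c v) * laurent_monomial q v) = 0 \<longrightarrow> (\<forall>v\<in>V. c v = 0))"

definition qint :: "'k::field \<Rightarrow> nat \<Rightarrow> 'k" where
  "qint v n = (v ^ n - 1) / (v - 1)"

definition qfact :: "'k::field \<Rightarrow> nat \<Rightarrow> 'k" where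
  "qfact v n = (\<Prod>m=1..n. qint v m)"

definition qbinom :: "'k::field \<Rightarrow> nat \<Rightarrow> nat \<Rightarrow> 'k" where
  "qbinom v n k = qfact v n / (qfact v k * qfact v (n - k))"

text \<open>\<open>Om i\<close>, \<open>OmInv i\<close>, \<open>Om' i\<close>, \<open>Om'Inv i\<close> stand for
  \<open>\<omega>\<^sub>i\<close>, \<open>\<omega>\<^sub>i\<^bsup>-1\<^esup>\<close>, \<open>\<omega>'\<^sub>i\<close>, \<open>\<omega>'\<^sub>i\<^bsup>-1\<^esup>\<close>.\<close>

datatype 'i gen = E 'i | F 'i | Om 'i | OmInv 'i | Om' 'i | Om'Inv 'i

definition serre_exponent :: "('i \<Rightarrow> 'i \<Rightarrow> int) \<Rightarrow> 'i \<Rightarrow> 'i \<Rightarrow> nat" where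
  "serre_exponent A i j = nat (1 - A i j)"

definition serre_coeff ::
    "('i \<Rightarrow> 'i \<Rightarrow> int) \<Rightarrow> ('i \<Rightarrow> 'i \<Rightarrow> 'k::field) \<Rightarrow> 'i \<Rightarrow> 'i \<Rightarrow> nat \<Rightarrow> 'k" where
  "serre_coeff A q i j k = (-1) ^ k * qbinom (q i i) (serre_exponent A i j) k
     * q i i ^ (k * (k - 1) div 2) * q i j ^ k"

definition serre_e ::
    "('i \<Rightarrow> 'i \<Rightarrow> int) \<Rightarrow> ('i \<Rightarrow> 'i \<Rightarrow> 'k::field) \<Rightarrow> 'i \<Rightarrow> 'i \<Rightarrow> ('i gen word \<Rightarrow>\<^sub>0 'k)" where
  "serre_e A q i j = (\<Sum>k=0..serre_exponent A i j. pm_scale (serre_coeff A q i j k)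
     (letter (E i) ^ (serre_exponent A i j - k) * letter (E j) * letter (E i) ^ k))"

definition serre_f ::
    "('i \<Rightarrow> 'i \<Rightarrow> int) \<Rightarrow> ('i \<Rightarrow> 'i \<Rightarrow> 'k::field) \<Rightarrow> 'i \<Rightarrow> 'i \<Rightarrow> ('i gen word \<Rightarrow>\<^sub>0 'k)" where
  "serre_f A q i j = (\<Sum>k=0..serre_exponent A i j. pm_scale (serre_coeff A q i j k)
     (letter (F i) ^ k * letter (F j) * letter (F i) ^ (serre_exponent A i j - k)))"

text \<open>A relation \<open>l = r\<close> is given by the element \<open>l - r\<close> of the free algebra.\<close>

inductive_set Uq_relations ::
    "('i \<Rightarrow> 'i \<Rightarrow> int) \<Rightarrow> ('i \<Rightarrow> 'i \<Rightarrow> 'k::field) \<Rightarrow> ('i gen word \<Rightarrow>\<^sub>0 'k) set"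
  for A :: "'i \<Rightarrow> 'i \<Rightarrow> int" and q :: "'i \<Rightarrow> 'i \<Rightarrow> 'k::field"
  where
    torus_comm:
      "s \<in> range Om \<union> range OmInv \<union> range Om' \<union> range Om'Inv \<Longrightarrow>
       t \<in> range Om \<union> range OmInv \<union> range Om' \<union> range Om'Inv \<Longrightarrow>
       letter s * letter t - letter t * letter s \<in> Uq_relations A q"
  | Om_inv: "letter (Om i) * letter (OmInv i) - 1 \<in> Uq_relations A q"
  | Om'_inv: "letter (Om' i) * letter (Om'Inv i) - 1 \<in> Uq_relations A q"
  | Om_E: "letter (Om i) * letter (E j) * letter (OmInv i)
      - pm_scale (q i j) (letter (E j)) \<in> Uq_relations A q"
  | Om'_E: "letter (Om' i) * letter (E j) * letter (Om'Inv i)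
      - pm_scale (inverse (q j i)) (letter (E j)) \<in> Uq_relations A q"
  | Om_F: "letter (Om i) * letter (F j) * letter (OmInv i)
      - pm_scale (inverse (q i j)) (letter (F j)) \<in> Uq_relations A q"
  | Om'_F: "letter (Om' i) * letter (F j) * letter (Om'Inv i)
      - pm_scale (q j i) (letter (F j)) \<in> Uq_relations A q"
  | E_F: "letter (E i) * letter (F j) - letter (F j) * letter (E i)
      - (if i = j then pm_scale (q i i / (q i i - 1)) (letter (Om i) - letter (Om' i)) else 0)
      \<in> Uq_relations A q"
  | serre_E: "i \<noteq> j \<Longrightarrow> serre_e A q i j \<in> Uq_relations A q"
  | serre_F: "i \<noteq> j \<Longrightarrow> serre_f A q i j \<in> Uq_relations A q"

type_synonym ('i, 'k) Uq_elem = "('i gen word \<Rightarrow>\<^sub>0 'k) set"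

definition Uq_ideal ::
    "('i \<Rightarrow> 'i \<Rightarrow> int) \<Rightarrow> ('i \<Rightarrow> 'i \<Rightarrow> 'k::field) \<Rightarrow> ('i gen word \<Rightarrow>\<^sub>0 'k) set" where
  "Uq_ideal A q = Idl\<^bsub>free_algebra :: ('k, 'i gen word \<Rightarrow>\<^sub>0 'k) module\<^esub> (Uq_relations A q)"

definition Uq_algebra ::
    "('i \<Rightarrow> 'i \<Rightarrow> int) \<Rightarrow> ('i \<Rightarrow> 'i \<Rightarrow> 'k::field) \<Rightarrow> ('k, ('i, 'k) Uq_elem) module" where
  "Uq_algebra A q = quot_module free_algebra (Uq_ideal A q)"

definition Uq_gen ::
    "('i \<Rightarrow> 'i \<Rightarrow> int) \<Rightarrow> ('i \<Rightarrow> 'i \<Rightarrow> 'k::field) \<Rightarrow> 'i gen \<Rightarrow> ('i, 'k) Uq_elem" where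
  "Uq_gen A q g =
     Uq_ideal A q +>\<^bsub>free_algebra :: ('k, 'i gen word \<Rightarrow>\<^sub>0 'k) module\<^esub> letter g"

fun Uq_comult_gen ::
    "('i \<Rightarrow> 'i \<Rightarrow> int) \<Rightarrow> ('i \<Rightarrow> 'i \<Rightarrow> 'k::field) \<Rightarrow> 'i gen \<Rightarrow>
     (('i, 'k) Uq_elem \<times> ('i, 'k) Uq_elem \<Rightarrow>\<^sub>0 'k) set" where
  "Uq_comult_gen A q (E i) =
     (let U = Uq_algebra A q; x = Uq_gen A q in
      pure_tensor U U (x (E i)) \<one>\<^bsub>U\<^esub> \<oplus>\<^bsub>tensor_algebra U U\<^esub> pure_tensor U U (x (Om i)) (x (E i)))"
| "Uq_comult_gen A q (F i) =
     (let U = Uq_algebra A q; x = Uq_gen A q in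
      pure_tensor U U \<one>\<^bsub>U\<^esub> (x (F i)) \<oplus>\<^bsub>tensor_algebra U U\<^esub> pure_tensor U U (x (F i)) (x (Om' i)))"
| "Uq_comult_gen A q g =
     pure_tensor (Uq_algebra A q) (Uq_algebra A q) (Uq_gen A q g) (Uq_gen A q g)"

fun Uq_counit_gen :: "'i gen \<Rightarrow> 'k::field" where
  "Uq_counit_gen (E i) = 0"
| "Uq_counit_gen (F i) = 0"
| "Uq_counit_gen _ = 1"

fun Uq_antipode_gen ::
    "('i \<Rightarrow> 'i \<Rightarrow> int) \<Rightarrow> ('i \<Rightarrow> 'i \<Rightarrow> 'k::field) \<Rightarrow> 'i gen \<Rightarrow> ('i, 'k) Uq_elem" where
  "Uq_antipode_gen A q (E i) =
     \<ominus>\<^bsub>Uq_algebra A q\<^esub> (Uq_gen A q (OmInv i) \<otimes>\<^bsub>Uq_algebra A q\<^esub> Uq_gen A q (E i))"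
| "Uq_antipode_gen A q (F i) =
     \<ominus>\<^bsub>Uq_algebra A q\<^esub> (Uq_gen A q (F i) \<otimes>\<^bsub>Uq_algebra A q\<^esub> Uq_gen A q (Om'Inv i))"
| "Uq_antipode_gen A q (Om i) = Uq_gen A q (OmInv i)"
| "Uq_antipode_gen A q (OmInv i) = Uq_gen A q (Om i)"
| "Uq_antipode_gen A q (Om' i) = Uq_gen A q (Om'Inv i)"
| "Uq_antipode_gen A q (Om'Inv i) = Uq_gen A q (Om' i)"

definition Uq ::
    "('i \<Rightarrow> 'i \<Rightarrow> int) \<Rightarrow> ('i \<Rightarrow> 'i \<Rightarrow> 'k::field) \<Rightarrow> ('k, ('i, 'k) Uq_elem) hopf" where
  "Uq A q = module.extend (Uq_algebra A q)
     (hopf.fields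
       (quot_free_lift (tensor_algebra (Uq_algebra A q) (Uq_algebra A q)) (Uq_comult_gen A q))
       (quot_free_lift scalars Uq_counit_gen)
       (quot_free_lift (opposite (Uq_algebra A q)) (Uq_antipode_gen A q)))"

definition Uq_ge ::
    "('i \<Rightarrow> 'i \<Rightarrow> int) \<Rightarrow> ('i \<Rightarrow> 'i \<Rightarrow> 'k::field) \<Rightarrow> ('k, ('i, 'k) Uq_elem) hopf" where
  "Uq_ge A q = restrict_hopf (Uq A q)
     (hopf_subalgebra_generated (Uq A q) (Uq_gen A q ` (range E \<union> range Om \<union> range OmInv)))"

definition Uq_le ::
    "('i \<Rightarrow> 'i \<Rightarrow> int) \<Rightarrow> ('i \<Rightarrow> 'i \<Rightarrow> 'k::field) \<Rightarrow> ('k, ('i, 'k) Uq_elem) hopf" where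
  "Uq_le A q = restrict_hopf (Uq A q)
     (hopf_subalgebra_generated (Uq A q) (Uq_gen A q ` (range F \<union> range Om' \<union> range Om'Inv)))"

text \<open>Elements of the root lattice are functions \<open>'i \<Rightarrow> int\<close>. The \<open>\<omega>\<^sub>i\<close> commute, so the order of
  the factors of \<open>\<omega>\<^sub>\<mu>\<close> does not matter.\<close>

definition index_list :: "'i::finite list" where
  "index_list = (SOME xs. distinct xs \<and> set xs = UNIV)"

definition Uq_omega ::
    "('i::finite \<Rightarrow> 'i \<Rightarrow> int) \<Rightarrow> ('i \<Rightarrow> 'i \<Rightarrow> 'k::field) \<Rightarrow> ('i \<Rightarrow> int) \<Rightarrow> ('i, 'k) Uq_elem" where
  "Uq_omega A q \<mu> =
     mult_list (Uq A q) (map (\<lambda>i. Uq_gen A q (Om i) [^]\<^bsub>Uq A q\<^esub> \<mu> i) index_list)"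

definition Uq_omega' ::
    "('i::finite \<Rightarrow> 'i \<Rightarrow> int) \<Rightarrow> ('i \<Rightarrow> 'i \<Rightarrow> 'k::field) \<Rightarrow> ('i \<Rightarrow> int) \<Rightarrow> ('i, 'k) Uq_elem" where
  "Uq_omega' A q \<mu> =
     mult_list (Uq A q) (map (\<lambda>i. Uq_gen A q (Om' i) [^]\<^bsub>Uq A q\<^esub> \<mu> i) index_list)"

definition q_lattice :: "('i::finite \<Rightarrow> 'i \<Rightarrow> 'k::field) \<Rightarrow> ('i \<Rightarrow> int) \<Rightarrow> ('i \<Rightarrow> int) \<Rightarrow> 'k" where
  "q_lattice q \<mu> \<nu> = (\<Prod>i\<in>UNIV. \<Prod>j\<in>UNIV. q i j powi (\<mu> i * \<nu> j))"

definition Uq_pairing ::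
    "('i::finite \<Rightarrow> 'i \<Rightarrow> int) \<Rightarrow> ('i \<Rightarrow> 'i \<Rightarrow> 'k::field) \<Rightarrow>
     (('i, 'k) Uq_elem \<Rightarrow> ('i, 'k) Uq_elem \<Rightarrow> 'k) \<Rightarrow> bool" where
  "Uq_pairing A q p \<longleftrightarrow>
     skew_dual_pairing (Uq_ge A q) (Uq_le A q) p \<and>
     (\<forall>i j. p (Uq_gen A q (F i)) (Uq_gen A q (E j)) = (if i = j then q i i / (1 - q i i) else 0)) \<and>
     (\<forall>\<mu> \<nu>. p (Uq_omega' A q \<mu>) (Uq_omega A q \<nu>) = q_lattice q \<nu> \<mu>) \<and>
     (\<forall>\<mu> i. p (Uq_omega' A q \<mu>) (Uq_gen A q (E i)) = 0) \<and>
     (\<forall>\<mu> i. p (Uq_gen A q (F i)) (Uq_omega A q \<mu>) = 0)"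

end

theory Submission imports Defs begin

text \<open>Let \<open>A\<close>, \<open>B\<close> be the two Borel subalgebras of \<open>U\<close>. On \<open>A \<otimes> B\<close> the algebra \<open>A\<close> acts by left
  multiplication and \<open>B\<close> acts by the commutation rule of the double,
  \<open>b \<cdot> (a \<otimes> b') = \<Sum> \<langle>S(b\<^sub>1), a\<^sub>1\<rangle> \<langle>b\<^sub>3, a\<^sub>3\<rangle> a\<^sub>2 \<otimes> b\<^sub>2 b'\<close>. The operators of the generators satisfy the
  defining relations of \<open>U\<close>: those inside one half because both actions are algebra homomorphisms, the
  mixed ones by the values of the pairing on generators. So \<open>U\<close> acts on \<open>A \<otimes> B\<close>, and \<open>u \<mapsto> u \<cdot> (1 \<otimes> 1)\<close> is
  a left inverse of the multiplication \<open>A \<otimes> B \<rightarrow> U\<close>, which is onto since \<open>f\<^sub>i\<close> and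
  \<open>\<omega>'\<^sub>i\<close> can be moved to the right. This avoids bases and the nondegeneracy of the pairing. Under the
  resulting bijection the Hopf structure of \<open>U\<close> becomes that of the double.

  That \<open>U\<close> is a Hopf algebra rests on the compatibility of the coproduct with the quantum Serre
  relations; these are iterated q-commutators, for which \<open>\<Delta>\<close> can be computed step by step.\<close>

text \<open>Injectivity of the multiplication \<open>A \<otimes> B \<rightarrow> U\<close>, usually
  read off from a PBW basis, is automatic: pairing with a unit is the counit, so \<open>b\<close>
  sends \<open>1 \<otimes> 1\<close> to \<open>1 \<otimes> b\<close>, and \<open>ab\<close> sends it
  to \<open>a \<otimes> b\<close>. The work lies in showing that the operators represent
  \<open>U\<close>. An element of \<open>B\<close> acts through its threefold coproduct by operators
  in three independent arguments; these are multiplicative in the triple, hence so is the action. In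
  the relation of \<open>e_i\<close> and \<open>f_i\<close> the outer Sweedler components of
  \<open>f_i\<close> produce the terms with \<open>\<omega>'_i\<close> and
  \<open>\<omega>_i\<close>, and the coefficient is
  \<open>-\<langle>f_i, e_i\<rangle> = q_ii / (q_ii - 1)\<close>. For the Serre elements write
  \<open>\<Delta>(e_i) = x + y\<close>. On each of the two starting tensors of
  \<open>\<Delta>(e_j)\<close>, at every step one of \<open>x\<close>, \<open>y\<close> commutes
  with the current tensor up to exactly the scalar of that step and drops out, so one term survives.
  The scalars match because \<open>q_ij q_ji\<close> is the power of \<open>q_ii\<close> with
  exponent \<open>a_ij\<close>. The coproduct of a Borel subalgebra \<open>C\<close> is a preimage
  under \<open>C \<otimes> C \<rightarrow> U \<otimes> U\<close>; that this map is injective needs a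
  linear projection onto \<open>C\<close>. The Hopf axioms of the double are obtained by transport
  of structure.\<close>

lemma ring_of_type_algebra_simps [simp]:
  "carrier ring_of_type_algebra = UNIV" "x \<otimes>\<^bsub>ring_of_type_algebra\<^esub> y = x * y"
  "x \<oplus>\<^bsub>ring_of_type_algebra\<^esub> y = x + y" "\<one>\<^bsub>ring_of_type_algebra\<^esub> = 1"
  "\<zero>\<^bsub>ring_of_type_algebra\<^esub> = 0"
  by (simp_all add: ring_of_type_algebra_def)

section \<open>Vector spaces over the ground field and their subspaces\<close>

locale vs = Module.module "ring_of_type_algebra :: 'k::field ring" M
  for M :: "('k::field, 'a, 'm) module_scheme" (structure)
begin

lemma smult_in [simp, intro]: "x \<in> carrier M \<Longrightarrow> k \<odot> x \<in> carrier M"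
  using smult_closed by simp

lemma smult_add_l: "x \<in> carrier M \<Longrightarrow> (a + b) \<odot> x = a \<odot> x \<oplus> b \<odot> x"
  using smult_l_distr[of a b x] by simp

lemma smult_add_r: "x \<in> carrier M \<Longrightarrow> y \<in> carrier M \<Longrightarrow> a \<odot> (x \<oplus> y) = a \<odot> x \<oplus> a \<odot> y"
  using smult_r_distr[of a x y] by simp

lemma smult_smult: "x \<in> carrier M \<Longrightarrow> a \<odot> (b \<odot> x) = (a * b) \<odot> x"
  using smult_assoc1[of a b x] by simp

lemma smult_1 [simp]: "x \<in> carrier M \<Longrightarrow> 1 \<odot> x = x"
  using smult_one[of x] by simp

lemma smult_0_l [simp]: "x \<in> carrier M \<Longrightarrow> 0 \<odot> x = \<zero>"
  using smult_l_null[of x] by simp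

lemma smult_0_r [simp]: "a \<odot> \<zero> = \<zero>"
  using smult_r_null[of a] by simp

lemma smult_minus_l: "x \<in> carrier M \<Longrightarrow> (- a) \<odot> x = \<ominus> (a \<odot> x)"
  by (metis M.minus_equality add.left_inverse smult_0_l smult_add_l smult_in)

lemma smult_minus1: "x \<in> carrier M \<Longrightarrow> \<ominus> x = (- 1) \<odot> x"
  by (simp add: smult_minus_l)

lemma minus_smult1: "x \<in> carrier M \<Longrightarrow> y \<in> carrier M \<Longrightarrow> x \<ominus> y = x \<oplus> (- 1) \<odot> y"
  by (simp add: smult_minus1 M.minus_eq)

lemma add_minus_cancel: "a \<in> carrier M \<Longrightarrow> b \<in> carrier M \<Longrightarrow> (a \<oplus> b) \<ominus> b = a"
  by (simp add: M.minus_eq M.a_assoc M.r_neg)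

lemma minus_self: "a \<in> carrier M \<Longrightarrow> a \<ominus> a = \<zero>"
  by (simp add: M.minus_eq M.r_neg)

lemma submodule_vsI:
  assumes "N \<subseteq> carrier M" "\<zero> \<in> N" "\<And>x y. x \<in> N \<Longrightarrow> y \<in> N \<Longrightarrow> x \<oplus> y \<in> N"
    "\<And>k x. x \<in> N \<Longrightarrow> k \<odot> x \<in> N"
  shows "submodule N (ring_of_type_algebra :: 'k ring) M"
  using assms by (intro submoduleI) (auto simp: subset_iff smult_minus1)

lemma submodule_vsD:
  assumes "submodule N (ring_of_type_algebra :: 'k ring) M"
  shows "x \<in> N \<Longrightarrow> x \<in> carrier M" "\<zero> \<in> N" "x \<in> N \<Longrightarrow> y \<in> N \<Longrightarrow> x \<oplus> y \<in> N"
    "x \<in> N \<Longrightarrow> k \<odot> x \<in> N" "x \<in> N \<Longrightarrow> \<ominus> x \<in> N"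
proof -
  note E = submoduleE[OF assms]
  show "x \<in> N \<Longrightarrow> x \<in> carrier M" using E(1) by blast
  show "\<zero> \<in> N" using submodule.axioms(1)[OF assms, THEN subgroup.one_closed] by simp
  show "x \<in> N \<Longrightarrow> y \<in> N \<Longrightarrow> x \<oplus> y \<in> N" by (rule E(5))
  show "x \<in> N \<Longrightarrow> k \<odot> x \<in> N" by (rule E(4)) simp_all
  show "x \<in> N \<Longrightarrow> \<ominus> x \<in> N" by (rule E(3))
qed

lemma submodule_Inter:
  assumes "\<N> \<noteq> {}" "\<And>N. N \<in> \<N> \<Longrightarrow> submodule N (ring_of_type_algebra :: 'k ring) M"
  shows "submodule (\<Inter>\<N>) (ring_of_type_algebra :: 'k ring) M"
proof (rule submodule_vsI)
  show "\<Inter>\<N> \<subseteq> carrier M" using assms submodule_vsD(1) by blast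
qed (auto intro: submodule_vsD(2-4)[OF assms(2)])

lemma submodule_carrier: "submodule (carrier M) (ring_of_type_algebra :: 'k ring) M"
  by (intro submodule_vsI) auto

lemma submodule_span: 
  assumes "S \<subseteq> carrier M"
  shows "submodule (submodule_span M S) (ring_of_type_algebra :: 'k ring) M"
  unfolding submodule_span_def
  using assms submodule_carrier by (intro submodule_Inter) auto

lemma submodule_span_superset: "S \<subseteq> submodule_span M S"
  unfolding submodule_span_def by auto

lemma submodule_span_least: 
  "submodule N (ring_of_type_algebra :: 'k ring) M \<Longrightarrow> S \<subseteq> N \<Longrightarrow> submodule_span M S \<subseteq> N"
  unfolding submodule_span_def by auto

end

lemma vsI:
  fixes M :: "('k::field, 'a, 'm) module_scheme" (structure)
  assumes "abelian_group M"
    and "\<And>a x. x \<in> carrier M \<Longrightarrow> a \<odot> x \<in> carrier M"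
    and "\<And>a b x. x \<in> carrier M \<Longrightarrow> (a + b) \<odot> x = a \<odot> x \<oplus> b \<odot> x"
    and "\<And>a x y. x \<in> carrier M \<Longrightarrow> y \<in> carrier M \<Longrightarrow> a \<odot> (x \<oplus> y) = a \<odot> x \<oplus> a \<odot> y"
    and "\<And>a b x. x \<in> carrier M \<Longrightarrow> (a * b) \<odot> x = a \<odot> (b \<odot> x)"
    and "\<And>x. x \<in> carrier M \<Longrightarrow> 1 \<odot> x = x"
  shows "vs M"
  unfolding vs_def
  by (intro moduleI) (use assms cring_from_type_algebra in auto)

subsection \<open>Linear and bilinear maps\<close>

lemma linear_mapsI:
  assumes "\<And>x. x \<in> carrier M \<Longrightarrow> f x \<in> carrier N"
    "\<And>x y. x \<in> carrier M \<Longrightarrow> y \<in> carrier M \<Longrightarrow> f (x \<oplus>\<^bsub>M\<^esub> y) = f x \<oplus>\<^bsub>N\<^esub> f y"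
    "\<And>k x. x \<in> carrier M \<Longrightarrow> f (k \<odot>\<^bsub>M\<^esub> x) = k \<odot>\<^bsub>N\<^esub> f x"
  shows "f \<in> linear_maps M N"
  using assms by (auto simp: linear_maps_def)

lemma lin_closed: "f \<in> linear_maps M N \<Longrightarrow> x \<in> carrier M \<Longrightarrow> f x \<in> carrier N"
  and lin_add: "f \<in> linear_maps M N \<Longrightarrow> x \<in> carrier M \<Longrightarrow> y \<in> carrier M \<Longrightarrow> f (x \<oplus>\<^bsub>M\<^esub> y) = f x \<oplus>\<^bsub>N\<^esub> f y"
  and lin_smult: "f \<in> linear_maps M N \<Longrightarrow> x \<in> carrier M \<Longrightarrow> f (k \<odot>\<^bsub>M\<^esub> x) = k \<odot>\<^bsub>N\<^esub> f x"
  by (auto simp: linear_maps_def)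

lemma lin_zero: "f \<in> linear_maps M N \<Longrightarrow> vs M \<Longrightarrow> vs N \<Longrightarrow> f \<zero>\<^bsub>M\<^esub> = \<zero>\<^bsub>N\<^esub>"
proof -
  assume f: "f \<in> linear_maps M N" and "vs M" "vs N"
  interpret M: vs M by fact
  interpret N: vs N by fact
  show ?thesis using lin_smult[OF f, of "\<zero>\<^bsub>M\<^esub>" 0] lin_closed[OF f, of "\<zero>\<^bsub>M\<^esub>"] by simp
qed

lemma lin_diff: "f \<in> linear_maps M N \<Longrightarrow> vs M \<Longrightarrow> vs N \<Longrightarrow> x \<in> carrier M \<Longrightarrow> y \<in> carrier M \<Longrightarrow>
    f (x \<ominus>\<^bsub>M\<^esub> y) = f x \<ominus>\<^bsub>N\<^esub> f y"
  by (simp add: vs.minus_smult1 lin_smult lin_closed lin_add vs.smult_in)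

lemma lin_comp: "f \<in> linear_maps M N \<Longrightarrow> g \<in> linear_maps N P \<Longrightarrow> (\<lambda>x. g (f x)) \<in> linear_maps M P"
  by (auto simp: linear_maps_def Pi_iff)

lemma lin_id: "(\<lambda>x. x) \<in> linear_maps M M"
  by (auto simp: linear_maps_def)

lemma linear_maps_cong_set:
  assumes "\<And>x. x \<in> carrier M \<Longrightarrow> f x = g x" "f \<in> linear_maps M N" "vs M"
  shows "g \<in> linear_maps M N"
proof -
  interpret vs M by fact
  show ?thesis
    by (rule linear_mapsI) (auto simp: assms(1)[symmetric] lin_closed[OF assms(2)] lin_add[OF assms(2)]
      lin_smult[OF assms(2)])
qed

lemma lin_kernel:
  assumes "f \<in> linear_maps M N" "vs M" "vs N"
  shows "submodule {x \<in> carrier M. f x = \<zero>\<^bsub>N\<^esub>} (ring_of_type_algebra) M"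
proof -
  interpret M: vs M by fact
  interpret N: vs N by fact
  show ?thesis
    by (rule M.submodule_vsI) (auto simp: lin_zero assms lin_add[OF assms(1)] lin_smult[OF assms(1)])
qed

definition bilin ::
  "('k::field, 'a, 'm) module_scheme \<Rightarrow> ('k, 'b, 'n) module_scheme \<Rightarrow> ('k, 'v, 'l) module_scheme \<Rightarrow>
   ('a \<Rightarrow> 'b \<Rightarrow> 'v) \<Rightarrow> bool" where
  "bilin A B V f \<longleftrightarrow> (\<forall>a\<in>carrier A. (\<lambda>b. f a b) \<in> linear_maps B V) \<and>
     (\<forall>b\<in>carrier B. (\<lambda>a. f a b) \<in> linear_maps A V)"

lemma bilinI:
  "(\<And>a. a \<in> carrier A \<Longrightarrow> (\<lambda>b. f a b) \<in> linear_maps B V) \<Longrightarrow>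
   (\<And>b. b \<in> carrier B \<Longrightarrow> (\<lambda>a. f a b) \<in> linear_maps A V) \<Longrightarrow> bilin A B V f"
  by (simp add: bilin_def)

lemma bilin_1: "bilin A B V f \<Longrightarrow> b \<in> carrier B \<Longrightarrow> (\<lambda>a. f a b) \<in> linear_maps A V"
  and bilin_2: "bilin A B V f \<Longrightarrow> a \<in> carrier A \<Longrightarrow> f a \<in> linear_maps B V"
  by (simp_all add: bilin_def)

lemma bilin_closed: "bilin A B V f \<Longrightarrow> a \<in> carrier A \<Longrightarrow> b \<in> carrier B \<Longrightarrow> f a b \<in> carrier V"
  using bilin_1 lin_closed by fast

subsection \<open>Linear extension from a basis\<close>

lemma lookup_pm_scale [simp]: "Poly_Mapping.lookup (pm_scale k x) w = k * Poly_Mapping.lookup x w"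
  unfolding pm_scale_def by (simp add: Poly_Mapping.map.rep_eq when_def)

lemma keys_pm_scale: "Poly_Mapping.keys (pm_scale k x) \<subseteq> Poly_Mapping.keys x"
  by (auto simp: in_keys_iff)

lemma pm_scale_single [simp]: "pm_scale k (Poly_Mapping.single p c) = Poly_Mapping.single p (k * c)"
  by (rule poly_mapping_eqI) (simp add: lookup_single when_def)

lemma pm_scale_distribs:
  "pm_scale (a + b) x = pm_scale a x + pm_scale b x" "pm_scale a (x + y) = pm_scale a x + pm_scale a y"
  "pm_scale (a * b) x = pm_scale a (pm_scale b x)" "pm_scale 1 x = x"
  by (rule poly_mapping_eqI; simp add: lookup_add algebra_simps)+

text \<open>The common shape of \<open>tensor_lift\<close> (on representatives) and
  \<open>free_lift\<close>; linearity is proved once for both.\<close>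

definition lin_ext :: "('k::field, 'v, 'm) module_scheme \<Rightarrow> ('x \<Rightarrow> 'v) \<Rightarrow> ('x \<Rightarrow>\<^sub>0 'k) \<Rightarrow> 'v" where
  "lin_ext V f t = (\<Oplus>\<^bsub>V\<^esub>p\<in>Poly_Mapping.keys t. Poly_Mapping.lookup t p \<odot>\<^bsub>V\<^esub> f p)"

lemma free_module_simps [simp]:
  "carrier (free_module S) = {x. Poly_Mapping.keys x \<subseteq> S}" "\<zero>\<^bsub>free_module S\<^esub> = 0"
  "x \<oplus>\<^bsub>free_module S\<^esub> y = x + y" "k \<odot>\<^bsub>free_module S\<^esub> x = pm_scale k x"
  by (simp_all add: free_module_def)

lemma vs_free_module: "vs (free_module S :: ('k::field, 'x \<Rightarrow>\<^sub>0 'k) module)"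
proof (rule vsI)
  show "abelian_group (free_module S :: ('k::field, 'x \<Rightarrow>\<^sub>0 'k) module)"
  proof (rule abelian_groupI)
    fix x :: "'x \<Rightarrow>\<^sub>0 'k" assume "x \<in> carrier (free_module S)"
    then show "\<exists>y\<in>carrier (free_module S). y \<oplus>\<^bsub>free_module S\<^esub> x = \<zero>\<^bsub>free_module S\<^esub>"
      by (intro bexI[of _ "- x"]) auto
  qed (simp_all add: add_ac keys_add[THEN order_trans])
qed (simp_all add: pm_scale_distribs keys_pm_scale[THEN order_trans])

lemma free_module_induct [consumes 1, case_names zero add]:
  assumes "Poly_Mapping.keys t \<subseteq> S" and "P 0"
    and "\<And>t p c. Poly_Mapping.keys t \<subseteq> S \<Longrightarrow> p \<in> S \<Longrightarrow> P t \<Longrightarrow> P (t + Poly_Mapping.single p c)"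
  shows "P (t :: 'x \<Rightarrow>\<^sub>0 'k::ab_group_add)"
proof -
  have "\<forall>t. Poly_Mapping.keys t \<subseteq> W \<longrightarrow> P t" if "finite W" "W \<subseteq> S" for W
    using that
  proof (induction W)
    case empty
    then show ?case using assms(2) by simp
  next
    case (insert p W)
    show ?case
    proof (intro allI impI)
      fix t :: "'x \<Rightarrow>\<^sub>0 'k" assume t: "Poly_Mapping.keys t \<subseteq> insert p W"
      let ?s = "Poly_Mapping.single p (Poly_Mapping.lookup t p)"
      have "Poly_Mapping.keys (t - ?s) \<subseteq> W"
        using t insert.hyps by (auto simp: in_keys_iff lookup_minus lookup_single when_def split: if_splits)
      then have "P (t - ?s + ?s)" using insert by (intro assms(3)) auto
      then show "P t" by simp
    qed
  qed
  from this[OF finite_keys assms(1)] show ?thesis by simp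
qed

context vs begin

text \<open>Additional indices contribute zero coefficients. Linear combinations with different
  supports can therefore be compared over the union of the supports.\<close>

lemma lin_ext_superset:
  assumes "finite W" "Poly_Mapping.keys t \<subseteq> W" "\<And>p. p \<in> W \<Longrightarrow> f p \<in> carrier M"
  shows "lin_ext M f t = (\<Oplus>p\<in>W. Poly_Mapping.lookup t p \<odot> f p)"
  unfolding lin_ext_def
  by (rule M.add.finprod_mono_neutral_cong_left) (use assms in \<open>auto simp: in_keys_iff\<close>)

lemma lin_ext_closed: "(\<And>p. p \<in> Poly_Mapping.keys t \<Longrightarrow> f p \<in> carrier M) \<Longrightarrow> lin_ext M f t \<in> carrier M"
  unfolding lin_ext_def by (intro M.finsum_closed) auto

lemma lin_ext_linear:
  assumes "\<And>p. p \<in> S \<Longrightarrow> f p \<in> carrier M"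
  shows "lin_ext M f \<in> linear_maps (free_module S) M"
proof (rule linear_mapsI)
  fix x y :: "'b \<Rightarrow>\<^sub>0 'k" assume xy: "x \<in> carrier (free_module S)" "y \<in> carrier (free_module S)"
  let ?W = "Poly_Mapping.keys x \<union> Poly_Mapping.keys y"
  have W: "finite ?W" "\<And>p. p \<in> ?W \<Longrightarrow> f p \<in> carrier M" using xy assms by auto
  have "lin_ext M f (x + y) = (\<Oplus>p\<in>?W. Poly_Mapping.lookup (x + y) p \<odot> f p)"
    using W(2) keys_add[of x y] by (intro lin_ext_superset) auto
  also have "\<dots> = (\<Oplus>p\<in>?W. Poly_Mapping.lookup x p \<odot> f p \<oplus> Poly_Mapping.lookup y p \<odot> f p)"
    using W by (intro M.finsum_cong') (auto simp: lookup_add smult_add_l)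
  also have "\<dots> = (\<Oplus>p\<in>?W. Poly_Mapping.lookup x p \<odot> f p) \<oplus> (\<Oplus>p\<in>?W. Poly_Mapping.lookup y p \<odot> f p)"
    using W by (intro M.finsum_addf) auto
  also have "\<dots> = lin_ext M f x \<oplus> lin_ext M f y"
    using W by (subst (1 2) lin_ext_superset[of ?W]) auto
  finally show "lin_ext M f (x \<oplus>\<^bsub>free_module S\<^esub> y) = lin_ext M f x \<oplus> lin_ext M f y" by simp
next
  fix k and x :: "'b \<Rightarrow>\<^sub>0 'k" assume x: "x \<in> carrier (free_module S)"
  let ?W = "Poly_Mapping.keys x"
  have W: "finite ?W" "\<And>p. p \<in> ?W \<Longrightarrow> f p \<in> carrier M" using x assms by auto
  have "lin_ext M f (pm_scale k x) = (\<Oplus>p\<in>?W. Poly_Mapping.lookup (pm_scale k x) p \<odot> f p)"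
    using W(2) keys_pm_scale[of k x] by (intro lin_ext_superset) auto
  also have "\<dots> = (\<Oplus>p\<in>?W. k \<odot> (Poly_Mapping.lookup x p \<odot> f p))"
    using W by (intro M.finsum_cong') (auto simp: smult_smult)
  also have "\<dots> = k \<odot> lin_ext M f x"
    unfolding lin_ext_def using W by (subst finsum_smult_ldistr) auto
  finally show "lin_ext M f (k \<odot>\<^bsub>free_module S\<^esub> x) = k \<odot> lin_ext M f x" by simp
qed (use assms in \<open>auto intro!: lin_ext_closed\<close>)

lemma lin_ext_single [simp]: "f p \<in> carrier M \<Longrightarrow> lin_ext M f (Poly_Mapping.single p k) = k \<odot> f p"
  using lin_ext_superset[of "{p}" "Poly_Mapping.single p k" f] by simp

end

subsection \<open>Quotients\<close>

lemma quot_module_simps: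
  "carrier (quot_module M N) = a_rcosets\<^bsub>M\<^esub> N" "\<zero>\<^bsub>quot_module M N\<^esub> = N"
  "\<xi> \<oplus>\<^bsub>quot_module M N\<^esub> \<eta> = \<xi> <+>\<^bsub>M\<^esub> \<eta>" "\<one>\<^bsub>quot_module M N\<^esub> = N +>\<^bsub>M\<^esub> \<one>\<^bsub>M\<^esub>"
  "\<xi> \<otimes>\<^bsub>quot_module M N\<^esub> \<eta> = rcoset_mult M N \<xi> \<eta>"
  "k \<odot>\<^bsub>quot_module M N\<^esub> \<xi> = (\<Union>x\<in>\<xi>. N +>\<^bsub>M\<^esub> (k \<odot>\<^bsub>M\<^esub> x))"
  by (simp_all add: quot_module_def FactRing_def ring.defs module.defs)

locale vs_sub = vs M for M :: "('k::field, 'a, 'm) module_scheme" (structure) +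
  fixes N assumes sub: "submodule N (ring_of_type_algebra :: 'k ring) M"
begin

sublocale N: abelian_subgroup N M
  by (rule abelian_subgroupI3)
    (simp_all add: additive_subgroup_def submodule.axioms(1)[OF sub] M.abelian_group_axioms)

lemma quot_carrier: "carrier (quot_module M N) = (\<lambda>x. N +> x) ` carrier M"
  by (auto simp: quot_module_simps A_RCOSETS_def')

lemma coset_eq_iff:
  assumes "x \<in> carrier M" "y \<in> carrier M"
  shows "N +> x = N +> y \<longleftrightarrow> x \<ominus> y \<in> N"
proof -
  have "x \<in> N +> y \<longleftrightarrow> x \<ominus> y \<in> N" using N.a_rcos_module[OF assms(2,1)] by (simp only: M.minus_eq)
  moreover have "N +> y = N +> x" if "x \<in> N +> y"
    using N.a_repr_independence'[OF that assms(2)] .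
  moreover have "x \<in> N +> y" if "N +> x = N +> y"
    using N.a_rcos_self[OF assms(1)] that by simp
  ultimately show ?thesis by metis
qed

lemma coset_add: "x \<in> carrier M \<Longrightarrow> y \<in> carrier M \<Longrightarrow>
    (N +> x) \<oplus>\<^bsub>quot_module M N\<^esub> (N +> y) = N +> (x \<oplus> y)"
  by (simp add: quot_module_simps N.a_rcos_sum)

text \<open>The union in \<open>quot_module\<close> runs over equal cosets: two representatives
  differ by an element of \<open>N\<close>, and \<open>N\<close> is closed under scalars.\<close>

lemma coset_smult:
  assumes x: "x \<in> carrier M"
  shows "k \<odot>\<^bsub>quot_module M N\<^esub> (N +> x) = N +> (k \<odot> x)"
proof -
  have "N +> (k \<odot> y) = N +> (k \<odot> x)" if y: "y \<in> N +> x" for y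
  proof -
    obtain n where n: "n \<in> N" "y = n \<oplus> x" using y by (auto simp: a_r_coset_def')
    have nc: "n \<in> carrier M" using n by simp
    have "k \<odot> y \<ominus> k \<odot> x = k \<odot> n"
      using n nc x by (simp add: smult_add_r add_minus_cancel)
    moreover have "y \<in> carrier M" using nc n x by simp
    ultimately show ?thesis
      using submodule_vsD(4)[OF sub n(1), of k] x by (simp add: coset_eq_iff)
  qed
  then show ?thesis using N.a_rcos_self[OF x] unfolding quot_module_simps by blast
qed

lemma coset_zero: "\<zero>\<^bsub>quot_module M N\<^esub> = N +> \<zero>"
  by (simp add: quot_module_simps M.a_coset_add_zero N.a_subset)

lemma vs_quot: "vs (quot_module M N)"
proof (rule vsI)
  show "abelian_group (quot_module M N)"
  proof (rule abelian_groupI)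
    fix \<xi> assume "\<xi> \<in> carrier (quot_module M N)"
    then obtain x where "x \<in> carrier M" "\<xi> = N +> x" by (auto simp: quot_carrier)
    then show "\<exists>\<eta>\<in>carrier (quot_module M N). \<eta> \<oplus>\<^bsub>quot_module M N\<^esub> \<xi> = \<zero>\<^bsub>quot_module M N\<^esub>"
      by (intro bexI[of _ "N +> \<ominus> x"]) (auto simp: quot_carrier coset_add coset_zero M.l_neg)
  qed (auto simp: quot_carrier coset_add coset_zero M.a_ac)
qed (auto simp: quot_carrier coset_add coset_smult smult_add_l smult_add_r smult_smult)

lemma coset_linear: "(\<lambda>x. N +> x) \<in> linear_maps M (quot_module M N)"
  by (rule linear_mapsI) (auto simp: quot_carrier coset_add coset_smult)

lemma coset_in_quot: "x \<in> carrier M \<Longrightarrow> N +> x \<in> carrier (quot_module M N)"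
  by (simp add: quot_carrier)

text \<open>A linear map that vanishes on \<open>N\<close> is constant on cosets. This gives meaning
  to the \<open>the_elem\<close> in \<open>tensor_lift\<close> and
  \<open>quot_free_lift\<close>.\<close>

lemma the_elem_coset:
  assumes h: "h \<in> linear_maps M V" "vs V" "\<And>n. n \<in> N \<Longrightarrow> h n = \<zero>\<^bsub>V\<^esub>" and x: "x \<in> carrier M"
  shows "the_elem (h ` (N +> x)) = h x"
proof -
  interpret V: vs V by fact
  have "h y = h x" if y: "y \<in> N +> x" for y
  proof -
    obtain n where n: "n \<in> N" "y = n \<oplus> x" using y unfolding a_r_coset_def' by blast
    have "h y = h n \<oplus>\<^bsub>V\<^esub> h x" unfolding n(2) by (rule lin_add[OF h(1) N.a_Hcarr[OF n(1)] x])
    then show ?thesis using h(3)[OF n(1)] lin_closed[OF h(1) x] by simp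
  qed
  then have "h ` (N +> x) = {h x}" using N.a_rcos_self[OF x] by blast
  then show ?thesis by simp
qed

lemma the_elem_linear:
  assumes h: "h \<in> linear_maps M V" "vs V" "\<And>n. n \<in> N \<Longrightarrow> h n = \<zero>\<^bsub>V\<^esub>"
  shows "(\<lambda>\<xi>. the_elem (h ` \<xi>)) \<in> linear_maps (quot_module M N) V"
  by (rule linear_mapsI)
    (auto simp: quot_carrier coset_add coset_smult the_elem_coset[OF h] lin_closed[OF h(1)]
      lin_add[OF h(1)] lin_smult[OF h(1)])

end

subsection \<open>Tensor products\<close>

lemma free_module_minus [simp]:
  "Poly_Mapping.keys x \<subseteq> S \<Longrightarrow> Poly_Mapping.keys y \<subseteq> S \<Longrightarrow> x \<ominus>\<^bsub>free_module S\<^esub> y = x - (y :: _ \<Rightarrow>\<^sub>0 'k::field)"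
  by (subst vs.minus_smult1[OF vs_free_module]) (auto intro!: poly_mapping_eqI simp: lookup_add lookup_minus)

lemma keys_diff_subset: "Poly_Mapping.keys x \<subseteq> S \<Longrightarrow> Poly_Mapping.keys y \<subseteq> S \<Longrightarrow> Poly_Mapping.keys (x - y) \<subseteq> S"
  using keys_diff[of x y] by blast

locale tensor = A: vs A + B: vs B
  for A :: "('k::field, 'a, 'm) module_scheme" and B :: "('k, 'b, 'n) module_scheme"
begin

abbreviation "FM \<equiv> free_module (carrier A \<times> carrier B) :: ('k, 'a \<times> 'b \<Rightarrow>\<^sub>0 'k) module"

lemma bilinear_relations_carrier: "bilinear_relations A B \<subseteq> carrier FM"
  unfolding bilinear_relations_def
  by (rule subsetI, elim UnE CollectE exE conjE;
    simp only: free_module_simps mem_Collect_eq; intro keys_diff_subset; simp)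

lemma vs_sub_tensor: "vs_sub FM (tensor_null A B)"
  unfolding tensor_null_def vs_sub_def vs_sub_axioms_def
  by (intro conjI vs_free_module vs.submodule_span bilinear_relations_carrier)

sublocale T: vs_sub FM "tensor_null A B"
  by (rule vs_sub_tensor)

lemma vs_tensor [simp]: "vs (tensor_module A B)"
  unfolding tensor_module_def by (rule T.vs_quot)

lemma pure_closed [simp]: "a \<in> carrier A \<Longrightarrow> b \<in> carrier B \<Longrightarrow> pure_tensor A B a b \<in> carrier (tensor_module A B)"
  unfolding pure_tensor_def tensor_module_def by (rule T.coset_in_quot) simp

lemma relation_null: "r \<in> bilinear_relations A B \<Longrightarrow> r \<in> tensor_null A B"
  unfolding tensor_null_def using vs.submodule_span_superset[OF vs_free_module] by blast

lemma pure_add_l: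
  assumes "a \<in> carrier A" "a' \<in> carrier A" "b \<in> carrier B"
  shows "pure_tensor A B (a \<oplus>\<^bsub>A\<^esub> a') b = pure_tensor A B a b \<oplus>\<^bsub>tensor_module A B\<^esub> pure_tensor A B a' b"
proof -
  let ?s = "\<lambda>x y. Poly_Mapping.single (x, y) (1::'k)"
  have "?s (a \<oplus>\<^bsub>A\<^esub> a') b - (?s a b + ?s a' b) \<in> tensor_null A B"
    unfolding diff_diff_eq[symmetric] by (rule relation_null) (use assms in \<open>auto simp: bilinear_relations_def\<close>)
  moreover have "Poly_Mapping.keys (?s a b + ?s a' b) \<subseteq> carrier A \<times> carrier B"
    using keys_add[of "?s a b" "?s a' b"] assms by auto
  ultimately show ?thesis unfolding pure_tensor_def tensor_module_def using assms
    by (subst T.coset_add) (auto simp: T.coset_eq_iff)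
qed

lemma pure_add_r:
  assumes "a \<in> carrier A" "b' \<in> carrier B" "b \<in> carrier B"
  shows "pure_tensor A B a (b \<oplus>\<^bsub>B\<^esub> b') = pure_tensor A B a b \<oplus>\<^bsub>tensor_module A B\<^esub> pure_tensor A B a b'"
proof -
  let ?s = "\<lambda>x y. Poly_Mapping.single (x, y) (1::'k)"
  have "?s a (b \<oplus>\<^bsub>B\<^esub> b') - (?s a b + ?s a b') \<in> tensor_null A B"
    unfolding diff_diff_eq[symmetric] by (rule relation_null) (use assms in \<open>auto simp: bilinear_relations_def\<close>)
  moreover have "Poly_Mapping.keys (?s a b + ?s a b') \<subseteq> carrier A \<times> carrier B"
    using keys_add[of "?s a b" "?s a b'"] assms by auto
  ultimately show ?thesis unfolding pure_tensor_def tensor_module_def using assms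
    by (subst T.coset_add) (auto simp: T.coset_eq_iff)
qed

lemma pure_smult_l:
  assumes "a \<in> carrier A" "b \<in> carrier B"
  shows "pure_tensor A B (k \<odot>\<^bsub>A\<^esub> a) b = k \<odot>\<^bsub>tensor_module A B\<^esub> pure_tensor A B a b"
proof -
  have "Poly_Mapping.single (k \<odot>\<^bsub>A\<^esub> a, b) (1::'k) - Poly_Mapping.single (a, b) k \<in> tensor_null A B"
    by (rule relation_null) (use assms in \<open>auto simp: bilinear_relations_def\<close>)
  then show ?thesis unfolding pure_tensor_def tensor_module_def using assms
    by (subst T.coset_smult) (auto simp: T.coset_eq_iff)
qed

lemma pure_smult_r:
  assumes "a \<in> carrier A" "b \<in> carrier B"
  shows "pure_tensor A B a (k \<odot>\<^bsub>B\<^esub> b) = k \<odot>\<^bsub>tensor_module A B\<^esub> pure_tensor A B a b"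
proof -
  have "Poly_Mapping.single (a, k \<odot>\<^bsub>B\<^esub> b) (1::'k) - Poly_Mapping.single (a, b) k \<in> tensor_null A B"
    by (rule relation_null) (use assms in \<open>auto simp: bilinear_relations_def\<close>)
  then show ?thesis unfolding pure_tensor_def tensor_module_def using assms
    by (subst T.coset_smult) (auto simp: T.coset_eq_iff)
qed

lemma bilin_pure: "bilin A B (tensor_module A B) (pure_tensor A B)"
  by (intro bilinI linear_mapsI) (auto simp: pure_add_l pure_add_r pure_smult_l pure_smult_r)

text \<open>Representatives are built up one basis vector at a time. There are no cases for zero and
  for scalars, because both are absorbed into pure tensors.\<close>

lemma tensor_induct [consumes 1, case_names pure add]:
  assumes "x \<in> carrier (tensor_module A B)"
    and "\<And>a b. a \<in> carrier A \<Longrightarrow> b \<in> carrier B \<Longrightarrow> P (pure_tensor A B a b)"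
    and "\<And>x y. x \<in> carrier (tensor_module A B) \<Longrightarrow> y \<in> carrier (tensor_module A B) \<Longrightarrow> P x \<Longrightarrow> P y \<Longrightarrow>
      P (x \<oplus>\<^bsub>tensor_module A B\<^esub> y)"
  shows "P x"
proof -
  let ?N = "tensor_null A B"
  obtain t where t: "Poly_Mapping.keys t \<subseteq> carrier A \<times> carrier B" "x = ?N +>\<^bsub>FM\<^esub> t"
    using assms(1) by (auto simp: tensor_module_def T.quot_carrier)
  from t(1) have "P (?N +>\<^bsub>FM\<^esub> t)"
  proof (induction rule: free_module_induct)
    case zero
    \<comment> \<open>The zero tensor is the pure tensor of the zero vectors; the factor
      \<open>0\<close> is inserted so that \<open>pure_smult_l\<close> applies.\<close>
    have "P (pure_tensor A B (0 \<odot>\<^bsub>A\<^esub> \<zero>\<^bsub>A\<^esub>) \<zero>\<^bsub>B\<^esub>)" by (rule assms(2)) auto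
    also have "pure_tensor A B (0 \<odot>\<^bsub>A\<^esub> \<zero>\<^bsub>A\<^esub>) \<zero>\<^bsub>B\<^esub> = ?N +>\<^bsub>FM\<^esub> 0"
      by (subst pure_smult_l) (simp_all add: vs.smult_0_l[OF vs_tensor], simp add: tensor_module_def T.coset_zero)
    finally show ?case .
  next
    case (add t p c)
    obtain a b where p: "p = (a, b)" "a \<in> carrier A" "b \<in> carrier B" using add.hyps by auto
    \<comment> \<open>The coefficient \<open>c\<close> moves into the first factor, so the new
      summand is pure.\<close>
    have s: "?N +>\<^bsub>FM\<^esub> Poly_Mapping.single p c = pure_tensor A B (c \<odot>\<^bsub>A\<^esub> a) b"
      using p by (simp add: pure_smult_l) (simp add: pure_tensor_def tensor_module_def T.coset_smult)
    have "?N +>\<^bsub>FM\<^esub> (t + Poly_Mapping.single p c) =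
        (?N +>\<^bsub>FM\<^esub> t) \<oplus>\<^bsub>tensor_module A B\<^esub> (?N +>\<^bsub>FM\<^esub> Poly_Mapping.single p c)"
      unfolding tensor_module_def using p add.hyps by (subst T.coset_add) auto
    moreover have "?N +>\<^bsub>FM\<^esub> t \<in> carrier (tensor_module A B)"
      unfolding tensor_module_def using add.hyps by (intro T.coset_in_quot) simp
    ultimately show ?case using s p add.IH by (auto intro!: assms(2,3))
  qed
  then show ?thesis using t by simp
qed

lemma linear_maps_tensor_eqI:
  assumes "f \<in> linear_maps (tensor_module A B) V" "g \<in> linear_maps (tensor_module A B) V"
    and "\<And>a b. a \<in> carrier A \<Longrightarrow> b \<in> carrier B \<Longrightarrow> f (pure_tensor A B a b) = g (pure_tensor A B a b)"
    and "x \<in> carrier (tensor_module A B)"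
  shows "f x = g x"
  using assms(4)
  by (induction rule: tensor_induct) (auto simp: assms(3) lin_add[OF assms(1)] lin_add[OF assms(2)])

text \<open>The universal property of the tensor product. The linear extension of \<open>f\<close>
  vanishes on all four families in \<open>bilinear_relations\<close>; its kernel is a subspace, so
  it contains their span \<open>tensor_null\<close>.\<close>

lemma
  assumes f: "bilin A B V f" and V: "vs V"
  shows tensor_lift_linear: "tensor_lift V f \<in> linear_maps (tensor_module A B) V"
    and tensor_lift_pure: "a \<in> carrier A \<Longrightarrow> b \<in> carrier B \<Longrightarrow> tensor_lift V f (pure_tensor A B a b) = f a b"
proof -
  interpret V: vs V by fact
  let ?h = "lin_ext V (\<lambda>p. f (fst p) (snd p))"
  have h: "?h \<in> linear_maps FM V"
    by (rule V.lin_ext_linear) (auto intro: bilin_closed[OF f])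
  have hs: "?h (Poly_Mapping.single (a, b) k) = k \<odot>\<^bsub>V\<^esub> f a b"
    if "a \<in> carrier A" "b \<in> carrier B" for a b k
    using that by (subst V.lin_ext_single) (auto intro: bilin_closed[OF f])
  let ?s = "\<lambda>x y. Poly_Mapping.single (x, y) :: 'k \<Rightarrow> _"
  have d: "?h (x - y) = ?h x \<ominus>\<^bsub>V\<^esub> ?h y" if "x \<in> carrier FM" "y \<in> carrier FM" for x y
    using lin_diff[OF h vs_free_module V that] that by simp
  have m: "x - y \<in> carrier FM" if "x \<in> carrier FM" "y \<in> carrier FM" for x y :: "'a \<times> 'b \<Rightarrow>\<^sub>0 'k"
    using keys_diff[of x y] that by auto
  have sc: "?s a b k \<in> carrier FM" if "a \<in> carrier A" "b \<in> carrier B" for a b k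
    using that by auto
  have c: "u \<oplus>\<^bsub>V\<^esub> v \<ominus>\<^bsub>V\<^esub> u \<ominus>\<^bsub>V\<^esub> v = \<zero>\<^bsub>V\<^esub>" if "u \<in> carrier V" "v \<in> carrier V" for u v
    using that by (simp add: V.a_comm[of u v] V.add_minus_cancel V.minus_self)
  have "bilinear_relations A B \<subseteq> {x \<in> carrier FM. ?h x = \<zero>\<^bsub>V\<^esub>}"
    using bilinear_relations_carrier
    by (auto simp: bilinear_relations_def d m sc hs bilin_closed[OF f] lin_add[OF bilin_1[OF f]]
      lin_add[OF bilin_2[OF f]] lin_smult[OF bilin_1[OF f]] lin_smult[OF bilin_2[OF f]]
      c V.minus_self simp del: free_module_simps)
  then have "tensor_null A B \<subseteq> {x \<in> carrier FM. ?h x = \<zero>\<^bsub>V\<^esub>}"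
    unfolding tensor_null_def
    by (intro T.submodule_span_least lin_kernel h V vs_free_module)
  then have n: "\<And>n. n \<in> tensor_null A B \<Longrightarrow> ?h n = \<zero>\<^bsub>V\<^esub>" by auto
  have e: "tensor_lift V f = (\<lambda>\<xi>. the_elem (?h ` \<xi>))"
    by (simp add: tensor_lift_def lin_ext_def[abs_def] fun_eq_iff)
  show "tensor_lift V f \<in> linear_maps (tensor_module A B) V"
    unfolding e tensor_module_def by (rule T.the_elem_linear[OF h V n])
  show "tensor_lift V f (pure_tensor A B a b) = f a b" if "a \<in> carrier A" "b \<in> carrier B"
    unfolding e pure_tensor_def using that
    by (subst T.the_elem_coset[OF h V n]) (simp_all add: hs bilin_closed[OF f])
qed

end

subsection \<open>Calculus of multilinear maps\<close>

lemma scalars_simps [simp]: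
  "carrier (scalars :: ('k::field,'k) module) = UNIV" "x \<oplus>\<^bsub>scalars\<^esub> y = x + y" "x \<otimes>\<^bsub>scalars\<^esub> y = x * y"
  "\<zero>\<^bsub>scalars\<^esub> = 0" "\<one>\<^bsub>scalars\<^esub> = 1" "k \<odot>\<^bsub>scalars\<^esub> x = k * x"
  by (simp_all add: scalars_def ring.defs module.defs ring_of_type_algebra_def)

lemma vs_scalars [simp]: "vs (scalars :: ('k::field,'k) module)"
proof (rule vsI)
  show "abelian_group (scalars :: ('k::field,'k) module)"
    by (rule abelian_groupI) (auto simp: add_ac intro: exI[of _ "- x" for x])
qed (simp_all add: algebra_simps)

lemma
  assumes "f \<in> linear_maps M N" "vs N"
  shows lin_smult_vec: "(\<lambda>x. k \<odot>\<^bsub>N\<^esub> f x) \<in> linear_maps M N"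
    and lin_add_fun: "g \<in> linear_maps M N \<Longrightarrow> (\<lambda>x. f x \<oplus>\<^bsub>N\<^esub> g x) \<in> linear_maps M N"
proof -
  interpret N: vs N by fact
  note f = lin_closed[OF assms(1)] lin_add[OF assms(1)] lin_smult[OF assms(1)]
  show "(\<lambda>x. k \<odot>\<^bsub>N\<^esub> f x) \<in> linear_maps M N"
    by (rule linear_mapsI) (simp_all add: f N.smult_add_r N.smult_smult mult.commute)
  show "(\<lambda>x. f x \<oplus>\<^bsub>N\<^esub> g x) \<in> linear_maps M N" if "g \<in> linear_maps M N"
    by (rule linear_mapsI) (simp_all add: f lin_closed[OF that] lin_add[OF that] lin_smult[OF that]
        N.smult_add_r N.M.a_ac)
qed

lemma lin_smult_scalar:
  assumes "f \<in> linear_maps M scalars" "vs N" "v \<in> carrier N"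
  shows "(\<lambda>x. f x \<odot>\<^bsub>N\<^esub> v) \<in> linear_maps M N"
proof -
  interpret N: vs N by fact
  show ?thesis
    by (rule linear_mapsI)
      (simp_all add: assms(3) lin_add[OF assms(1)] lin_smult[OF assms(1)] N.smult_add_l N.smult_smult)
qed

lemma lin_times_l: "f \<in> linear_maps M scalars \<Longrightarrow> (\<lambda>x. f x * c) \<in> linear_maps M scalars"
  and lin_times_r: "f \<in> linear_maps M scalars \<Longrightarrow> (\<lambda>x. c * f x) \<in> linear_maps M scalars"
  by (auto simp: linear_maps_def algebra_simps)

lemma bilin_linear_1: "bilin A B V f \<Longrightarrow> g \<in> linear_maps Y A \<Longrightarrow> b \<in> carrier B \<Longrightarrow> (\<lambda>x. f (g x) b) \<in> linear_maps Y V"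
  by (rule lin_comp[of g Y A "\<lambda>a. f a b" V]) (auto intro: bilin_1)

lemma bilin_linear_2: "bilin A B V f \<Longrightarrow> a \<in> carrier A \<Longrightarrow> g \<in> linear_maps Y B \<Longrightarrow> (\<lambda>x. f a (g x)) \<in> linear_maps Y V"
  by (rule lin_comp[of g Y B "\<lambda>b. f a b" V]) (auto intro: bilin_2)

lemma bilin_cong:
  assumes "bilin A B V f" "vs A" "vs B" "\<And>a b. a \<in> carrier A \<Longrightarrow> b \<in> carrier B \<Longrightarrow> f a b = g a b"
  shows "bilin A B V g"
proof (rule bilinI)
  show "(\<lambda>b. g a b) \<in> linear_maps B V" if "a \<in> carrier A" for a
    by (rule linear_maps_cong_set[OF _ bilin_2[OF assms(1) that] assms(3)]) (simp add: assms(4) that)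
  show "(\<lambda>a. g a b) \<in> linear_maps A V" if "b \<in> carrier B" for b
    by (rule linear_maps_cong_set[OF _ bilin_1[OF assms(1) that] assms(2)]) (simp add: assms(4) that)
qed

context tensor begin

lemma lin_pure_l: "f \<in> linear_maps Y A \<Longrightarrow> b \<in> carrier B \<Longrightarrow> (\<lambda>x. pure_tensor A B (f x) b) \<in> linear_maps Y (tensor_module A B)"
  by (rule bilin_linear_1[OF bilin_pure])

lemma lin_pure_r: "f \<in> linear_maps Y B \<Longrightarrow> a \<in> carrier A \<Longrightarrow> (\<lambda>x. pure_tensor A B a (f x)) \<in> linear_maps Y (tensor_module A B)"
  by (rule bilin_linear_2[OF bilin_pure])

lemma tensor_lift_cong:
  assumes "bilin A B V f" "vs V" "\<And>a b. a \<in> carrier A \<Longrightarrow> b \<in> carrier B \<Longrightarrow> f a b = g a b"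
    "\<eta> \<in> carrier (tensor_module A B)"
  shows "tensor_lift V f \<eta> = tensor_lift V g \<eta>"
proof -
  have g: "bilin A B V g" by (rule bilin_cong[OF assms(1) A.vs_axioms B.vs_axioms assms(3)])
  show ?thesis
    by (rule linear_maps_tensor_eqI[OF tensor_lift_linear[OF assms(1,2)] tensor_lift_linear[OF g assms(2)] _ assms(4)])
      (simp add: tensor_lift_pure assms g)
qed

lemma tensor_lift_comp:
  assumes "bilin A B V f" "vs V" "vs W" "G \<in> linear_maps V W" "\<eta> \<in> carrier (tensor_module A B)"
  shows "G (tensor_lift V f \<eta>) = tensor_lift W (\<lambda>a b. G (f a b)) \<eta>"
proof -
  have g: "bilin A B W (\<lambda>a b. G (f a b))"
    by (rule bilinI) (auto intro: lin_comp[OF bilin_1[OF assms(1)] assms(4)] lin_comp[OF bilin_2[OF assms(1)] assms(4)])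
  show ?thesis
    by (rule linear_maps_tensor_eqI[OF lin_comp[OF tensor_lift_linear[OF assms(1,2)] assms(4)]
          tensor_lift_linear[OF g assms(3)] _ assms(5)]) (simp add: tensor_lift_pure assms g)
qed

text \<open>For a fixed tensor, linearity in the parameter is clear on pure tensors and survives
  sums. It provides the linearity of nested Sweedler sums in their free arguments.\<close>

lemma tensor_lift_param:
  assumes "vs Y" "vs V" and \<eta>: "\<eta> \<in> carrier (tensor_module A B)"
    and b: "\<And>x. x \<in> carrier Y \<Longrightarrow> bilin A B V (f x)"
    and l: "\<And>a b. a \<in> carrier A \<Longrightarrow> b \<in> carrier B \<Longrightarrow> (\<lambda>x. f x a b) \<in> linear_maps Y V"
  shows "(\<lambda>x. tensor_lift V (f x) \<eta>) \<in> linear_maps Y V"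
proof -
  interpret Y: vs Y by fact
  interpret V: vs V by fact
  note cl = lin_closed[OF tensor_lift_linear[OF b assms(2)]]
  note ad = lin_add[OF tensor_lift_linear[OF b assms(2)]]
  show ?thesis using \<eta>
  proof (induction rule: tensor_induct)
    case (pure a c)
    show ?case
      by (rule linear_maps_cong_set[OF _ l[OF pure] assms(1)]) (simp add: tensor_lift_pure b assms(2) pure)
  next
    case (add \<xi> \<eta>)
    show ?case
      by (rule linear_maps_cong_set[OF _ lin_add_fun[OF add.IH(1) assms(2) add.IH(2)] assms(1)])
        (simp add: ad add.hyps)
  qed
qed

text \<open>Fubini for tensors: both sides are linear in \<open>\<xi>\<close> and agree when
  \<open>\<xi>\<close> is pure.\<close>

lemma tensor_lift_swap:
  assumes "tensor C D" "vs V" and \<xi>: "\<xi> \<in> carrier (tensor_module A B)" and \<eta>: "\<eta> \<in> carrier (tensor_module C D)"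
    and b1: "\<And>a b. a \<in> carrier A \<Longrightarrow> b \<in> carrier B \<Longrightarrow> bilin C D V (f a b)"
    and b2: "\<And>c d. c \<in> carrier C \<Longrightarrow> d \<in> carrier D \<Longrightarrow> bilin A B V (\<lambda>a b. f a b c d)"
  shows "tensor_lift V (\<lambda>a b. tensor_lift V (f a b) \<eta>) \<xi> = tensor_lift V (\<lambda>c d. tensor_lift V (\<lambda>a b. f a b c d) \<xi>) \<eta>"
proof -
  interpret C: tensor C D by fact
  have L: "bilin A B V (\<lambda>a b. tensor_lift V (f a b) \<eta>)"
    by (intro bilinI C.tensor_lift_param A.vs_axioms B.vs_axioms assms) (auto intro: b1 bilin_1[OF b2] bilin_2[OF b2])
  have R: "bilin C D V (\<lambda>c d. tensor_lift V (\<lambda>a b. f a b c d) \<xi>)" if "\<xi> \<in> carrier (tensor_module A B)" for \<xi>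
    by (intro bilinI tensor_lift_param C.A.vs_axioms C.B.vs_axioms assms that) (auto intro: b2 bilin_1[OF b1] bilin_2[OF b1])
  show ?thesis
  proof (rule linear_maps_tensor_eqI[OF tensor_lift_linear[OF L assms(2)] _ _ \<xi>])
    show "(\<lambda>\<xi>. tensor_lift V (\<lambda>c d. tensor_lift V (\<lambda>a b. f a b c d) \<xi>) \<eta>) \<in> linear_maps (tensor_module A B) V"
      by (rule C.tensor_lift_param[OF vs_tensor assms(2) \<eta> R])
        (auto intro!: tensor_lift_linear[OF b2] assms)
    fix a b assume ab: "a \<in> carrier A" "b \<in> carrier B"
    show "tensor_lift V (\<lambda>a b. tensor_lift V (f a b) \<eta>) (pure_tensor A B a b) =
        tensor_lift V (\<lambda>c d. tensor_lift V (\<lambda>a b. f a b c d) (pure_tensor A B a b)) \<eta>"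
      by (subst tensor_lift_pure[OF L assms(2) ab], rule C.tensor_lift_cong[OF b1[OF ab] assms(2) _ \<eta>])
        (simp add: tensor_lift_pure[OF b2] assms ab)
  qed
qed

end

subsection \<open>Algebras\<close>

locale kalg = vs M + ring M for M :: "('k::field, 'a, 'm) module_scheme" (structure) +
  assumes mult_smult_l: "x \<in> carrier M \<Longrightarrow> y \<in> carrier M \<Longrightarrow> (k \<odot> x) \<otimes> y = k \<odot> (x \<otimes> y)"
    and mult_smult_r: "x \<in> carrier M \<Longrightarrow> y \<in> carrier M \<Longrightarrow> x \<otimes> (k \<odot> y) = k \<odot> (x \<otimes> y)"
begin

lemma bilin_mult: "bilin M M M (\<otimes>)"
  by (intro bilinI linear_mapsI) (simp_all add: mult_smult_l mult_smult_r l_distr r_distr)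

lemma lin_mult_l: "f \<in> linear_maps Y M \<Longrightarrow> c \<in> carrier M \<Longrightarrow> (\<lambda>x. f x \<otimes> c) \<in> linear_maps Y M"
  by (rule bilin_linear_1[OF bilin_mult])

lemma lin_mult_r: "f \<in> linear_maps Y M \<Longrightarrow> c \<in> carrier M \<Longrightarrow> (\<lambda>x. c \<otimes> f x) \<in> linear_maps Y M"
  by (rule bilin_linear_2[OF bilin_mult])

end

lemma kalg_scalars: "kalg (scalars :: ('k::field,'k) module)"
proof -
  interpret vs "scalars :: ('k::field,'k) module" by simp
  have "ring (scalars :: ('k::field,'k) module)"
    by (rule ringI[OF abelian_group_axioms monoidI]) (simp_all add: algebra_simps)
  then show ?thesis by (simp add: kalg_def kalg_axioms_def vs_axioms algebra_simps)
qed

text \<open>The opposite algebra serves two purposes: it is the target of the antipode as an algebra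
  map, and in it the Serre elements in the \<open>F i\<close> become iterated q-commutators.\<close>

lemma kalg_opposite: "kalg M \<Longrightarrow> kalg (opposite M)"
proof -
  assume "kalg M" then interpret kalg M .
  have s: "carrier (opposite M) = carrier M" "\<zero>\<^bsub>opposite M\<^esub> = \<zero>\<^bsub>M\<^esub>" "\<one>\<^bsub>opposite M\<^esub> = \<one>\<^bsub>M\<^esub>"
    "x \<oplus>\<^bsub>opposite M\<^esub> y = x \<oplus>\<^bsub>M\<^esub> y" "x \<otimes>\<^bsub>opposite M\<^esub> y = y \<otimes>\<^bsub>M\<^esub> x" "k \<odot>\<^bsub>opposite M\<^esub> x = k \<odot>\<^bsub>M\<^esub> x" for x y k
    by (simp_all add: opposite_def)
  have g: "abelian_group (opposite M)"
    proof (rule abelian_groupI)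
    show "\<exists>y\<in>carrier (opposite M). y \<oplus>\<^bsub>opposite M\<^esub> x = \<zero>\<^bsub>opposite M\<^esub>" if "x \<in> carrier (opposite M)" for x
      using that by (intro bexI[of _ "\<ominus>\<^bsub>M\<^esub> x"]) (simp_all add: s l_neg)
  qed (simp_all add: s a_ac)
  have v: "vs (opposite M)"
    by (rule vsI[OF g]) (simp_all add: s smult_add_l smult_add_r smult_smult)
  have "ring (opposite M)"
    by (rule ringI[OF g monoidI]) (simp_all add: s m_assoc l_distr r_distr)
  then show ?thesis
    using v by (simp add: kalg_def kalg_axioms_def s mult_smult_l mult_smult_r)
qed

lemma opposite_simps [simp]:
  "carrier (opposite M) = carrier M" "x \<oplus>\<^bsub>opposite M\<^esub> y = x \<oplus>\<^bsub>M\<^esub> y" "\<zero>\<^bsub>opposite M\<^esub> = \<zero>\<^bsub>M\<^esub>"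
  "\<one>\<^bsub>opposite M\<^esub> = \<one>\<^bsub>M\<^esub>" "x \<otimes>\<^bsub>opposite M\<^esub> y = y \<otimes>\<^bsub>M\<^esub> x" "k \<odot>\<^bsub>opposite M\<^esub> x = k \<odot>\<^bsub>M\<^esub> x"
  by (simp_all add: opposite_def)

lemma algebra_homsI:
  assumes "f \<in> linear_maps M N" "f \<one>\<^bsub>M\<^esub> = \<one>\<^bsub>N\<^esub>"
    "\<And>x y. x \<in> carrier M \<Longrightarrow> y \<in> carrier M \<Longrightarrow> f (x \<otimes>\<^bsub>M\<^esub> y) = f x \<otimes>\<^bsub>N\<^esub> f y"
  shows "f \<in> algebra_homs M N"
  using assms by (auto simp: algebra_homs_def ring_hom_def linear_maps_def)

lemma alg_lin: "f \<in> algebra_homs M N \<Longrightarrow> f \<in> linear_maps M N"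
  and alg_one: "f \<in> algebra_homs M N \<Longrightarrow> f \<one>\<^bsub>M\<^esub> = \<one>\<^bsub>N\<^esub>"
  and alg_mult: "f \<in> algebra_homs M N \<Longrightarrow> x \<in> carrier M \<Longrightarrow> y \<in> carrier M \<Longrightarrow> f (x \<otimes>\<^bsub>M\<^esub> y) = f x \<otimes>\<^bsub>N\<^esub> f y"
  by (auto simp: algebra_homs_def ring_hom_def)

lemmas alg_closed = lin_closed[OF alg_lin] and alg_add = lin_add[OF alg_lin] and alg_smult = lin_smult[OF alg_lin]

subsection \<open>The tensor product of two algebras\<close>

lemma tensor_algebra_simps [simp]:
  "carrier (tensor_algebra A B) = carrier (tensor_module A B)" "x \<oplus>\<^bsub>tensor_algebra A B\<^esub> y = x \<oplus>\<^bsub>tensor_module A B\<^esub> y"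
  "\<zero>\<^bsub>tensor_algebra A B\<^esub> = \<zero>\<^bsub>tensor_module A B\<^esub>" "k \<odot>\<^bsub>tensor_algebra A B\<^esub> x = k \<odot>\<^bsub>tensor_module A B\<^esub> x"
  "\<one>\<^bsub>tensor_algebra A B\<^esub> = pure_tensor A B \<one>\<^bsub>A\<^esub> \<one>\<^bsub>B\<^esub>"
  by (simp_all add: tensor_algebra_def)

lemma linear_maps_tensor_algebra [simp]:
  "linear_maps (tensor_algebra A B) V = linear_maps (tensor_module A B) V"
  "linear_maps V (tensor_algebra A B) = linear_maps V (tensor_module A B)"
  by (simp_all add: linear_maps_def)

lemma bilin_tensor_algebra [simp]:
  "bilin A B (tensor_algebra C D) f = bilin A B (tensor_module C D) f"
  by (simp add: bilin_def)

locale tensor_alg = A: kalg A + B: kalg B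
  for A :: "('k::field, 'a, 'm) module_scheme" and B :: "('k, 'b, 'n) module_scheme"
begin

sublocale tensor A B ..

abbreviation "TA \<equiv> tensor_algebra A B"

lemma bilin_pure_mult: "a \<in> carrier A \<Longrightarrow> b \<in> carrier B \<Longrightarrow>
    bilin A B (tensor_module A B) (\<lambda>a' b'. pure_tensor A B (a \<otimes>\<^bsub>A\<^esub> a') (b \<otimes>\<^bsub>B\<^esub> b'))"
  by (intro bilinI lin_pure_l lin_pure_r A.lin_mult_r B.lin_mult_r lin_id) auto

lemma bilin_pure_mult': "a' \<in> carrier A \<Longrightarrow> b' \<in> carrier B \<Longrightarrow>
    bilin A B (tensor_module A B) (\<lambda>a b. pure_tensor A B (a \<otimes>\<^bsub>A\<^esub> a') (b \<otimes>\<^bsub>B\<^esub> b'))"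
  by (intro bilinI lin_pure_l lin_pure_r A.lin_mult_l B.lin_mult_l lin_id) auto

lemma bilin_pure_mult_lift: "\<eta> \<in> carrier (tensor_module A B) \<Longrightarrow> bilin A B (tensor_module A B)
    (\<lambda>a b. tensor_lift (tensor_module A B) (\<lambda>a' b'. pure_tensor A B (a \<otimes>\<^bsub>A\<^esub> a') (b \<otimes>\<^bsub>B\<^esub> b')) \<eta>)"
  by (intro bilinI tensor_lift_param vs_tensor A.vs_axioms B.vs_axioms bilin_pure_mult)
    (auto intro: bilin_1[OF bilin_pure_mult'] bilin_2[OF bilin_pure_mult'])

lemma tensor_mult_def: "\<xi> \<otimes>\<^bsub>TA\<^esub> \<eta> = tensor_lift (tensor_module A B) (\<lambda>a b.
    tensor_lift (tensor_module A B) (\<lambda>a' b'. pure_tensor A B (a \<otimes>\<^bsub>A\<^esub> a') (b \<otimes>\<^bsub>B\<^esub> b')) \<eta>) \<xi>"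
  by (simp add: tensor_algebra_def)

lemma pure_mult_pure [simp]:
  assumes "a \<in> carrier A" "b \<in> carrier B" "a' \<in> carrier A" "b' \<in> carrier B"
  shows "pure_tensor A B a b \<otimes>\<^bsub>TA\<^esub> pure_tensor A B a' b' = pure_tensor A B (a \<otimes>\<^bsub>A\<^esub> a') (b \<otimes>\<^bsub>B\<^esub> b')"
  unfolding tensor_mult_def using assms
  by (simp add: tensor_lift_pure[OF bilin_pure_mult_lift] tensor_lift_pure[OF bilin_pure_mult])

lemma bilin_tensor_mult: "bilin (tensor_module A B) (tensor_module A B) (tensor_module A B) (\<lambda>\<xi> \<eta>. \<xi> \<otimes>\<^bsub>TA\<^esub> \<eta>)"
  unfolding tensor_mult_def
  by (intro bilinI tensor_lift_linear bilin_pure_mult_lift tensor_lift_param bilin_pure_mult vs_tensor)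

lemma tensor_mult_closed: "\<xi> \<in> carrier (tensor_module A B) \<Longrightarrow> \<eta> \<in> carrier (tensor_module A B) \<Longrightarrow>
    \<xi> \<otimes>\<^bsub>TA\<^esub> \<eta> \<in> carrier (tensor_module A B)"
  by (rule bilin_closed[OF bilin_tensor_mult])

lemmas tm_simps = lin_add[OF bilin_1[OF bilin_tensor_mult]] lin_add[OF bilin_2[OF bilin_tensor_mult]]
  lin_smult[OF bilin_1[OF bilin_tensor_mult]] lin_smult[OF bilin_2[OF bilin_tensor_mult]]

lemma tensor_mult_assoc:
  assumes "\<xi> \<in> carrier (tensor_module A B)" "\<eta> \<in> carrier (tensor_module A B)" "\<zeta> \<in> carrier (tensor_module A B)"
  shows "(\<xi> \<otimes>\<^bsub>TA\<^esub> \<eta>) \<otimes>\<^bsub>TA\<^esub> \<zeta> = \<xi> \<otimes>\<^bsub>TA\<^esub> (\<eta> \<otimes>\<^bsub>TA\<^esub> \<zeta>)"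
  using assms(1)
proof (induction rule: tensor_induct)
  case (pure a b)
  note ab = this
  show ?case using assms(2)
  proof (induction rule: tensor_induct)
    case (pure a' b')
    show ?case using assms(3)
      by (induction rule: tensor_induct) (simp_all add: ab pure A.m_assoc B.m_assoc tm_simps tensor_mult_closed)
  qed (use ab assms in \<open>simp_all add: tm_simps tensor_mult_closed\<close>)
qed (use assms in \<open>simp_all add: tm_simps tensor_mult_closed\<close>)

lemma kalg_tensor: "kalg TA"
proof -
  interpret V: vs "tensor_module A B" by simp
  have g: "abelian_group TA"
  proof (rule abelian_groupI)
    show "\<exists>y\<in>carrier TA. y \<oplus>\<^bsub>TA\<^esub> x = \<zero>\<^bsub>TA\<^esub>" if "x \<in> carrier TA" for x
      using that by (intro bexI[of _ "\<ominus>\<^bsub>tensor_module A B\<^esub> x"]) (simp_all add: V.M.l_neg)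
  qed (simp_all add: V.M.a_ac)
  have one: "pure_tensor A B \<one>\<^bsub>A\<^esub> \<one>\<^bsub>B\<^esub> \<otimes>\<^bsub>TA\<^esub> \<xi> = \<xi>" "\<xi> \<otimes>\<^bsub>TA\<^esub> pure_tensor A B \<one>\<^bsub>A\<^esub> \<one>\<^bsub>B\<^esub> = \<xi>"
    if "\<xi> \<in> carrier (tensor_module A B)" for \<xi>
    using that by (induction rule: tensor_induct) (simp_all add: tm_simps)
  have "ring TA"
    by (rule ringI[OF g monoidI]) (simp_all add: tensor_mult_closed tensor_mult_assoc one tm_simps)
  moreover have "vs TA"
    by (rule vsI[OF g]) (simp_all add: V.smult_add_l V.smult_add_r V.smult_smult)
  ultimately show ?thesis by (simp add: kalg_def kalg_axioms_def tm_simps)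
qed

sublocale TA: kalg TA by (rule kalg_tensor)

lemma algebra_homs_tensorI:
  assumes "f \<in> linear_maps (tensor_module A B) N" "kalg N" "f (pure_tensor A B \<one>\<^bsub>A\<^esub> \<one>\<^bsub>B\<^esub>) = \<one>\<^bsub>N\<^esub>"
    and p: "\<And>a b a' b'. a \<in> carrier A \<Longrightarrow> b \<in> carrier B \<Longrightarrow> a' \<in> carrier A \<Longrightarrow> b' \<in> carrier B \<Longrightarrow>
      f (pure_tensor A B (a \<otimes>\<^bsub>A\<^esub> a') (b \<otimes>\<^bsub>B\<^esub> b')) = f (pure_tensor A B a b) \<otimes>\<^bsub>N\<^esub> f (pure_tensor A B a' b')"
  shows "f \<in> algebra_homs TA N"
proof (rule algebra_homsI)
  interpret N: kalg N by fact
  note f = lin_closed[OF assms(1)] lin_add[OF assms(1)]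
  fix \<xi> \<eta> assume \<xi>: "\<xi> \<in> carrier TA" and \<eta>: "\<eta> \<in> carrier TA"
  from \<xi>[unfolded tensor_algebra_simps] show "f (\<xi> \<otimes>\<^bsub>TA\<^esub> \<eta>) = f \<xi> \<otimes>\<^bsub>N\<^esub> f \<eta>"
  proof (induction rule: tensor_induct)
    case (pure a b)
    note ab = this
    from \<eta>[unfolded tensor_algebra_simps] show ?case
      by (induction rule: tensor_induct) (simp_all add: ab p tm_simps f tensor_mult_closed N.r_distr)
  qed (use \<eta> in \<open>simp_all add: tm_simps f tensor_mult_closed N.l_distr\<close>)
qed (use assms in simp_all)

end

subsection \<open>Complements of subspaces\<close>

context vs begin

lemma diff_eq_diffI:
  assumes "a \<in> carrier M" "b \<in> carrier M" "c \<in> carrier M" "d \<in> carrier M" "a \<oplus> b = c \<oplus> d"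
  shows "a \<ominus> c = d \<ominus> b"
proof -
  have "a = (c \<oplus> d) \<ominus> b" using add_minus_cancel[of a b] assms by simp
  also have "\<dots> = (d \<ominus> b) \<oplus> c" using assms by (simp add: M.minus_eq M.a_ac)
  finally show ?thesis using add_minus_cancel[of "d \<ominus> b" c] assms by simp
qed

text \<open>Zorn's lemma gives a subspace \<open>K\<close> that is maximal among those meeting
  \<open>C\<close> only in zero. Maximality forces \<open>K + C\<close> to be everything, and
  \<open>r\<close> is the projection along \<open>K\<close>.\<close>

lemma linear_retraction:
  assumes C: "submodule C (ring_of_type_algebra :: 'k ring) M"
  obtains r where "r \<in> linear_maps M (M\<lparr>carrier := C\<rparr>)" "\<And>c. c \<in> C \<Longrightarrow> r c = c"
proof -
  note CD = submodule_vsD[OF C]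
  let ?A = "{K. submodule K (ring_of_type_algebra :: 'k ring) M \<and> K \<inter> C = {\<zero>}}"
  have "submodule {\<zero>} (ring_of_type_algebra :: 'k ring) M"
    by (rule submodule_vsI) auto
  then have "{\<zero>} \<in> ?A" using CD(2) by auto
  then have ne: "?A \<noteq> {}" by blast
  have "\<Union>\<C> \<in> ?A" if ch: "\<C> \<noteq> {}" "subset.chain ?A \<C>" for \<C>
  proof -
    have sm: "\<And>K. K \<in> \<C> \<Longrightarrow> submodule K (ring_of_type_algebra :: 'k ring) M" "\<And>K. K \<in> \<C> \<Longrightarrow> K \<inter> C = {\<zero>}"
      using ch by (auto simp: subset.chain_def)
    have "submodule (\<Union>\<C>) (ring_of_type_algebra :: 'k ring) M"
    proof (rule submodule_vsI)
      show "\<Union>\<C> \<subseteq> carrier M" using submodule_vsD(1)[OF sm(1)] by blast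
      show "\<zero> \<in> \<Union>\<C>" using submodule_vsD(2)[OF sm(1)] ch by blast
      show "x \<oplus> y \<in> \<Union>\<C>" if xy: "x \<in> \<Union>\<C>" "y \<in> \<Union>\<C>" for x y
      proof -
        obtain K L where KL: "K \<in> \<C>" "L \<in> \<C>" "x \<in> K" "y \<in> L" using xy by blast
        then have "K \<subseteq> L \<or> L \<subseteq> K" using ch by (auto simp: subset_chain_def)
        then show ?thesis using KL submodule_vsD(3)[OF sm(1)] by blast
      qed
      show "k \<odot> x \<in> \<Union>\<C>" if "x \<in> \<Union>\<C>" for k x using that submodule_vsD(4)[OF sm(1)] by blast
    qed
    moreover have "\<Union>\<C> \<inter> C = {\<zero>}" using sm(2) ch(1) by blast
    ultimately show ?thesis by simp
  qed
  then obtain K where K: "submodule K (ring_of_type_algebra :: 'k ring) M" "K \<inter> C = {\<zero>}"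
    and Kmax: "\<And>L. submodule L (ring_of_type_algebra :: 'k ring) M \<Longrightarrow> L \<inter> C = {\<zero>} \<Longrightarrow> K \<subseteq> L \<Longrightarrow> L = K"
    using subset_Zorn_nonempty[OF ne] by auto
  note KD = submodule_vsD[OF K(1)]
  \<comment> \<open>If \<open>x\<close> were outside \<open>K + C\<close>, then \<open>?L\<close>,
    the span of \<open>K\<close> and \<open>x\<close>, would still meet \<open>C\<close> only in
    zero, against the maximality of \<open>K\<close>.\<close>
  have ex: "\<exists>c. c \<in> C \<and> (\<exists>k\<in>K. x = k \<oplus> c)" if x: "x \<in> carrier M" for x
  proof (rule ccontr)
    assume no: "\<not> ?thesis"
    let ?L = "{k \<oplus> a \<odot> x | k a. k \<in> K}"
    have "submodule ?L (ring_of_type_algebra :: 'k ring) M"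
    proof (rule submodule_vsI)
      show "?L \<subseteq> carrier M" using KD(1) x by auto
      show "\<zero> \<in> ?L" using KD(2) x by (auto intro!: exI[of _ \<zero>] exI[of _ 0])
      fix u assume "u \<in> ?L"
      then obtain k a where u: "u = k \<oplus> a \<odot> x" "k \<in> K" by blast
      have "l \<odot> u = l \<odot> k \<oplus> (l * a) \<odot> x" for l
        using u KD(1)[OF u(2)] x by (simp add: smult_add_r smult_smult)
      then show "l \<odot> u \<in> ?L" for l using KD(4)[OF u(2)] by blast
      fix v assume "v \<in> ?L"
      then obtain k' a' where v: "v = k' \<oplus> a' \<odot> x" "k' \<in> K" by blast
      have "u \<oplus> v = (k \<oplus> k') \<oplus> (a + a') \<odot> x"
        using u v KD(1)[OF u(2)] KD(1)[OF v(2)] x by (simp add: smult_add_l M.a_ac)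
      then show "u \<oplus> v \<in> ?L" using KD(3)[OF u(2) v(2)] by blast
    qed
    moreover have "K \<subseteq> ?L"
    proof
      fix k assume "k \<in> K"
      then show "k \<in> ?L" using KD(1) x by (auto intro!: exI[of _ k] exI[of _ 0])
    qed
    moreover have "?L \<inter> C = {\<zero>}"
    proof -
      have "u = \<zero>" if u: "u \<in> ?L" "u \<in> C" for u
      proof -
        obtain k a where k: "u = k \<oplus> a \<odot> x" "k \<in> K" using u by blast
        have kc: "k \<in> carrier M" "u \<in> carrier M" using KD(1)[OF k(2)] CD(1)[OF u(2)] by auto
        \<comment> \<open>With \<open>a\<close> nonzero the equation could be solved for
          \<open>x\<close>, which would put \<open>x\<close> into \<open>K + C\<close>.\<close>
        have "a = 0"
        proof (rule ccontr)
          assume a: "a \<noteq> 0"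
          have "a \<odot> x = (- 1) \<odot> k \<oplus> u"
            using kc x k(1) by (simp add: smult_minus_l M.r_neg1 k)
          then have "inverse a \<odot> (a \<odot> x) = inverse a \<odot> ((- 1) \<odot> k \<oplus> u)" by simp
          then have "x = inverse a \<odot> ((- 1) \<odot> k) \<oplus> inverse a \<odot> u"
            using a x kc by (simp add: smult_smult smult_add_r)
          moreover have "inverse a \<odot> ((- 1) \<odot> k) \<in> K" "inverse a \<odot> u \<in> C"
            using KD(4) CD(4) k(2) u(2) by auto
          ultimately show False using no by blast
        qed
        then have "u = k" using k kc x by simp
        then show ?thesis using K(2) k(2) u(2) by blast
      qed
      moreover have "\<zero> \<in> ?L" using KD(2) x by (auto intro!: exI[of _ \<zero>] exI[of _ 0])
      ultimately show ?thesis using CD(2) by blast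
    qed
    ultimately have "?L = K" by (intro Kmax)
    moreover have "x \<in> ?L" using KD(2) x by (auto intro!: exI[of _ \<zero>] exI[of _ 1])
    ultimately have "x \<in> K" by simp
    then show False using no CD(2) x by (metis M.r_zero)
  qed
  have uniq: "c = c'" if h: "c \<in> C" "c' \<in> C" "k \<in> K" "k' \<in> K" "k \<oplus> c = k' \<oplus> c'" for c c' k k'
  proof -
    note h' = h CD(1)[OF h(1)] CD(1)[OF h(2)] KD(1)[OF h(3)] KD(1)[OF h(4)]
    have e: "k \<ominus> k' = c' \<ominus> c" using h' by (intro diff_eq_diffI) auto
    have "k \<ominus> k' \<in> K" "c' \<ominus> c \<in> C" unfolding minus_smult1[OF h'(8,9)] minus_smult1[OF h'(7,6)]
      using h' KD(3,4) CD(3,4) by auto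
    then have "c' \<ominus> c = \<zero>" using K(2) e by auto
    then have "\<zero> \<oplus> c = c'" using h' by (metis M.add.m_assoc M.l_neg M.minus_eq M.r_zero M.a_inv_closed M.a_comm)
    then show ?thesis using h' by simp
  qed
  define r where "r x = (SOME c. c \<in> C \<and> (\<exists>k\<in>K. x = k \<oplus> c))" for x
  have r: "r x \<in> C" "\<exists>k\<in>K. x = k \<oplus> r x" if "x \<in> carrier M" for x
    using someI_ex[OF ex[OF that]] unfolding r_def by auto
  have req: "r (k \<oplus> c) = c" if "k \<in> K" "c \<in> C" for k c
  proof -
    have "k \<oplus> c \<in> carrier M" using that KD(1) CD(1) by simp
    then obtain k' where "k' \<in> K" "k \<oplus> c = k' \<oplus> r (k \<oplus> c)" using r by blast
    then show ?thesis using uniq[of c "r (k \<oplus> c)" k k'] r(1) that \<open>k \<oplus> c \<in> carrier M\<close> by simp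
  qed
  show ?thesis
  proof
    show "r c = c" if "c \<in> C" for c using req[OF KD(2) that] CD(1)[OF that] by simp
    show "r \<in> linear_maps M (M\<lparr>carrier := C\<rparr>)"
    proof (rule linear_mapsI)
      fix x assume x: "x \<in> carrier M"
      then show "r x \<in> carrier (M\<lparr>carrier := C\<rparr>)" using r by simp
      obtain k where k: "k \<in> K" "x = k \<oplus> r x" using r[OF x] by blast
      show "r (l \<odot> x) = l \<odot>\<^bsub>M\<lparr>carrier := C\<rparr>\<^esub> r x" for l
      proof -
        have "l \<odot> x = l \<odot> k \<oplus> l \<odot> r x" using smult_add_r[OF KD(1)[OF k(1)] CD(1)[OF r(1)[OF x]], of l] k(2) by simp
        then show ?thesis using req[OF KD(4)[OF k(1)] CD(4)[OF r(1)[OF x]], of l l] by simp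
      qed
      fix y assume y: "y \<in> carrier M"
      obtain k' where k': "k' \<in> K" "y = k' \<oplus> r y" using r[OF y] by blast
      have "x \<oplus> y = (k \<oplus> r x) \<oplus> (k' \<oplus> r y)" using k(2) k'(2) by simp
      also have "\<dots> = (k \<oplus> k') \<oplus> (r x \<oplus> r y)"
        using KD(1)[OF k(1)] KD(1)[OF k'(1)] CD(1)[OF r(1)[OF x]] CD(1)[OF r(1)[OF y]] by (simp add: M.a_ac)
      finally show "r (x \<oplus> y) = r x \<oplus>\<^bsub>M\<lparr>carrier := C\<rparr>\<^esub> r y"
        using req[OF KD(3)[OF k(1) k'(1)] CD(3)[OF r(1)[OF x] r(1)[OF y]]] by simp
    qed
  qed
qed

end

subsection \<open>Sweedler calculus\<close>

definition trilin ::
  "('k::field, 'a, 'm) module_scheme \<Rightarrow> ('k, 'b, 'n) module_scheme \<Rightarrow> ('k, 'c, 'p) module_scheme \<Rightarrow>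
   ('k, 'v, 'l) module_scheme \<Rightarrow> ('a \<Rightarrow> 'b \<Rightarrow> 'c \<Rightarrow> 'v) \<Rightarrow> bool" where
  "trilin A B C V f \<longleftrightarrow> (\<forall>a\<in>carrier A. bilin B C V (f a)) \<and> (\<forall>b\<in>carrier B. bilin A C V (\<lambda>a. f a b)) \<and>
     (\<forall>c\<in>carrier C. bilin A B V (\<lambda>a b. f a b c))"

lemma trilinI:
  assumes "\<And>b c. b \<in> carrier B \<Longrightarrow> c \<in> carrier C \<Longrightarrow> (\<lambda>a. f a b c) \<in> linear_maps A V"
    "\<And>a c. a \<in> carrier A \<Longrightarrow> c \<in> carrier C \<Longrightarrow> (\<lambda>b. f a b c) \<in> linear_maps B V"
    "\<And>a b. a \<in> carrier A \<Longrightarrow> b \<in> carrier B \<Longrightarrow> (\<lambda>c. f a b c) \<in> linear_maps C V"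
  shows "trilin A B C V f"
  using assms by (simp add: trilin_def bilin_def)

lemma trilin_bilin:
  "trilin A B C V f \<Longrightarrow> a \<in> carrier A \<Longrightarrow> bilin B C V (f a)"
  "trilin A B C V f \<Longrightarrow> b \<in> carrier B \<Longrightarrow> bilin A C V (\<lambda>a. f a b)"
  "trilin A B C V f \<Longrightarrow> c \<in> carrier C \<Longrightarrow> bilin A B V (\<lambda>a b. f a b c)"
  by (simp_all add: trilin_def)

lemma trilin_linear:
  "trilin A B C V f \<Longrightarrow> b \<in> carrier B \<Longrightarrow> c \<in> carrier C \<Longrightarrow> (\<lambda>a. f a b c) \<in> linear_maps A V"
  "trilin A B C V f \<Longrightarrow> a \<in> carrier A \<Longrightarrow> c \<in> carrier C \<Longrightarrow> (\<lambda>b. f a b c) \<in> linear_maps B V"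
  "trilin A B C V f \<Longrightarrow> a \<in> carrier A \<Longrightarrow> b \<in> carrier B \<Longrightarrow> (\<lambda>c. f a b c) \<in> linear_maps C V"
  by (simp_all add: trilin_def bilin_def)

text \<open>Only a linear coproduct is required, since this is all that Sweedler sums need. The
  calculus is thus available on a structure whose coalgebra axioms are still to be proved.\<close>

locale precoalg = vs H for H :: "('k::field, 'a, 'm) hopf_scheme" (structure) +
  assumes comult_linear: "comult H \<in> linear_maps H (tensor_module H H)"
begin

sublocale T2: tensor H H ..

lemma comult_closed: "x \<in> carrier H \<Longrightarrow> comult H x \<in> carrier (tensor_module H H)"
  by (rule lin_closed[OF comult_linear])

lemma sw_lin_arg: "bilin H H V f \<Longrightarrow> vs V \<Longrightarrow> g \<in> linear_maps Y H \<Longrightarrow> (\<lambda>y. sweedler H V f (g y)) \<in> linear_maps Y V"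
  unfolding sweedler_def by (rule lin_comp[OF lin_comp[OF _ comult_linear] T2.tensor_lift_linear])

lemma sw_linear: "bilin H H V f \<Longrightarrow> vs V \<Longrightarrow> sweedler H V f \<in> linear_maps H V"
  by (rule sw_lin_arg[OF _ _ lin_id])

lemma sw_closed: "bilin H H V f \<Longrightarrow> vs V \<Longrightarrow> x \<in> carrier H \<Longrightarrow> sweedler H V f x \<in> carrier V"
  by (rule lin_closed[OF sw_linear])

lemma sw_lin_param:
  "vs Y \<Longrightarrow> vs V \<Longrightarrow> x \<in> carrier H \<Longrightarrow> (\<And>y. y \<in> carrier Y \<Longrightarrow> bilin H H V (f y)) \<Longrightarrow>
   (\<And>a b. a \<in> carrier H \<Longrightarrow> b \<in> carrier H \<Longrightarrow> (\<lambda>y. f y a b) \<in> linear_maps Y V) \<Longrightarrow>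
   (\<lambda>y. sweedler H V (f y) x) \<in> linear_maps Y V"
  unfolding sweedler_def by (rule T2.tensor_lift_param) (auto intro: comult_closed)

lemma sw_cong:
  "bilin H H V f \<Longrightarrow> vs V \<Longrightarrow> x \<in> carrier H \<Longrightarrow>
   (\<And>a b. a \<in> carrier H \<Longrightarrow> b \<in> carrier H \<Longrightarrow> f a b = g a b) \<Longrightarrow> sweedler H V f x = sweedler H V g x"
  unfolding sweedler_def by (rule T2.tensor_lift_cong) (auto intro: comult_closed)

lemma sw_comp:
  "bilin H H V f \<Longrightarrow> vs V \<Longrightarrow> vs W \<Longrightarrow> G \<in> linear_maps V W \<Longrightarrow> x \<in> carrier H \<Longrightarrow>
   G (sweedler H V f x) = sweedler H W (\<lambda>a b. G (f a b)) x"
  unfolding sweedler_def by (rule T2.tensor_lift_comp) (auto intro: comult_closed)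

lemma sw_pure: "comult H x = pure_tensor H H a b \<Longrightarrow> bilin H H V f \<Longrightarrow> vs V \<Longrightarrow> a \<in> carrier H \<Longrightarrow> b \<in> carrier H \<Longrightarrow>
   sweedler H V f x = f a b"
  unfolding sweedler_def by (simp add: T2.tensor_lift_pure)

lemma sw_pure2: "comult H x = pure_tensor H H a b \<oplus>\<^bsub>tensor_module H H\<^esub> pure_tensor H H c d \<Longrightarrow> bilin H H V f \<Longrightarrow> vs V \<Longrightarrow>
   a \<in> carrier H \<Longrightarrow> b \<in> carrier H \<Longrightarrow> c \<in> carrier H \<Longrightarrow> d \<in> carrier H \<Longrightarrow>
   sweedler H V f x = f a b \<oplus>\<^bsub>V\<^esub> f c d"
  unfolding sweedler_def by (simp add: T2.tensor_lift_pure lin_add[OF T2.tensor_lift_linear])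

lemma sw_swap:
  assumes "precoalg H'" "vs V" "x \<in> carrier H" "y \<in> carrier H'"
    and "\<And>a b. a \<in> carrier H \<Longrightarrow> b \<in> carrier H \<Longrightarrow> bilin H' H' V (f a b)"
    and "\<And>c d. c \<in> carrier H' \<Longrightarrow> d \<in> carrier H' \<Longrightarrow> bilin H H V (\<lambda>a b. f a b c d)"
  shows "sweedler H V (\<lambda>a b. sweedler H' V (f a b) y) x = sweedler H' V (\<lambda>c d. sweedler H V (\<lambda>a b. f a b c d) x) y"
proof -
  interpret H': precoalg H' by fact
  show ?thesis unfolding sweedler_def
    by (rule T2.tensor_lift_swap[OF H'.T2.tensor_axioms])
      (auto intro: assms comult_closed H'.comult_closed)
qed

end

text \<open>A bialgebra without coassociativity and the counit laws. For \<open>Uq\<close> the maps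
  are algebra homomorphisms by construction, while the remaining laws are checked on
  generators.\<close>

locale prebialg = kalg H for H :: "('k::field, 'a, 'm) hopf_scheme" (structure) +
  assumes comult_hom: "comult H \<in> algebra_homs H (tensor_algebra H H)"
    and counit_hom: "counit H \<in> algebra_homs H scalars"
begin

sublocale precoalg H
  using alg_lin[OF comult_hom] by unfold_locales simp

sublocale T2: tensor_alg H H ..

sublocale T3: tensor_alg H "tensor_algebra H H" ..

lemma counit_linear: "counit H \<in> linear_maps H scalars"
  using alg_lin[OF counit_hom] .

text \<open>Makes the outer one of two nested Sweedler sums meaningful, in both bracketings of the
  threefold coproduct.\<close>

lemma sw_lin12:
  assumes "trilin H H H V f" "vs V"
  shows "bilin H H V (\<lambda>y c. sweedler H V (\<lambda>a b. f a b c) y)"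
    "bilin H H V (\<lambda>a y. sweedler H V (\<lambda>b c. f a b c) y)"
  by (intro bilinI sw_lin_param sw_lin_arg[OF _ _ lin_id] assms trilin_bilin[OF assms(1)] trilin_linear[OF assms(1)] vs_axioms; assumption)+

lemma bilin_mult_l: "bilin H H V f \<Longrightarrow> a \<in> carrier H \<Longrightarrow> b \<in> carrier H \<Longrightarrow> bilin H H V (\<lambda>a' b'. f (a \<otimes> a') (b \<otimes> b'))"
  by (rule bilinI)
    (simp_all add: bilin_linear_2[OF _ _ lin_mult_r[OF lin_id]] bilin_linear_1[OF _ lin_mult_r[OF lin_id]])

lemma bilin_mult_r: "bilin H H V f \<Longrightarrow> a' \<in> carrier H \<Longrightarrow> b' \<in> carrier H \<Longrightarrow> bilin H H V (\<lambda>a b. f (a \<otimes> a') (b \<otimes> b'))"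
  by (rule bilinI)
    (simp_all add: bilin_linear_2[OF _ _ lin_mult_l[OF lin_id]] bilin_linear_1[OF _ lin_mult_l[OF lin_id]])

lemma bilin_sw_mult: "bilin H H V f \<Longrightarrow> vs V \<Longrightarrow> y \<in> carrier H \<Longrightarrow>
   bilin H H V (\<lambda>a b. sweedler H V (\<lambda>a' b'. f (a \<otimes> a') (b \<otimes> b')) y)"
  by (rule bilinI; rule sw_lin_param)
    (simp_all add: bilin_mult_l vs_axioms bilin_1[OF bilin_mult_r] bilin_2[OF bilin_mult_r])

lemma sw_mult:
  assumes f: "bilin H H V f" and V: "vs V" and x: "x \<in> carrier H" and y: "y \<in> carrier H"
  shows "sweedler H V f (x \<otimes> y) = sweedler H V (\<lambda>a b. sweedler H V (\<lambda>a' b'. f (a \<otimes> a') (b \<otimes> b')) y) x"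
proof -
  let ?T = "tensor_module H H"
  let ?L = "tensor_lift V f"
  note L = T2.tensor_lift_linear[OF f V]
  note cl = comult_closed[OF x] comult_closed[OF y]
  have "sweedler H V f (x \<otimes> y) = ?L (comult H x \<otimes>\<^bsub>tensor_algebra H H\<^esub> comult H y)"
    unfolding sweedler_def by (simp add: alg_mult[OF comult_hom] x y)
  also have "\<dots> = tensor_lift V (\<lambda>a b. ?L (tensor_lift ?T (\<lambda>a' b'. pure_tensor H H (a \<otimes> a') (b \<otimes> b')) (comult H y))) (comult H x)"
    unfolding T2.tensor_mult_def
    by (rule T2.tensor_lift_comp[OF T2.bilin_pure_mult_lift[OF cl(2)] T2.vs_tensor V L cl(1)])
  also have "\<dots> = tensor_lift V (\<lambda>a b. tensor_lift V (\<lambda>a' b'. f (a \<otimes> a') (b \<otimes> b')) (comult H y)) (comult H x)"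
  proof (rule T2.tensor_lift_cong[symmetric, OF _ V _ cl(1)])
    show "bilin H H V (\<lambda>a b. tensor_lift V (\<lambda>a' b'. f (a \<otimes> a') (b \<otimes> b')) (comult H y))"
      using bilin_sw_mult[OF f V y] by (simp add: sweedler_def)
    fix a b assume ab: "a \<in> carrier H" "b \<in> carrier H"
    have "?L (tensor_lift ?T (\<lambda>a' b'. pure_tensor H H (a \<otimes> a') (b \<otimes> b')) (comult H y)) =
        tensor_lift V (\<lambda>a' b'. ?L (pure_tensor H H (a \<otimes> a') (b \<otimes> b'))) (comult H y)"
      by (rule T2.tensor_lift_comp[OF T2.bilin_pure_mult[OF ab] T2.vs_tensor V L cl(2)])
    also have "\<dots> = tensor_lift V (\<lambda>a' b'. f (a \<otimes> a') (b \<otimes> b')) (comult H y)"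
      by (rule T2.tensor_lift_cong[symmetric, OF bilin_mult_l[OF f ab] V _ cl(2)])
        (simp add: T2.tensor_lift_pure[OF f V] ab)
    finally show "tensor_lift V (\<lambda>a' b'. f (a \<otimes> a') (b \<otimes> b')) (comult H y) =
      ?L (tensor_lift ?T (\<lambda>a' b'. pure_tensor H H (a \<otimes> a') (b \<otimes> b')) (comult H y))" by simp
  qed
  finally show ?thesis by (simp add: sweedler_def)
qed

lemma sw_one: "bilin H H V f \<Longrightarrow> vs V \<Longrightarrow> sweedler H V f \<one> = f \<one> \<one>"
  by (rule sw_pure) (simp_all add: alg_one[OF comult_hom])


text \<open>With \<open>f\<close>, \<open>g\<close>, \<open>h\<close> equal, this says that a
  Sweedler sum is multiplicative in its argument as soon as the summand is multiplicative in the
  pair of components. Every later multiplicativity proof goes through it or its two-term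
  variant.\<close>

lemma sw_mult_split:
  assumes "kalg M" and f: "bilin H H M f" and g: "bilin H H M g" and h: "bilin H H M h"
    and x: "x \<in> carrier H" and y: "y \<in> carrier H"
    and eq: "\<And>a b a' b'. a \<in> carrier H \<Longrightarrow> b \<in> carrier H \<Longrightarrow> a' \<in> carrier H \<Longrightarrow> b' \<in> carrier H \<Longrightarrow>
      h (a \<otimes> a') (b \<otimes> b') = f a b \<otimes>\<^bsub>M\<^esub> g a' b'"
  shows "sweedler H M h (x \<otimes> y) = sweedler H M f x \<otimes>\<^bsub>M\<^esub> sweedler H M g y"
proof -
  interpret M: kalg M by fact
  note V = M.vs_axioms
  have 1: "f a b \<otimes>\<^bsub>M\<^esub> sweedler H M g y = sweedler H M (\<lambda>a' b'. h (a \<otimes> a') (b \<otimes> b')) y"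
    if "a \<in> carrier H" "b \<in> carrier H" for a b
  proof -
    have "f a b \<otimes>\<^bsub>M\<^esub> sweedler H M g y = sweedler H M (\<lambda>a' b'. f a b \<otimes>\<^bsub>M\<^esub> g a' b') y"
      by (rule sw_comp[OF g V V M.lin_mult_r[OF lin_id bilin_closed[OF f that]] y])
    also have "\<dots> = sweedler H M (\<lambda>a' b'. h (a \<otimes> a') (b \<otimes> b')) y"
      by (rule sw_cong[OF bilin_mult_l[OF h that] V y, symmetric]) (simp add: eq that)
    finally show ?thesis .
  qed
  have "sweedler H M f x \<otimes>\<^bsub>M\<^esub> sweedler H M g y = sweedler H M (\<lambda>a b. f a b \<otimes>\<^bsub>M\<^esub> sweedler H M g y) x"
    by (rule sw_comp[OF f V V M.lin_mult_l[OF lin_id sw_closed[OF g V y]] x])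
  also have "\<dots> = sweedler H M (\<lambda>a b. sweedler H M (\<lambda>a' b'. h (a \<otimes> a') (b \<otimes> b')) y) x"
    by (rule sw_cong[OF bilin_sw_mult[OF h V y] V x, symmetric]) (simp add: 1)
  finally show ?thesis by (simp add: sw_mult[OF h V x y])
qed

end

locale bialg = prebialg H for H :: "('k::field, 'a, 'm) hopf_scheme" (structure) +
  assumes coassoc: "x \<in> carrier H \<Longrightarrow>
      sweedler H (tensor_algebra H (tensor_algebra H H)) (\<lambda>y c.
        sweedler H (tensor_algebra H (tensor_algebra H H)) (\<lambda>a b.
          pure_tensor H (tensor_algebra H H) a (pure_tensor H H b c)) y) x =
      sweedler H (tensor_algebra H (tensor_algebra H H)) (\<lambda>a y.
        sweedler H (tensor_algebra H (tensor_algebra H H)) (\<lambda>b c.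
          pure_tensor H (tensor_algebra H H) a (pure_tensor H H b c)) y) x"
    and counit_left: "x \<in> carrier H \<Longrightarrow> sweedler H H (\<lambda>a b. counit H a \<odot> b) x = x"
    and counit_right: "x \<in> carrier H \<Longrightarrow> sweedler H H (\<lambda>a b. counit H b \<odot> a) x = x"
begin

text \<open>The axiom concerns one particular trilinear map, the one into
  \<open>H \<otimes> (H \<otimes> H)\<close>. It is universal: \<open>f\<close> factors through it
  by the linear map \<open>?G\<close>, which is applied to both sides of the axiom.\<close>

lemma sw_coassoc:
  assumes f: "trilin H H H V f" and V: "vs V" and x: "x \<in> carrier H"
  shows "sweedler H V (\<lambda>y c. sweedler H V (\<lambda>a b. f a b c) y) x = sweedler H V (\<lambda>a y. sweedler H V (\<lambda>b c. f a b c) y) x"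
proof -
  let ?TT = "tensor_algebra H (tensor_algebra H H)"
  let ?p = "\<lambda>a b c. pure_tensor H (tensor_algebra H H) a (pure_tensor H H b c)"
  have p: "trilin H H H ?TT ?p"
    by (intro trilinI) (auto intro!: T3.lin_pure_l T3.lin_pure_r T2.lin_pure_l T2.lin_pure_r lin_id)
  have TT: "vs ?TT" by (rule T3.TA.vs_axioms)
  let ?g = "\<lambda>a t. tensor_lift V (\<lambda>b c. f a b c) t"
  have g: "bilin H (tensor_algebra H H) V ?g"
    by (intro bilinI T2.tensor_lift_param vs_axioms V trilin_bilin[OF f] trilin_linear[OF f])
      (auto intro!: T2.tensor_lift_linear V trilin_bilin[OF f])
  let ?G = "tensor_lift V ?g"
  have G: "?G \<in> linear_maps ?TT V" using T3.tensor_lift_linear[OF g V] by simp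
  have Gp: "?G (?p a b c) = f a b c" if "a \<in> carrier H" "b \<in> carrier H" "c \<in> carrier H" for a b c
    using that by (simp add: T3.tensor_lift_pure[OF g V] T2.tensor_lift_pure[OF trilin_bilin(1)[OF f] V])
  have eq: "sweedler H V (\<lambda>a b. ?G (?p a b c)) y = sweedler H V (\<lambda>a b. f a b c) y"
    "sweedler H V (\<lambda>b d. ?G (?p c b d)) y = sweedler H V (\<lambda>b d. f c b d) y"
    if "c \<in> carrier H" "y \<in> carrier H" for c y
    using that by (auto intro!: sw_cong[symmetric] V trilin_bilin[OF f] simp: Gp)
  have "?G (sweedler H ?TT (\<lambda>y c. sweedler H ?TT (\<lambda>a b. ?p a b c) y) x) = 
      sweedler H V (\<lambda>y c. sweedler H V (\<lambda>a b. f a b c) y) x"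
    by (subst sw_comp[OF sw_lin12(1)[OF p TT] TT V G x], rule sw_cong[symmetric, OF sw_lin12(1)[OF f V] V x])
      (simp add: sw_comp[OF trilin_bilin(3)[OF p] TT V G] eq)
  moreover have "?G (sweedler H ?TT (\<lambda>a y. sweedler H ?TT (\<lambda>b c. ?p a b c) y) x) = 
      sweedler H V (\<lambda>a y. sweedler H V (\<lambda>b c. f a b c) y) x"
    by (subst sw_comp[OF sw_lin12(2)[OF p TT] TT V G x], rule sw_cong[symmetric, OF sw_lin12(2)[OF f V] V x])
      (simp add: sw_comp[OF trilin_bilin(1)[OF p] TT V G] eq)
  ultimately show ?thesis using coassoc[OF x] by simp
qed

lemma sw_counit_left:
  assumes "h \<in> linear_maps H V" "vs V" "x \<in> carrier H"
  shows "sweedler H V (\<lambda>a b. counit H a \<odot>\<^bsub>V\<^esub> h b) x = h x"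
proof -
  have b: "bilin H H H (\<lambda>a b. counit H a \<odot> b)"
    by (intro bilinI lin_smult_scalar[OF counit_linear] lin_smult_vec lin_id vs_axioms)
  have b': "bilin H H V (\<lambda>a b. counit H a \<odot>\<^bsub>V\<^esub> h b)"
    by (intro bilinI lin_smult_scalar[OF counit_linear] lin_smult_vec assms lin_closed[OF assms(1)])
  have "h x = h (sweedler H H (\<lambda>a b. counit H a \<odot> b) x)" by (simp add: counit_left assms)
  also have "\<dots> = sweedler H V (\<lambda>a b. h (counit H a \<odot> b)) x"
    by (rule sw_comp[OF b vs_axioms assms(2,1,3)])
  also have "\<dots> = sweedler H V (\<lambda>a b. counit H a \<odot>\<^bsub>V\<^esub> h b) x"
    by (rule sw_cong[symmetric, OF b' assms(2,3)]) (simp add: lin_smult[OF assms(1)])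
  finally show ?thesis by simp
qed

lemma sw_counit_right:
  assumes "h \<in> linear_maps H V" "vs V" "x \<in> carrier H"
  shows "sweedler H V (\<lambda>a b. counit H b \<odot>\<^bsub>V\<^esub> h a) x = h x"
proof -
  have b: "bilin H H H (\<lambda>a b. counit H b \<odot> a)"
    by (intro bilinI lin_smult_scalar[OF counit_linear] lin_smult_vec lin_id vs_axioms)
  have b': "bilin H H V (\<lambda>a b. counit H b \<odot>\<^bsub>V\<^esub> h a)"
    by (intro bilinI lin_smult_scalar[OF counit_linear] lin_smult_vec assms lin_closed[OF assms(1)])
  have "h x = h (sweedler H H (\<lambda>a b. counit H b \<odot> a) x)" by (simp add: counit_right assms)
  also have "\<dots> = sweedler H V (\<lambda>a b. h (counit H b \<odot> a)) x"
    by (rule sw_comp[OF b vs_axioms assms(2,1,3)])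
  also have "\<dots> = sweedler H V (\<lambda>a b. counit H b \<odot>\<^bsub>V\<^esub> h a) x"
    by (rule sw_cong[symmetric, OF b' assms(2,3)]) (simp add: lin_smult[OF assms(1)])
  finally show ?thesis by simp
qed

end

subsection \<open>Restriction of the structure to a Hopf subalgebra\<close>

text \<open>A tensor product sees only carrier, addition and scalars. Records for the same space,
  such as an algebra and its Hopf algebra or two ways of restricting the carrier, therefore have
  literally the same tensor products.\<close>

lemma tensor_module_cong:
  assumes "carrier A = carrier A'" "carrier B = carrier B'"
    "\<And>x y. x \<oplus>\<^bsub>A\<^esub> y = x \<oplus>\<^bsub>A'\<^esub> y" "\<And>x y. x \<oplus>\<^bsub>B\<^esub> y = x \<oplus>\<^bsub>B'\<^esub> y"
    "\<And>k x. k \<odot>\<^bsub>A\<^esub> x = k \<odot>\<^bsub>A'\<^esub> x" "\<And>k x. k \<odot>\<^bsub>B\<^esub> x = k \<odot>\<^bsub>B'\<^esub> x"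
  shows "tensor_module A B = tensor_module A' B'" "pure_tensor A B = pure_tensor A' B'"
  by (simp_all add: tensor_module_def pure_tensor_def fun_eq_iff tensor_null_def bilinear_relations_def assms)

lemma restrict_hopf_simps [simp]:
  "carrier (restrict_hopf H C) = C" "x \<oplus>\<^bsub>restrict_hopf H C\<^esub> y = x \<oplus>\<^bsub>H\<^esub> y" "x \<otimes>\<^bsub>restrict_hopf H C\<^esub> y = x \<otimes>\<^bsub>H\<^esub> y"
  "\<zero>\<^bsub>restrict_hopf H C\<^esub> = \<zero>\<^bsub>H\<^esub>" "\<one>\<^bsub>restrict_hopf H C\<^esub> = \<one>\<^bsub>H\<^esub>" "k \<odot>\<^bsub>restrict_hopf H C\<^esub> x = k \<odot>\<^bsub>H\<^esub> x"
  "counit (restrict_hopf H C) = counit H" "antipode (restrict_hopf H C) = antipode H"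
  by (simp_all add: restrict_hopf_def)

lemma lin_restrict: "f \<in> linear_maps M N \<Longrightarrow> C \<subseteq> carrier M \<Longrightarrow> f \<in> linear_maps (restrict_hopf M C) N"
  by (auto simp: linear_maps_def subset_iff)

locale sub_alg = kalg H for H :: "('k::field, 'a, 'm) hopf_scheme" (structure) +
  fixes C
  assumes sub_ring: "subring C H" and sub_module: "submodule C (ring_of_type_algebra :: 'k ring) H"
begin

sublocale T2: tensor_alg H H ..

abbreviation "R \<equiv> restrict_hopf H C"

lemmas CD = submodule_vsD[OF sub_module]

lemma sub_carrier: "C \<subseteq> carrier H" using CD(1) by blast

lemma sub_one: "\<one> \<in> C" and sub_mult: "x \<in> C \<Longrightarrow> y \<in> C \<Longrightarrow> x \<otimes> y \<in> C"
  using subringE[OF sub_ring] by auto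

lemma sub_kalg: "kalg R"
proof -
  have g: "abelian_group R"
  proof (rule abelian_groupI)
    show "\<exists>y\<in>carrier R. y \<oplus>\<^bsub>R\<^esub> x = \<zero>\<^bsub>R\<^esub>" if "x \<in> carrier R" for x
      using that CD(1,5) by (intro bexI[of _ "\<ominus> x"]) (auto simp: M.l_neg)
  qed (use CD in \<open>simp_all add: M.a_ac\<close>)
  have "vs R"
    by (rule vsI[OF g]) (use CD in \<open>simp_all add: smult_add_l smult_add_r smult_smult\<close>)
  moreover have "ring R"
    by (rule ringI[OF g monoidI]) (use CD in \<open>simp_all add: sub_one sub_mult m_assoc l_distr r_distr\<close>)
  ultimately show ?thesis
    using CD by (simp add: kalg_def kalg_axioms_def mult_smult_l mult_smult_r)
qed

sublocale S: kalg R by (rule sub_kalg)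
sublocale RR: tensor_alg R R ..

lemma tensor_carrier_update:
  "tensor_module (H\<lparr>carrier := C\<rparr>) (H\<lparr>carrier := C\<rparr>) = tensor_module R R"
  by (rule tensor_module_cong) simp_all

lemma bilin_sub: "bilin H H V f \<Longrightarrow> bilin R R V f"
  using CD(1) by (intro bilinI) (auto intro!: lin_restrict[OF _ sub_carrier] intro: bilin_1 bilin_2)

lemma incl_linear: "tensor_incl H \<in> linear_maps (tensor_module R R) (tensor_module H H)"
  unfolding tensor_incl_def by (rule RR.tensor_lift_linear[OF bilin_sub[OF T2.bilin_pure] T2.vs_tensor])

lemma incl_pure: "a \<in> C \<Longrightarrow> b \<in> C \<Longrightarrow> tensor_incl H (pure_tensor R R a b) = pure_tensor H H a b"
  unfolding tensor_incl_def by (rule RR.tensor_lift_pure[OF bilin_sub[OF T2.bilin_pure] T2.vs_tensor]) simp_all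

text \<open>Some linear projection onto \<open>C\<close>; it respects neither product nor
  coproduct.\<close>

definition "retr = (SOME r. r \<in> linear_maps H R \<and> (\<forall>c\<in>C. r c = c))"

lemma retr_linear: "retr \<in> linear_maps H R" and retr_id: "c \<in> C \<Longrightarrow> retr c = c"
proof -
  obtain r where "r \<in> linear_maps H (H\<lparr>carrier := C\<rparr>)" "\<And>c. c \<in> C \<Longrightarrow> r c = c"
    using linear_retraction[OF sub_module] by blast
  then have "\<exists>r. r \<in> linear_maps H R \<and> (\<forall>c\<in>C. r c = c)" by (auto simp: linear_maps_def)
  from someI_ex[OF this] show "retr \<in> linear_maps H R" "c \<in> C \<Longrightarrow> retr c = c"
    unfolding retr_def by auto
qed

text \<open>The tensor square of the projection \<open>retr\<close> is a left inverse. Over a ring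
  without complements this could fail.\<close>

lemma incl_inj: "inj_on (tensor_incl H) (carrier (tensor_module R R))"
proof -
  have b: "bilin H H (tensor_module R R) (\<lambda>a b. pure_tensor R R (retr a) (retr b))"
    by (intro bilinI RR.lin_pure_l RR.lin_pure_r retr_linear lin_closed[OF retr_linear])
  let ?rr = "tensor_lift (tensor_module R R) (\<lambda>a b. pure_tensor R R (retr a) (retr b))"
  have "?rr (tensor_incl H \<xi>) = \<xi>" if "\<xi> \<in> carrier (tensor_module R R)" for \<xi>
  proof (rule RR.linear_maps_tensor_eqI[OF lin_comp[OF incl_linear T2.tensor_lift_linear[OF b RR.vs_tensor]] lin_id _ that])
    fix x y assume "x \<in> carrier R" "y \<in> carrier R"
    then show "?rr (tensor_incl H (pure_tensor R R x y)) = pure_tensor R R x y"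
      using sub_carrier by (simp add: incl_pure T2.tensor_lift_pure[OF b RR.vs_tensor] retr_id subset_iff)
  qed
  then show ?thesis by (rule inj_on_inverseI)
qed

lemma incl_hom: "tensor_incl H \<in> algebra_homs RR.TA T2.TA"
  by (rule RR.algebra_homs_tensorI)
    (use CD(1) in \<open>simp_all add: incl_linear T2.kalg_tensor incl_pure sub_one sub_mult\<close>)

end

locale sub_bialg = bialg H + sub_alg H C for H :: "('k::field, 'a, 'm) hopf_scheme" (structure) and C +
  assumes sub_comult: "comult H ` C \<subseteq> tensor_incl H ` carrier (tensor_module (H\<lparr>carrier := C\<rparr>) (H\<lparr>carrier := C\<rparr>))"
begin

lemma comult_sub:
  assumes "x \<in> C"
  shows "comult R x \<in> carrier (tensor_module R R)" "tensor_incl H (comult R x) = comult H x"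
proof -
  have e: "comult R x = inv_into (carrier (tensor_module R R)) (tensor_incl H) (comult H x)"
    unfolding tensor_carrier_update[symmetric] by (simp add: restrict_hopf_def)
  have "comult H x \<in> tensor_incl H ` carrier (tensor_module R R)"
    using sub_comult assms by (auto simp: tensor_carrier_update)
  then show "comult R x \<in> carrier (tensor_module R R)" "tensor_incl H (comult R x) = comult H x"
    unfolding e by (rule inv_into_into, rule f_inv_into_f)
qed

text \<open>By injectivity of the inclusion, the coproduct given through \<open>inv_into\<close> is
  identified by its image in the ambient tensor square.\<close>

lemma comult_sub_eqI:
  assumes "x \<in> C" "\<xi> \<in> carrier (tensor_module R R)" "tensor_incl H \<xi> = comult H x"
  shows "comult R x = \<xi>"
  by (rule inj_onD[OF incl_inj]) (simp_all add: assms comult_sub)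

lemma comult_sub_hom: "comult R \<in> algebra_homs R (tensor_algebra R R)"
proof (rule algebra_homsI)
  show "comult R \<in> linear_maps R (tensor_algebra R R)"
    unfolding linear_maps_tensor_algebra
    by (rule linear_mapsI, simp add: comult_sub)
      (rule comult_sub_eqI; simp add: CD comult_sub lin_add[OF incl_linear] lin_smult[OF incl_linear]
        lin_add[OF comult_linear] lin_smult[OF comult_linear] RR.T.a_closed vs.smult_in[OF RR.vs_tensor]
        abelian_monoid.a_closed[OF abelian_group.axioms(1)[OF module.axioms(2)[OF RR.vs_tensor[unfolded vs_def]]]])+
  show "comult R \<one>\<^bsub>R\<^esub> = \<one>\<^bsub>tensor_algebra R R\<^esub>"
    by (rule comult_sub_eqI) (simp_all add: sub_one incl_pure alg_one[OF comult_hom])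
  show "comult R (x \<otimes>\<^bsub>R\<^esub> y) = comult R x \<otimes>\<^bsub>tensor_algebra R R\<^esub> comult R y"
    if "x \<in> carrier R" "y \<in> carrier R" for x y
    by (rule comult_sub_eqI)
      (use that CD(1) in \<open>simp_all add: sub_mult RR.tensor_mult_closed comult_sub alg_mult[OF incl_hom] alg_mult[OF comult_hom]\<close>)
qed

sublocale SC: precoalg R
  using alg_lin[OF comult_sub_hom] by unfold_locales simp

text \<open>The integrands need to agree on \<open>C\<close> only. A map defined just on
  \<open>C\<close> can thus be handled by composing it with \<open>retr\<close>, which extends it to
  all of \<open>H\<close>.\<close>

lemma sw_sub:
  assumes f: "bilin H H V f'" and V: "vs V" and x: "x \<in> C"
    and eq: "\<And>a b. a \<in> C \<Longrightarrow> b \<in> C \<Longrightarrow> f a b = f' a b"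
  shows "sweedler R V f x = sweedler H V f' x"
proof -
  note b = bilin_sub[OF f]
  have "sweedler H V f' x = tensor_lift V f' (tensor_incl H (comult R x))"
    by (simp add: sweedler_def comult_sub x)
  also have "\<dots> = tensor_lift V (\<lambda>a b. tensor_lift V f' (pure_tensor H H a b)) (comult R x)"
    unfolding tensor_incl_def
    by (rule RR.tensor_lift_comp[OF bilin_sub[OF T2.bilin_pure] T2.vs_tensor V T2.tensor_lift_linear[OF f V] comult_sub(1)[OF x]])
  also have "\<dots> = tensor_lift V f (comult R x)"
    by (rule RR.tensor_lift_cong[OF _ V _ comult_sub(1)[OF x], symmetric], rule bilin_cong[OF b S.vs_axioms S.vs_axioms])
      (use CD(1) in \<open>simp_all add: eq T2.tensor_lift_pure[OF f V]\<close>)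
  finally show ?thesis by (simp add: sweedler_def)
qed

text \<open>The axioms of \<open>R\<close> have values in tensor products over \<open>C\<close>,
  into which pure tensors over \<open>H\<close> do not map. Inserting \<open>retr\<close> in every
  slot extends the integrands to \<open>H\<close>, where coassociativity and the counit laws are
  known.\<close>

lemma sub_bialg: "bialg R"
proof (intro bialg.intro prebialg.intro prebialg_axioms.intro bialg_axioms.intro sub_kalg comult_sub_hom)
  show "counit R \<in> algebra_homs R scalars"
    using counit_hom CD(1) by (auto simp: algebra_homs_def ring_hom_def linear_maps_def)
next
  fix x assume x: "x \<in> carrier R"
  have b: "bilin H H R (\<lambda>a b. counit H a \<odot>\<^bsub>R\<^esub> retr b)"
    by (intro bilinI lin_smult_scalar[OF counit_linear] lin_smult_vec retr_linear S.vs_axioms lin_closed[OF retr_linear])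
  have b': "bilin H H R (\<lambda>a b. counit H b \<odot>\<^bsub>R\<^esub> retr a)"
    by (intro bilinI lin_smult_scalar[OF counit_linear] lin_smult_vec retr_linear S.vs_axioms lin_closed[OF retr_linear])
  show "sweedler R R (\<lambda>a b. counit R a \<odot>\<^bsub>R\<^esub> b) x = x"
    using sw_sub[OF b S.vs_axioms, of x "\<lambda>a b. counit R a \<odot>\<^bsub>R\<^esub> b"] x CD(1)
    by (simp add: retr_id sw_counit_left[OF retr_linear S.vs_axioms, simplified])
  show "sweedler R R (\<lambda>a b. counit R b \<odot>\<^bsub>R\<^esub> a) x = x"
    using sw_sub[OF b' S.vs_axioms, of x "\<lambda>a b. counit R b \<odot>\<^bsub>R\<^esub> a"] x CD(1)
    by (simp add: retr_id sw_counit_right[OF retr_linear S.vs_axioms, simplified])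
next
  fix x assume "x \<in> carrier R"
  then have x: "x \<in> C" "x \<in> carrier H" using CD(1) by auto
  interpret S3: tensor_alg R "tensor_algebra R R" ..
  let ?W = "tensor_algebra R (tensor_algebra R R)"
  let ?f = "\<lambda>a b c. pure_tensor R (tensor_algebra R R) a (pure_tensor R R b c)"
  let ?f' = "\<lambda>a b c. ?f (retr a) (retr b) (retr c)"
  have W: "vs ?W" by (rule S3.TA.vs_axioms)
  note rc = lin_closed[OF retr_linear]
  have t: "trilin H H H ?W ?f'"
    by (intro trilinI; simp only: linear_maps_tensor_algebra; intro S3.lin_pure_l S3.lin_pure_r;
      (simp only: linear_maps_tensor_algebra tensor_algebra_simps)?;
      intro RR.lin_pure_l RR.lin_pure_r RR.pure_closed retr_linear rc)
  have 1: "sweedler R ?W (\<lambda>a b. ?f a b c) y = sweedler H ?W (\<lambda>a b. ?f' a b c) y"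
    "sweedler R ?W (\<lambda>a b. ?f c a b) y = sweedler H ?W (\<lambda>a b. ?f' c a b) y" if "y \<in> C" "c \<in> C" for y c
    by (rule sw_sub[OF trilin_bilin(3)[OF t CD(1)[OF that(2)]] W that(1)]; simp add: retr_id that)
      (rule sw_sub[OF trilin_bilin(1)[OF t CD(1)[OF that(2)]] W that(1)]; simp add: retr_id that)
  have "sweedler R ?W (\<lambda>y c. sweedler R ?W (\<lambda>a b. ?f a b c) y) x = sweedler H ?W (\<lambda>y c. sweedler H ?W (\<lambda>a b. ?f' a b c) y) x"
    by (rule sw_sub[OF sw_lin12(1)[OF t W] W x(1) 1(1)])
  also have "\<dots> = sweedler H ?W (\<lambda>a y. sweedler H ?W (\<lambda>b c. ?f' a b c) y) x"
    by (rule sw_coassoc[OF t W x(2)])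
  also have "\<dots> = sweedler R ?W (\<lambda>a y. sweedler R ?W (\<lambda>b c. ?f a b c) y) x"
    by (rule sw_sub[OF sw_lin12(2)[OF t W] W x(1) 1(2), symmetric])
  finally show "sweedler R ?W (\<lambda>y c. sweedler R ?W (\<lambda>a b. ?f a b c) y) x =
    sweedler R ?W (\<lambda>a y. sweedler R ?W (\<lambda>b c. ?f a b c) y) x" .
qed

lemma comult_sub_pure: "comult H x = pure_tensor H H a b \<Longrightarrow> x \<in> C \<Longrightarrow> a \<in> C \<Longrightarrow> b \<in> C \<Longrightarrow> comult R x = pure_tensor R R a b"
  by (rule comult_sub_eqI) (simp_all add: incl_pure)

lemma comult_sub_pure2: "comult H x = pure_tensor H H a b \<oplus>\<^bsub>tensor_module H H\<^esub> pure_tensor H H c d \<Longrightarrow>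
    x \<in> C \<Longrightarrow> a \<in> C \<Longrightarrow> b \<in> C \<Longrightarrow> c \<in> C \<Longrightarrow> d \<in> C \<Longrightarrow>
    comult R x = pure_tensor R R a b \<oplus>\<^bsub>tensor_module R R\<^esub> pure_tensor R R c d"
  by (rule comult_sub_eqI)
    (simp_all add: incl_pure lin_add[OF incl_linear] abelian_monoid.a_closed[OF abelian_group.axioms(1)[OF module.axioms(2)[OF RR.vs_tensor[unfolded vs_def]]]])

end

subsection \<open>Transport of a Hopf algebra structure\<close>

lemma hopf_bialg: "hopf_algebra H \<Longrightarrow> bialg H"
proof -
  assume "hopf_algebra H"
  then interpret hopf_algebra H .
  show ?thesis
    by (intro bialg.intro prebialg.intro prebialg_axioms.intro kalg.intro kalg_axioms.intro bialg_axioms.intro vs.intro)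
      (simp_all add: vector_space smult_mult_left smult_mult_right comult_hom counit_hom coassoc counit_left counit_right ring_axioms)
qed

lemma hopf_algebraI:
  fixes H :: "('k::field, 'a, 'm) hopf_scheme" (structure)
  assumes "bialg H" "antipode H \<in> linear_maps H H"
    "\<And>x. x \<in> carrier H \<Longrightarrow> sweedler H H (\<lambda>a b. antipode H a \<otimes> b) x = counit H x \<odot> \<one>"
    "\<And>x. x \<in> carrier H \<Longrightarrow> sweedler H H (\<lambda>a b. a \<otimes> antipode H b) x = counit H x \<odot> \<one>"
  shows "hopf_algebra H"
proof -
  interpret bialg H by fact
  show ?thesis
    by unfold_locales
      (simp_all add: mult_smult_l mult_smult_r comult_hom counit_hom coassoc counit_left counit_right assms module_axioms)
qed


text \<open>Transport of structure: of \<open>H'\<close> only the vector space and closure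
  properties are assumed, and every algebra and Hopf law is pulled back along \<open>\<phi>\<close>.
  In this way the Drinfeld double becomes a Hopf algebra without a check of its
  associativity.\<close>

lemma hopf_transport:
  fixes H :: "('k::field, 'a, 'm) hopf_scheme" and H' :: "('k, 'b, 'n) hopf_scheme"
  assumes "hopf_algebra H" and H': "vs H'" "\<one>\<^bsub>H'\<^esub> \<in> carrier H'"
    "\<And>x y. x \<in> carrier H' \<Longrightarrow> y \<in> carrier H' \<Longrightarrow> x \<otimes>\<^bsub>H'\<^esub> y \<in> carrier H'"
    and \<phi>: "\<phi> \<in> linear_maps H H'" "bij_betw \<phi> (carrier H) (carrier H')"
    and one: "\<phi> \<one>\<^bsub>H\<^esub> = \<one>\<^bsub>H'\<^esub>"
    and mult: "\<And>x y. x \<in> carrier H \<Longrightarrow> y \<in> carrier H \<Longrightarrow> \<phi> (x \<otimes>\<^bsub>H\<^esub> y) = \<phi> x \<otimes>\<^bsub>H'\<^esub> \<phi> y"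
    and comult: "\<And>x. x \<in> carrier H \<Longrightarrow> comult H' (\<phi> x) =
      sweedler H (tensor_module H' H') (\<lambda>a b. pure_tensor H' H' (\<phi> a) (\<phi> b)) x"
    and counit: "\<And>x. x \<in> carrier H \<Longrightarrow> counit H' (\<phi> x) = counit H x"
    and antipode: "\<And>x. x \<in> carrier H \<Longrightarrow> antipode H' (\<phi> x) = \<phi> (antipode H x)"
  shows "hopf_isomorphic H H'"
proof -
  interpret H: bialg H by (rule hopf_bialg) fact
  note Ho = hopf_algebra.antipode_linear[OF assms(1)] hopf_algebra.antipode_left[OF assms(1)] hopf_algebra.antipode_right[OF assms(1)]
  interpret V: vs H' by fact
  note cl = lin_closed[OF \<phi>(1)]
  have pre: "\<exists>x\<in>carrier H. y = \<phi> x" if "y \<in> carrier H'" for y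
    using that \<phi>(2) by (auto simp: bij_betw_def)
  have alg: "kalg H'"
  proof -
    have "ring H'"
    proof (rule ringI[OF V.abelian_group_axioms monoidI])
      fix x y z assume "x \<in> carrier H'" "y \<in> carrier H'" "z \<in> carrier H'"
      then obtain a b c where abc: "a \<in> carrier H" "b \<in> carrier H" "c \<in> carrier H" "x = \<phi> a" "y = \<phi> b" "z = \<phi> c"
        using pre by metis
      show "x \<otimes>\<^bsub>H'\<^esub> y \<otimes>\<^bsub>H'\<^esub> z = x \<otimes>\<^bsub>H'\<^esub> (y \<otimes>\<^bsub>H'\<^esub> z)"
        "(x \<oplus>\<^bsub>H'\<^esub> y) \<otimes>\<^bsub>H'\<^esub> z = x \<otimes>\<^bsub>H'\<^esub> z \<oplus>\<^bsub>H'\<^esub> y \<otimes>\<^bsub>H'\<^esub> z"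
        "z \<otimes>\<^bsub>H'\<^esub> (x \<oplus>\<^bsub>H'\<^esub> y) = z \<otimes>\<^bsub>H'\<^esub> x \<oplus>\<^bsub>H'\<^esub> z \<otimes>\<^bsub>H'\<^esub> y"
        using abc by (simp_all add: mult[symmetric] lin_add[OF \<phi>(1), symmetric] H.m_assoc H.l_distr H.r_distr)
    next
      fix x assume "x \<in> carrier H'"
      then obtain a where a: "a \<in> carrier H" "x = \<phi> a" using pre by metis
      show "\<one>\<^bsub>H'\<^esub> \<otimes>\<^bsub>H'\<^esub> x = x" "x \<otimes>\<^bsub>H'\<^esub> \<one>\<^bsub>H'\<^esub> = x" using a by (simp_all add: mult[symmetric] one[symmetric])
    qed (use H' in auto)
    moreover have "k \<odot>\<^bsub>H'\<^esub> x \<otimes>\<^bsub>H'\<^esub> y = k \<odot>\<^bsub>H'\<^esub> (x \<otimes>\<^bsub>H'\<^esub> y) \<and> x \<otimes>\<^bsub>H'\<^esub> (k \<odot>\<^bsub>H'\<^esub> y) = k \<odot>\<^bsub>H'\<^esub> (x \<otimes>\<^bsub>H'\<^esub> y)"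
      if xy: "x \<in> carrier H'" "y \<in> carrier H'" for k x y
    proof -
      obtain a b where "a \<in> carrier H" "b \<in> carrier H" "x = \<phi> a" "y = \<phi> b" using pre xy by metis
      then show ?thesis
        by (simp add: mult[symmetric] lin_smult[OF \<phi>(1), symmetric] H.mult_smult_l H.mult_smult_r)
    qed
    ultimately show ?thesis using H'(1) by (simp add: kalg_def kalg_axioms_def)
  qed
  interpret A: kalg H' by fact
  interpret T: tensor_alg H' H' ..
  have b\<phi>: "bilin H H V (\<lambda>a b. f (\<phi> a) (\<phi> b))" if "bilin H' H' V f" for V :: "('k, 'z, 'y) module_scheme" and f
    by (intro bilinI bilin_linear_1[OF that \<phi>(1)] bilin_linear_2[OF that _ \<phi>(1)] cl)
  have bp: "bilin H H (tensor_module H' H') (\<lambda>a b. pure_tensor H' H' (\<phi> a) (\<phi> b))"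
    by (intro bilinI T.lin_pure_l T.lin_pure_r \<phi>(1) cl)
  \<comment> \<open>The rule by which all Sweedler sums over \<open>H'\<close> are turned into sums
    over \<open>H\<close>.\<close>
  have sw: "sweedler H' V f (\<phi> x) = sweedler H V (\<lambda>a b. f (\<phi> a) (\<phi> b)) x"
    if f: "bilin H' H' V f" and V: "vs V" and x: "x \<in> carrier H" for V :: "('k, 'z, 'y) module_scheme" and f x
  proof -
    have bf: "bilin H H V (\<lambda>a b. f (\<phi> a) (\<phi> b))"
      by (intro bilinI bilin_linear_1[OF f \<phi>(1)] bilin_linear_2[OF f _ \<phi>(1)] cl)
    have "sweedler H' V f (\<phi> x) =
        sweedler H V (\<lambda>a b. tensor_lift V f (pure_tensor H' H' (\<phi> a) (\<phi> b))) x"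
      unfolding sweedler_def[of H'] comult[OF x]
      by (rule H.sw_comp[OF bp T.vs_tensor V T.tensor_lift_linear[OF f V] x])
    also have "\<dots> = sweedler H V (\<lambda>a b. f (\<phi> a) (\<phi> b)) x"
      by (rule H.sw_cong[OF bf V x, symmetric]) (simp add: T.tensor_lift_pure[OF f V] cl)
    finally show ?thesis .
  qed
  have comult_lin: "comult H' \<in> linear_maps H' (tensor_module H' H')"
  proof (rule linear_mapsI)
    note L = H.sw_linear[OF bp T.vs_tensor]
    fix x assume "x \<in> carrier H'"
    then obtain a where a: "a \<in> carrier H" "x = \<phi> a" using pre by metis
    then show "comult H' x \<in> carrier (tensor_module H' H')" by (simp add: comult lin_closed[OF L])
    show "comult H' (k \<odot>\<^bsub>H'\<^esub> x) = k \<odot>\<^bsub>tensor_module H' H'\<^esub> comult H' x" for k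
      using a by (simp add: comult lin_smult[OF \<phi>(1), symmetric] lin_smult[OF L])
    fix y assume "y \<in> carrier H'"
    then obtain b where b: "b \<in> carrier H" "y = \<phi> b" using pre by metis
    then show "comult H' (x \<oplus>\<^bsub>H'\<^esub> y) = comult H' x \<oplus>\<^bsub>tensor_module H' H'\<^esub> comult H' y"
      using a by (simp add: comult lin_add[OF \<phi>(1), symmetric] lin_add[OF L])
  qed
  interpret C: precoalg H' using comult_lin by unfold_locales
  let ?\<phi>\<phi> = "tensor_lift (tensor_module H' H') (\<lambda>a b. pure_tensor H' H' (\<phi> a) (\<phi> b))"
  have hom: "?\<phi>\<phi> \<in> algebra_homs H.T2.TA T.TA"
    by (rule H.T2.algebra_homs_tensorI[OF _ T.kalg_tensor])
      (simp_all add: H.T2.tensor_lift_linear[OF bp] H.T2.tensor_lift_pure[OF bp] one mult cl)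
  have bi: "bialg H'"
  proof (intro bialg.intro prebialg.intro prebialg_axioms.intro bialg_axioms.intro alg)
    show "comult H' \<in> algebra_homs H' (tensor_algebra H' H')"
    proof (rule algebra_homsI)
      show "comult H' \<one>\<^bsub>H'\<^esub> = \<one>\<^bsub>tensor_algebra H' H'\<^esub>"
        unfolding one[symmetric] comult[OF H.one_closed]
        using H.sw_one[OF bp T.vs_tensor] by (simp add: one)
      fix x y assume "x \<in> carrier H'" "y \<in> carrier H'"
      then obtain a b where ab: "a \<in> carrier H" "b \<in> carrier H" "x = \<phi> a" "y = \<phi> b" using pre by metis
      have "comult H' (\<phi> a \<otimes>\<^bsub>H'\<^esub> \<phi> b) = ?\<phi>\<phi> (comult H (a \<otimes>\<^bsub>H\<^esub> b))"
        using ab by (simp add: mult[symmetric] comult sweedler_def)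
      also have "\<dots> = ?\<phi>\<phi> (comult H a) \<otimes>\<^bsub>T.TA\<^esub> ?\<phi>\<phi> (comult H b)"
        using ab by (simp add: alg_mult[OF H.comult_hom] alg_mult[OF hom] H.comult_closed)
      also have "\<dots> = comult H' (\<phi> a) \<otimes>\<^bsub>T.TA\<^esub> comult H' (\<phi> b)"
        using ab by (simp add: comult sweedler_def)
      finally show "comult H' (x \<otimes>\<^bsub>H'\<^esub> y) = comult H' x \<otimes>\<^bsub>tensor_algebra H' H'\<^esub> comult H' y" using ab by simp
    qed (simp add: comult_lin)
    show "counit H' \<in> algebra_homs H' scalars"
    proof (rule algebra_homsI[OF linear_mapsI])
      show "counit H' \<one>\<^bsub>H'\<^esub> = \<one>\<^bsub>scalars\<^esub>"
        unfolding one[symmetric] using alg_one[OF H.counit_hom] by (simp add: counit)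
      fix x assume "x \<in> carrier H'"
      then obtain a where a: "a \<in> carrier H" "x = \<phi> a" using pre by metis
      show "counit H' x \<in> carrier scalars" by simp
      show "counit H' (k \<odot>\<^bsub>H'\<^esub> x) = k \<odot>\<^bsub>scalars\<^esub> counit H' x" for k
        using a by (simp add: lin_smult[OF \<phi>(1), symmetric] counit lin_smult[OF H.counit_linear])
      fix y assume "y \<in> carrier H'"
      then obtain b where b: "b \<in> carrier H" "y = \<phi> b" using pre by metis
      show "counit H' (x \<oplus>\<^bsub>H'\<^esub> y) = counit H' x \<oplus>\<^bsub>scalars\<^esub> counit H' y"
        "counit H' (x \<otimes>\<^bsub>H'\<^esub> y) = counit H' x \<otimes>\<^bsub>scalars\<^esub> counit H' y"
        using a b by (simp_all add: lin_add[OF \<phi>(1), symmetric] mult[symmetric] counit lin_add[OF H.counit_linear]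
            alg_mult[OF H.counit_hom])
    qed
  next
    fix y assume "y \<in> carrier H'"
    then obtain x where x: "x \<in> carrier H" "y = \<phi> x" using pre by metis
    have cl': "counit H' \<in> linear_maps H' scalars"
    proof (rule linear_mapsI)
      fix u v assume "u \<in> carrier H'" "v \<in> carrier H'"
      then obtain a b where "a \<in> carrier H" "b \<in> carrier H" "u = \<phi> a" "v = \<phi> b" using pre by metis
      then show "counit H' (u \<oplus>\<^bsub>H'\<^esub> v) = counit H' u \<oplus>\<^bsub>scalars\<^esub> counit H' v"
        by (simp add: lin_add[OF \<phi>(1), symmetric] counit lin_add[OF H.counit_linear])
    next
      fix k u assume "u \<in> carrier H'"
      then obtain a where "a \<in> carrier H" "u = \<phi> a" using pre by metis
      then show "counit H' (k \<odot>\<^bsub>H'\<^esub> u) = k \<odot>\<^bsub>scalars\<^esub> counit H' u"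
        by (simp add: lin_smult[OF \<phi>(1), symmetric] counit lin_smult[OF H.counit_linear])
    qed simp
    have b: "bilin H' H' H' (\<lambda>a b. counit H' a \<odot>\<^bsub>H'\<^esub> b)"
      by (intro bilinI lin_smult_scalar[OF cl'] lin_smult_vec lin_id V.vs_axioms)
    have b': "bilin H' H' H' (\<lambda>a b. counit H' b \<odot>\<^bsub>H'\<^esub> a)"
      by (intro bilinI lin_smult_scalar[OF cl'] lin_smult_vec lin_id V.vs_axioms)
    have "sweedler H' H' (\<lambda>a b. counit H' a \<odot>\<^bsub>H'\<^esub> b) y = sweedler H H' (\<lambda>a b. counit H' (\<phi> a) \<odot>\<^bsub>H'\<^esub> \<phi> b) x"
      unfolding x(2) by (rule sw[OF b V.vs_axioms x(1)])
    also have "\<dots> = sweedler H H' (\<lambda>a b. counit H a \<odot>\<^bsub>H'\<^esub> \<phi> b) x"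
      by (rule H.sw_cong[OF b\<phi>[OF b] V.vs_axioms x(1)]) (simp add: counit)
    also have "\<dots> = y" unfolding x(2) by (rule H.sw_counit_left[OF \<phi>(1) V.vs_axioms x(1)])
    finally show "sweedler H' H' (\<lambda>a b. counit H' a \<odot>\<^bsub>H'\<^esub> b) y = y" .
    have "sweedler H' H' (\<lambda>a b. counit H' b \<odot>\<^bsub>H'\<^esub> a) y = sweedler H H' (\<lambda>a b. counit H' (\<phi> b) \<odot>\<^bsub>H'\<^esub> \<phi> a) x"
      unfolding x(2) by (rule sw[OF b' V.vs_axioms x(1)])
    also have "\<dots> = sweedler H H' (\<lambda>a b. counit H b \<odot>\<^bsub>H'\<^esub> \<phi> a) x"
      by (rule H.sw_cong[OF b\<phi>[OF b'] V.vs_axioms x(1)]) (simp add: counit)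
    also have "\<dots> = y" unfolding x(2) by (rule H.sw_counit_right[OF \<phi>(1) V.vs_axioms x(1)])
    finally show "sweedler H' H' (\<lambda>a b. counit H' b \<odot>\<^bsub>H'\<^esub> a) y = y" .
    interpret T3: tensor_alg H' "tensor_algebra H' H'" ..
    let ?W = "tensor_algebra H' (tensor_algebra H' H')"
    let ?f = "\<lambda>a b c. pure_tensor H' (tensor_algebra H' H') a (pure_tensor H' H' b c)"
    let ?g = "\<lambda>a b c. ?f (\<phi> a) (\<phi> b) (\<phi> c)"
    have W: "vs ?W" by (rule T3.TA.vs_axioms)
    have t: "trilin H' H' H' ?W ?f"
      by (intro trilinI) (auto intro!: T3.lin_pure_l T3.lin_pure_r T.lin_pure_l T.lin_pure_r lin_id)
    have g: "trilin H H H ?W ?g"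
      by (intro trilinI) (auto intro!: T3.lin_pure_l T3.lin_pure_r T.lin_pure_l T.lin_pure_r \<phi>(1) simp: cl)
    have t1: "bilin H' H' ?W (\<lambda>y c. sweedler H' ?W (\<lambda>a b. ?f a b c) y)"
      and t2: "bilin H' H' ?W (\<lambda>a y. sweedler H' ?W (\<lambda>b c. ?f a b c) y)"
      by (intro bilinI C.sw_lin_param C.sw_lin_arg[OF _ _ lin_id] W V.vs_axioms trilin_bilin[OF t] trilin_linear[OF t]; assumption)+
    have "sweedler H' ?W (\<lambda>y c. sweedler H' ?W (\<lambda>a b. ?f a b c) y) y =
        sweedler H ?W (\<lambda>y c. sweedler H ?W (\<lambda>a b. ?g a b c) y) x"
      unfolding x(2) sw[OF t1 W x(1)]
      by (rule H.sw_cong[OF H.sw_lin12(1)[OF g W] W x(1), symmetric])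
        (rule sw[OF trilin_bilin(3)[OF t] W, symmetric]; simp add: cl)
    also have "\<dots> = sweedler H ?W (\<lambda>a y. sweedler H ?W (\<lambda>b c. ?g a b c) y) x"
      by (rule H.sw_coassoc[OF g W x(1)])
    also have "\<dots> = sweedler H' ?W (\<lambda>a y. sweedler H' ?W (\<lambda>b c. ?f a b c) y) y"
      unfolding x(2) sw[OF t2 W x(1)]
      by (rule H.sw_cong[OF H.sw_lin12(2)[OF g W] W x(1)])
        (rule sw[OF trilin_bilin(1)[OF t] W, symmetric]; simp add: cl)
    finally show "sweedler H' ?W (\<lambda>y c. sweedler H' ?W (\<lambda>a b. ?f a b c) y) y =
      sweedler H' ?W (\<lambda>a y. sweedler H' ?W (\<lambda>b c. ?f a b c) y) y" .
  qed
  interpret B: bialg H' by fact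
  have Sl: "antipode H' \<in> linear_maps H' H'"
  proof (rule linear_mapsI)
    fix u assume "u \<in> carrier H'"
    then obtain a where a: "a \<in> carrier H" "u = \<phi> a" using pre by metis
    then show "antipode H' u \<in> carrier H'" by (simp add: antipode cl lin_closed[OF Ho(1)])
    show "antipode H' (k \<odot>\<^bsub>H'\<^esub> u) = k \<odot>\<^bsub>H'\<^esub> antipode H' u" for k
      using a by (simp add: lin_smult[OF \<phi>(1), symmetric] antipode lin_smult[OF Ho(1)] lin_closed[OF Ho(1)])
    fix v assume "v \<in> carrier H'"
    then obtain b where "b \<in> carrier H" "v = \<phi> b" using pre by metis
    then show "antipode H' (u \<oplus>\<^bsub>H'\<^esub> v) = antipode H' u \<oplus>\<^bsub>H'\<^esub> antipode H' v"
      using a by (simp add: lin_add[OF \<phi>(1), symmetric] antipode lin_add[OF Ho(1)] lin_closed[OF Ho(1)])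
  qed
  have "hopf_algebra H'"
  proof (rule hopf_algebraI[OF bi Sl])
    fix y assume "y \<in> carrier H'"
    then obtain x where x: "x \<in> carrier H" "y = \<phi> x" using pre by metis
    note S = lin_closed[OF Ho(1)]
    have b: "bilin H' H' H' (\<lambda>a b. antipode H' a \<otimes>\<^bsub>H'\<^esub> b)" "bilin H' H' H' (\<lambda>a b. a \<otimes>\<^bsub>H'\<^esub> antipode H' b)"
      by (rule bilinI; intro A.lin_mult_l A.lin_mult_r lin_id Sl lin_closed[OF Sl]; assumption)+
    have b0: "bilin H H H (\<lambda>a b. antipode H a \<otimes>\<^bsub>H\<^esub> b)" "bilin H H H (\<lambda>a b. a \<otimes>\<^bsub>H\<^esub> antipode H b)"
      by (rule bilinI; intro H.lin_mult_l H.lin_mult_r lin_id Ho(1) S; assumption)+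
    have c: "\<phi> (counit H x \<odot>\<^bsub>H\<^esub> \<one>\<^bsub>H\<^esub>) = counit H' y \<odot>\<^bsub>H'\<^esub> \<one>\<^bsub>H'\<^esub>"
      using x by (simp add: lin_smult[OF \<phi>(1)] one counit)
    have "sweedler H' H' (\<lambda>a b. antipode H' a \<otimes>\<^bsub>H'\<^esub> b) y = sweedler H H' (\<lambda>a b. antipode H' (\<phi> a) \<otimes>\<^bsub>H'\<^esub> \<phi> b) x"
      unfolding x(2) by (rule sw[OF b(1) V.vs_axioms x(1)])
    also have "\<dots> = sweedler H H' (\<lambda>a b. \<phi> (antipode H a \<otimes>\<^bsub>H\<^esub> b)) x"
      by (rule H.sw_cong[OF b\<phi>[OF b(1)] V.vs_axioms x(1)]) (simp add: antipode mult S)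
    also have "\<dots> = \<phi> (sweedler H H (\<lambda>a b. antipode H a \<otimes>\<^bsub>H\<^esub> b) x)"
      by (rule H.sw_comp[OF b0(1) H.vs_axioms V.vs_axioms \<phi>(1) x(1), symmetric])
    also have "\<dots> = counit H' y \<odot>\<^bsub>H'\<^esub> \<one>\<^bsub>H'\<^esub>"
      unfolding Ho(2)[OF x(1)] by (rule c)
    finally show "sweedler H' H' (\<lambda>a b. antipode H' a \<otimes>\<^bsub>H'\<^esub> b) y = counit H' y \<odot>\<^bsub>H'\<^esub> \<one>\<^bsub>H'\<^esub>" .
    have "sweedler H' H' (\<lambda>a b. a \<otimes>\<^bsub>H'\<^esub> antipode H' b) y = sweedler H H' (\<lambda>a b. \<phi> a \<otimes>\<^bsub>H'\<^esub> antipode H' (\<phi> b)) x"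
      unfolding x(2) by (rule sw[OF b(2) V.vs_axioms x(1)])
    also have "\<dots> = sweedler H H' (\<lambda>a b. \<phi> (a \<otimes>\<^bsub>H\<^esub> antipode H b)) x"
      by (rule H.sw_cong[OF b\<phi>[OF b(2)] V.vs_axioms x(1)]) (simp add: antipode mult S)
    also have "\<dots> = \<phi> (sweedler H H (\<lambda>a b. a \<otimes>\<^bsub>H\<^esub> antipode H b) x)"
      by (rule H.sw_comp[OF b0(2) H.vs_axioms V.vs_axioms \<phi>(1) x(1), symmetric])
    also have "\<dots> = counit H' y \<odot>\<^bsub>H'\<^esub> \<one>\<^bsub>H'\<^esub>"
      unfolding Ho(3)[OF x(1)] by (rule c)
    finally show "sweedler H' H' (\<lambda>a b. a \<otimes>\<^bsub>H'\<^esub> antipode H' b) y = counit H' y \<odot>\<^bsub>H'\<^esub> \<one>\<^bsub>H'\<^esub>" .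
  qed
  moreover have "\<phi> \<in> hopf_iso H H'"
    unfolding hopf_iso_def
  proof (intro CollectI conjI ballI)
    show "\<phi> \<in> algebra_homs H H'" by (rule algebra_homsI[OF \<phi>(1) one mult])
    fix x assume x: "x \<in> carrier H"
    \<comment> \<open>The two records differ in product and unit only, and a linear combination does
      not involve these.\<close>
    have eq: "tensor_lift (tensor_algebra H' H') f = tensor_lift (tensor_module H' H') f" for f :: "'a \<Rightarrow> 'a \<Rightarrow> _"
      by (simp add: tensor_lift_def finsum_def fun_eq_iff tensor_algebra_def finprod_def)
    show "comult H' (\<phi> x) = sweedler H (tensor_algebra H' H') (\<lambda>a b. pure_tensor H' H' (\<phi> a) (\<phi> b)) x"
      by (simp add: comult x sweedler_def eq)
  qed (simp_all add: \<phi>(2) counit antipode)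
  ultimately show ?thesis using \<open>hopf_algebra H\<close> by (auto simp: hopf_isomorphic_def)
qed

subsection \<open>Free algebras and presentations\<close>

lemma free_algebra_simps [simp]:
  "carrier free_algebra = UNIV" "x \<oplus>\<^bsub>free_algebra\<^esub> y = x + y" "x \<otimes>\<^bsub>free_algebra\<^esub> y = x * y"
  "\<zero>\<^bsub>free_algebra\<^esub> = 0" "\<one>\<^bsub>free_algebra\<^esub> = 1" "k \<odot>\<^bsub>free_algebra\<^esub> x = pm_scale k x"
  by (simp_all add: free_algebra_def ring.defs module.defs ring_of_type_algebra_def)

lemma poly_mapping_single_induct [case_names zero add]:
  "P 0 \<Longrightarrow> (\<And>t p c. P t \<Longrightarrow> P (t + Poly_Mapping.single p c)) \<Longrightarrow> P (t :: 'x \<Rightarrow>\<^sub>0 'k::ab_group_add)"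
  using free_module_induct[of t UNIV P] by simp

text \<open>Scaling is multiplication by a constant, that is, by a multiple of the empty word. Hence
  every ring ideal of the free algebra is also a subspace.\<close>

lemma pm_scale_conv_mult: "pm_scale k x = Poly_Mapping.single 0 k * (x :: 'w::monoid_add \<Rightarrow>\<^sub>0 'k::field)"
  by (induction x rule: poly_mapping_single_induct)
    (simp_all add: pm_scale_distribs distrib_left mult_single, simp add: poly_mapping_eq_iff fun_eq_iff)

lemma single_zero_commute: "x * Poly_Mapping.single 0 k = Poly_Mapping.single 0 k * (x :: 'w::monoid_add \<Rightarrow>\<^sub>0 'k::field)"
  by (induction x rule: poly_mapping_single_induct) (simp_all add: distrib_left distrib_right mult_single mult.commute)

lemma pm_scale_mult:
  fixes x y :: "'w::monoid_add \<Rightarrow>\<^sub>0 'k::field"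
  shows "pm_scale k x * y = pm_scale k (x * y)" "x * pm_scale k y = pm_scale k (x * y)"
proof -
  show "pm_scale k x * y = pm_scale k (x * y)" by (simp add: pm_scale_conv_mult mult.assoc)
  show "x * pm_scale k y = pm_scale k (x * y)"
    by (simp add: pm_scale_conv_mult flip: mult.assoc) (simp add: single_zero_commute)
qed

lemma kalg_free_algebra: "kalg (free_algebra :: ('k::field, 'g word \<Rightarrow>\<^sub>0 'k) module)" (is "kalg ?F")
proof -
  have g: "abelian_group ?F"
  proof (rule abelian_groupI)
    show "\<exists>y\<in>carrier ?F. y \<oplus>\<^bsub>?F\<^esub> x = \<zero>\<^bsub>?F\<^esub>" if "x \<in> carrier ?F" for x
      by (intro bexI[of _ "- x"]) simp_all
  qed (simp_all add: add_ac)
  have "vs ?F" by (rule vsI[OF g]) (simp_all add: pm_scale_distribs)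
  moreover have "ring ?F" by (rule ringI[OF g monoidI]) (simp_all add: mult.assoc distrib_left distrib_right)
  ultimately show ?thesis by (simp add: kalg_def kalg_axioms_def pm_scale_mult)
qed

lemma single_Word: "Poly_Mapping.single (Word (g # gs)) (c::'k::field) = pm_scale c (letter g * Poly_Mapping.single (Word gs) 1)"
  by (simp add: letter_def mult_single plus_word_def)

lemma free_algebra_induct [case_names one letter add mult scale]:
  assumes "P 1" "\<And>g. P (letter g)" "\<And>x y. P x \<Longrightarrow> P y \<Longrightarrow> P (x + y)" "\<And>x y. P x \<Longrightarrow> P y \<Longrightarrow> P (x * y)"
    "\<And>k x. P x \<Longrightarrow> P (pm_scale k x)"
  shows "P (x :: 'g word \<Rightarrow>\<^sub>0 'k::field)"
proof -
  have 1: "P (Poly_Mapping.single (Word gs) c)" for gs c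
  proof (induction gs arbitrary: c)
    case Nil
    have "Poly_Mapping.single (Word []) c = pm_scale c (1 :: 'g word \<Rightarrow>\<^sub>0 'k)"
      by (simp add: zero_word_def[symmetric] flip: single_one)
    then show ?case using assms(1,5) by simp
  qed (simp add: single_Word assms)
  have "P (Poly_Mapping.single p c)" for p c using 1[of "letters p" c] by simp
  moreover have "P 0" using assms(5)[OF assms(1), of 0] by (simp add: pm_scale_conv_mult)
  ultimately show ?thesis by (induction x rule: poly_mapping_single_induct) (simp_all add: assms(3))
qed

lemma free_lift_lin_ext: "free_lift M v = lin_ext M (\<lambda>w. mult_list M (map v (letters w)))"
  by (simp add: free_lift_def lin_ext_def fun_eq_iff)

context kalg begin

lemma mult_list_closed: "set xs \<subseteq> carrier M \<Longrightarrow> mult_list M xs \<in> carrier M"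
  by (induction xs) (simp_all add: mult_list_def)

lemma mult_list_append: "set xs \<subseteq> carrier M \<Longrightarrow> set ys \<subseteq> carrier M \<Longrightarrow>
    mult_list M (xs @ ys) = mult_list M xs \<otimes> mult_list M ys"
  using mult_list_closed by (induction xs) (auto simp: mult_list_def m_assoc)

lemma free_lift_letter: "v g \<in> carrier M \<Longrightarrow> free_lift M v (letter g) = v g"
  by (simp add: free_lift_lin_ext letter_def mult_list_def)

lemma free_lift_hom:
  assumes v: "\<And>g. v g \<in> carrier M"
  shows "free_lift M v \<in> algebra_homs free_algebra M"
proof -
  have c: "mult_list M (map v xs) \<in> carrier M" for xs using v by (intro mult_list_closed) auto
  have lin: "free_lift M v \<in> linear_maps free_algebra M"
    using lin_ext_linear[of UNIV "\<lambda>w. mult_list M (map v (letters w))"] c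
    by (simp add: free_lift_lin_ext linear_maps_def)
  note L = lin_add[OF lin, simplified] lin_closed[OF lin, simplified] lin_zero[OF lin, simplified]
  have s: "free_lift M v (Poly_Mapping.single w a) = a \<odot> mult_list M (map v (letters w))" for w a
    by (simp add: free_lift_lin_ext c)
  have z: "free_lift M v 0 = \<zero>" using lin_zero[OF lin kalg.axioms(1)[OF kalg_free_algebra] vs_axioms] by simp
  have m1: "free_lift M v (Poly_Mapping.single w a * y) = free_lift M v (Poly_Mapping.single w a) \<otimes> free_lift M v y" for w a y
  proof (induction y rule: poly_mapping_single_induct)
    case (add t p b)
    have "mult_list M (map v (letters w @ letters p)) = mult_list M (map v (letters w)) \<otimes> mult_list M (map v (letters p))"
      using v by (simp, subst mult_list_append) auto
    then show ?case
      using add by (simp add: distrib_left mult_single L s c r_distr mult_smult_l mult_smult_r smult_smult plus_word_def mult.commute)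
  qed (simp add: z s c)
  have "free_lift M v (x * y) = free_lift M v x \<otimes> free_lift M v y" for x y
    by (induction x rule: poly_mapping_single_induct) (simp_all add: z L distrib_right m1 l_distr)
  moreover have "free_lift M v (Poly_Mapping.single 0 1) = \<one>"
    unfolding s by (simp add: zero_word_def mult_list_def)
  ultimately show ?thesis using lin by (intro algebra_homsI) simp_all
qed

end

locale presented =
  fixes Rel :: "('g word \<Rightarrow>\<^sub>0 'k::field) set"
begin

abbreviation "FA \<equiv> free_algebra :: ('k, 'g word \<Rightarrow>\<^sub>0 'k) module"
abbreviation "I \<equiv> Idl\<^bsub>FA\<^esub> Rel"
abbreviation "Q \<equiv> quot_module FA I"
abbreviation "cls x \<equiv> I +>\<^bsub>FA\<^esub> x"

lemma FA_ring: "ring FA" and FA_vs: "vs FA"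
  by (rule kalg.axioms(2)[OF kalg_free_algebra], rule kalg.axioms(1)[OF kalg_free_algebra])

lemma ideal_I: "ideal I FA" by (rule ring.genideal_ideal[OF FA_ring]) simp

lemma submodule_I: "submodule I (ring_of_type_algebra :: 'k ring) FA"
proof (rule vs.submodule_vsI[OF FA_vs])
  have a: "additive_subgroup I FA" using ideal_I by (simp add: ideal_def abelian_subgroup_def)
  show "\<zero>\<^bsub>FA\<^esub> \<in> I" using additive_subgroup.zero_closed[OF a] .
  show "x \<oplus>\<^bsub>FA\<^esub> y \<in> I" if "x \<in> I" "y \<in> I" for x y using additive_subgroup.a_closed[OF a that] .
  show "k \<odot>\<^bsub>FA\<^esub> x \<in> I" if "x \<in> I" for k x
    using ideal.I_l_closed[OF ideal_I that, of "Poly_Mapping.single 0 k"] by (simp add: pm_scale_conv_mult)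
qed simp

lemma vs_sub_I: "vs_sub FA I"
  by (simp add: vs_sub_def vs_sub_axioms_def FA_vs submodule_I)

lemma carrier_Q: "carrier Q = range cls"
  using vs_sub.quot_carrier[OF vs_sub_I] by simp

lemma cls_linear: "cls \<in> linear_maps FA Q" by (rule vs_sub.coset_linear[OF vs_sub_I])

lemma cls_mult: "cls x \<otimes>\<^bsub>Q\<^esub> cls y = cls (x * y)"
  using ideal.rcoset_mult_add[OF ideal_I, of x y] by (simp add: quot_module_simps)

lemma cls_one: "\<one>\<^bsub>Q\<^esub> = cls 1" by (simp add: quot_module_simps)

lemmas cls_simps = lin_add[OF cls_linear, simplified, symmetric] lin_smult[OF cls_linear, simplified, symmetric]

lemma vs_Q: "vs Q" by (rule vs_sub.vs_quot[OF vs_sub_I])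

lemma kalg_Q: "kalg Q"
proof -
  have "ring Q"
    by (rule ringI[OF module.axioms(2)[OF vs_Q[unfolded vs_def]] monoidI])
      (auto simp: carrier_Q cls_one cls_mult cls_simps mult.assoc distrib_left distrib_right)
  then show ?thesis
    by (auto simp: kalg_def kalg_axioms_def vs_Q carrier_Q cls_mult cls_simps pm_scale_mult)
qed

lemma cls_eq_zero: "r \<in> I \<Longrightarrow> cls r = \<zero>\<^bsub>Q\<^esub>"
proof -
  assume r: "r \<in> I"
  have "r \<ominus>\<^bsub>FA\<^esub> 0 = r" using vs.minus_smult1[OF FA_vs, of r 0] by (simp add: pm_scale_conv_mult)
  then show ?thesis
    using r vs_sub.coset_zero[OF vs_sub_I] vs_sub.coset_eq_iff[OF vs_sub_I, of r 0] by simp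
qed

lemma Rel_I: "r \<in> Rel \<Longrightarrow> r \<in> I"
  using ring.genideal_self[OF FA_ring, of Rel] by auto

lemma cls_eqI: "x - y \<in> Rel \<Longrightarrow> cls x = cls y"
proof -
  assume "x - y \<in> Rel"
  moreover have "x \<ominus>\<^bsub>FA\<^esub> y = x - y"
    by (subst vs.minus_smult1[OF FA_vs]) (simp_all add: poly_mapping_eq_iff fun_eq_iff lookup_add lookup_minus)
  ultimately show ?thesis using vs_sub.coset_eq_iff[OF vs_sub_I, of x y] Rel_I by simp
qed

lemma Q_induct [consumes 1, case_names one letter add mult smult]:
  assumes "x \<in> carrier Q" and "P \<one>\<^bsub>Q\<^esub>" "\<And>g. P (cls (letter g))"
    "\<And>x y. x \<in> carrier Q \<Longrightarrow> y \<in> carrier Q \<Longrightarrow> P x \<Longrightarrow> P y \<Longrightarrow> P (x \<oplus>\<^bsub>Q\<^esub> y)"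
    "\<And>x y. x \<in> carrier Q \<Longrightarrow> y \<in> carrier Q \<Longrightarrow> P x \<Longrightarrow> P y \<Longrightarrow> P (x \<otimes>\<^bsub>Q\<^esub> y)"
    "\<And>k x. x \<in> carrier Q \<Longrightarrow> P x \<Longrightarrow> P (k \<odot>\<^bsub>Q\<^esub> x)"
  shows "P x"
proof -
  obtain t where "x = cls t" using assms(1) by (auto simp: carrier_Q)
  moreover have "P (cls t)"
  proof (induction t rule: free_algebra_induct)
    case (add x y) then show ?case using assms(4)[of "cls x" "cls y"] by (simp add: carrier_Q cls_simps)
  next
    case (mult x y) then show ?case using assms(5)[of "cls x" "cls y"] by (simp add: carrier_Q cls_mult)
  next
    case (scale k x) then show ?case using assms(6)[of "cls x" k] by (simp add: carrier_Q cls_simps)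
  qed (use assms(2,3) in \<open>simp_all add: cls_one\<close>)
  ultimately show ?thesis by simp
qed

text \<open>The universal property of a presentation: the kernel of \<open>free_lift M v\<close> is
  an ideal that contains the relations, hence the ideal that they generate.\<close>

lemma
  assumes "kalg M" and v: "\<And>g. v g \<in> carrier M" and r: "\<And>r. r \<in> Rel \<Longrightarrow> free_lift M v r = \<zero>\<^bsub>M\<^esub>"
  shows quot_free_lift_hom: "quot_free_lift M v \<in> algebra_homs Q M"
    and quot_free_lift_cls: "quot_free_lift M v (cls x) = free_lift M v x"
    and quot_free_lift_gen: "quot_free_lift M v (cls (letter g)) = v g"
proof -
  interpret M: kalg M by fact
  let ?h = "free_lift M v"
  note h = M.free_lift_hom[of v, OF v]
  let ?N = "{x \<in> carrier FA. ?h x = \<zero>\<^bsub>M\<^esub>}"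
  have "ideal ?N FA"
  proof (rule idealI[OF FA_ring])
    show "subgroup ?N (add_monoid FA)"
      using submodule.axioms(1)[OF lin_kernel[OF alg_lin[OF h] FA_vs M.vs_axioms]] .
  qed (use alg_mult[OF h] alg_closed[OF h] in simp_all)
  then have "I \<subseteq> ?N" by (rule ring.genideal_minimal[OF FA_ring]) (use r in auto)
  then have n: "\<And>n. n \<in> I \<Longrightarrow> ?h n = \<zero>\<^bsub>M\<^esub>" by auto
  show c: "quot_free_lift M v (cls x) = free_lift M v x" for x
    unfolding quot_free_lift_def
    by (rule vs_sub.the_elem_coset[OF vs_sub_I alg_lin[OF h] M.vs_axioms n]) simp_all
  show "quot_free_lift M v (cls (letter g)) = v g" by (simp add: c M.free_lift_letter v)
  have "(\<lambda>\<xi>. quot_free_lift M v \<xi>) \<in> linear_maps Q M"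
    unfolding quot_free_lift_def by (rule vs_sub.the_elem_linear[OF vs_sub_I alg_lin[OF h] M.vs_axioms n])
  then show "quot_free_lift M v \<in> algebra_homs Q M"
    by (intro algebra_homsI)
      (use alg_mult[OF h] alg_one[OF h] in \<open>auto simp: carrier_Q cls_one cls_mult c\<close>)
qed

end

subsection \<open>Endomorphism algebras\<close>

text \<open>Operators are made extensional so that equality on \<open>V\<close> is equality in the
  algebra; otherwise the ring laws would fail on values outside the carrier.\<close>

definition End_alg :: "('k::field, 'v, 'm) module_scheme \<Rightarrow> ('k, 'v \<Rightarrow> 'v) module" where
  "End_alg V = \<lparr>carrier = linear_maps V V \<inter> extensional (carrier V),
     monoid.mult = (\<lambda>f g. compose (carrier V) f g), one = (\<lambda>x\<in>carrier V. x),
     ring.zero = (\<lambda>x\<in>carrier V. \<zero>\<^bsub>V\<^esub>), add = (\<lambda>f g. \<lambda>x\<in>carrier V. f x \<oplus>\<^bsub>V\<^esub> g x),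
     module.smult = (\<lambda>k f. \<lambda>x\<in>carrier V. k \<odot>\<^bsub>V\<^esub> f x)\<rparr>"

lemma End_alg_carrierI: "vs V \<Longrightarrow> f \<in> linear_maps V V \<Longrightarrow> restrict f (carrier V) \<in> carrier (End_alg V)"
  by (auto simp: End_alg_def intro: linear_maps_cong_set)

lemma End_alg_linear: "f \<in> carrier (End_alg V) \<Longrightarrow> f \<in> linear_maps V V"
  by (simp add: End_alg_def)

lemma End_alg_eqI: "f \<in> carrier (End_alg V) \<Longrightarrow> g \<in> carrier (End_alg V) \<Longrightarrow> (\<And>x. x \<in> carrier V \<Longrightarrow> f x = g x) \<Longrightarrow> f = g"
  by (auto simp: End_alg_def intro: extensionalityI)

lemma End_alg_apply:
  "x \<in> carrier V \<Longrightarrow> (f \<otimes>\<^bsub>End_alg V\<^esub> g) x = f (g x)" "x \<in> carrier V \<Longrightarrow> \<one>\<^bsub>End_alg V\<^esub> x = x"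
  "x \<in> carrier V \<Longrightarrow> \<zero>\<^bsub>End_alg V\<^esub> x = \<zero>\<^bsub>V\<^esub>" "x \<in> carrier V \<Longrightarrow> (f \<oplus>\<^bsub>End_alg V\<^esub> g) x = f x \<oplus>\<^bsub>V\<^esub> g x"
  "x \<in> carrier V \<Longrightarrow> (k \<odot>\<^bsub>End_alg V\<^esub> f) x = k \<odot>\<^bsub>V\<^esub> f x"
  by (simp_all add: End_alg_def compose_def)

lemma kalg_End: assumes "vs V" shows "kalg (End_alg V)"
proof -
  interpret V: vs V by fact
  let ?E = "End_alg V"
  note cl = lin_closed[OF End_alg_linear]
  have c1: "f \<otimes>\<^bsub>?E\<^esub> g \<in> carrier ?E" "f \<oplus>\<^bsub>?E\<^esub> g \<in> carrier ?E"
    if "f \<in> carrier ?E" "g \<in> carrier ?E" for f g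
    using End_alg_carrierI[OF assms lin_comp[OF End_alg_linear[OF that(2)] End_alg_linear[OF that(1)]]]
      End_alg_carrierI[OF assms lin_add_fun[OF End_alg_linear[OF that(1)] assms End_alg_linear[OF that(2)]]]
    by (simp_all add: End_alg_def compose_def)
  have c2: "k \<odot>\<^bsub>?E\<^esub> f \<in> carrier ?E" if "f \<in> carrier ?E" for f k
    using End_alg_carrierI[OF assms lin_smult_vec[OF End_alg_linear[OF that] assms, of k]]
    by (simp add: End_alg_def)
  note c = c1 c2 and eqI = End_alg_eqI[where V = V]
  have z: "(\<lambda>x. \<zero>\<^bsub>V\<^esub>) \<in> linear_maps V V" by (rule linear_mapsI) simp_all
  have c0: "\<zero>\<^bsub>?E\<^esub> \<in> carrier ?E" "\<one>\<^bsub>?E\<^esub> \<in> carrier ?E"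
    using End_alg_carrierI[OF assms z] End_alg_carrierI[OF assms lin_id] by (simp_all add: End_alg_def)
  note s = End_alg_apply cl c c0
  have g: "abelian_group ?E"
  proof (rule abelian_groupI)
    show "\<exists>y\<in>carrier ?E. y \<oplus>\<^bsub>?E\<^esub> f = \<zero>\<^bsub>?E\<^esub>" if f: "f \<in> carrier ?E" for f
      by (rule bexI[of _ "(- 1) \<odot>\<^bsub>?E\<^esub> f"], rule eqI)
        (use f in \<open>simp_all add: s V.smult_minus_l V.M.l_neg\<close>)
  qed (auto intro!: c c0, (rule eqI; simp add: s V.M.a_ac)+)
  have "vs ?E"
    by (rule vsI[OF g]) (auto intro!: c eqI simp: s V.smult_add_l V.smult_add_r V.smult_smult)
  moreover have "ring ?E"
    by (rule ringI[OF g monoidI]) (auto intro!: c c0 eqI simp: s lin_add[OF End_alg_linear])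
  ultimately show ?thesis
    by (auto simp: kalg_def kalg_axioms_def intro!: eqI simp: s lin_smult[OF End_alg_linear])
qed

subsection \<open>Generation\<close>

text \<open>The unital subalgebra generated by \<open>S\<close>; zero and negatives arise as scalar
  multiples. In contrast to \<open>hopf_subalgebra_generated\<close>, an intersection, it offers
  induction.\<close>

inductive_set gen_subalgebra :: "('k::field, 'a, 'm) module_scheme \<Rightarrow> 'a set \<Rightarrow> 'a set"
  for H :: "('k::field, 'a, 'm) module_scheme" (structure) and S where
  one: "\<one> \<in> gen_subalgebra H S"
| gen: "s \<in> S \<Longrightarrow> s \<in> gen_subalgebra H S"
| add: "x \<in> gen_subalgebra H S \<Longrightarrow> y \<in> gen_subalgebra H S \<Longrightarrow> x \<oplus> y \<in> gen_subalgebra H S"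
| mult: "x \<in> gen_subalgebra H S \<Longrightarrow> y \<in> gen_subalgebra H S \<Longrightarrow> x \<otimes> y \<in> gen_subalgebra H S"
| smult: "x \<in> gen_subalgebra H S \<Longrightarrow> k \<odot> x \<in> gen_subalgebra H S"

context kalg begin

lemma gen_subalgebra_carrier:
  assumes "S \<subseteq> carrier M" "x \<in> gen_subalgebra M S"
  shows "x \<in> carrier M"
  using assms(2) by (induction rule: gen_subalgebra.induct) (use assms(1) in auto)

lemma gen_subalgebra_submodule:
  assumes "S \<subseteq> carrier M"
  shows "submodule (gen_subalgebra M S) (ring_of_type_algebra :: 'k ring) M"
proof (rule submodule_vsI)
  show "gen_subalgebra M S \<subseteq> carrier M" using gen_subalgebra_carrier[OF assms] by blast
  show "\<zero> \<in> gen_subalgebra M S" using gen_subalgebra.smult[OF gen_subalgebra.one[of M S], of 0] by simp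
qed (rule gen_subalgebra.intros; assumption)+

lemma gen_subalgebra_subring:
  assumes "S \<subseteq> carrier M"
  shows "subring (gen_subalgebra M S) M"
proof (rule subringI)
  show "gen_subalgebra M S \<subseteq> carrier M" using gen_subalgebra_carrier[OF assms] by blast
  show "\<ominus> h \<in> gen_subalgebra M S" if "h \<in> gen_subalgebra M S" for h
    using that by (rule submodule_vsD(5)[OF gen_subalgebra_submodule[OF assms]])
qed (auto intro: gen_subalgebra.intros)

lemma gen_subalgebra_least:
  assumes "subring C M" "submodule C (ring_of_type_algebra :: 'k ring) M" "S \<subseteq> C"
  shows "gen_subalgebra M S \<subseteq> C"
proof
  fix x assume "x \<in> gen_subalgebra M S"
  then show "x \<in> C"
    by (induction rule: gen_subalgebra.induct)
      (use assms subringE[OF assms(1)] submodule_vsD(4)[OF assms(2)] in auto)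
qed

end

text \<open>The coproduct is multiplicative and the inclusion of tensor squares is an algebra map,
  so the condition on coproducts passes from generators to products. The antipode is
  antimultiplicative, which suffices for it as well. The generated subalgebra is then itself one of
  the Hopf subalgebras in the intersection.\<close>

lemma hopf_subalgebra_generated_eq:
  fixes H :: "('k::field, 'a, 'm) hopf_scheme" (structure)
  assumes "prebialg H" and S: "S \<subseteq> carrier H"
    and comult: "\<And>s. s \<in> S \<Longrightarrow> comult H s \<in> tensor_incl H `
      carrier (tensor_module (H\<lparr>carrier := gen_subalgebra H S\<rparr>) (H\<lparr>carrier := gen_subalgebra H S\<rparr>))"
    and antipode: "antipode H \<in> linear_maps H H" "antipode H \<one> = \<one>"
      "\<And>x y. x \<in> carrier H \<Longrightarrow> y \<in> carrier H \<Longrightarrow> antipode H (x \<otimes> y) = antipode H y \<otimes> antipode H x"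
    and antipode_S: "\<And>s. s \<in> S \<Longrightarrow> antipode H s \<in> gen_subalgebra H S"
  shows "hopf_subalgebra_generated H S = gen_subalgebra H S" "hopf_subalgebra (gen_subalgebra H S) H"
proof -
  interpret prebialg H by fact
  let ?C = "gen_subalgebra H S"
  interpret C: sub_alg H ?C
    by (simp add: sub_alg_def sub_alg_axioms_def kalg_axioms gen_subalgebra_subring gen_subalgebra_submodule S)
  note Cc = gen_subalgebra_carrier[OF S]
  let ?J = "tensor_incl H ` carrier (tensor_module C.R C.R)"
  note i = C.incl_hom
  have "comult H x \<in> ?J" if "x \<in> ?C" for x
    using that
  proof (induction rule: gen_subalgebra.induct)
    case one
    have "comult H \<one> = tensor_incl H (pure_tensor C.R C.R \<one> \<one>)"
      by (simp add: C.incl_pure C.sub_one alg_one[OF comult_hom])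
    then show ?case using C.RR.pure_closed[of \<one> \<one>] C.sub_one by simp
  next
    case (gen s)
    then show ?case using comult[OF gen] by (simp add: C.tensor_carrier_update)
  next
    case (add x y)
    then obtain \<xi> \<eta> where "\<xi> \<in> carrier (tensor_module C.R C.R)" "\<eta> \<in> carrier (tensor_module C.R C.R)"
      "comult H x = tensor_incl H \<xi>" "comult H y = tensor_incl H \<eta>" by blast
    then show ?case using Cc[OF add.hyps(1)] Cc[OF add.hyps(2)]
        abelian_monoid.a_closed[OF abelian_group.axioms(1)[OF module.axioms(2)[OF C.RR.vs_tensor[unfolded vs_def]]], of \<xi> \<eta>]
      by (simp add: lin_add[OF comult_linear] lin_add[OF C.incl_linear, symmetric])
  next
    case (mult x y)
    then obtain \<xi> \<eta> where "\<xi> \<in> carrier (tensor_module C.R C.R)" "\<eta> \<in> carrier (tensor_module C.R C.R)"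
      "comult H x = tensor_incl H \<xi>" "comult H y = tensor_incl H \<eta>" by blast
    then show ?case using Cc[OF mult.hyps(1)] Cc[OF mult.hyps(2)] C.RR.tensor_mult_closed[of \<xi> \<eta>]
      by (simp add: alg_mult[OF comult_hom] alg_mult[OF i, simplified, symmetric])
  next
    case (smult x k)
    then obtain \<xi> where "\<xi> \<in> carrier (tensor_module C.R C.R)" "comult H x = tensor_incl H \<xi>" by blast
    then show ?case using Cc[OF smult.hyps(1)] vs.smult_in[OF C.RR.vs_tensor, of \<xi> k]
      by (simp add: lin_smult[OF comult_linear] lin_smult[OF C.incl_linear, symmetric])
  qed
  moreover have "antipode H x \<in> ?C" if "x \<in> ?C" for x
    using that
  proof (induction rule: gen_subalgebra.induct)
    case one then show ?case by (simp add: antipode gen_subalgebra.one)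
  next
    case (add x y) then show ?case
      using lin_add[OF antipode(1) Cc[OF add.hyps(1)] Cc[OF add.hyps(2)]] by (simp add: gen_subalgebra.add)
  next
    case (mult x y) then show ?case
      using antipode(3)[OF Cc[OF mult.hyps(1)] Cc[OF mult.hyps(2)]] by (simp add: gen_subalgebra.mult)
  next
    case (smult x k) then show ?case
      using lin_smult[OF antipode(1) Cc[OF smult.hyps(1)]] by (simp add: gen_subalgebra.smult)
  qed (rule antipode_S)
  ultimately show h: "hopf_subalgebra ?C H"
    unfolding hopf_subalgebra_def C.tensor_carrier_update
    using gen_subalgebra_subring[OF S] gen_subalgebra_submodule[OF S] by auto
  show "hopf_subalgebra_generated H S = ?C"
  proof
    show "hopf_subalgebra_generated H S \<subseteq> ?C"
      unfolding hopf_subalgebra_generated_def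
      by (rule Inter_lower) (simp add: h subset_iff gen_subalgebra.gen)
    show "?C \<subseteq> hopf_subalgebra_generated H S"
      unfolding hopf_subalgebra_generated_def
      by (rule Inter_greatest) (simp add: hopf_subalgebra_def gen_subalgebra_least)
  qed
qed

subsection \<open>Checking the axioms on generators\<close>

context prebialg begin

text \<open>Both sides of each law are multiplicative in the argument, so agreement on
  \<open>G\<close> spreads to everything it generates. For coassociativity the inner sums have to be
  multiplicative first, which is \<open>Fm\<close> and \<open>Km\<close>.\<close>

lemma bialg_of_generators:
  assumes G: "G \<subseteq> carrier H" "carrier H \<subseteq> gen_subalgebra H G"
    and coassoc: "\<And>x. x \<in> G \<Longrightarrow>
      sweedler H (tensor_algebra H (tensor_algebra H H)) (\<lambda>y c.
        sweedler H (tensor_algebra H (tensor_algebra H H)) (\<lambda>a b.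
          pure_tensor H (tensor_algebra H H) a (pure_tensor H H b c)) y) x =
      sweedler H (tensor_algebra H (tensor_algebra H H)) (\<lambda>a y.
        sweedler H (tensor_algebra H (tensor_algebra H H)) (\<lambda>b c.
          pure_tensor H (tensor_algebra H H) a (pure_tensor H H b c)) y) x"
    and counit_left: "\<And>x. x \<in> G \<Longrightarrow> sweedler H H (\<lambda>a b. counit H a \<odot> b) x = x"
    and counit_right: "\<And>x. x \<in> G \<Longrightarrow> sweedler H H (\<lambda>a b. counit H b \<odot> a) x = x"
  shows "bialg H"
proof -
  let ?W = "tensor_algebra H (tensor_algebra H H)"
  let ?p = "\<lambda>a b c. pure_tensor H (tensor_algebra H H) a (pure_tensor H H b c)"
  let ?F = "\<lambda>y c. sweedler H ?W (\<lambda>a b. ?p a b c) y"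
  let ?K = "\<lambda>a y. sweedler H ?W (\<lambda>b c. ?p a b c) y"
  have p: "trilin H H H ?W ?p"
    by (intro trilinI) (auto intro!: T3.lin_pure_l T3.lin_pure_r T2.lin_pure_l T2.lin_pure_r lin_id)
  have W: "vs ?W" by (rule T3.TA.vs_axioms)
  have pm: "?p (a \<otimes> a') (b \<otimes> b') (c \<otimes> c') = ?p a b c \<otimes>\<^bsub>?W\<^esub> ?p a' b' c'"
    if "a \<in> carrier H" "b \<in> carrier H" "c \<in> carrier H" "a' \<in> carrier H" "b' \<in> carrier H" "c' \<in> carrier H" for a b c a' b' c'
    using that by simp
  note F = sw_lin12(1)[OF p W] and K = sw_lin12(2)[OF p W]
  have Fm: "?F (y \<otimes> y') (c \<otimes> c') = ?F y c \<otimes>\<^bsub>?W\<^esub> ?F y' c'"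
    if "y \<in> carrier H" "c \<in> carrier H" "y' \<in> carrier H" "c' \<in> carrier H" for y c y' c'
    by (rule sw_mult_split[OF T3.kalg_tensor trilin_bilin(3)[OF p] trilin_bilin(3)[OF p] trilin_bilin(3)[OF p]])
      (use that in \<open>simp_all only: pm m_closed\<close>)
  have Km: "?K (a \<otimes> a') (y \<otimes> y') = ?K a y \<otimes>\<^bsub>?W\<^esub> ?K a' y'"
    if "y \<in> carrier H" "a \<in> carrier H" "y' \<in> carrier H" "a' \<in> carrier H" for y a y' a'
    by (rule sw_mult_split[OF T3.kalg_tensor trilin_bilin(1)[OF p] trilin_bilin(1)[OF p] trilin_bilin(1)[OF p]])
      (use that in \<open>simp_all only: pm m_closed\<close>)
  have el: "bilin H H H (\<lambda>a b. counit H a \<odot> b)" and er: "bilin H H H (\<lambda>a b. counit H b \<odot> a)"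
    by (rule bilinI; intro lin_smult_scalar[OF counit_linear] lin_smult_vec lin_id vs_axioms; assumption)+
  have gc: "x \<in> gen_subalgebra H G \<Longrightarrow> x \<in> carrier H" for x by (rule gen_subalgebra_carrier[OF G(1)])
  have 1: "sweedler H ?W ?F x = sweedler H ?W ?K x \<and> sweedler H H (\<lambda>a b. counit H a \<odot> b) x = x \<and>
      sweedler H H (\<lambda>a b. counit H b \<odot> a) x = x" if "x \<in> gen_subalgebra H G" for x
    using that
  proof (induction rule: gen_subalgebra.induct)
    case one
    have "sweedler H ?W ?F \<one> = ?p \<one> \<one> \<one>" "sweedler H ?W ?K \<one> = ?p \<one> \<one> \<one>"
      by (simp_all add: sw_one[OF F W] sw_one[OF K W] sw_one[OF trilin_bilin(3)[OF p] W] sw_one[OF trilin_bilin(1)[OF p] W])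
    then show ?case by (simp add: sw_one[OF el vs_axioms] sw_one[OF er vs_axioms] alg_one[OF counit_hom])
  next
    case (gen s)
    then show ?case by (simp add: coassoc counit_left counit_right)
  next
    case (add x y)
    note xy = gc[OF add.hyps(1)] gc[OF add.hyps(2)]
    show ?case using add.IH
      by (simp add: lin_add[OF sw_linear[OF F W] xy] lin_add[OF sw_linear[OF K W] xy]
          lin_add[OF sw_linear[OF el vs_axioms] xy] lin_add[OF sw_linear[OF er vs_axioms] xy])
  next
    case (mult x y)
    note xy = gc[OF mult.hyps(1)] gc[OF mult.hyps(2)]
    have "sweedler H ?W ?F (x \<otimes> y) = sweedler H ?W ?F x \<otimes>\<^bsub>?W\<^esub> sweedler H ?W ?F y"
      by (rule sw_mult_split[OF T3.kalg_tensor F F F xy Fm])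
    moreover have "sweedler H ?W ?K (x \<otimes> y) = sweedler H ?W ?K x \<otimes>\<^bsub>?W\<^esub> sweedler H ?W ?K y"
      by (rule sw_mult_split[OF T3.kalg_tensor K K K xy Km])
    moreover have "sweedler H H (\<lambda>a b. counit H a \<odot> b) (x \<otimes> y) =
        sweedler H H (\<lambda>a b. counit H a \<odot> b) x \<otimes> sweedler H H (\<lambda>a b. counit H a \<odot> b) y"
      by (rule sw_mult_split[OF kalg_axioms el el el xy])
        (simp add: alg_mult[OF counit_hom] mult_smult_l mult_smult_r smult_smult mult.commute)
    moreover have "sweedler H H (\<lambda>a b. counit H b \<odot> a) (x \<otimes> y) =
        sweedler H H (\<lambda>a b. counit H b \<odot> a) x \<otimes> sweedler H H (\<lambda>a b. counit H b \<odot> a) y"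
      by (rule sw_mult_split[OF kalg_axioms er er er xy])
        (simp add: alg_mult[OF counit_hom] mult_smult_l mult_smult_r smult_smult mult.commute)
    ultimately show ?case using mult.IH by simp
  next
    case (smult x k)
    note x = gc[OF smult.hyps(1)]
    show ?case using smult.IH
      by (simp add: lin_smult[OF sw_linear[OF F W] x] lin_smult[OF sw_linear[OF K W] x]
          lin_smult[OF sw_linear[OF el vs_axioms] x] lin_smult[OF sw_linear[OF er vs_axioms] x])
  qed
  show ?thesis
    by (intro bialg.intro bialg_axioms.intro prebialg_axioms) (use 1 G(2) in blast)+
qed

text \<open>Here the sums are not homomorphisms. For a product the legs nest, as in
  \<open>S(y1) S(x1) x2 y2\<close>: the inner pair collapses to a scalar by the hypothesis on one
  factor, and then the outer pair does by that on the other.\<close>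

lemma antipode_of_generators:
  assumes G: "G \<subseteq> carrier H" "carrier H \<subseteq> gen_subalgebra H G"
    and S: "S \<in> linear_maps H H" "S \<one> = \<one>" "\<And>x y. x \<in> carrier H \<Longrightarrow> y \<in> carrier H \<Longrightarrow> S (x \<otimes> y) = S y \<otimes> S x"
    and l: "\<And>x. x \<in> G \<Longrightarrow> sweedler H H (\<lambda>a b. S a \<otimes> b) x = counit H x \<odot> \<one>"
    and r: "\<And>x. x \<in> G \<Longrightarrow> sweedler H H (\<lambda>a b. a \<otimes> S b) x = counit H x \<odot> \<one>"
    and x: "x \<in> carrier H"
  shows "sweedler H H (\<lambda>a b. S a \<otimes> b) x = counit H x \<odot> \<one>" "sweedler H H (\<lambda>a b. a \<otimes> S b) x = counit H x \<odot> \<one>"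
proof -
  note V = vs_axioms and Sc = lin_closed[OF S(1)]
  have bl: "bilin H H H (\<lambda>a b. S a \<otimes> b)" and br: "bilin H H H (\<lambda>a b. a \<otimes> S b)"
    by (rule bilinI; intro lin_mult_l lin_mult_r S(1) lin_id Sc; assumption)+
  have gc: "x \<in> gen_subalgebra H G \<Longrightarrow> x \<in> carrier H" for x by (rule gen_subalgebra_carrier[OF G(1)])
  have ml: "sweedler H H (\<lambda>a b. S a \<otimes> b) (x \<otimes> y) = (counit H x * counit H y) \<odot> \<one>"
    if x: "x \<in> carrier H" and y: "y \<in> carrier H" and IH: "sweedler H H (\<lambda>a b. S a \<otimes> b) x = counit H x \<odot> \<one>"
      "sweedler H H (\<lambda>a b. S a \<otimes> b) y = counit H y \<odot> \<one>" for x y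
  proof -
    have 1: "sweedler H H (\<lambda>a b. S (a \<otimes> a') \<otimes> (b \<otimes> b')) x = counit H x \<odot> (S a' \<otimes> b')"
      if ab: "a' \<in> carrier H" "b' \<in> carrier H" for a' b'
    proof -
      have "sweedler H H (\<lambda>a b. S (a \<otimes> a') \<otimes> (b \<otimes> b')) x = sweedler H H (\<lambda>a b. (S a' \<otimes> (S a \<otimes> b)) \<otimes> b') x"
        by (rule sw_cong[OF bilin_mult_r[OF bl ab] V x]) (simp add: S(3) ab Sc m_assoc)
      also have "\<dots> = (S a' \<otimes> sweedler H H (\<lambda>a b. S a \<otimes> b) x) \<otimes> b'"
        by (rule sw_comp[OF bl V V _ x, symmetric]) (intro lin_mult_l lin_mult_r lin_id ab Sc)
      finally show ?thesis by (simp add: IH mult_smult_l mult_smult_r ab Sc)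
    qed
    have "sweedler H H (\<lambda>a b. S a \<otimes> b) (x \<otimes> y) =
        sweedler H H (\<lambda>a b. sweedler H H (\<lambda>a' b'. S (a \<otimes> a') \<otimes> (b \<otimes> b')) y) x"
      by (rule sw_mult[OF bl V x y])
    \<comment> \<open>The legs of \<open>x\<close> stand inside those of \<open>y\<close>, so the
      sum over \<open>x\<close> must become the inner one. For the right-hand law the legs of
      \<open>y\<close> are inside and no exchange is required.\<close>
    also have "\<dots> = sweedler H H (\<lambda>a' b'. sweedler H H (\<lambda>a b. S (a \<otimes> a') \<otimes> (b \<otimes> b')) x) y"
      by (rule sw_swap[OF precoalg_axioms V x y bilin_mult_l[OF bl] bilin_mult_r[OF bl]])
    also have "\<dots> = sweedler H H (\<lambda>a' b'. counit H x \<odot> (S a' \<otimes> b')) y"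
      by (rule sw_cong[symmetric]) (use bl y V in \<open>simp_all add: 1 bilin_def lin_smult_vec\<close>)
    also have "\<dots> = counit H x \<odot> sweedler H H (\<lambda>a' b'. S a' \<otimes> b') y"
      by (rule sw_comp[OF bl V V _ y, symmetric]) (intro lin_smult_vec lin_id V)
    finally show ?thesis by (simp add: IH smult_smult)
  qed
  have mr: "sweedler H H (\<lambda>a b. a \<otimes> S b) (x \<otimes> y) = (counit H x * counit H y) \<odot> \<one>"
    if x: "x \<in> carrier H" and y: "y \<in> carrier H" and IH: "sweedler H H (\<lambda>a b. a \<otimes> S b) x = counit H x \<odot> \<one>"
      "sweedler H H (\<lambda>a b. a \<otimes> S b) y = counit H y \<odot> \<one>" for x y
  proof -
    have 1: "sweedler H H (\<lambda>a' b'. (a \<otimes> a') \<otimes> S (b \<otimes> b')) y = counit H y \<odot> (a \<otimes> S b)"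
      if ab: "a \<in> carrier H" "b \<in> carrier H" for a b
    proof -
      have "sweedler H H (\<lambda>a' b'. (a \<otimes> a') \<otimes> S (b \<otimes> b')) y = sweedler H H (\<lambda>a' b'. (a \<otimes> (a' \<otimes> S b')) \<otimes> S b) y"
        by (rule sw_cong[OF bilin_mult_l[OF br ab] V y]) (simp add: S(3) ab Sc m_assoc)
      also have "\<dots> = (a \<otimes> sweedler H H (\<lambda>a' b'. a' \<otimes> S b') y) \<otimes> S b"
        by (rule sw_comp[OF br V V _ y, symmetric]) (intro lin_mult_l lin_mult_r lin_id ab Sc)
      finally show ?thesis by (simp add: IH mult_smult_l mult_smult_r ab Sc)
    qed
    have "sweedler H H (\<lambda>a b. a \<otimes> S b) (x \<otimes> y) =
        sweedler H H (\<lambda>a b. sweedler H H (\<lambda>a' b'. (a \<otimes> a') \<otimes> S (b \<otimes> b')) y) x"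
      by (rule sw_mult[OF br V x y])
    also have "\<dots> = sweedler H H (\<lambda>a b. counit H y \<odot> (a \<otimes> S b)) x"
      by (rule sw_cong[symmetric]) (use br x V in \<open>simp_all add: 1 bilin_def lin_smult_vec\<close>)
    also have "\<dots> = counit H y \<odot> sweedler H H (\<lambda>a b. a \<otimes> S b) x"
      by (rule sw_comp[OF br V V _ x, symmetric]) (intro lin_smult_vec lin_id V)
    finally show ?thesis by (simp add: IH smult_smult mult.commute)
  qed
  have "sweedler H H (\<lambda>a b. S a \<otimes> b) x = counit H x \<odot> \<one> \<and> sweedler H H (\<lambda>a b. a \<otimes> S b) x = counit H x \<odot> \<one>"
    if "x \<in> gen_subalgebra H G" for x
    using that
  proof (induction rule: gen_subalgebra.induct)
    case one
    then show ?case by (simp add: sw_one[OF bl V] sw_one[OF br V] S alg_one[OF counit_hom])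
  next
    case (gen s)
    then show ?case by (simp add: l r)
  next
    case (add x y)
    note xy = gc[OF add.hyps(1)] gc[OF add.hyps(2)]
    show ?case using add.IH
      by (simp add: lin_add[OF sw_linear[OF bl V] xy] lin_add[OF sw_linear[OF br V] xy]
          lin_add[OF counit_linear xy] smult_add_l)
  next
    case (mult x y)
    note xy = gc[OF mult.hyps(1)] gc[OF mult.hyps(2)]
    show ?case using mult.IH by (simp add: ml[OF xy] mr[OF xy] alg_mult[OF counit_hom xy])
  next
    case (smult x k)
    note x = gc[OF smult.hyps(1)]
    show ?case using smult.IH
      by (simp add: lin_smult[OF sw_linear[OF bl V] x] lin_smult[OF sw_linear[OF br V] x]
          lin_smult[OF counit_linear x] smult_smult)
  qed
  then show "sweedler H H (\<lambda>a b. S a \<otimes> b) x = counit H x \<odot> \<one>" "sweedler H H (\<lambda>a b. a \<otimes> S b) x = counit H x \<odot> \<one>"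
    using G(2) x by blast+
qed

end

subsection \<open>The quantum Serre elements as iterated q-commutators\<close>

text \<open>The iterated q-commutator: \<open>z\<close> is replaced by \<open>x z - c z x\<close>
  for each \<open>c\<close> in the list, the last entry acting first.\<close>

definition qad :: "('k::field, 'a, 'm) module_scheme \<Rightarrow> 'a \<Rightarrow> 'k list \<Rightarrow> 'a \<Rightarrow> 'a" where
  "qad M x cs z = foldr (\<lambda>c z. x \<otimes>\<^bsub>M\<^esub> z \<ominus>\<^bsub>M\<^esub> c \<odot>\<^bsub>M\<^esub> (z \<otimes>\<^bsub>M\<^esub> x)) cs z"

lemma qad_Nil [simp]: "qad M x [] z = z"
  and qad_Cons: "qad M x (c # cs) z = x \<otimes>\<^bsub>M\<^esub> qad M x cs z \<ominus>\<^bsub>M\<^esub> c \<odot>\<^bsub>M\<^esub> (qad M x cs z \<otimes>\<^bsub>M\<^esub> x)"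
  by (simp_all add: qad_def)

context kalg begin

lemma qad_closed [simp]: "x \<in> carrier M \<Longrightarrow> z \<in> carrier M \<Longrightarrow> qad M x cs z \<in> carrier M"
  by (induction cs) (simp_all add: qad_Cons)

lemma qad_add:
  "x \<in> carrier M \<Longrightarrow> z \<in> carrier M \<Longrightarrow> z' \<in> carrier M \<Longrightarrow> qad M x cs (z \<oplus> z') = qad M x cs z \<oplus> qad M x cs z'"
  by (induction cs) (simp_all add: qad_Cons l_distr r_distr smult_add_r minus_eq minus_add a_ac)

lemma qad_scale:
  "x \<in> carrier M \<Longrightarrow> z \<in> carrier M \<Longrightarrow> qad M (\<alpha> \<odot> x) cs (\<beta> \<odot> z) = (\<alpha> ^ length cs * \<beta>) \<odot> qad M x cs z"
  by (induction cs)
    (simp_all add: qad_Cons mult_smult_l mult_smult_r smult_smult minus_smult1 smult_add_r mult_ac)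

lemma qad_zero: "x \<in> carrier M \<Longrightarrow> qad M x cs \<zero> = \<zero>"
  by (induction cs) (simp_all add: qad_Cons minus_self)

text \<open>Left and right multiplication by \<open>x\<close> commute, hence so do the q-commutators
  with \<open>x\<close> for different coefficients. A coefficient may act first instead of last, and
  by \<open>qad_rev\<close> the order of the list is immaterial.\<close>

lemma qad_Cons': "x \<in> carrier M \<Longrightarrow> z \<in> carrier M \<Longrightarrow>
    qad M x (c # cs) z = qad M x cs (x \<otimes> z \<ominus> c \<odot> (z \<otimes> x))"
proof (induction cs)
  case (Cons d cs)
  let ?z = "qad M x cs z"
  have z: "?z \<in> carrier M" using Cons.prems by simp
  have "x \<otimes> (x \<otimes> ?z \<ominus> d \<odot> (?z \<otimes> x)) \<ominus> c \<odot> ((x \<otimes> ?z \<ominus> d \<odot> (?z \<otimes> x)) \<otimes> x) =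
    x \<otimes> (x \<otimes> ?z \<ominus> c \<odot> (?z \<otimes> x)) \<ominus> d \<odot> ((x \<otimes> ?z \<ominus> c \<odot> (?z \<otimes> x)) \<otimes> x)"
    using Cons.prems z
    by (simp add: minus_smult1 r_distr l_distr mult_smult_l mult_smult_r smult_smult smult_add_r m_assoc a_ac mult_ac)
  then show ?case using Cons by (simp add: qad_Cons)
qed (simp add: qad_Cons)

lemma qad_append: "qad M x (cs @ ds) z = qad M x cs (qad M x ds z)"
  by (simp add: qad_def)

lemma qad_rev: "x \<in> carrier M \<Longrightarrow> z \<in> carrier M \<Longrightarrow> qad M x (rev cs) z = qad M x cs z"
proof (induction cs arbitrary: z)
  case (Cons c cs)
  have "qad M x (rev (c # cs)) z = qad M x (rev cs) (x \<otimes> z \<ominus> c \<odot> (z \<otimes> x))"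
    by (simp add: qad_append qad_Cons)
  then show ?case using Cons by (simp add: qad_Cons')
qed simp

lemma qad_weight:
  "x \<in> carrier M \<Longrightarrow> z \<in> carrier M \<Longrightarrow> w \<in> carrier M \<Longrightarrow> w \<otimes> x = \<alpha> \<odot> (x \<otimes> w) \<Longrightarrow> w \<otimes> z = \<beta> \<odot> (z \<otimes> w) \<Longrightarrow>
   w \<otimes> qad M x cs z = (\<alpha> ^ length cs * \<beta>) \<odot> (qad M x cs z \<otimes> w)"
proof (induction cs)
  case (Cons c cs)
  let ?z = "qad M x cs z"
  have z: "?z \<in> carrier M" using Cons.prems by simp
  have 1: "w \<otimes> (x \<otimes> ?z) = (\<alpha> * (\<alpha> ^ length cs * \<beta>)) \<odot> (x \<otimes> ?z \<otimes> w)"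
    using Cons z by (simp add: mult_smult_l mult_smult_r smult_smult m_assoc flip: m_assoc[of w])
  have "w \<otimes> (?z \<otimes> x) = ((\<alpha> ^ length cs * \<beta>) \<odot> (?z \<otimes> w)) \<otimes> x"
    using Cons z by (simp flip: m_assoc)
  also have "\<dots> = (\<alpha> ^ length cs * \<beta>) \<odot> (?z \<otimes> (w \<otimes> x))"
    using Cons.prems(1-3) z by (simp add: mult_smult_l m_assoc)
  finally have 2: "w \<otimes> (?z \<otimes> x) = (\<alpha> * (\<alpha> ^ length cs * \<beta>)) \<odot> (?z \<otimes> x \<otimes> w)"
    using Cons.prems z by (simp add: mult_smult_l mult_smult_r smult_smult m_assoc mult_ac)
  show ?case using Cons.prems(1-3) z
    by (simp add: qad_Cons minus_smult1 r_distr l_distr mult_smult_l mult_smult_r 1 2 smult_smult smult_add_r mult_ac)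
qed simp

text \<open>A summand \<open>y\<close> that commutes with \<open>z\<close> up to exactly the
  coefficient \<open>c\<close> contributes nothing to the q-commutator.\<close>

lemma qad_split:
  assumes "x \<in> carrier M" "y \<in> carrier M" "z \<in> carrier M" "y \<otimes> z = c \<odot> (z \<otimes> y)"
  shows "(x \<oplus> y) \<otimes> z \<ominus> c \<odot> (z \<otimes> (x \<oplus> y)) = x \<otimes> z \<ominus> c \<odot> (z \<otimes> x)"
    and "(y \<oplus> x) \<otimes> z \<ominus> c \<odot> (z \<otimes> (y \<oplus> x)) = x \<otimes> z \<ominus> c \<odot> (z \<otimes> x)"
proof -
  have "(x \<oplus> y) \<otimes> z \<ominus> c \<odot> (z \<otimes> (x \<oplus> y)) = (x \<otimes> z \<ominus> c \<odot> (z \<otimes> x)) \<oplus> (c \<odot> (z \<otimes> y) \<ominus> c \<odot> (z \<otimes> y))"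
    using assms by (simp add: l_distr r_distr smult_add_r minus_eq minus_add a_ac)
  then show 1: "(x \<oplus> y) \<otimes> z \<ominus> c \<odot> (z \<otimes> (x \<oplus> y)) = x \<otimes> z \<ominus> c \<odot> (z \<otimes> x)"
    using assms by (simp add: minus_self)
  then show "(y \<oplus> x) \<otimes> z \<ominus> c \<odot> (z \<otimes> (y \<oplus> x)) = x \<otimes> z \<ominus> c \<odot> (z \<otimes> x)"
    using assms by (simp add: a_comm)
qed

end

lemma qad_hom:
  assumes "f \<in> algebra_homs M N" "kalg M" "kalg N" "x \<in> carrier M" "z \<in> carrier M"
  shows "f (qad M x cs z) = qad N (f x) cs (f z)"
proof -
  interpret M: kalg M by fact
  interpret N: kalg N by fact
  show ?thesis using assms(4,5)
    by (induction cs)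
      (simp_all add: qad_Cons lin_diff[OF alg_lin[OF assms(1)] M.vs_axioms N.vs_axioms] alg_mult[OF assms(1)] alg_smult[OF assms(1)])
qed

lemma alg_hom_opposite: "f \<in> algebra_homs M N \<Longrightarrow> f \<in> algebra_homs (opposite M) (opposite N)"
  by (auto simp: algebra_homs_def ring_hom_def linear_maps_def)

text \<open>The exponents decrease along the list, so exponent zero acts first and passing from
  \<open>n\<close> to \<open>n + 1\<close> adds one outermost commutator with coefficient
  \<open>v ^ n * c\<close>.\<close>

definition ad_coeffs :: "'k::field \<Rightarrow> 'k \<Rightarrow> nat \<Rightarrow> 'k list" where
  "ad_coeffs v c n = map (\<lambda>l. v ^ l * c) (rev [0..<n])"

lemma ad_coeffs_simps [simp]: "ad_coeffs v c 0 = []" "ad_coeffs v c (Suc n) = (v ^ n * c) # ad_coeffs v c n"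
  "length (ad_coeffs v c n) = n"
  by (simp_all add: ad_coeffs_def)

lemma qfact_nz: "(\<And>m. m > 0 \<Longrightarrow> v ^ m \<noteq> 1) \<Longrightarrow> qfact (v::'k::field) n \<noteq> 0"
  unfolding qfact_def qint_def using power_one_right[of v] by (auto simp: prod_zero_iff) (metis zero_less_one)

text \<open>The q-Pascal rule for row \<open>n = a + b + 1\<close> and column \<open>k = a\<close>,
  written so that all truncated subtractions disappear. The boundary column \<open>k = n\<close> is
  excluded by this form and is treated separately where the rule is applied.\<close>

lemma qbinom_pascal:
  assumes v: "\<And>m. m > 0 \<Longrightarrow> (v::'k::field) ^ m \<noteq> 1"
  shows "qbinom v (Suc (Suc (a + b))) (Suc a) = qbinom v (Suc (a + b)) (Suc a) + v ^ Suc b * qbinom v (Suc (a + b)) a"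
proof -
  note nz = qfact_nz[OF v]
  have v1: "v - 1 \<noteq> 0" using v[of 1] by simp
  have s: "qfact v (Suc n) = qint v (Suc n) * qfact v n" for n by (simp add: qfact_def mult.commute)
  have inz: "qint v (Suc n) \<noteq> 0" for n using v[of "Suc n"] v1 by (simp add: qint_def)
  have d: "Suc (Suc (a + b)) - Suc a = Suc b" "Suc (a + b) - Suc a = b" "Suc (a + b) - a = Suc b" by auto
  \<comment> \<open>The q-analogue of splitting a number into \<open>b + 1\<close> and
    \<open>a + 1\<close>; multiplied by the factorial quotient it is the rule.\<close>
  have i: "qint v (Suc (Suc (a + b))) = qint v (Suc b) + v ^ Suc b * qint v (Suc a)"
  proof -
    have "v ^ Suc (Suc (a + b)) - 1 = (v ^ Suc b - 1) + v ^ Suc b * (v ^ Suc a - 1)"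
      by (simp add: algebra_simps power_add)
    then show ?thesis unfolding qint_def by (simp only: add_divide_distrib times_divide_eq_right)
  qed
  let ?A = "qfact v a" and ?B = "qfact v b" and ?N = "qfact v (Suc (a + b))" and ?p = "qint v (Suc a)" and ?r = "qint v (Suc b)"
  have "qbinom v (Suc (Suc (a + b))) (Suc a) = (?r + v ^ Suc b * ?p) * ?N / ((?p * ?A) * (?r * ?B))"
    unfolding qbinom_def d s[of "Suc (a + b)"] i s[of a] s[of b] by simp
  also have "\<dots> = ?N / ((?p * ?A) * ?B) + v ^ Suc b * (?N / (?A * (?r * ?B)))"
    using nz[of a] nz[of b] inz[of a] inz[of b] by (simp add: divide_simps algebra_simps)
  also have "\<dots> = qbinom v (Suc (a + b)) (Suc a) + v ^ Suc b * qbinom v (Suc (a + b)) a"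
    unfolding qbinom_def d s[of a] s[of b] by simp
  finally show ?thesis .
qed

text \<open>The q-binomial theorem for two commuting operators \<open>L\<close> and
  \<open>R\<close>, with \<open>z m k\<close> standing for \<open>L\<close> applied \<open>m\<close>
  times and \<open>R\<close> applied \<open>k\<close> times to \<open>y\<close>. Left and right
  multiplication may take either role, which covers both kinds of Serre elements.\<close>

lemma qad_expansion:
  fixes L R :: "('w \<Rightarrow>\<^sub>0 'k::field) \<Rightarrow> ('w \<Rightarrow>\<^sub>0 'k)"
  assumes v: "\<And>m. m > 0 \<Longrightarrow> (v::'k) ^ m \<noteq> 1"
    and L: "\<And>x y. L (x + y) = L x + L y" "\<And>k x. L (pm_scale k x) = pm_scale k (L x)"
    and R: "\<And>x y. R (x + y) = R x + R y" "\<And>k x. R (pm_scale k x) = pm_scale k (R x)"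
    and z0: "z 0 0 = y" and zL: "\<And>m k. L (z m k) = z (Suc m) k" and zR: "\<And>m k. R (z m k) = z m (Suc k)"
  shows "foldr (\<lambda>c z. L z - pm_scale c (R z)) (ad_coeffs v c n) y =
    (\<Sum>k=0..n. pm_scale ((- 1) ^ k * qbinom v n k * v ^ (k * (k - 1) div 2) * c ^ k) (z (n - k) k))"
proof -
  \<comment> \<open>Extending the coefficients by zero beyond \<open>n\<close> lets the recursion
    \<open>gS\<close> hold for all \<open>k\<close>.\<close>
  define g where "g n k = (if k \<le> n then (- 1) ^ k * qbinom v n k * v ^ (k * (k - 1) div 2) * c ^ k else 0)" for n k :: nat
  note nz = qfact_nz[OF v]
  have q0: "qbinom v n 0 = 1" "qbinom v n n = 1" for n
    using nz[of n] by (simp_all add: qbinom_def) (simp_all add: qfact_def)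
  have e: "Suc k * (Suc k - 1) div 2 = k + k * (k - 1) div 2" for k :: nat
  proof -
    have "Suc k * (Suc k - 1) = 2 * k + k * (k - 1)" by (cases k) simp_all
    then show ?thesis by simp
  qed
  have g0: "g n 0 = 1" for n by (simp add: g_def q0)
  \<comment> \<open>The Pascal rule contributes \<open>v\<close> to the power \<open>n - k\<close>
    and the triangular exponent contributes \<open>v ^ k\<close>; together they give the coefficient
    \<open>v ^ n\<close> of the new commutator.\<close>
  have gS: "g (Suc n) (Suc k) = g n (Suc k) - v ^ n * c * g n k" for n k
  proof -
    consider "k < n" | "k = n" | "k > n" by linarith
    then show ?thesis
    proof cases
      case 1
      then obtain b where n: "n = Suc (k + b)" using less_imp_Suc_add by blast
      have P: "qbinom v (Suc n) (Suc k) = qbinom v n (Suc k) + v ^ Suc b * qbinom v n k"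
        unfolding n by (rule qbinom_pascal[OF v])
      have V: "v ^ n = v ^ Suc b * v ^ k" by (simp add: n power_add)
      show ?thesis using 1 unfolding g_def e P by (simp add: V algebra_simps power_add)
    next
      case 2
      then show ?thesis unfolding g_def e by (simp add: q0 power_add algebra_simps)
    qed (simp add: g_def)
  qed
  have Lsum: "L (sum h S) = (\<Sum>k\<in>S. L (h k))" and Rsum: "R (sum h S) = (\<Sum>k\<in>S. R (h k))" if "finite S" for h and S :: "nat set"
    using that L(1)[of 0 0] R(1)[of 0 0] by (induction S) (simp_all add: L R)
  have ps: "pm_scale a (sum h S) = (\<Sum>k\<in>S. pm_scale a (h k))" for a h and S :: "nat set"
    by (rule poly_mapping_eqI) (simp add: lookup_sum sum_distrib_left)
  have pd: "pm_scale (a - b) t = pm_scale a t - pm_scale b t" for a b and t :: "'w \<Rightarrow>\<^sub>0 'k"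
    by (rule poly_mapping_eqI) (simp add: lookup_minus algebra_simps)
  have p0: "pm_scale 0 t = 0" for t :: "'w \<Rightarrow>\<^sub>0 'k" by (rule poly_mapping_eqI) simp
  have "foldr (\<lambda>c z. L z - pm_scale c (R z)) (ad_coeffs v c n) y = (\<Sum>k=0..n. pm_scale (g n k) (z (n - k) k))"
  proof (induction n)
    case 0
    then show ?case by (simp add: g0 z0 pm_scale_distribs)
  next
    case (Suc n)
    have "(\<Sum>k=0..Suc n. pm_scale (g (Suc n) k) (z (Suc n - k) k)) =
        pm_scale (g n 0) (z (Suc n) 0) + (\<Sum>k=0..n. pm_scale (g (Suc n) (Suc k)) (z (n - k) (Suc k)))"
      by (subst sum.atLeast0_atMost_Suc_shift) (simp add: g0)
    also have "\<dots> = pm_scale (g n 0) (z (Suc n) 0) + (\<Sum>k=0..n. pm_scale (g n (Suc k)) (z (n - k) (Suc k)))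
        - (\<Sum>k=0..n. pm_scale (v ^ n * c) (pm_scale (g n k) (z (n - k) (Suc k))))"
      by (simp add: gS pd sum_subtractf pm_scale_distribs(3))
    also have "pm_scale (g n 0) (z (Suc n) 0) + (\<Sum>k=0..n. pm_scale (g n (Suc k)) (z (n - k) (Suc k))) =
        (\<Sum>k=0..Suc n. pm_scale (g n k) (z (Suc n - k) k))"
      by (subst sum.atLeast0_atMost_Suc_shift) simp
    also have "\<dots> = (\<Sum>k=0..n. pm_scale (g n k) (z (Suc n - k) k))"
      by (simp add: g_def p0)
    also have "\<dots> = (\<Sum>k=0..n. pm_scale (g n k) (L (z (n - k) k)))"
      by (rule sum.cong) (simp_all add: zL Suc_diff_le)
    finally show ?case by (simp add: Suc.IH Lsum Rsum L R zR ps)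
  qed
  also have "\<dots> = (\<Sum>k=0..n. pm_scale ((- 1) ^ k * qbinom v n k * v ^ (k * (k - 1) div 2) * c ^ k) (z (n - k) k))"
    by (rule sum.cong) (simp_all add: g_def)
  finally show ?thesis .
qed

context kalg begin

lemma inverse_commute:
  assumes "w \<in> carrier M" "w' \<in> carrier M" "x \<in> carrier M" "w \<otimes> w' = \<one>" "w' \<otimes> w = \<one>" "w \<otimes> x = \<alpha> \<odot> (x \<otimes> w)"
  shows "x \<otimes> w' = \<alpha> \<odot> (w' \<otimes> x)"
proof -
  have "x \<otimes> w' = w' \<otimes> (w \<otimes> x) \<otimes> w'" using assms(1-5) by (simp flip: m_assoc)
  also have "\<dots> = \<alpha> \<odot> (w' \<otimes> (x \<otimes> (w \<otimes> w')))"
    unfolding assms(6) using assms(1-3) by (simp add: mult_smult_l mult_smult_r m_assoc)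
  finally show ?thesis using assms by simp
qed

lemma funpow_mult_closed: "w \<in> carrier M \<Longrightarrow> w' \<in> carrier M \<Longrightarrow> ((\<otimes>) w ^^ n) w' \<in> carrier M"
  by (induction n) auto

lemma funpow_mult_commute:
  assumes c: "w \<in> carrier M" "w' \<in> carrier M" "x \<in> carrier M"
    and wx: "w \<otimes> x = \<alpha> \<odot> (x \<otimes> w)" and w'x: "w' \<otimes> x = \<gamma> \<odot> (x \<otimes> w')"
  shows "((\<otimes>) w ^^ n) w' \<otimes> x = (\<alpha> ^ n * \<gamma>) \<odot> (x \<otimes> ((\<otimes>) w ^^ n) w')"
proof (induction n)
  case (Suc n)
  note W = funpow_mult_closed[OF c(1,2), of n]
  have "w \<otimes> ((\<otimes>) w ^^ n) w' \<otimes> x = (\<alpha> ^ n * \<gamma>) \<odot> (w \<otimes> x \<otimes> ((\<otimes>) w ^^ n) w')"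
    using c W by (simp add: m_assoc Suc mult_smult_r)
  then show ?case using c W by (simp add: wx mult_smult_l smult_smult m_assoc mult_ac)
qed (simp add: w'x)

lemma funpow_mult_self:
  assumes c: "w \<in> carrier M" "w' \<in> carrier M" and ww: "w \<otimes> w' = w' \<otimes> w"
  shows "((\<otimes>) w ^^ n) w' \<otimes> w = w \<otimes> ((\<otimes>) w ^^ n) w'"
  using c funpow_mult_closed[OF c] by (induction n) (simp_all add: ww m_assoc)

text \<open>At each step \<open>x\<close> carries \<open>P n\<close> to \<open>P (Suc n)\<close> and
  \<open>y\<close> drops out by \<open>qad_split\<close>. Thus a single chain remains of the
  exponentially many words in \<open>x\<close> and \<open>y\<close>.\<close>

lemma qad_chain:
  assumes "x \<in> carrier M" "y \<in> carrier M" "\<And>n. P n \<in> carrier M"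
    and "\<And>n. n < N \<Longrightarrow> x \<otimes> P n \<ominus> d n \<odot> (P n \<otimes> x) = P (Suc n)" "\<And>n. n < N \<Longrightarrow> y \<otimes> P n = d n \<odot> (P n \<otimes> y)"
    and "n \<le> N"
  shows "qad M (x \<oplus> y) (rev (map d [0..<n])) (P 0) = P n"
  using assms(6)
proof (induction n)
  case (Suc n)
  then show ?case using qad_split(1)[OF assms(1,2,3) assms(5)[of n]] assms(4)[of n] by (simp add: qad_Cons)
qed simp

end

locale kalg0 = kalg M for M :: "('k::field, 'a) module" (structure)
begin

sublocale opp: kalg "opposite M" by (rule kalg_opposite[OF kalg_axioms])

lemma opposite_minus: "x \<in> carrier M \<Longrightarrow> y \<in> carrier M \<Longrightarrow> x \<ominus>\<^bsub>opposite M\<^esub> y = x \<ominus> y"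
  using vs.minus_smult1[OF kalg.axioms(1)[OF kalg_opposite[OF kalg_axioms]], of x y] by (simp add: minus_smult1)

lemma qad_opposite_closed: "x \<in> carrier M \<Longrightarrow> z \<in> carrier M \<Longrightarrow> qad (opposite M) x cs z \<in> carrier M"
  using opp.qad_closed[of x z cs] by simp

lemma qad_opposite_weight:
  assumes c: "x \<in> carrier M" "y \<in> carrier M" "w \<in> carrier M"
    and wx: "w \<otimes> x = \<alpha> \<odot> (x \<otimes> w)" and wy: "w \<otimes> y = \<beta> \<odot> (y \<otimes> w)"
  shows "w \<otimes> qad (opposite M) x cs y = (\<alpha> ^ length cs * \<beta>) \<odot> (qad (opposite M) x cs y \<otimes> w)"
proof (induction cs)
  case (Cons b cs)
  let ?z = "qad (opposite M) x cs y"
  have z: "?z \<in> carrier M" using c by (intro qad_opposite_closed)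
  have 1: "w \<otimes> (x \<otimes> ?z) = (\<alpha> * (\<alpha> ^ length cs * \<beta>)) \<odot> (x \<otimes> ?z \<otimes> w)"
    using Cons z c wx by (simp add: mult_smult_l mult_smult_r smult_smult m_assoc flip: m_assoc[of w])
  have "w \<otimes> (?z \<otimes> x) = ((\<alpha> ^ length cs * \<beta>) \<odot> (?z \<otimes> w)) \<otimes> x"
    using Cons z c by (simp flip: m_assoc)
  also have "\<dots> = (\<alpha> ^ length cs * \<beta>) \<odot> (?z \<otimes> (w \<otimes> x))"
    using c z by (simp add: mult_smult_l m_assoc)
  finally have 2: "w \<otimes> (?z \<otimes> x) = (\<alpha> * (\<alpha> ^ length cs * \<beta>)) \<odot> (?z \<otimes> x \<otimes> w)"
    using c z wx by (simp add: mult_smult_l mult_smult_r smult_smult m_assoc mult_ac)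
  show ?case using c z
    by (simp add: qad_Cons opposite_minus minus_smult1 r_distr l_distr mult_smult_l mult_smult_r 1 2 smult_smult smult_add_r mult_ac)
qed (simp add: wy)

text \<open>The coefficients \<open>d\<close> and their reversal occur because moving the torus factors to the right
  replaces the commutator with coefficient \<open>d n\<close> by one with the reciprocal coefficient.\<close>

lemma qad_twist:
  assumes c: "x \<in> carrier M" "y \<in> carrier M" "w \<in> carrier M" "w' \<in> carrier M"
    and wx: "w \<otimes> x = \<alpha> \<odot> (x \<otimes> w)" and wy: "w \<otimes> y = \<beta> \<odot> (y \<otimes> w)" and w'x: "w' \<otimes> x = \<gamma> \<odot> (x \<otimes> w')"
    and ww: "w \<otimes> w' = w' \<otimes> w"
    and d: "\<And>n. n < N \<Longrightarrow> d n * \<alpha> ^ n * \<gamma> * d' n = \<alpha> ^ n * \<beta>"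
    and n: "n \<le> N"
  shows "\<exists>g. qad M (x \<otimes> w) (rev (map d [0..<n])) (y \<otimes> w') =
    g \<odot> (qad (opposite M) x (rev (map d' [0..<n])) y \<otimes> (((\<otimes>) w ^^ n) w'))"
  using n
proof (induction n)
  case 0
  then show ?case using c by (auto intro!: exI[of _ 1])
next
  case (Suc n)
  let ?V = "qad (opposite M) x (rev (map d' [0..<n])) y" and ?W = "((\<otimes>) w ^^ n) w'"
  have V: "?V \<in> carrier M" using c by (intro qad_opposite_closed)
  note W = funpow_mult_closed[OF c(3,4)] and Wx = funpow_mult_commute[OF c(3,4,1) wx w'x]
    and Ww = funpow_mult_self[OF c(3,4) ww]
  have wV: "w \<otimes> ?V = (\<alpha> ^ n * \<beta>) \<odot> (?V \<otimes> w)"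
    using qad_opposite_weight[OF c(1-3) wx wy, of "rev (map d' [0..<n])"] by simp
  obtain g where g: "qad M (x \<otimes> w) (rev (map d [0..<n])) (y \<otimes> w') = g \<odot> (?V \<otimes> ?W)"
    using Suc by auto
  have a1: "x \<otimes> w \<otimes> (?V \<otimes> ?W) = (\<alpha> ^ n * \<beta>) \<odot> (x \<otimes> ?V \<otimes> (w \<otimes> ?W))"
  proof -
    have "x \<otimes> w \<otimes> (?V \<otimes> ?W) = x \<otimes> (w \<otimes> ?V) \<otimes> ?W" using c V W[of n] by (simp add: m_assoc)
    then show ?thesis unfolding wV using c V W[of n] by (simp add: mult_smult_l mult_smult_r m_assoc)
  qed
  have a2: "?V \<otimes> ?W \<otimes> (x \<otimes> w) = (\<alpha> ^ n * \<gamma>) \<odot> (?V \<otimes> x \<otimes> (w \<otimes> ?W))"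
  proof -
    have "?V \<otimes> ?W \<otimes> (x \<otimes> w) = ?V \<otimes> (?W \<otimes> x) \<otimes> w" using c V W[of n] by (simp add: m_assoc)
    then show ?thesis unfolding Wx using c V W[of n] by (simp add: mult_smult_l mult_smult_r m_assoc Ww)
  qed
  have dn: "d n * \<alpha> ^ n * \<gamma> * d' n = \<alpha> ^ n * \<beta>" using d Suc by simp
  \<comment> \<open>By \<open>dn\<close> the factor \<open>\<alpha> ^ n * \<beta>\<close> from
    \<open>a1\<close> is \<open>d' n\<close> times the factor from \<open>a2\<close> multiplied by
    \<open>d n\<close>. Pulling out this common factor leaves the commutator with coefficient
    \<open>d' n\<close> in the opposite algebra; the sign comes from exchanging its two
    terms.\<close>
  let ?k = "- (d n * \<alpha> ^ n * \<gamma>)"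
  have "x \<otimes> w \<otimes> (?V \<otimes> ?W) \<ominus> d n \<odot> (?V \<otimes> ?W \<otimes> (x \<otimes> w)) =
      ?k \<odot> ((?V \<otimes> x \<ominus> d' n \<odot> (x \<otimes> ?V)) \<otimes> (w \<otimes> ?W))"
    unfolding a1 a2 dn[symmetric] using c V W[of n]
    by (simp add: minus_smult1 l_distr smult_smult smult_add_r mult_smult_l mult_ac a_comm)
  moreover have "qad M (x \<otimes> w) (rev (map d [0..<Suc n])) (y \<otimes> w') =
      g \<odot> (x \<otimes> w \<otimes> (?V \<otimes> ?W) \<ominus> d n \<odot> (?V \<otimes> ?W \<otimes> (x \<otimes> w)))"
    using c V W[of n] by (simp add: qad_Cons g minus_smult1 mult_smult_l mult_smult_r smult_smult smult_add_r mult_ac)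
  ultimately show ?case using c V W[of n]
    by (auto simp: qad_Cons opposite_minus smult_smult intro!: exI[of _ "g * ?k"])
qed

end

text \<open>Together with \<open>ad_coeffs_chain\<close> this describes the two orders in which the
  same coefficients are applied; \<open>qad_rev\<close> makes them equivalent.\<close>

lemma ad_coeffs_rev: "rev (map (\<lambda>l. v ^ (N - 1 - l) * c) [0..<N]) = rev (ad_coeffs v c N)"
  by (rule nth_equalityI) (auto simp: ad_coeffs_def rev_nth)

lemma ad_coeffs_chain: "ad_coeffs v c N = rev (map (\<lambda>l. v ^ l * c) [0..<N])"
  by (simp add: ad_coeffs_def rev_map)

subsection \<open>The defining relations\<close>

locale uq =
  fixes A :: "'i \<Rightarrow> 'i \<Rightarrow> int" and q :: "'i \<Rightarrow> 'i \<Rightarrow> 'k::field"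
  assumes A_off: "i \<noteq> j \<Longrightarrow> A i j \<le> 0" and q_nz: "q i j \<noteq> 0" and q_rel: "q i j * q j i = q i i powi A i j"
    and q_root: "m > 0 \<Longrightarrow> q i i ^ m \<noteq> 1"
begin

abbreviation "U \<equiv> Uq_algebra A q"
abbreviation "g \<equiv> Uq_gen A q"
abbreviation "torus \<equiv> range Om \<union> range OmInv \<union> range Om' \<union> range Om'Inv :: 'i gen set"
abbreviation "cs i j \<equiv> ad_coeffs (q i i) (q i j) (serre_exponent A i j)"

text \<open>The exponents of \<open>q i i\<close> add up to \<open>serre_exponent A i j - 1\<close>,
  which is \<open>-a_ij\<close>, and \<open>q_ij q_ji\<close> is the inverse of that power. This is
  the reason for the length \<open>1 - a_ij\<close> of the Serre relations.\<close>

lemma q_serre: "i \<noteq> j \<Longrightarrow> k < serre_exponent A i j \<Longrightarrow> q i i ^ (serre_exponent A i j - 1 - k) * q i j * (q i i ^ k * q j i) = 1"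
proof -
  assume ij: "i \<noteq> j" and k: "k < serre_exponent A i j"
  have "q i i ^ (serre_exponent A i j - 1 - k) * q i j * (q i i ^ k * q j i) =
      q i i ^ (serre_exponent A i j - 1 - k + k) * (q i j * q j i)" by (simp add: power_add)
  also have "serre_exponent A i j - 1 - k + k = nat (- A i j)" using A_off[OF ij] k by (auto simp: serre_exponent_def)
  also have "q i j * q j i = inverse (q i i ^ nat (- A i j))"
    using A_off[OF ij] q_rel[of i j] by (simp add: power_int_def power_inverse split: if_splits)
  finally show ?thesis using q_nz by simp
qed

sublocale P: presented "Uq_relations A q" .

lemma U_Q: "U = P.Q" and g_cls: "g x = P.cls (letter x)"
  by (simp_all add: Uq_algebra_def Uq_ideal_def Uq_gen_def)

lemma FA_minus: "x \<ominus>\<^bsub>P.FA\<^esub> y = x - y" for x y :: "'i gen word \<Rightarrow>\<^sub>0 'k"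
  by (subst vs.minus_smult1[OF P.FA_vs]) (simp_all add: poly_mapping_eq_iff fun_eq_iff lookup_add lookup_minus)

lemma serre_e_qad: "serre_e A q i j = qad P.FA (letter (E i)) (cs i j) (letter (E j))"
proof -
  have "qad P.FA (letter (E i)) (cs i j) (letter (E j)) =
    foldr (\<lambda>c z. letter (E i) * z - pm_scale c (z * letter (E i))) (cs i j) (letter (E j))"
    by (simp add: qad_def FA_minus)
  also have "\<dots> = serre_e A q i j"
    unfolding serre_e_def serre_coeff_def
    by (rule qad_expansion[where L = "\<lambda>z. letter (E i) * z" and R = "\<lambda>z. z * letter (E i)" and
          z = "\<lambda>m k. letter (E i) ^ m * letter (E j) * letter (E i) ^ k"])
      (simp_all add: q_root distrib_left distrib_right pm_scale_mult mult.assoc power_commutes)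
  finally show ?thesis by simp
qed

text \<open>Compared with \<open>serre_e\<close> the powers on the two sides of the middle letter
  are exchanged, so the commutators are taken in the opposite algebra.\<close>

lemma serre_f_qad: "serre_f A q i j = qad (opposite P.FA) (letter (F i)) (cs i j) (letter (F j))"
proof -
  interpret kalg0 P.FA unfolding kalg0_def by (rule kalg_free_algebra)
  have "qad (opposite P.FA) (letter (F i)) (cs i j) (letter (F j)) =
    foldr (\<lambda>c z. z * letter (F i) - pm_scale c (letter (F i) * z)) (cs i j) (letter (F j))"
    by (simp add: qad_def opposite_minus FA_minus)
  also have "\<dots> = serre_f A q i j"
    unfolding serre_f_def serre_coeff_def
    by (rule qad_expansion[where L = "\<lambda>z. z * letter (F i)" and R = "\<lambda>z. letter (F i) * z" and
          z = "\<lambda>m k. letter (F i) ^ k * letter (F j) * letter (F i) ^ m"])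
      (simp_all add: q_root distrib_left distrib_right pm_scale_mult mult.assoc power_commutes)
  finally show ?thesis by simp
qed

end

text \<open>Images of the generators satisfying all relations except the Serre relations, with
  conjugations rewritten as commutations up to a scalar. It is instantiated for \<open>U\<close>
  itself, its tensor square, the scalars, the opposite of \<open>U\<close> and the operators on the
  tensor product of the Borel subalgebras.\<close>

locale uq_rep = uq A q + kalg0 M for A :: "'i \<Rightarrow> 'i \<Rightarrow> int" and q :: "'i \<Rightarrow> 'i \<Rightarrow> 'k::field" and
  M :: "('k, 'a) module" (structure) +
  fixes v :: "'i gen \<Rightarrow> 'a"
  assumes v_closed [simp]: "v x \<in> carrier M"
    and torus: "s \<in> torus \<Longrightarrow> t \<in> torus \<Longrightarrow> v s \<otimes> v t = v t \<otimes> v s"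
    and Om_inv: "v (Om i) \<otimes> v (OmInv i) = \<one>" and Om'_inv: "v (Om' i) \<otimes> v (Om'Inv i) = \<one>"
    and Om_E: "v (Om i) \<otimes> v (E j) = q i j \<odot> (v (E j) \<otimes> v (Om i))"
    and Om'_E: "v (Om' i) \<otimes> v (E j) = inverse (q j i) \<odot> (v (E j) \<otimes> v (Om' i))"
    and Om_F: "v (Om i) \<otimes> v (F j) = inverse (q i j) \<odot> (v (F j) \<otimes> v (Om i))"
    and Om'_F: "v (Om' i) \<otimes> v (F j) = q j i \<odot> (v (F j) \<otimes> v (Om' i))"
    and E_F: "v (E i) \<otimes> v (F j) \<ominus> v (F j) \<otimes> v (E i) =
      (if i = j then (q i i / (q i i - 1)) \<odot> (v (Om i) \<ominus> v (Om' i)) else \<zero>)"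
begin

text \<open>The presentation contains one-sided inverses only; the other side follows because the
  torus generators commute.\<close>

lemma Om_inv': "v (OmInv i) \<otimes> v (Om i) = \<one>" and Om'_inv': "v (Om'Inv i) \<otimes> v (Om' i) = \<one>"
  using torus[of "Om i" "OmInv i"] torus[of "Om' i" "Om'Inv i"] Om_inv[of i] Om'_inv[of i] by auto

lemma E_OmInv: "v (E j) \<otimes> v (OmInv i) = q i j \<odot> (v (OmInv i) \<otimes> v (E j))"
  and E_Om'Inv: "v (E j) \<otimes> v (Om'Inv i) = inverse (q j i) \<odot> (v (Om'Inv i) \<otimes> v (E j))"
  and F_OmInv: "v (F j) \<otimes> v (OmInv i) = inverse (q i j) \<odot> (v (OmInv i) \<otimes> v (F j))"
  and F_Om'Inv: "v (F j) \<otimes> v (Om'Inv i) = q j i \<odot> (v (Om'Inv i) \<otimes> v (F j))"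
  by (rule inverse_commute[OF _ _ _ Om_inv Om_inv' Om_E] inverse_commute[OF _ _ _ Om'_inv Om'_inv' Om'_E]
      inverse_commute[OF _ _ _ Om_inv Om_inv' Om_F] inverse_commute[OF _ _ _ Om'_inv Om'_inv' Om'_F]; simp)+

lemma lift_hom: "free_lift M v \<in> algebra_homs P.FA M" by (rule free_lift_hom) simp

lemma lift_serre_e: "free_lift M v (serre_e A q i j) = qad M (v (E i)) (cs i j) (v (E j))"
  unfolding serre_e_qad
  by (subst qad_hom[OF lift_hom kalg_free_algebra kalg_axioms]) (simp_all add: free_lift_letter)

lemma lift_serre_f: "free_lift M v (serre_f A q i j) = qad (opposite M) (v (F i)) (cs i j) (v (F j))"
  unfolding serre_f_qad
  by (subst qad_hom[OF alg_hom_opposite[OF lift_hom] kalg_opposite[OF kalg_free_algebra] opp.kalg_axioms])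
    (simp_all add: free_lift_letter)

lemma lift_relations:
  assumes "\<And>i j. i \<noteq> j \<Longrightarrow> qad M (v (E i)) (cs i j) (v (E j)) = \<zero>"
    and "\<And>i j. i \<noteq> j \<Longrightarrow> qad (opposite M) (v (F i)) (cs i j) (v (F j)) = \<zero>"
    and "r \<in> Uq_relations A q"
  shows "free_lift M v r = \<zero>"
proof -
  note h = lift_hom
  have d: "free_lift M v (x - y) = free_lift M v x \<ominus> free_lift M v y" for x y
    using lin_diff[OF alg_lin[OF h] P.FA_vs vs_axioms, of x y] by (simp add: FA_minus)
  have m: "free_lift M v (x * y) = free_lift M v x \<otimes> free_lift M v y" for x y using alg_mult[OF h, of x y] by simp
  have s: "free_lift M v (pm_scale k x) = k \<odot> free_lift M v x" for k x using alg_smult[OF h, of x k] by simp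
  have o: "free_lift M v 1 = \<one>" using alg_one[OF h] by simp
  have z: "free_lift M v 0 = \<zero>" using lin_zero[OF alg_lin[OF h] P.FA_vs vs_axioms] by simp
  have inv: "w \<otimes> x \<otimes> w' = \<alpha> \<odot> x"
    if "w \<in> carrier M" "w' \<in> carrier M" "x \<in> carrier M" "w \<otimes> w' = \<one>" "w \<otimes> x = \<alpha> \<odot> (x \<otimes> w)" for w w' x \<alpha>
    using that by (simp add: mult_smult_l m_assoc)
  from assms(3) show ?thesis
  proof cases
    case (torus_comm s t)
    then show ?thesis using torus[of s t] by (simp add: d m free_lift_letter minus_self)
  next
    case (Om_inv i) then show ?thesis by (simp add: d m o free_lift_letter minus_self uq_rep.Om_inv[OF uq_rep_axioms])
  next
    case (Om'_inv i) then show ?thesis by (simp add: d m o free_lift_letter minus_self uq_rep.Om'_inv[OF uq_rep_axioms])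
  next
    case (Om_E i j) then show ?thesis
      by (simp add: d m s free_lift_letter inv[OF _ _ _ uq_rep.Om_inv[OF uq_rep_axioms] uq_rep.Om_E[OF uq_rep_axioms]] minus_self)
  next
    case (Om'_E i j) then show ?thesis
      by (simp add: d m s free_lift_letter inv[OF _ _ _ uq_rep.Om'_inv[OF uq_rep_axioms] uq_rep.Om'_E[OF uq_rep_axioms]] minus_self)
  next
    case (Om_F i j) then show ?thesis
      by (simp add: d m s free_lift_letter inv[OF _ _ _ uq_rep.Om_inv[OF uq_rep_axioms] uq_rep.Om_F[OF uq_rep_axioms]] minus_self)
  next
    case (Om'_F i j) then show ?thesis
      by (simp add: d m s free_lift_letter inv[OF _ _ _ uq_rep.Om'_inv[OF uq_rep_axioms] uq_rep.Om'_F[OF uq_rep_axioms]] minus_self)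
  next
    case (E_F i j)
    then show ?thesis
      using uq_rep.E_F[OF uq_rep_axioms, of i j] by (simp add: d m s z free_lift_letter minus_self)
  next
    case (serre_E i j) then show ?thesis using assms(1) by (simp add: lift_serre_e)
  next
    case (serre_F i j) then show ?thesis using assms(2) by (simp add: lift_serre_f)
  qed
qed

end

context uq begin

lemma kalg_U: "kalg U" unfolding U_Q by (rule P.kalg_Q)

sublocale U: kalg0 U unfolding kalg0_def by (rule kalg_U)

lemma g_closed [simp]: "g x \<in> carrier U" by (simp add: g_cls U_Q P.carrier_Q)

lemma cls_rel: "x - y \<in> Uq_relations A q \<Longrightarrow> P.cls x = P.cls y" by (rule P.cls_eqI)

lemma uq_rep_U: "uq_rep A q U g"
proof (intro uq_rep.intro uq_rep_axioms.intro uq_axioms U.kalg0_axioms)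
  note cm = P.cls_mult[folded U_Q] and co = P.cls_one[folded U_Q] and cl = P.cls_simps[folded U_Q]
  have cd: "P.cls x \<ominus>\<^bsub>U\<^esub> P.cls y = P.cls (x - y)" for x y
    using lin_diff[OF P.cls_linear P.FA_vs P.vs_Q, of x y] by (simp add: FA_minus U_Q)
  have cz: "\<zero>\<^bsub>U\<^esub> = P.cls 0"
    using lin_zero[OF P.cls_linear P.FA_vs P.vs_Q] by (simp add: U_Q)
  show "g x \<in> carrier U" for x by simp
  show comm: "g s \<otimes>\<^bsub>U\<^esub> g t = g t \<otimes>\<^bsub>U\<^esub> g s" if "s \<in> torus" "t \<in> torus" for s t
    unfolding g_cls cm by (rule cls_rel) (rule Uq_relations.torus_comm[OF that])
  show O: "g (Om i) \<otimes>\<^bsub>U\<^esub> g (OmInv i) = \<one>\<^bsub>U\<^esub>" for i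
    unfolding g_cls cm co by (rule cls_rel) (rule Uq_relations.Om_inv)
  show O': "g (Om' i) \<otimes>\<^bsub>U\<^esub> g (Om'Inv i) = \<one>\<^bsub>U\<^esub>" for i
    unfolding g_cls cm co by (rule cls_rel) (rule Uq_relations.Om'_inv)
  have I: "g (OmInv i) \<otimes>\<^bsub>U\<^esub> g (Om i) = \<one>\<^bsub>U\<^esub>" for i using comm[of "OmInv i" "Om i"] O by simp
  have I': "g (Om'Inv i) \<otimes>\<^bsub>U\<^esub> g (Om' i) = \<one>\<^bsub>U\<^esub>" for i using comm[of "Om'Inv i" "Om' i"] O' by simp
  \<comment> \<open>The defining conjugation relation is multiplied by \<open>w\<close> from the
    right.\<close>
  have move: "w \<otimes>\<^bsub>U\<^esub> x = \<alpha> \<odot>\<^bsub>U\<^esub> (x \<otimes>\<^bsub>U\<^esub> w)"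
    if "w \<in> carrier U" "w' \<in> carrier U" "x \<in> carrier U" "w' \<otimes>\<^bsub>U\<^esub> w = \<one>\<^bsub>U\<^esub>" "w \<otimes>\<^bsub>U\<^esub> x \<otimes>\<^bsub>U\<^esub> w' = \<alpha> \<odot>\<^bsub>U\<^esub> x" for w w' x \<alpha>
  proof -
    have "w \<otimes>\<^bsub>U\<^esub> x = w \<otimes>\<^bsub>U\<^esub> x \<otimes>\<^bsub>U\<^esub> w' \<otimes>\<^bsub>U\<^esub> w" using that(1-4) by (simp add: U.m_assoc)
    then show ?thesis unfolding that(5) using that(1-3) by (simp add: U.mult_smult_l)
  qed
  show "g (Om i) \<otimes>\<^bsub>U\<^esub> g (E j) = q i j \<odot>\<^bsub>U\<^esub> (g (E j) \<otimes>\<^bsub>U\<^esub> g (Om i))" for i j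
    by (rule move[OF _ _ _ I]) (simp_all, unfold g_cls cm cl, rule cls_rel, rule Uq_relations.Om_E)
  show "g (Om' i) \<otimes>\<^bsub>U\<^esub> g (E j) = inverse (q j i) \<odot>\<^bsub>U\<^esub> (g (E j) \<otimes>\<^bsub>U\<^esub> g (Om' i))" for i j
    by (rule move[OF _ _ _ I']) (simp_all, unfold g_cls cm cl, rule cls_rel, rule Uq_relations.Om'_E)
  show "g (Om i) \<otimes>\<^bsub>U\<^esub> g (F j) = inverse (q i j) \<odot>\<^bsub>U\<^esub> (g (F j) \<otimes>\<^bsub>U\<^esub> g (Om i))" for i j
    by (rule move[OF _ _ _ I]) (simp_all, unfold g_cls cm cl, rule cls_rel, rule Uq_relations.Om_F)
  show "g (Om' i) \<otimes>\<^bsub>U\<^esub> g (F j) = q j i \<odot>\<^bsub>U\<^esub> (g (F j) \<otimes>\<^bsub>U\<^esub> g (Om' i))" for i j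
    by (rule move[OF _ _ _ I']) (simp_all, unfold g_cls cm cl, rule cls_rel, rule Uq_relations.Om'_F)
  have "g (E i) \<otimes>\<^bsub>U\<^esub> g (F j) \<ominus>\<^bsub>U\<^esub> g (F j) \<otimes>\<^bsub>U\<^esub> g (E i) =
      P.cls (if i = j then pm_scale (q i i / (q i i - 1)) (letter (Om i) - letter (Om' i)) else 0)" for i j
    unfolding g_cls cm cd by (rule cls_rel) (rule Uq_relations.E_F)
  then show "g (E i) \<otimes>\<^bsub>U\<^esub> g (F j) \<ominus>\<^bsub>U\<^esub> g (F j) \<otimes>\<^bsub>U\<^esub> g (E i) =
      (if i = j then (q i i / (q i i - 1)) \<odot>\<^bsub>U\<^esub> (g (Om i) \<ominus>\<^bsub>U\<^esub> g (Om' i)) else \<zero>\<^bsub>U\<^esub>)" for i j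
    unfolding g_cls cd by (simp add: cl cz)
qed

sublocale U: uq_rep A q U g by (rule uq_rep_U)

lemma free_lift_g: "free_lift U g x = P.cls x"
proof (induction x rule: free_algebra_induct)
  case one show ?case using alg_one[OF U.lift_hom] P.cls_one by (simp add: U_Q)
next
  case (letter x) show ?case unfolding g_cls[symmetric] by (rule U.free_lift_letter) simp
next
  case (add x y) then show ?case using alg_add[OF U.lift_hom, of x y] P.cls_simps(1)[of x y] by (simp add: U_Q)
next
  case (mult x y) then show ?case using alg_mult[OF U.lift_hom, of x y] P.cls_mult[of x y] by (simp add: U_Q)
next
  case (scale k x) then show ?case using alg_smult[OF U.lift_hom, of x k] P.cls_simps(2)[of k x] by (simp add: U_Q)
qed

lemma serre_E_U: "i \<noteq> j \<Longrightarrow> qad U (g (E i)) (cs i j) (g (E j)) = \<zero>\<^bsub>U\<^esub>"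
  using P.cls_eq_zero[OF P.Rel_I[OF Uq_relations.serre_E]]
  by (simp add: U.lift_serre_e[symmetric] free_lift_g U_Q[symmetric])

lemma serre_F_U: "i \<noteq> j \<Longrightarrow> qad (opposite U) (g (F i)) (cs i j) (g (F j)) = \<zero>\<^bsub>U\<^esub>"
  using P.cls_eq_zero[OF P.Rel_I[OF Uq_relations.serre_F]]
  by (simp add: U.lift_serre_f[symmetric] free_lift_g U_Q[symmetric])

end

text \<open>The universal property of \<open>U\<close>. It yields coproduct, counit, antipode and
  finally the action on the tensor product.\<close>

lemma (in uq_rep)
  assumes "\<And>i j. i \<noteq> j \<Longrightarrow> qad M (v (E i)) (cs i j) (v (E j)) = \<zero>"
    and "\<And>i j. i \<noteq> j \<Longrightarrow> qad (opposite M) (v (F i)) (cs i j) (v (F j)) = \<zero>"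
  shows Uq_lift_hom: "quot_free_lift M v \<in> algebra_homs U M" and Uq_lift_gen: "quot_free_lift M v (g x) = v x"
  unfolding U_Q g_cls
  by (rule P.quot_free_lift_hom[OF kalg_axioms] P.quot_free_lift_gen[OF kalg_axioms];
      simp add: lift_relations[OF assms])+

context vs begin

lemma diff_add_add: "a \<in> carrier M \<Longrightarrow> b \<in> carrier M \<Longrightarrow> c \<in> carrier M \<Longrightarrow> d \<in> carrier M \<Longrightarrow>
    (a \<oplus> b) \<ominus> (c \<oplus> d) = (a \<ominus> c) \<oplus> (b \<ominus> d)"
  by (simp add: M.minus_eq M.minus_add M.a_ac)

end

lemma (in tensor) pure_diff_l: "a \<in> carrier A \<Longrightarrow> a' \<in> carrier A \<Longrightarrow> b \<in> carrier B \<Longrightarrow>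
    pure_tensor A B (a \<ominus>\<^bsub>A\<^esub> a') b = pure_tensor A B a b \<ominus>\<^bsub>tensor_module A B\<^esub> pure_tensor A B a' b"
  by (rule lin_diff[OF bilin_1[OF bilin_pure] A.vs_axioms vs_tensor])

lemma (in tensor) pure_diff_r: "a \<in> carrier A \<Longrightarrow> b' \<in> carrier B \<Longrightarrow> b \<in> carrier B \<Longrightarrow>
    pure_tensor A B a (b \<ominus>\<^bsub>B\<^esub> b') = pure_tensor A B a b \<ominus>\<^bsub>tensor_module A B\<^esub> pure_tensor A B a b'"
  by (rule lin_diff[OF bilin_2[OF bilin_pure] B.vs_axioms vs_tensor])

lemma (in tensor_alg) TA_minus: "x \<in> carrier (tensor_module A B) \<Longrightarrow> y \<in> carrier (tensor_module A B) \<Longrightarrow>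
    x \<ominus>\<^bsub>TA\<^esub> y = x \<ominus>\<^bsub>tensor_module A B\<^esub> y"
  using TA.minus_smult1[of x y] by (simp add: vs.minus_smult1[OF vs_tensor])

context uq begin

subsection \<open>The coproduct\<close>

sublocale UU: tensor_alg U U ..

abbreviation "TM \<equiv> tensor_module U U"
abbreviation "pure \<equiv> pure_tensor U U"
abbreviation "D \<equiv> Uq_comult_gen A q"

lemma D_simps:
  "D (E i) = pure (g (E i)) \<one>\<^bsub>U\<^esub> \<oplus>\<^bsub>TM\<^esub> pure (g (Om i)) (g (E i))"
  "D (F i) = pure \<one>\<^bsub>U\<^esub> (g (F i)) \<oplus>\<^bsub>TM\<^esub> pure (g (F i)) (g (Om' i))"
  "s \<in> torus \<Longrightarrow> D s = pure (g s) (g s)"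
  by (auto simp: Let_def)

declare Uq_comult_gen.simps [simp del]

interpretation TM: vs TM by simp

lemma D_closed: "D x \<in> carrier TM"
  by (cases x) (simp_all add: D_simps TM.M.a_closed)

lemmas TM_add_closed = TM.M.a_closed

lemma D_torus_E:
  assumes "s \<in> torus" "g s \<otimes>\<^bsub>U\<^esub> g (E j) = \<alpha> \<odot>\<^bsub>U\<^esub> (g (E j) \<otimes>\<^bsub>U\<^esub> g s)"
  shows "D s \<otimes>\<^bsub>UU.TA\<^esub> D (E j) = \<alpha> \<odot>\<^bsub>TM\<^esub> (D (E j) \<otimes>\<^bsub>UU.TA\<^esub> D s)"
  using U.torus[OF assms(1), of "Om j"]
  by (simp add: D_simps(1,2) D_simps(3)[OF assms(1)] assms(2) UU.tm_simps UU.pure_smult_l UU.pure_smult_r TM.smult_add_r)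

lemma D_torus_F:
  assumes "s \<in> torus" "g s \<otimes>\<^bsub>U\<^esub> g (F j) = \<alpha> \<odot>\<^bsub>U\<^esub> (g (F j) \<otimes>\<^bsub>U\<^esub> g s)"
  shows "D s \<otimes>\<^bsub>UU.TA\<^esub> D (F j) = \<alpha> \<odot>\<^bsub>TM\<^esub> (D (F j) \<otimes>\<^bsub>UU.TA\<^esub> D s)"
  using U.torus[OF assms(1), of "Om' j"]
  by (simp add: D_simps(1,2) D_simps(3)[OF assms(1)] assms(2) UU.tm_simps UU.pure_smult_l UU.pure_smult_r TM.smult_add_r)

text \<open>Of the four terms in each product, \<open>e_i \<otimes> f_j\<close> and the term with
  two torus factors cancel. What is left is \<open>[e_i, f_j] \<otimes> \<omega>'_j + \<omega>_i
  \<otimes> [e_i, f_j]\<close>.\<close>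

lemma D_E_F: "D (E i) \<otimes>\<^bsub>UU.TA\<^esub> D (F j) \<ominus>\<^bsub>UU.TA\<^esub> D (F j) \<otimes>\<^bsub>UU.TA\<^esub> D (E i) =
    (if i = j then (q i i / (q i i - 1)) \<odot>\<^bsub>UU.TA\<^esub> (D (Om i) \<ominus>\<^bsub>UU.TA\<^esub> D (Om' i)) else \<zero>\<^bsub>UU.TA\<^esub>)"
proof -
  let ?e = "g (E i)" and ?f = "g (F j)" and ?w = "g (Om i)" and ?w' = "g (Om' j)"
  let ?c = "?e \<otimes>\<^bsub>U\<^esub> ?f \<ominus>\<^bsub>U\<^esub> ?f \<otimes>\<^bsub>U\<^esub> ?e"
  have 1: "D (E i) \<otimes>\<^bsub>UU.TA\<^esub> D (F j) = (pure ?e ?f \<oplus>\<^bsub>TM\<^esub> pure (?w \<otimes>\<^bsub>U\<^esub> ?f) (?e \<otimes>\<^bsub>U\<^esub> ?w')) \<oplus>\<^bsub>TM\<^esub>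
      (pure (?e \<otimes>\<^bsub>U\<^esub> ?f) ?w' \<oplus>\<^bsub>TM\<^esub> pure ?w (?e \<otimes>\<^bsub>U\<^esub> ?f))"
    by (simp add: D_simps UU.tm_simps TM.M.a_ac)
  have 2: "D (F j) \<otimes>\<^bsub>UU.TA\<^esub> D (E i) = (pure ?e ?f \<oplus>\<^bsub>TM\<^esub> pure (?f \<otimes>\<^bsub>U\<^esub> ?w) (?w' \<otimes>\<^bsub>U\<^esub> ?e)) \<oplus>\<^bsub>TM\<^esub>
      (pure (?f \<otimes>\<^bsub>U\<^esub> ?e) ?w' \<oplus>\<^bsub>TM\<^esub> pure ?w (?f \<otimes>\<^bsub>U\<^esub> ?e))"
    by (simp add: D_simps UU.tm_simps TM.M.a_ac)
  \<comment> \<open>Both sides equal \<open>f_j \<omega>_i \<otimes> e_i \<omega>'_j\<close>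
    multiplied by the inverse of \<open>q i j\<close>.\<close>
  have 3: "pure (?f \<otimes>\<^bsub>U\<^esub> ?w) (?w' \<otimes>\<^bsub>U\<^esub> ?e) = pure (?w \<otimes>\<^bsub>U\<^esub> ?f) (?e \<otimes>\<^bsub>U\<^esub> ?w')"
    by (simp add: U.Om'_E U.Om_F UU.pure_smult_l UU.pure_smult_r)
  have "D (E i) \<otimes>\<^bsub>UU.TA\<^esub> D (F j) \<ominus>\<^bsub>UU.TA\<^esub> D (F j) \<otimes>\<^bsub>UU.TA\<^esub> D (E i) = pure ?c ?w' \<oplus>\<^bsub>TM\<^esub> pure ?w ?c"
    unfolding 1 2 3
    by (simp add: UU.TA_minus TM.diff_add_add TM.minus_self UU.pure_diff_l UU.pure_diff_r TM_add_closed)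
  also have "\<dots> = (if i = j then (q i i / (q i i - 1)) \<odot>\<^bsub>UU.TA\<^esub> (D (Om i) \<ominus>\<^bsub>UU.TA\<^esub> D (Om' i)) else \<zero>\<^bsub>UU.TA\<^esub>)"
  proof (cases "i = j")
    case True
    let ?v = "g (Om i)" and ?v' = "g (Om' i)"
    \<comment> \<open>A telescoping sum: \<open>(\<omega> - \<omega>') \<otimes> \<omega>' +
      \<omega> \<otimes> (\<omega> - \<omega>')\<close> is
      \<open>\<omega> \<otimes> \<omega> - \<omega>' \<otimes> \<omega>'\<close>.\<close>
    have "(pure ?v ?v' \<ominus>\<^bsub>TM\<^esub> pure ?v' ?v') \<oplus>\<^bsub>TM\<^esub> (pure ?v ?v \<ominus>\<^bsub>TM\<^esub> pure ?v ?v') =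
        (pure ?v ?v' \<oplus>\<^bsub>TM\<^esub> pure ?v ?v) \<ominus>\<^bsub>TM\<^esub> (pure ?v' ?v' \<oplus>\<^bsub>TM\<^esub> pure ?v ?v')"
      by (simp add: TM.diff_add_add)
    also have "\<dots> = (pure ?v ?v' \<oplus>\<^bsub>TM\<^esub> pure ?v ?v) \<ominus>\<^bsub>TM\<^esub> (pure ?v ?v' \<oplus>\<^bsub>TM\<^esub> pure ?v' ?v')"
      by (simp add: TM.M.a_comm)
    also have "\<dots> = pure ?v ?v \<ominus>\<^bsub>TM\<^esub> pure ?v' ?v'" by (simp add: TM.diff_add_add TM.minus_self)
    finally show ?thesis using True
      by (simp add: U.E_F UU.pure_smult_l UU.pure_smult_r UU.pure_diff_l UU.pure_diff_r D_simps UU.TA_minus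
          flip: TM.smult_add_r)
  next
    case False
    have z: "pure \<zero>\<^bsub>U\<^esub> x = \<zero>\<^bsub>TM\<^esub>" "pure x \<zero>\<^bsub>U\<^esub> = \<zero>\<^bsub>TM\<^esub>" if "x \<in> carrier U" for x
      using UU.pure_smult_l[of "\<zero>\<^bsub>U\<^esub>" x 0] UU.pure_smult_r[of x "\<zero>\<^bsub>U\<^esub>" 0] that by simp_all
    then show ?thesis using False by (simp add: U.E_F)
  qed
  finally show ?thesis .
qed

lemma uq_rep_D: "uq_rep A q UU.TA D"
proof (intro uq_rep.intro uq_rep_axioms.intro uq_axioms)
  show "kalg0 UU.TA" by (simp add: kalg0_def UU.kalg_tensor)
  show "D x \<in> carrier UU.TA" for x using D_closed by simp
  show "D s \<otimes>\<^bsub>UU.TA\<^esub> D t = D t \<otimes>\<^bsub>UU.TA\<^esub> D s" if "s \<in> torus" "t \<in> torus" for s t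
    using U.torus[OF that] that by (simp add: D_simps)
  show "D (Om i) \<otimes>\<^bsub>UU.TA\<^esub> D (OmInv i) = \<one>\<^bsub>UU.TA\<^esub>" "D (Om' i) \<otimes>\<^bsub>UU.TA\<^esub> D (Om'Inv i) = \<one>\<^bsub>UU.TA\<^esub>" for i
    by (simp_all add: D_simps(3) U.Om_inv U.Om'_inv)
qed (simp_all add: D_E_F D_torus_E D_torus_F U.Om_E U.Om'_E U.Om_F U.Om'_F)

sublocale DD: uq_rep A q UU.TA D by (rule uq_rep_D)

text \<open>Expanding the iterated q-commutator from the inside with increasing exponents keeps the summand
  starting with \<open>e\<^sub>j \<otimes> 1\<close> a pure tensor; with decreasing exponents the same happens for
  \<open>\<omega>\<^sub>j \<otimes> e\<^sub>j\<close>. Both orders give the same operator.\<close>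

lemma D_serre_E:
  assumes ij: "i \<noteq> j"
  shows "qad UU.TA (D (E i)) (cs i j) (D (E j)) = \<zero>\<^bsub>UU.TA\<^esub>"
proof -
  let ?N = "serre_exponent A i j"
  let ?e = "g (E i)" and ?w = "g (Om i)"
  let ?x = "pure ?e \<one>\<^bsub>U\<^esub>" and ?y = "pure ?w ?e"
  let ?d = "\<lambda>n. q i i ^ n * q i j" and ?d' = "\<lambda>n. q i i ^ (?N - 1 - n) * q i j"
  let ?V = "\<lambda>d n. qad U ?e (rev (map d [0..<n])) (g (E j))"
  let ?W = "\<lambda>n. ((\<otimes>\<^bsub>U\<^esub>) ?w ^^ n) (g (Om j))"
  have Vc: "?V d n \<in> carrier U" and Wc: "?W n \<in> carrier U" for d n by (simp_all add: U.funpow_mult_closed)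
  have D: "D (E i) = ?x \<oplus>\<^bsub>UU.TA\<^esub> ?y" "D (E i) = ?y \<oplus>\<^bsub>UU.TA\<^esub> ?x" by (simp_all add: D_simps TM.M.a_comm)
  have Vw: "?w \<otimes>\<^bsub>U\<^esub> ?V d n = (q i i ^ n * q i j) \<odot>\<^bsub>U\<^esub> (?V d n \<otimes>\<^bsub>U\<^esub> ?w)" for d n
    using U.qad_weight[of ?e "g (E j)" ?w "q i i" "q i j" "rev (map d [0..<n])"] by (simp add: U.Om_E)
  have We: "?W n \<otimes>\<^bsub>U\<^esub> ?e = (q i i ^ n * q j i) \<odot>\<^bsub>U\<^esub> (?e \<otimes>\<^bsub>U\<^esub> ?W n)" for n
    by (rule U.funpow_mult_commute) (simp_all add: U.Om_E)
  have Ww: "?W n \<otimes>\<^bsub>U\<^esub> ?w = ?w \<otimes>\<^bsub>U\<^esub> ?W n" for n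
    by (rule U.funpow_mult_self) (simp_all add: U.torus)
  have "qad UU.TA (D (E i)) (rev (map ?d [0..<?N])) (pure (g (E j)) \<one>\<^bsub>U\<^esub>) = pure (?V ?d ?N) \<one>\<^bsub>U\<^esub>"
    unfolding D(1)
    by (rule UU.TA.qad_chain[where P = "\<lambda>n. pure (?V ?d n) \<one>\<^bsub>U\<^esub>" and d = ?d and N = ?N, simplified upt_0 list.map rev.simps qad_Nil])
      (simp_all add: Vc qad_Cons UU.TA_minus UU.pure_diff_l UU.pure_smult_l Vw)
  moreover have "qad UU.TA (D (E i)) (rev (map ?d' [0..<?N])) (pure (g (Om j)) (g (E j))) = pure (?W ?N) (?V ?d' ?N)"
    unfolding D(2)
  proof (rule UU.TA.qad_chain[where P = "\<lambda>n. pure (?W n) (?V ?d' n)" and d = ?d' and N = ?N, simplified upt_0 list.map rev.simps qad_Nil funpow_0])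
    fix n assume n: "n < ?N"
    \<comment> \<open>Passing \<open>e_i\<close> through the torus factor \<open>?W n\<close> costs
      \<open>q_ii ^ n * q_ji\<close>, whose inverse is \<open>?d' n\<close> by
      \<open>q_serre\<close>; hence \<open>?x\<close> drops out.\<close>
    show "?x \<otimes>\<^bsub>UU.TA\<^esub> pure (?W n) (?V ?d' n) = ?d' n \<odot>\<^bsub>UU.TA\<^esub> (pure (?W n) (?V ?d' n) \<otimes>\<^bsub>UU.TA\<^esub> ?x)"
      using q_serre[OF ij n] by (simp add: Vc Wc We UU.pure_smult_l TM.smult_smult mult_ac)
    show "?y \<otimes>\<^bsub>UU.TA\<^esub> pure (?W n) (?V ?d' n) \<ominus>\<^bsub>UU.TA\<^esub> ?d' n \<odot>\<^bsub>UU.TA\<^esub> (pure (?W n) (?V ?d' n) \<otimes>\<^bsub>UU.TA\<^esub> ?y) =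
        pure (?W (Suc n)) (?V ?d' (Suc n))"
      by (simp add: Vc Wc Ww qad_Cons UU.TA_minus UU.pure_diff_r UU.pure_smult_r)
  qed (simp_all add: Vc Wc)
  moreover have "?V ?d ?N = \<zero>\<^bsub>U\<^esub>" using serre_E_U[OF ij] by (simp add: ad_coeffs_chain)
  moreover have "?V ?d' ?N = \<zero>\<^bsub>U\<^esub>" using serre_E_U[OF ij] by (simp only: ad_coeffs_rev U.qad_rev g_closed)
  moreover have "qad UU.TA (D (E i)) (cs i j) (D (E j)) = qad UU.TA (D (E i)) (rev (map ?d [0..<?N])) (pure (g (E j)) \<one>\<^bsub>U\<^esub>) \<oplus>\<^bsub>TM\<^esub>
      qad UU.TA (D (E i)) (rev (map ?d' [0..<?N])) (pure (g (Om j)) (g (E j)))"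
    unfolding ad_coeffs_rev ad_coeffs_chain[symmetric]
    using UU.TA.qad_add[of "D (E i)" "pure (g (E j)) \<one>\<^bsub>U\<^esub>" "pure (g (Om j)) (g (E j))" "cs i j"]
      UU.TA.qad_rev[of "D (E i)" "pure (g (Om j)) (g (E j))" "cs i j"] D_closed[of "E i"]
    by (simp add: D_simps TM.M.a_comm)
  ultimately show ?thesis
    using lin_zero[OF bilin_1[OF UU.bilin_pure] U.vs_axioms UU.vs_tensor, of "\<one>\<^bsub>U\<^esub>"]
      lin_zero[OF bilin_2[OF UU.bilin_pure] U.vs_axioms UU.vs_tensor, of "?W ?N"] Wc[of ?N] by simp
qed

text \<open>The same collapse in the opposite tensor square. The weights of
  \<open>\<omega>'_i\<close> on \<open>f_j\<close> involve \<open>q_ji\<close> in place of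
  \<open>q_ij\<close>, and accordingly increasing exponents now belong to
  \<open>f_j \<otimes> \<omega>'_j\<close>, which carries the torus factors, and decreasing ones to
  \<open>1 \<otimes> f_j\<close>.\<close>

lemma D_serre_F:
  assumes ij: "i \<noteq> j"
  shows "qad (opposite UU.TA) (D (F i)) (cs i j) (D (F j)) = \<zero>\<^bsub>UU.TA\<^esub>"
proof -
  let ?O = "opposite UU.TA"
  let ?N = "serre_exponent A i j"
  let ?f = "g (F i)" and ?w = "g (Om' i)"
  let ?x = "pure ?f ?w" and ?y = "pure \<one>\<^bsub>U\<^esub> ?f"
  let ?d = "\<lambda>n. q i i ^ n * q i j" and ?d' = "\<lambda>n. q i i ^ (?N - 1 - n) * q i j"
  let ?V = "\<lambda>d n. qad (opposite U) ?f (rev (map d [0..<n])) (g (F j))"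
  let ?W = "\<lambda>n. ((\<otimes>\<^bsub>U\<^esub>) ?w ^^ n) (g (Om' j))"
  have Vc: "?V d n \<in> carrier U" and Wc: "?W n \<in> carrier U" for d n
    by (simp_all add: U.funpow_mult_closed U.qad_opposite_closed)
  have D: "D (F i) = ?x \<oplus>\<^bsub>?O\<^esub> ?y" "D (F i) = ?y \<oplus>\<^bsub>?O\<^esub> ?x" by (simp_all add: D_simps TM.M.a_comm)
  have Vw: "?w \<otimes>\<^bsub>U\<^esub> ?V d n = (q i i ^ n * q j i) \<odot>\<^bsub>U\<^esub> (?V d n \<otimes>\<^bsub>U\<^esub> ?w)" for d n
    using U.qad_opposite_weight[of ?f "g (F j)" ?w "q i i" "q j i" "rev (map d [0..<n])"] by (simp add: U.Om'_F)
  have Wf: "?W n \<otimes>\<^bsub>U\<^esub> ?f = (q i i ^ n * q i j) \<odot>\<^bsub>U\<^esub> (?f \<otimes>\<^bsub>U\<^esub> ?W n)" for n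
    by (rule U.funpow_mult_commute) (simp_all add: U.Om'_F)
  have Ww: "?W n \<otimes>\<^bsub>U\<^esub> ?w = ?w \<otimes>\<^bsub>U\<^esub> ?W n" for n
    by (rule U.funpow_mult_self) (simp_all add: U.torus)
  have "qad ?O (D (F i)) (rev (map ?d [0..<?N])) (pure (g (F j)) (g (Om' j))) = pure (?V ?d ?N) (?W ?N)"
    unfolding D(1)
    by (rule DD.opp.qad_chain[where P = "\<lambda>n. pure (?V ?d n) (?W n)" and d = ?d and N = ?N, simplified upt_0 list.map rev.simps qad_Nil funpow_0])
      (simp_all add: Vc Wc Ww Wf qad_Cons UU.TA_minus UU.pure_diff_l UU.pure_smult_l UU.pure_smult_r
        DD.opposite_minus U.opposite_minus)
  moreover have "qad ?O (D (F i)) (rev (map ?d' [0..<?N])) (pure \<one>\<^bsub>U\<^esub> (g (F j))) = pure \<one>\<^bsub>U\<^esub> (?V ?d' ?N)"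
    unfolding D(2)
  proof (rule DD.opp.qad_chain[where P = "\<lambda>n. pure \<one>\<^bsub>U\<^esub> (?V ?d' n)" and d = ?d' and N = ?N, simplified upt_0 list.map rev.simps qad_Nil])
    fix n assume n: "n < ?N"
    show "?x \<otimes>\<^bsub>?O\<^esub> pure \<one>\<^bsub>U\<^esub> (?V ?d' n) = ?d' n \<odot>\<^bsub>?O\<^esub> (pure \<one>\<^bsub>U\<^esub> (?V ?d' n) \<otimes>\<^bsub>?O\<^esub> ?x)"
      using q_serre[OF ij n] by (simp add: Vc Vw UU.pure_smult_r TM.smult_smult mult_ac)
    show "?y \<otimes>\<^bsub>?O\<^esub> pure \<one>\<^bsub>U\<^esub> (?V ?d' n) \<ominus>\<^bsub>?O\<^esub> ?d' n \<odot>\<^bsub>?O\<^esub> (pure \<one>\<^bsub>U\<^esub> (?V ?d' n) \<otimes>\<^bsub>?O\<^esub> ?y) =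
        pure \<one>\<^bsub>U\<^esub> (?V ?d' (Suc n))"
      by (simp add: Vc qad_Cons UU.TA_minus UU.pure_diff_r UU.pure_smult_r DD.opposite_minus U.opposite_minus)
  qed (simp_all add: Vc)
  moreover have "?V ?d ?N = \<zero>\<^bsub>U\<^esub>" using serre_F_U[OF ij] by (simp add: ad_coeffs_chain)
  moreover have "?V ?d' ?N = \<zero>\<^bsub>U\<^esub>"
    unfolding ad_coeffs_rev using serre_F_U[OF ij] U.opp.qad_rev[of "g (F i)" "g (F j)" "cs i j"] by simp
  moreover have "qad ?O (D (F i)) (cs i j) (D (F j)) = qad ?O (D (F i)) (rev (map ?d' [0..<?N])) (pure \<one>\<^bsub>U\<^esub> (g (F j))) \<oplus>\<^bsub>TM\<^esub>
      qad ?O (D (F i)) (rev (map ?d [0..<?N])) (pure (g (F j)) (g (Om' j)))"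
    unfolding ad_coeffs_rev ad_coeffs_chain[symmetric]
    using DD.opp.qad_add[of "D (F i)" "pure \<one>\<^bsub>U\<^esub> (g (F j))" "pure (g (F j)) (g (Om' j))" "cs i j"]
      DD.opp.qad_rev[of "D (F i)" "pure \<one>\<^bsub>U\<^esub> (g (F j))" "cs i j"] D_closed[of "F i"]
    by (simp add: D_simps)
  ultimately show ?thesis
    using lin_zero[OF bilin_2[OF UU.bilin_pure] U.vs_axioms UU.vs_tensor, of "\<one>\<^bsub>U\<^esub>"]
      lin_zero[OF bilin_1[OF UU.bilin_pure] U.vs_axioms UU.vs_tensor, of "?W ?N"] Wc[of ?N] by simp
qed

subsection \<open>The counit and the antipode\<close>

lemma kalg0_scalars: "kalg0 (scalars :: ('k, 'k) module)" by (simp add: kalg0_def kalg_scalars)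

lemma scalars_minus [simp]: "x \<ominus>\<^bsub>scalars\<^esub> y = x - (y::'k)"
  by (subst vs.minus_smult1[OF vs_scalars]) simp_all

lemma uq_rep_counit: "uq_rep A q (scalars :: ('k, 'k) module) Uq_counit_gen"
  by (intro uq_rep.intro uq_rep_axioms.intro uq_axioms kalg0_scalars) auto

abbreviation "S \<equiv> Uq_antipode_gen A q"

lemma S_simps:
  "S (E i) = (- 1) \<odot>\<^bsub>U\<^esub> (g (OmInv i) \<otimes>\<^bsub>U\<^esub> g (E i))" "S (F i) = (- 1) \<odot>\<^bsub>U\<^esub> (g (F i) \<otimes>\<^bsub>U\<^esub> g (Om'Inv i))"
  by (simp_all add: U.smult_minus1)

declare Uq_antipode_gen.simps(1,2) [simp del]

lemma torus_left: "s \<in> torus \<Longrightarrow> t \<in> torus \<Longrightarrow> x \<in> carrier U \<Longrightarrow> g s \<otimes>\<^bsub>U\<^esub> (g t \<otimes>\<^bsub>U\<^esub> x) = g t \<otimes>\<^bsub>U\<^esub> (g s \<otimes>\<^bsub>U\<^esub> x)"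
  using U.torus[of s t] by (simp flip: U.m_assoc)

text \<open>Together with the two-factor rules in \<open>torus_simps\<close> these move inverse
  torus elements to the left, giving a normal form up to the order of the torus elements.\<close>

lemma E_torus_left:
  "x \<in> carrier U \<Longrightarrow> g (E j) \<otimes>\<^bsub>U\<^esub> (g (OmInv i) \<otimes>\<^bsub>U\<^esub> x) = q i j \<odot>\<^bsub>U\<^esub> (g (OmInv i) \<otimes>\<^bsub>U\<^esub> (g (E j) \<otimes>\<^bsub>U\<^esub> x))"
  "x \<in> carrier U \<Longrightarrow> g (E j) \<otimes>\<^bsub>U\<^esub> (g (Om'Inv i) \<otimes>\<^bsub>U\<^esub> x) = inverse (q j i) \<odot>\<^bsub>U\<^esub> (g (Om'Inv i) \<otimes>\<^bsub>U\<^esub> (g (E j) \<otimes>\<^bsub>U\<^esub> x))"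
  "x \<in> carrier U \<Longrightarrow> g (F j) \<otimes>\<^bsub>U\<^esub> (g (OmInv i) \<otimes>\<^bsub>U\<^esub> x) = inverse (q i j) \<odot>\<^bsub>U\<^esub> (g (OmInv i) \<otimes>\<^bsub>U\<^esub> (g (F j) \<otimes>\<^bsub>U\<^esub> x))"
  "x \<in> carrier U \<Longrightarrow> g (F j) \<otimes>\<^bsub>U\<^esub> (g (Om'Inv i) \<otimes>\<^bsub>U\<^esub> x) = q j i \<odot>\<^bsub>U\<^esub> (g (Om'Inv i) \<otimes>\<^bsub>U\<^esub> (g (F j) \<otimes>\<^bsub>U\<^esub> x))"
  by (simp_all add: U.E_OmInv U.E_Om'Inv U.F_OmInv U.F_Om'Inv U.mult_smult_l U.m_assoc flip: U.m_assoc[of "g (E j)"] U.m_assoc[of "g (F j)"])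

lemmas torus_simps = E_torus_left U.E_OmInv U.E_Om'Inv U.F_OmInv U.F_Om'Inv U.mult_smult_l U.mult_smult_r U.smult_smult U.m_assoc

text \<open>In normal form both products have the same scalar \<open>?k\<close> and the same torus
  factors, so their difference is a multiple of a torus element times the original
  commutator.\<close>

lemma S_E_F: "S (F j) \<otimes>\<^bsub>U\<^esub> S (E i) \<ominus>\<^bsub>U\<^esub> S (E i) \<otimes>\<^bsub>U\<^esub> S (F j) =
    (if i = j then (q i i / (q i i - 1)) \<odot>\<^bsub>U\<^esub> (S (Om i) \<ominus>\<^bsub>U\<^esub> S (Om' i)) else \<zero>\<^bsub>U\<^esub>)"
proof -
  let ?e = "g (E i)" and ?f = "g (F j)" and ?w = "g (OmInv i)" and ?w' = "g (Om'Inv j)"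
  let ?c = "?e \<otimes>\<^bsub>U\<^esub> ?f \<ominus>\<^bsub>U\<^esub> ?f \<otimes>\<^bsub>U\<^esub> ?e" and ?k = "inverse (q i j) * q j j"
  have 1: "S (F j) \<otimes>\<^bsub>U\<^esub> S (E i) = ?k \<odot>\<^bsub>U\<^esub> (?w \<otimes>\<^bsub>U\<^esub> (?w' \<otimes>\<^bsub>U\<^esub> (?f \<otimes>\<^bsub>U\<^esub> ?e)))"
    by (simp add: S_simps torus_simps mult_ac) (simp add: torus_left[of "Om'Inv j" "OmInv i"])
  have 2: "S (E i) \<otimes>\<^bsub>U\<^esub> S (F j) = ?k \<odot>\<^bsub>U\<^esub> (?w \<otimes>\<^bsub>U\<^esub> (?w' \<otimes>\<^bsub>U\<^esub> (?e \<otimes>\<^bsub>U\<^esub> ?f)))"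
    by (simp add: S_simps torus_simps mult_ac)
  have 3: "S (F j) \<otimes>\<^bsub>U\<^esub> S (E i) \<ominus>\<^bsub>U\<^esub> S (E i) \<otimes>\<^bsub>U\<^esub> S (F j) = (- ?k) \<odot>\<^bsub>U\<^esub> (?w \<otimes>\<^bsub>U\<^esub> (?w' \<otimes>\<^bsub>U\<^esub> ?c))"
    unfolding 1 2 by (simp add: U.minus_smult1 U.r_distr U.mult_smult_r U.smult_add_r U.smult_smult U.a_comm)
  show ?thesis
  proof (cases "i = j")
    case True
    \<comment> \<open>For \<open>i = j\<close> the scalar \<open>?k\<close> is 1. Multiplying
      \<open>\<omega> - \<omega>'\<close> by both inverses gives the difference of the inverses with
      the opposite sign, which the minus in step \<open>3\<close> corrects.\<close>
    have 4: "?w \<otimes>\<^bsub>U\<^esub> (?w' \<otimes>\<^bsub>U\<^esub> g (Om i)) = ?w'"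
      using U.torus[of "Om'Inv j" "Om i"] by (simp add: U.Om_inv' flip: U.m_assoc)
    have 5: "?w \<otimes>\<^bsub>U\<^esub> (?w' \<otimes>\<^bsub>U\<^esub> g (Om' i)) = ?w"
      using True by (simp add: U.Om'_inv')
    show ?thesis unfolding 3 U.E_F using True q_nz[of i i] 4 5
      by (simp add: U.minus_smult1 U.r_distr U.mult_smult_r U.smult_add_r U.smult_smult U.a_comm)
  qed (unfold 3 U.E_F, simp)
qed

lemma kalg0_opposite_U: "kalg0 (opposite U)" by (simp add: kalg0_def U.opp.kalg_axioms)

lemma S_closed: "S x \<in> carrier U" by (cases x) (simp_all add: S_simps)

lemma uq_rep_S: "uq_rep A q (opposite U) S"
proof (intro uq_rep.intro uq_rep_axioms.intro uq_axioms kalg0_opposite_U)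
  show "S x \<in> carrier (opposite U)" for x by (simp add: S_closed)
  show "S s \<otimes>\<^bsub>opposite U\<^esub> S t = S t \<otimes>\<^bsub>opposite U\<^esub> S s" if "s \<in> torus" "t \<in> torus" for s t
    using that by (auto simp: U.torus)
  show "S (E i) \<otimes>\<^bsub>opposite U\<^esub> S (F j) \<ominus>\<^bsub>opposite U\<^esub> S (F j) \<otimes>\<^bsub>opposite U\<^esub> S (E i) =
    (if i = j then (q i i / (q i i - 1)) \<odot>\<^bsub>opposite U\<^esub> (S (Om i) \<ominus>\<^bsub>opposite U\<^esub> S (Om' i)) else \<zero>\<^bsub>opposite U\<^esub>)" for i j
    using S_E_F[of j i] by (simp add: U.opposite_minus S_closed del: Uq_antipode_gen.simps)
  show "S (Om i) \<otimes>\<^bsub>opposite U\<^esub> S (E j) = q i j \<odot>\<^bsub>opposite U\<^esub> (S (E j) \<otimes>\<^bsub>opposite U\<^esub> S (Om i))" for i j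
    by (simp add: S_simps torus_simps mult_ac) (simp add: torus_left[of "OmInv j" "OmInv i"])
  show "S (Om' i) \<otimes>\<^bsub>opposite U\<^esub> S (E j) = inverse (q j i) \<odot>\<^bsub>opposite U\<^esub> (S (E j) \<otimes>\<^bsub>opposite U\<^esub> S (Om' i))" for i j
    by (simp add: S_simps torus_simps mult_ac) (simp add: torus_left[of "OmInv j" "Om'Inv i"])
  show "S (Om i) \<otimes>\<^bsub>opposite U\<^esub> S (F j) = inverse (q i j) \<odot>\<^bsub>opposite U\<^esub> (S (F j) \<otimes>\<^bsub>opposite U\<^esub> S (Om i))" for i j
    by (simp add: S_simps torus_simps mult_ac U.torus[of "Om'Inv j" "OmInv i"] torus_left[of "Om'Inv j" "OmInv i"])
  show "S (Om' i) \<otimes>\<^bsub>opposite U\<^esub> S (F j) = q j i \<odot>\<^bsub>opposite U\<^esub> (S (F j) \<otimes>\<^bsub>opposite U\<^esub> S (Om' i))" for i j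
    by (simp add: S_simps torus_simps mult_ac U.torus[of "Om'Inv j" "Om'Inv i"] torus_left[of "Om'Inv j" "Om'Inv i"])
qed (simp_all add: U.Om_inv' U.Om'_inv' U.Om_inv U.Om'_inv)

lemma opposite_opposite [simp]: "opposite (opposite M) = M" by (simp add: opposite_def)

text \<open>In the opposite algebra \<open>S (E i)\<close> is, up to sign, \<open>e_i\<close>
  followed by an inverse torus element. By \<open>qad_twist\<close> the torus factors can be
  collected on one side, leaving the Serre element of \<open>U\<close>, which is zero. The signs are
  taken out by \<open>qad_scale\<close>.\<close>

lemma S_serre_E:
  assumes ij: "i \<noteq> j"
  shows "qad (opposite U) (S (E i)) (cs i j) (S (E j)) = \<zero>\<^bsub>U\<^esub>"
proof -
  let ?O = "opposite U"
  interpret O: kalg0 ?O by (rule kalg0_opposite_U)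
  let ?N = "serre_exponent A i j"
  obtain k where k: "qad ?O (g (E i) \<otimes>\<^bsub>?O\<^esub> g (OmInv i)) (rev (map (\<lambda>n. q i i ^ n * q i j) [0..<?N])) (g (E j) \<otimes>\<^bsub>?O\<^esub> g (OmInv j)) =
    k \<odot>\<^bsub>?O\<^esub> (qad (opposite ?O) (g (E i)) (rev (map (\<lambda>n. q i i ^ (?N - 1 - n) * q i j) [0..<?N])) (g (E j)) \<otimes>\<^bsub>?O\<^esub>
      (((\<otimes>\<^bsub>?O\<^esub>) (g (OmInv i)) ^^ ?N) (g (OmInv j))))"
    using O.qad_twist[of "g (E i)" "g (E j)" "g (OmInv i)" "g (OmInv j)" "q i i" "q i j" "q j i" ?N
        "\<lambda>n. q i i ^ n * q i j" "\<lambda>n. q i i ^ (?N - 1 - n) * q i j" ?N]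
      q_serre[OF ij] by (auto simp: U.E_OmInv U.torus mult_ac)
  have z: "qad U (g (E i)) (rev (map (\<lambda>n. q i i ^ (?N - 1 - n) * q i j) [0..<?N])) (g (E j)) = \<zero>\<^bsub>U\<^esub>"
    using serre_E_U[OF ij] by (simp only: ad_coeffs_rev U.qad_rev g_closed)
  have "qad ?O (g (E i) \<otimes>\<^bsub>?O\<^esub> g (OmInv i)) (cs i j) (g (E j) \<otimes>\<^bsub>?O\<^esub> g (OmInv j)) = \<zero>\<^bsub>U\<^esub>"
    using k[unfolded opposite_opposite z] U.opp.funpow_mult_closed[of "g (OmInv i)" "g (OmInv j)" ?N]
    by (simp add: ad_coeffs_chain)
  then show ?thesis
    using U.opp.qad_scale[of "g (E i) \<otimes>\<^bsub>?O\<^esub> g (OmInv i)" "g (E j) \<otimes>\<^bsub>?O\<^esub> g (OmInv j)" "- 1" "cs i j" "- 1"]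
    by (simp add: S_simps)
qed

text \<open>Here the torus element already stands on the right in \<open>U\<close>, so
  \<open>qad_twist\<close> is applied in \<open>U\<close> and leaves the Serre element of the
  opposite algebra. All weights are inverted, as the inverse torus elements act.\<close>

lemma S_serre_F:
  assumes ij: "i \<noteq> j"
  shows "qad U (S (F i)) (cs i j) (S (F j)) = \<zero>\<^bsub>U\<^esub>"
proof -
  let ?N = "serre_exponent A i j"
  have wf: "g (Om'Inv i) \<otimes>\<^bsub>U\<^esub> g (F j) = inverse (q j i) \<odot>\<^bsub>U\<^esub> (g (F j) \<otimes>\<^bsub>U\<^esub> g (Om'Inv i))" for i j
    using q_nz by (simp add: U.F_Om'Inv U.smult_smult)
  \<comment> \<open>The compatibility of the two coefficient sequences demanded by
    \<open>qad_twist\<close>, reduced to \<open>q_serre\<close>.\<close>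
  have "q i i ^ n * q i j * inverse (q i i) ^ n * inverse (q i j) * (q i i ^ (?N - 1 - n) * q i j) =
      inverse (q i i) ^ n * inverse (q j i)" if "n < ?N" for n
    using q_serre[OF ij that] q_nz by (simp add: field_simps)
  then obtain k where k: "qad U (g (F i) \<otimes>\<^bsub>U\<^esub> g (Om'Inv i)) (rev (map (\<lambda>n. q i i ^ n * q i j) [0..<?N])) (g (F j) \<otimes>\<^bsub>U\<^esub> g (Om'Inv j)) =
    k \<odot>\<^bsub>U\<^esub> (qad (opposite U) (g (F i)) (rev (map (\<lambda>n. q i i ^ (?N - 1 - n) * q i j) [0..<?N])) (g (F j)) \<otimes>\<^bsub>U\<^esub>
      (((\<otimes>\<^bsub>U\<^esub>) (g (Om'Inv i)) ^^ ?N) (g (Om'Inv j))))"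
    using U.qad_twist[of "g (F i)" "g (F j)" "g (Om'Inv i)" "g (Om'Inv j)" "inverse (q i i)" "inverse (q j i)" "inverse (q i j)" ?N
        "\<lambda>n. q i i ^ n * q i j" "\<lambda>n. q i i ^ (?N - 1 - n) * q i j" ?N] wf
    by (auto simp: U.torus)
  have z: "qad (opposite U) (g (F i)) (rev (map (\<lambda>n. q i i ^ (?N - 1 - n) * q i j) [0..<?N])) (g (F j)) = \<zero>\<^bsub>U\<^esub>"
    unfolding ad_coeffs_rev using serre_F_U[OF ij] U.opp.qad_rev[of "g (F i)" "g (F j)" "cs i j"] by simp
  have "qad U (g (F i) \<otimes>\<^bsub>U\<^esub> g (Om'Inv i)) (cs i j) (g (F j) \<otimes>\<^bsub>U\<^esub> g (Om'Inv j)) = \<zero>\<^bsub>U\<^esub>"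
    using k[unfolded z] U.funpow_mult_closed[of "g (Om'Inv i)" "g (Om'Inv j)" ?N] by (simp add: ad_coeffs_chain)
  then show ?thesis
    using U.qad_scale[of "g (F i) \<otimes>\<^bsub>U\<^esub> g (Om'Inv i)" "g (F j) \<otimes>\<^bsub>U\<^esub> g (Om'Inv j)" "- 1" "cs i j" "- 1"]
    by (simp add: S_simps)
qed

end

section \<open>Group-like and skew-primitive elements\<close>

lemma kalg_cong:
  fixes M :: "('k::field, 'a, 'm) module_scheme" and M' :: "('k, 'a, 'n) module_scheme"
  assumes "kalg M" "carrier M' = carrier M" "\<one>\<^bsub>M'\<^esub> = \<one>\<^bsub>M\<^esub>" "\<zero>\<^bsub>M'\<^esub> = \<zero>\<^bsub>M\<^esub>"
    "\<And>x y. x \<oplus>\<^bsub>M'\<^esub> y = x \<oplus>\<^bsub>M\<^esub> y" "\<And>x y. x \<otimes>\<^bsub>M'\<^esub> y = x \<otimes>\<^bsub>M\<^esub> y" "\<And>k x. k \<odot>\<^bsub>M'\<^esub> x = k \<odot>\<^bsub>M\<^esub> x"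
  shows "kalg M'"
proof -
  interpret kalg M by fact
  have g: "abelian_group M'"
  proof (rule abelian_groupI)
    show "\<exists>y\<in>carrier M'. y \<oplus>\<^bsub>M'\<^esub> x = \<zero>\<^bsub>M'\<^esub>" if "x \<in> carrier M'" for x
      using that assms by (intro bexI[of _ "\<ominus>\<^bsub>M\<^esub> x"]) (simp_all add: l_neg)
  qed (use assms in \<open>simp_all add: a_ac\<close>)
  have "ring M'" by (rule ringI[OF g monoidI]) (use assms in \<open>simp_all add: m_assoc l_distr r_distr\<close>)
  moreover have "vs M'" by (rule vsI[OF g]) (use assms in \<open>simp_all add: smult_add_l smult_add_r smult_smult\<close>)
  ultimately show ?thesis by (simp add: kalg_def kalg_axioms_def assms mult_smult_l mult_smult_r)
qed

context prebialg begin

lemma counit_axioms_bilin: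
  "bilin H H H (\<lambda>a b. counit H a \<odot> b)" "bilin H H H (\<lambda>a b. counit H b \<odot> a)"
  by (rule bilinI; intro lin_smult_scalar[OF counit_linear] lin_smult_vec lin_id vs_axioms; assumption)+

lemma coassoc_trilin:
  "trilin H H H (tensor_algebra H (tensor_algebra H H)) (\<lambda>a b c. pure_tensor H (tensor_algebra H H) a (pure_tensor H H b c))"
  by (intro trilinI) (auto intro!: T3.lin_pure_l T3.lin_pure_r T2.lin_pure_l T2.lin_pure_r lin_id)

text \<open>Both iterated coproducts are \<open>x \<otimes> s \<otimes> s + t \<otimes> x \<otimes>
  s + t \<otimes> t \<otimes> x\<close>, summed in different order of brackets. The generator
  \<open>e_i\<close> has \<open>s = 1\<close> and \<open>t = \<omega>_i\<close>; for
  \<open>f_i\<close> these are \<open>\<omega>'_i\<close> and \<open>1\<close>.\<close>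

lemma skew_primitive_axioms:
  assumes c: "x \<in> carrier H" "s \<in> carrier H" "t \<in> carrier H"
    and x: "comult H x = pure_tensor H H x s \<oplus>\<^bsub>tensor_module H H\<^esub> pure_tensor H H t x" "counit H x = 0"
    and s: "comult H s = pure_tensor H H s s" "counit H s = 1" and t: "comult H t = pure_tensor H H t t" "counit H t = 1"
  shows "sweedler H (tensor_algebra H (tensor_algebra H H)) (\<lambda>y c.
        sweedler H (tensor_algebra H (tensor_algebra H H)) (\<lambda>a b.
          pure_tensor H (tensor_algebra H H) a (pure_tensor H H b c)) y) x =
      sweedler H (tensor_algebra H (tensor_algebra H H)) (\<lambda>a y.
        sweedler H (tensor_algebra H (tensor_algebra H H)) (\<lambda>b c.
          pure_tensor H (tensor_algebra H H) a (pure_tensor H H b c)) y) x"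
    and "sweedler H H (\<lambda>a b. counit H a \<odot> b) x = x" and "sweedler H H (\<lambda>a b. counit H b \<odot> a) x = x"
proof -
  have W: "vs (tensor_algebra H (tensor_algebra H H))" by (rule T3.TA.vs_axioms)
  note p = coassoc_trilin
  show "sweedler H (tensor_algebra H (tensor_algebra H H)) (\<lambda>y c.
        sweedler H (tensor_algebra H (tensor_algebra H H)) (\<lambda>a b.
          pure_tensor H (tensor_algebra H H) a (pure_tensor H H b c)) y) x =
      sweedler H (tensor_algebra H (tensor_algebra H H)) (\<lambda>a y.
        sweedler H (tensor_algebra H (tensor_algebra H H)) (\<lambda>b c.
          pure_tensor H (tensor_algebra H H) a (pure_tensor H H b c)) y) x"
    unfolding sw_pure2[OF x(1) sw_lin12(1)[OF p W] W c(1,2,3,1)] sw_pure2[OF x(1) sw_lin12(2)[OF p W] W c(1,2,3,1)]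
      sw_pure2[OF x(1) trilin_bilin(3)[OF p c(2)] W c(1,2,3,1)] sw_pure[OF t(1) trilin_bilin(3)[OF p c(1)] W c(3,3)]
      sw_pure2[OF x(1) trilin_bilin(1)[OF p c(3)] W c(1,2,3,1)] sw_pure[OF s(1) trilin_bilin(1)[OF p c(1)] W c(2,2)]
    using c by (intro T3.TA.a_assoc) simp_all
  show "sweedler H H (\<lambda>a b. counit H a \<odot> b) x = x" "sweedler H H (\<lambda>a b. counit H b \<odot> a) x = x"
    using c by (simp_all add: sw_pure2[OF x(1) counit_axioms_bilin(1) vs_axioms c(1,2,3,1)]
        sw_pure2[OF x(1) counit_axioms_bilin(2) vs_axioms c(1,2,3,1)] x s t)
qed

lemma grouplike_axioms:
  assumes c: "x \<in> carrier H" and x: "comult H x = pure_tensor H H x x" "counit H x = 1"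
  shows "sweedler H (tensor_algebra H (tensor_algebra H H)) (\<lambda>y c.
        sweedler H (tensor_algebra H (tensor_algebra H H)) (\<lambda>a b.
          pure_tensor H (tensor_algebra H H) a (pure_tensor H H b c)) y) x =
      sweedler H (tensor_algebra H (tensor_algebra H H)) (\<lambda>a y.
        sweedler H (tensor_algebra H (tensor_algebra H H)) (\<lambda>b c.
          pure_tensor H (tensor_algebra H H) a (pure_tensor H H b c)) y) x"
    and "sweedler H H (\<lambda>a b. counit H a \<odot> b) x = x" and "sweedler H H (\<lambda>a b. counit H b \<odot> a) x = x"
proof -
  have W: "vs (tensor_algebra H (tensor_algebra H H))" by (rule T3.TA.vs_axioms)
  note p = coassoc_trilin
  show "sweedler H (tensor_algebra H (tensor_algebra H H)) (\<lambda>y c.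
        sweedler H (tensor_algebra H (tensor_algebra H H)) (\<lambda>a b.
          pure_tensor H (tensor_algebra H H) a (pure_tensor H H b c)) y) x =
      sweedler H (tensor_algebra H (tensor_algebra H H)) (\<lambda>a y.
        sweedler H (tensor_algebra H (tensor_algebra H H)) (\<lambda>b c.
          pure_tensor H (tensor_algebra H H) a (pure_tensor H H b c)) y) x"
    unfolding sw_pure[OF x(1) sw_lin12(1)[OF p W] W c c] sw_pure[OF x(1) sw_lin12(2)[OF p W] W c c]
      sw_pure[OF x(1) trilin_bilin(3)[OF p c] W c c] sw_pure[OF x(1) trilin_bilin(1)[OF p c] W c c] ..
  show "sweedler H H (\<lambda>a b. counit H a \<odot> b) x = x" "sweedler H H (\<lambda>a b. counit H b \<odot> a) x = x"
    using c by (simp_all add: sw_pure[OF x(1) counit_axioms_bilin(1) vs_axioms c c]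
        sw_pure[OF x(1) counit_axioms_bilin(2) vs_axioms c c] x)
qed

end

subsection \<open>The Hopf algebra\<close>

context uq begin

abbreviation "UH \<equiv> Uq A q"

lemma Uq_simps [simp]:
  "carrier UH = carrier U" "x \<oplus>\<^bsub>UH\<^esub> y = x \<oplus>\<^bsub>U\<^esub> y" "x \<otimes>\<^bsub>UH\<^esub> y = x \<otimes>\<^bsub>U\<^esub> y" "\<zero>\<^bsub>UH\<^esub> = \<zero>\<^bsub>U\<^esub>" "\<one>\<^bsub>UH\<^esub> = \<one>\<^bsub>U\<^esub>"
  "k \<odot>\<^bsub>UH\<^esub> x = k \<odot>\<^bsub>U\<^esub> x"
  by (simp_all add: Uq_def module.defs hopf.defs)

lemma Uq_structure:
  "comult UH = quot_free_lift UU.TA D" "counit UH = quot_free_lift scalars Uq_counit_gen"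
  "antipode UH = quot_free_lift (opposite U) S"
  by (simp_all add: Uq_def module.defs hopf.defs)

lemma Uq_tensor: "tensor_module UH UH = TM" "pure_tensor UH UH = pure" "tensor_algebra UH UH = UU.TA"
proof -
  show 1: "tensor_module UH UH = TM" "pure_tensor UH UH = pure" by (rule tensor_module_cong; simp)+
  show "tensor_algebra UH UH = UU.TA" by (simp add: tensor_algebra_def 1)
qed

lemma algebra_homs_Uq: "algebra_homs UH N = algebra_homs U N" "linear_maps UH N = linear_maps U N" "linear_maps N UH = linear_maps N U"
  by (simp_all add: algebra_homs_def ring_hom_def linear_maps_def)

interpretation C: uq_rep A q "scalars :: ('k, 'k) module" Uq_counit_gen by (rule uq_rep_counit)
interpretation SS: uq_rep A q "opposite U" S by (rule uq_rep_S)

lemma comult_hom_U: "comult UH \<in> algebra_homs U UU.TA" and comult_g: "comult UH (g x) = D x"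
  unfolding Uq_structure by (rule DD.Uq_lift_hom[OF D_serre_E D_serre_F] DD.Uq_lift_gen[OF D_serre_E D_serre_F]; assumption)+

lemma counit_hom_U: "counit UH \<in> algebra_homs U scalars" and counit_g: "counit UH (g x) = Uq_counit_gen x"
proof -
  have z: "qad scalars 0 cs 0 = (0::'k)" for cs :: "'k list"
    using C.qad_zero[of 0] by simp
  have z': "qad (opposite scalars) 0 cs 0 = (0::'k)" for cs :: "'k list"
    using C.opp.qad_zero[of 0] by simp
  show "counit UH \<in> algebra_homs U scalars" "counit UH (g x) = Uq_counit_gen x"
    unfolding Uq_structure by (rule C.Uq_lift_hom C.Uq_lift_gen; simp add: z z')+
qed

lemma antipode_hom_U: "antipode UH \<in> algebra_homs U (opposite U)" and antipode_g: "antipode UH (g x) = S x"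
  unfolding Uq_structure by (rule SS.Uq_lift_hom SS.Uq_lift_gen; simp add: S_serre_E S_serre_F)+

lemma kalg_UH: "kalg UH" by (rule kalg_cong[OF kalg_U]) simp_all

lemma prebialg_Uq: "prebialg UH"
  by (intro prebialg.intro prebialg_axioms.intro kalg_UH) (simp_all add: algebra_homs_Uq Uq_tensor comult_hom_U counit_hom_U)

lemma U_generated: "x \<in> carrier U \<Longrightarrow> x \<in> gen_subalgebra UH (range g)"
  unfolding U_Q
proof (induction rule: P.Q_induct)
  case one show ?case using gen_subalgebra.one[of UH "range g"] by (simp add: U_Q)
next
  case (letter x) show ?case unfolding g_cls[symmetric] by (rule gen_subalgebra.gen) simp
next
  case (add x y) then show ?case using gen_subalgebra.add[of x UH "range g" y] by (simp add: U_Q)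
next
  case (mult x y) then show ?case using gen_subalgebra.mult[of x UH "range g" y] by (simp add: U_Q)
next
  case (smult k x) then show ?case using gen_subalgebra.smult[of x UH "range g" k] by (simp add: U_Q)
qed

lemma comult_UH:
  "comult UH (g (E i)) = pure_tensor UH UH (g (E i)) \<one>\<^bsub>UH\<^esub> \<oplus>\<^bsub>tensor_module UH UH\<^esub> pure_tensor UH UH (g (Om i)) (g (E i))"
  "comult UH (g (F i)) = pure_tensor UH UH (g (F i)) (g (Om' i)) \<oplus>\<^bsub>tensor_module UH UH\<^esub> pure_tensor UH UH \<one>\<^bsub>UH\<^esub> (g (F i))"
  "s \<in> torus \<Longrightarrow> comult UH (g s) = pure_tensor UH UH (g s) (g s)"
  using abelian_monoid.a_comm[OF abelian_group.axioms(1)[OF module.axioms(2)[OF UU.vs_tensor[unfolded vs_def]]]]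
  by (simp_all add: comult_g Uq_tensor D_simps)

lemma comult_UH_one: "comult UH \<one>\<^bsub>UH\<^esub> = pure_tensor UH UH \<one>\<^bsub>UH\<^esub> \<one>\<^bsub>UH\<^esub>"
  using alg_one[OF comult_hom_U] by (simp add: Uq_tensor)

lemma bialg_Uq: "bialg UH"
proof -
  interpret H: prebialg UH by (rule prebialg_Uq)
  have e: "counit UH \<one>\<^bsub>UH\<^esub> = 1" using alg_one[OF counit_hom_U] by simp
  have sk: "x \<in> torus \<Longrightarrow> counit UH (g x) = 1" for x by (auto simp: counit_g)
  note E = H.skew_primitive_axioms[OF _ _ _ comult_UH(1) _ comult_UH_one e comult_UH(3) sk, simplified counit_g Uq_counit_gen.simps]
  note F = H.skew_primitive_axioms[OF _ _ _ comult_UH(2) _ comult_UH(3) sk comult_UH_one e, simplified counit_g Uq_counit_gen.simps]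
  note T = H.grouplike_axioms[OF _ comult_UH(3) sk]
  have c: "g x \<in> carrier UH" "\<one>\<^bsub>UH\<^esub> \<in> carrier UH" for x by simp_all
  show ?thesis
  proof (rule H.bialg_of_generators[of "range g"])
    show "carrier UH \<subseteq> gen_subalgebra UH (range g)" using U_generated by auto
    fix x assume "x \<in> range g"
    then obtain y where y: "x = g y" by blast
    have 0: "counit UH (g (E i)) = 0" "counit UH (g (F i)) = 0" for i by (simp_all add: counit_g)
    show "sweedler UH (tensor_algebra UH (tensor_algebra UH UH)) (\<lambda>y c.
        sweedler UH (tensor_algebra UH (tensor_algebra UH UH)) (\<lambda>a b.
          pure_tensor UH (tensor_algebra UH UH) a (pure_tensor UH UH b c)) y) x =
      sweedler UH (tensor_algebra UH (tensor_algebra UH UH)) (\<lambda>a y.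
        sweedler UH (tensor_algebra UH (tensor_algebra UH UH)) (\<lambda>b c.
          pure_tensor UH (tensor_algebra UH UH) a (pure_tensor UH UH b c)) y) x"
      "sweedler UH UH (\<lambda>a b. counit UH a \<odot>\<^bsub>UH\<^esub> b) x = x" "sweedler UH UH (\<lambda>a b. counit UH b \<odot>\<^bsub>UH\<^esub> a) x = x"
      unfolding y
      by (cases y; hypsubst;
          rule H.skew_primitive_axioms[OF c(1) c(2) c(1) comult_UH(1) 0(1) comult_UH_one e comult_UH(3) sk]
            H.skew_primitive_axioms[OF c(1) c(1) c(2) comult_UH(2) 0(2) comult_UH(3) sk comult_UH_one e]
            H.grouplike_axioms[OF c(1) comult_UH(3) sk]; simp)+
  qed auto
qed

lemma antipode_UH:
  "antipode UH \<in> linear_maps UH UH" "antipode UH \<one>\<^bsub>UH\<^esub> = \<one>\<^bsub>UH\<^esub>"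
  "x \<in> carrier UH \<Longrightarrow> y \<in> carrier UH \<Longrightarrow> antipode UH (x \<otimes>\<^bsub>UH\<^esub> y) = antipode UH y \<otimes>\<^bsub>UH\<^esub> antipode UH x"
  using alg_lin[OF antipode_hom_U] alg_one[OF antipode_hom_U] alg_mult[OF antipode_hom_U, of x y]
  by (simp_all add: algebra_homs_Uq linear_maps_def)

lemma hopf_Uq: "hopf_algebra UH"
proof -
  interpret H: bialg UH by (rule bialg_Uq)
  note Sc = lin_closed[OF antipode_UH(1)]
  have bl: "bilin UH UH UH (\<lambda>a b. antipode UH a \<otimes>\<^bsub>UH\<^esub> b)" and br: "bilin UH UH UH (\<lambda>a b. a \<otimes>\<^bsub>UH\<^esub> antipode UH b)"
    by (rule bilinI; intro H.lin_mult_l H.lin_mult_r antipode_UH(1) lin_id Sc; assumption)+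
  note V = H.vs_axioms
  have c: "g x \<in> carrier UH" "\<one>\<^bsub>UH\<^esub> \<in> carrier UH" for x by simp_all
  have n: "(- 1) \<odot>\<^bsub>U\<^esub> x \<oplus>\<^bsub>U\<^esub> x = \<zero>\<^bsub>U\<^esub>" "x \<oplus>\<^bsub>U\<^esub> (- 1) \<odot>\<^bsub>U\<^esub> x = \<zero>\<^bsub>U\<^esub>" if "x \<in> carrier U" for x
    using that by (simp_all add: U.smult_minus_l U.l_neg U.r_neg)
  have S1: "antipode UH \<one>\<^bsub>U\<^esub> = \<one>\<^bsub>U\<^esub>" using antipode_UH(2) by simp
  have "sweedler UH UH (\<lambda>a b. antipode UH a \<otimes>\<^bsub>UH\<^esub> b) x = counit UH x \<odot>\<^bsub>UH\<^esub> \<one>\<^bsub>UH\<^esub> \<and>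
      sweedler UH UH (\<lambda>a b. a \<otimes>\<^bsub>UH\<^esub> antipode UH b) x = counit UH x \<odot>\<^bsub>UH\<^esub> \<one>\<^bsub>UH\<^esub>" if xg: "x \<in> range g" for x
  proof -
    obtain y where y: "x = g y" using xg by blast
    show ?thesis
    proof (cases y)
      case (E i)
      show ?thesis unfolding y E H.sw_pure2[OF comult_UH(1) bl V c(1) c(2) c(1) c(1)] H.sw_pure2[OF comult_UH(1) br V c(1) c(2) c(1) c(1)]
        by (simp add: antipode_g counit_g S_simps S1 n U.mult_smult_l U.mult_smult_r U.Om_inv flip: U.m_assoc)
    next
      case (F i)
      show ?thesis unfolding y F H.sw_pure2[OF comult_UH(2) bl V c(1) c(1) c(2) c(1)] H.sw_pure2[OF comult_UH(2) br V c(1) c(1) c(2) c(1)]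
        by (simp add: antipode_g counit_g S_simps S1 n U.mult_smult_l U.mult_smult_r U.Om'_inv' U.m_assoc)
    next
      case (Om i)
      then have "y \<in> torus" by simp
      show ?thesis unfolding y H.sw_pure[OF comult_UH(3) bl V c(1) c(1), OF \<open>y \<in> torus\<close>] H.sw_pure[OF comult_UH(3) br V c(1) c(1), OF \<open>y \<in> torus\<close>]
        by (simp add: Om antipode_g counit_g U.Om_inv U.Om_inv' U.Om'_inv U.Om'_inv')
    next
      case (OmInv i)
      then have "y \<in> torus" by simp
      show ?thesis unfolding y H.sw_pure[OF comult_UH(3) bl V c(1) c(1), OF \<open>y \<in> torus\<close>] H.sw_pure[OF comult_UH(3) br V c(1) c(1), OF \<open>y \<in> torus\<close>]
        by (simp add: OmInv antipode_g counit_g U.Om_inv U.Om_inv' U.Om'_inv U.Om'_inv')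
    next
      case (Om' i)
      then have "y \<in> torus" by simp
      show ?thesis unfolding y H.sw_pure[OF comult_UH(3) bl V c(1) c(1), OF \<open>y \<in> torus\<close>] H.sw_pure[OF comult_UH(3) br V c(1) c(1), OF \<open>y \<in> torus\<close>]
        by (simp add: Om' antipode_g counit_g U.Om_inv U.Om_inv' U.Om'_inv U.Om'_inv')
    next
      case (Om'Inv i)
      then have "y \<in> torus" by simp
      show ?thesis unfolding y H.sw_pure[OF comult_UH(3) bl V c(1) c(1), OF \<open>y \<in> torus\<close>] H.sw_pure[OF comult_UH(3) br V c(1) c(1), OF \<open>y \<in> torus\<close>]
        by (simp add: Om'Inv antipode_g counit_g U.Om_inv U.Om_inv' U.Om'_inv U.Om'_inv')
    qed
  qed
  then have l: "\<And>x. x \<in> range g \<Longrightarrow> sweedler UH UH (\<lambda>a b. antipode UH a \<otimes>\<^bsub>UH\<^esub> b) x = counit UH x \<odot>\<^bsub>UH\<^esub> \<one>\<^bsub>UH\<^esub>"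
    and r: "\<And>x. x \<in> range g \<Longrightarrow> sweedler UH UH (\<lambda>a b. a \<otimes>\<^bsub>UH\<^esub> antipode UH b) x = counit UH x \<odot>\<^bsub>UH\<^esub> \<one>\<^bsub>UH\<^esub>"
    by blast+
  have gs: "range g \<subseteq> carrier UH" "carrier UH \<subseteq> gen_subalgebra UH (range g)"
    by (simp add: image_subset_iff, simp add: subset_iff U_generated)
  show ?thesis
    by (rule hopf_algebraI[OF bialg_Uq antipode_UH(1)];
        rule H.antipode_of_generators[OF gs antipode_UH l r]; assumption)
qed

subsection \<open>The Borel subalgebras\<close>

text \<open>One criterion for both kinds of generators: a tensor written with factors from
  \<open>C\<close> is the image of the same expression over \<open>C\<close>.\<close>

lemma prebialg_sub_comult:
  assumes "C = gen_subalgebra UH Y" "Y \<subseteq> carrier UH"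
    and "comult UH s = pure_tensor UH UH a b \<or>
      comult UH s = pure_tensor UH UH a b \<oplus>\<^bsub>tensor_module UH UH\<^esub> pure_tensor UH UH c d"
    and "a \<in> C" "b \<in> C" "c \<in> C" "d \<in> C"
  shows "comult UH s \<in> tensor_incl UH ` carrier (tensor_module (UH\<lparr>carrier := C\<rparr>) (UH\<lparr>carrier := C\<rparr>))"
proof -
  interpret H: bialg UH by (rule bialg_Uq)
  interpret C: sub_alg UH C
    unfolding assms(1) by (simp only: sub_alg_def sub_alg_axioms_def H.kalg_axioms H.gen_subalgebra_subring H.gen_subalgebra_submodule assms(2))
  have 1: "pure_tensor UH UH a b = tensor_incl UH (pure_tensor C.R C.R a b)"
    "pure_tensor UH UH c d = tensor_incl UH (pure_tensor C.R C.R c d)"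
    using assms(4-7) by (simp_all add: C.incl_pure)
  have 2: "pure_tensor C.R C.R a b \<in> carrier (tensor_module C.R C.R)" "pure_tensor C.R C.R c d \<in> carrier (tensor_module C.R C.R)"
    using assms(4-7) by simp_all
  have 3: "pure_tensor C.R C.R a b \<oplus>\<^bsub>tensor_module C.R C.R\<^esub> pure_tensor C.R C.R c d \<in> carrier (tensor_module C.R C.R)"
    by (rule abelian_monoid.a_closed[OF abelian_group.axioms(1)[OF module.axioms(2)[OF C.RR.vs_tensor[unfolded vs_def]]] 2])
  show ?thesis unfolding C.tensor_carrier_update
    using assms(3) unfolding 1 lin_add[OF C.incl_linear 2, symmetric] using 2 3 by auto
qed

abbreviation "gens_ge \<equiv> g ` (range E \<union> range Om \<union> range OmInv)"
abbreviation "gens_le \<equiv> g ` (range F \<union> range Om' \<union> range Om'Inv)"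
abbreviation "GE \<equiv> gen_subalgebra UH gens_ge"
abbreviation "LE \<equiv> gen_subalgebra UH gens_le"

lemma gens_in:
  "g (E i) \<in> GE" "g (Om i) \<in> GE" "g (OmInv i) \<in> GE" "\<one>\<^bsub>U\<^esub> \<in> GE"
  "g (F i) \<in> LE" "g (Om' i) \<in> LE" "g (Om'Inv i) \<in> LE" "\<one>\<^bsub>U\<^esub> \<in> LE"
  using gen_subalgebra.one[of UH gens_ge] gen_subalgebra.one[of UH gens_le] by (auto intro!: gen_subalgebra.gen)

lemma gen_U:
  "x \<in> gen_subalgebra UH Y \<Longrightarrow> y \<in> gen_subalgebra UH Y \<Longrightarrow> x \<otimes>\<^bsub>U\<^esub> y \<in> gen_subalgebra UH Y"
  "x \<in> gen_subalgebra UH Y \<Longrightarrow> k \<odot>\<^bsub>U\<^esub> x \<in> gen_subalgebra UH Y"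
  "x \<in> gen_subalgebra UH Y \<Longrightarrow> y \<in> gen_subalgebra UH Y \<Longrightarrow> x \<oplus>\<^bsub>U\<^esub> y \<in> gen_subalgebra UH Y"
  using gen_subalgebra.mult[of x UH Y y] gen_subalgebra.smult[of x UH Y k] gen_subalgebra.add[of x UH Y y] by simp_all

lemma
  shows hopf_generated_ge: "hopf_subalgebra_generated UH gens_ge = GE" and hopf_sub_ge: "hopf_subalgebra GE UH"
    and hopf_generated_le: "hopf_subalgebra_generated UH gens_le = LE" and hopf_sub_le: "hopf_subalgebra LE UH"
proof -
  have gc: "gens_ge \<subseteq> carrier UH" "gens_le \<subseteq> carrier UH" by auto
  have co: "comult UH s \<in> tensor_incl UH ` carrier (tensor_module (UH\<lparr>carrier := GE\<rparr>) (UH\<lparr>carrier := GE\<rparr>))" if "s \<in> gens_ge" for s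
    using that
  proof (elim imageE UnE)
    fix x i assume "s = g x" "x = E i"
    then show ?thesis using comult_UH(1)[of i] gens_in
      by (intro prebialg_sub_comult[OF refl gc(1), of _ "g (E i)" "\<one>\<^bsub>UH\<^esub>" "g (Om i)" "g (E i)"]) simp_all
  next
    fix x i assume "s = g x" "x = Om i"
    then show ?thesis using comult_UH(3)[of "Om i"] gens_in
      by (intro prebialg_sub_comult[OF refl gc(1), of _ "g (Om i)" "g (Om i)" "g (Om i)" "g (Om i)"]) simp_all
  next
    fix x i assume "s = g x" "x = OmInv i"
    then show ?thesis using comult_UH(3)[of "OmInv i"] gens_in
      by (intro prebialg_sub_comult[OF refl gc(1), of _ "g (OmInv i)" "g (OmInv i)" "g (OmInv i)" "g (OmInv i)"]) simp_all
  qed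
  have co': "comult UH s \<in> tensor_incl UH ` carrier (tensor_module (UH\<lparr>carrier := LE\<rparr>) (UH\<lparr>carrier := LE\<rparr>))" if "s \<in> gens_le" for s
    using that
  proof (elim imageE UnE)
    fix x i assume "s = g x" "x = F i"
    then show ?thesis using comult_UH(2)[of i] gens_in
      by (intro prebialg_sub_comult[OF refl gc(2), of _ "g (F i)" "g (Om' i)" "\<one>\<^bsub>UH\<^esub>" "g (F i)"]) simp_all
  next
    fix x i assume "s = g x" "x = Om' i"
    then show ?thesis using comult_UH(3)[of "Om' i"] gens_in
      by (intro prebialg_sub_comult[OF refl gc(2), of _ "g (Om' i)" "g (Om' i)" "g (Om' i)" "g (Om' i)"]) simp_all
  next
    fix x i assume "s = g x" "x = Om'Inv i"
    then show ?thesis using comult_UH(3)[of "Om'Inv i"] gens_in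
      by (intro prebialg_sub_comult[OF refl gc(2), of _ "g (Om'Inv i)" "g (Om'Inv i)" "g (Om'Inv i)" "g (Om'Inv i)"]) simp_all
  qed
  have an: "antipode UH s \<in> GE" if "s \<in> gens_ge" for s
    using that gens_in gen_U by (auto simp: antipode_g S_simps)
  have an': "antipode UH s \<in> LE" if "s \<in> gens_le" for s
    using that gens_in gen_U by (auto simp: antipode_g S_simps)
  show "hopf_subalgebra_generated UH gens_ge = GE" "hopf_subalgebra GE UH"
    using hopf_subalgebra_generated_eq[OF prebialg_Uq gc(1) co antipode_UH an] by auto
  show "hopf_subalgebra_generated UH gens_le = LE" "hopf_subalgebra LE UH"
    using hopf_subalgebra_generated_eq[OF prebialg_Uq gc(2) co' antipode_UH an'] by auto
qed

lemma Uq_ge_eq: "Uq_ge A q = restrict_hopf UH GE" and Uq_le_eq: "Uq_le A q = restrict_hopf UH LE"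
  by (simp_all add: Uq_ge_def Uq_le_def hopf_generated_ge hopf_generated_le)

lemma sub_bialg_ge: "sub_bialg UH GE" and sub_bialg_le: "sub_bialg UH LE"
  using hopf_sub_ge hopf_sub_le bialg_Uq kalg_UH
  by (auto simp: sub_bialg_def sub_bialg_axioms_def sub_alg_def sub_alg_axioms_def hopf_subalgebra_def)

end

subsection \<open>One-sided actions of the dual\<close>

context precoalg begin

lemma sw_add_fun:
  assumes f: "bilin H H V f" and g: "bilin H H V k" and V: "vs V" and x: "x \<in> carrier H"
  shows "sweedler H V (\<lambda>a b. f a b \<oplus>\<^bsub>V\<^esub> k a b) x = sweedler H V f x \<oplus>\<^bsub>V\<^esub> sweedler H V k x"
proof -
  have b: "bilin H H V (\<lambda>a b. f a b \<oplus>\<^bsub>V\<^esub> k a b)"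
    by (rule bilinI; intro lin_add_fun bilin_1[OF f] bilin_2[OF f] bilin_1[OF g] bilin_2[OF g] V; assumption)
  show ?thesis unfolding sweedler_def
    by (rule T2.linear_maps_tensor_eqI[OF T2.tensor_lift_linear[OF b V]
          lin_add_fun[OF T2.tensor_lift_linear[OF f V] V T2.tensor_lift_linear[OF g V]] _ comult_closed[OF x]])
      (simp add: T2.tensor_lift_pure b f g V)
qed

end

context prebialg begin

text \<open>Two terms are what a skew-primitive \<open>f\<close> requires: the functional
  \<open>p f\<close> splits on a product into two summands.\<close>

lemma sw_mult_split2:
  assumes "kalg M" and f: "bilin H H M f1" "bilin H H M f2" and g: "bilin H H M g1" "bilin H H M g2" and h: "bilin H H M h"
    and x: "x \<in> carrier H" and y: "y \<in> carrier H"
    and eq: "\<And>a b a' b'. a \<in> carrier H \<Longrightarrow> b \<in> carrier H \<Longrightarrow> a' \<in> carrier H \<Longrightarrow> b' \<in> carrier H \<Longrightarrow>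
      h (a \<otimes> a') (b \<otimes> b') = f1 a b \<otimes>\<^bsub>M\<^esub> g1 a' b' \<oplus>\<^bsub>M\<^esub> f2 a b \<otimes>\<^bsub>M\<^esub> g2 a' b'"
  shows "sweedler H M h (x \<otimes> y) =
    sweedler H M f1 x \<otimes>\<^bsub>M\<^esub> sweedler H M g1 y \<oplus>\<^bsub>M\<^esub> sweedler H M f2 x \<otimes>\<^bsub>M\<^esub> sweedler H M g2 y"
proof -
  interpret M: kalg M by fact
  note V = M.vs_axioms
  have bm: "bilin H H M (\<lambda>a b. c \<otimes>\<^bsub>M\<^esub> k a b)" "bilin H H M (\<lambda>a b. k a b \<otimes>\<^bsub>M\<^esub> c)"
    if "bilin H H M k" "c \<in> carrier M" for k c
    by (rule bilinI; intro M.lin_mult_l M.lin_mult_r bilin_1[OF that(1)] bilin_2[OF that(1)] that(2); assumption)+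
  have 1: "sweedler H M (\<lambda>a' b'. h (a \<otimes> a') (b \<otimes> b')) y =
      f1 a b \<otimes>\<^bsub>M\<^esub> sweedler H M g1 y \<oplus>\<^bsub>M\<^esub> f2 a b \<otimes>\<^bsub>M\<^esub> sweedler H M g2 y"
    if ab: "a \<in> carrier H" "b \<in> carrier H" for a b
  proof -
    note c1 = bilin_closed[OF f(1) ab] and c2 = bilin_closed[OF f(2) ab]
    have "sweedler H M (\<lambda>a' b'. h (a \<otimes> a') (b \<otimes> b')) y =
        sweedler H M (\<lambda>a' b'. f1 a b \<otimes>\<^bsub>M\<^esub> g1 a' b' \<oplus>\<^bsub>M\<^esub> f2 a b \<otimes>\<^bsub>M\<^esub> g2 a' b') y"
      by (rule sw_cong[OF bilin_mult_l[OF h ab] V y]) (simp add: eq ab)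
    also have "\<dots> = sweedler H M (\<lambda>a' b'. f1 a b \<otimes>\<^bsub>M\<^esub> g1 a' b') y \<oplus>\<^bsub>M\<^esub> sweedler H M (\<lambda>a' b'. f2 a b \<otimes>\<^bsub>M\<^esub> g2 a' b') y"
      by (rule sw_add_fun[OF bm(1)[OF g(1) c1] bm(1)[OF g(2) c2] V y])
    also have "\<dots> = f1 a b \<otimes>\<^bsub>M\<^esub> sweedler H M g1 y \<oplus>\<^bsub>M\<^esub> f2 a b \<otimes>\<^bsub>M\<^esub> sweedler H M g2 y"
      using sw_comp[OF g(1) V V M.lin_mult_r[OF lin_id c1] y] sw_comp[OF g(2) V V M.lin_mult_r[OF lin_id c2] y] by simp
    finally show ?thesis .
  qed
  note c1 = sw_closed[OF g(1) V y] and c2 = sw_closed[OF g(2) V y]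
  have "sweedler H M h (x \<otimes> y) = sweedler H M (\<lambda>a b. sweedler H M (\<lambda>a' b'. h (a \<otimes> a') (b \<otimes> b')) y) x"
    by (rule sw_mult[OF h V x y])
  also have "\<dots> = sweedler H M (\<lambda>a b. f1 a b \<otimes>\<^bsub>M\<^esub> sweedler H M g1 y \<oplus>\<^bsub>M\<^esub> f2 a b \<otimes>\<^bsub>M\<^esub> sweedler H M g2 y) x"
    by (rule sw_cong[OF bilin_sw_mult[OF h V y] V x 1])
  also have "\<dots> = sweedler H M (\<lambda>a b. f1 a b \<otimes>\<^bsub>M\<^esub> sweedler H M g1 y) x \<oplus>\<^bsub>M\<^esub> sweedler H M (\<lambda>a b. f2 a b \<otimes>\<^bsub>M\<^esub> sweedler H M g2 y) x"
    by (rule sw_add_fun[OF bm(2)[OF f(1) c1] bm(2)[OF f(2) c2] V x])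
  also have "\<dots> = sweedler H M f1 x \<otimes>\<^bsub>M\<^esub> sweedler H M g1 y \<oplus>\<^bsub>M\<^esub> sweedler H M f2 x \<otimes>\<^bsub>M\<^esub> sweedler H M g2 y"
    using sw_comp[OF f(1) V V M.lin_mult_l[OF lin_id c1] x] sw_comp[OF f(2) V V M.lin_mult_l[OF lin_id c2] x] by simp
  finally show ?thesis .
qed

end

context bialg begin

text \<open>\<open>rho\<close> and \<open>lam\<close> are the two hit actions of the dual algebra on
  \<open>H\<close>: a functional is applied to one leg of the coproduct. \<open>conv\<close> is the
  convolution product on functionals.\<close>

definition "rho h a = sweedler H H (\<lambda>x y. h y \<odot> x) a"
definition "lam h a = sweedler H H (\<lambda>x y. h x \<odot> y) a"
definition "conv h k a = sweedler H scalars (\<lambda>x y. h x * k y) a"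

lemma
  assumes "h \<in> linear_maps H scalars"
  shows rho_bilin: "bilin H H H (\<lambda>x y. h y \<odot> x)" and lam_bilin: "bilin H H H (\<lambda>x y. h x \<odot> y)"
  by (rule bilinI; intro lin_smult_scalar[OF assms] lin_smult_vec lin_id vs_axioms; assumption)+

lemma conv_bilin: "h \<in> linear_maps H scalars \<Longrightarrow> k \<in> linear_maps H scalars \<Longrightarrow> bilin H H scalars (\<lambda>x y. h x * k y)"
  by (rule bilinI; intro lin_times_l lin_times_r; assumption)

lemma rho_linear: "h \<in> linear_maps H scalars \<Longrightarrow> rho h \<in> linear_maps H H"
  and lam_linear: "h \<in> linear_maps H scalars \<Longrightarrow> lam h \<in> linear_maps H H"
  unfolding rho_def[abs_def] lam_def[abs_def] by (rule sw_linear[OF rho_bilin vs_axioms] sw_linear[OF lam_bilin vs_axioms]; assumption)+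

lemmas rho_closed = lin_closed[OF rho_linear] and lam_closed = lin_closed[OF lam_linear]

lemma
  assumes "vs Y" "a \<in> carrier H" "\<And>y. y \<in> carrier Y \<Longrightarrow> h y \<in> linear_maps H scalars"
    "\<And>a. a \<in> carrier H \<Longrightarrow> (\<lambda>y. h y a) \<in> linear_maps Y scalars"
  shows lin_rho: "(\<lambda>y. rho (h y) a) \<in> linear_maps Y H" and lin_lam: "(\<lambda>y. lam (h y) a) \<in> linear_maps Y H"
  unfolding rho_def lam_def
  by (rule sw_lin_param[OF assms(1) vs_axioms assms(2)];
      intro rho_bilin lam_bilin lin_smult_scalar assms(3,4) vs_axioms; assumption)+

lemma rho_cong: "h \<in> linear_maps H scalars \<Longrightarrow> a \<in> carrier H \<Longrightarrow> (\<And>x. x \<in> carrier H \<Longrightarrow> h x = k x) \<Longrightarrow> rho h a = rho k a"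
  and lam_cong: "h \<in> linear_maps H scalars \<Longrightarrow> a \<in> carrier H \<Longrightarrow> (\<And>x. x \<in> carrier H \<Longrightarrow> h x = k x) \<Longrightarrow> lam h a = lam k a"
  unfolding rho_def lam_def by (rule sw_cong[OF rho_bilin vs_axioms] sw_cong[OF lam_bilin vs_axioms]; simp)+

lemma rho_counit: "a \<in> carrier H \<Longrightarrow> rho (counit H) a = a"
  and lam_counit: "a \<in> carrier H \<Longrightarrow> lam (counit H) a = a"
  unfolding rho_def lam_def by (rule counit_right counit_left; assumption)+

lemma rho_conv:
  assumes h: "h \<in> linear_maps H scalars" and k: "k \<in> linear_maps H scalars" and a: "a \<in> carrier H"
  shows "rho (conv h k) a = rho h (rho k a)"
proof -
  let ?f = "\<lambda>a b c. (h b * k c) \<odot> a"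
  note V = vs_axioms
  have t: "trilin H H H H ?f"
    by (rule trilinI; intro lin_smult_vec lin_id lin_smult_scalar lin_times_l lin_times_r h k V; assumption)
  have "rho (conv h k) a = sweedler H H (\<lambda>x y. sweedler H H (\<lambda>b c. ?f x b c) y) a"
    unfolding rho_def
  proof (rule sw_cong[OF sw_lin12(2)[OF t V] V a, symmetric])
    fix x y assume xy: "x \<in> carrier H" "y \<in> carrier H"
    show "sweedler H H (\<lambda>b c. ?f x b c) y = conv h k y \<odot> x" unfolding conv_def
      by (rule sw_comp[OF conv_bilin[OF h k] vs_scalars V lin_smult_scalar[OF lin_id V xy(1)] xy(2), symmetric])
  qed
  also have "\<dots> = sweedler H H (\<lambda>y c. sweedler H H (\<lambda>a b. ?f a b c) y) a" by (rule sw_coassoc[OF t V a, symmetric])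
  also have "\<dots> = sweedler H H (\<lambda>x y. rho h (k y \<odot> x)) a"
  proof (rule sw_cong[OF sw_lin12(1)[OF t V] V a])
    fix y c assume yc: "y \<in> carrier H" "c \<in> carrier H"
    have "rho h (k c \<odot> y) = k c \<odot> rho h y" by (rule lin_smult[OF rho_linear[OF h] yc(1)])
    also have "\<dots> = sweedler H H (\<lambda>a b. k c \<odot> (h b \<odot> a)) y"
      unfolding rho_def
      by (rule sw_comp[OF rho_bilin[OF h] V V lin_smult_vec[OF lin_id V] yc(1)])
    also have "\<dots> = sweedler H H (\<lambda>a b. ?f a b c) y"
      by (rule sw_cong[OF trilin_bilin(3)[OF t yc(2)] V yc(1), symmetric]) (simp add: smult_smult mult.commute)
    finally show "sweedler H H (\<lambda>a b. ?f a b c) y = rho h (k c \<odot> y)" by simp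
  qed
  also have "\<dots> = rho h (rho k a)"
    unfolding rho_def[of k] by (rule sw_comp[OF rho_bilin[OF k] V V rho_linear[OF h] a, symmetric])
  finally show ?thesis .
qed

text \<open>Again coassociativity, but unlike \<open>rho\<close> the order of the functionals is
  reversed. In \<open>theta_mult\<close> the antimultiplicativity of the antipode undoes the
  reversal.\<close>

lemma lam_conv:
  assumes h: "h \<in> linear_maps H scalars" and k: "k \<in> linear_maps H scalars" and a: "a \<in> carrier H"
  shows "lam (conv h k) a = lam k (lam h a)"
proof -
  let ?f = "\<lambda>a b c. (h a * k b) \<odot> c"
  note V = vs_axioms
  have t: "trilin H H H H ?f"
    by (rule trilinI; intro lin_smult_vec lin_id lin_smult_scalar lin_times_l lin_times_r h k V; assumption)
  have "lam (conv h k) a = sweedler H H (\<lambda>y c. sweedler H H (\<lambda>a b. ?f a b c) y) a"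
    unfolding lam_def
  proof (rule sw_cong[OF sw_lin12(1)[OF t V] V a, symmetric])
    fix y c assume yc: "y \<in> carrier H" "c \<in> carrier H"
    show "sweedler H H (\<lambda>a b. ?f a b c) y = conv h k y \<odot> c" unfolding conv_def
      by (rule sw_comp[OF conv_bilin[OF h k] vs_scalars V lin_smult_scalar[OF lin_id V yc(2)] yc(1), symmetric])
  qed
  also have "\<dots> = sweedler H H (\<lambda>x y. sweedler H H (\<lambda>b c. ?f x b c) y) a" by (rule sw_coassoc[OF t V a])
  also have "\<dots> = sweedler H H (\<lambda>x y. lam k (h x \<odot> y)) a"
  proof (rule sw_cong[OF sw_lin12(2)[OF t V] V a])
    fix x y assume xy: "x \<in> carrier H" "y \<in> carrier H"
    have "lam k (h x \<odot> y) = h x \<odot> lam k y" by (rule lin_smult[OF lam_linear[OF k] xy(2)])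
    also have "\<dots> = sweedler H H (\<lambda>a b. h x \<odot> (k a \<odot> b)) y"
      unfolding lam_def
      by (rule sw_comp[OF lam_bilin[OF k] V V lin_smult_vec[OF lin_id V] xy(2)])
    also have "\<dots> = sweedler H H (\<lambda>b c. ?f x b c) y"
      by (rule sw_cong[OF trilin_bilin(1)[OF t xy(1)] V xy(2), symmetric]) (simp add: smult_smult)
    finally show "sweedler H H (\<lambda>b c. ?f x b c) y = lam k (h x \<odot> y)" by simp
  qed
  also have "\<dots> = lam k (lam h a)"
    unfolding lam_def[of h] by (rule sw_comp[OF lam_bilin[OF h] V V lam_linear[OF k] a, symmetric])
  finally show ?thesis .
qed

text \<open>The functionals act on different legs, hence commute by coassociativity. The second
  claim recognises the composite as the threefold sum in the product of the double; \<open>G\<close>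
  is whatever is done with the middle leg.\<close>

lemma
  assumes h: "h \<in> linear_maps H scalars" and k: "k \<in> linear_maps H scalars" and a: "a \<in> carrier H"
  shows rho_lam: "rho k (lam h a) = lam h (rho k a)"
    and rho_lam_sweedler3: "G \<in> linear_maps H V \<Longrightarrow> vs V \<Longrightarrow>
      G (rho k (lam h a)) = sweedler3 H V (\<lambda>x y z. (h x * k z) \<odot>\<^bsub>V\<^esub> G y) a"
proof -
  have t: "trilin H H H V (\<lambda>x y z. (h x * k z) \<odot>\<^bsub>V\<^esub> G y)" if "G \<in> linear_maps H V" "vs V"
    for V :: "('k, 'z, 'y) module_scheme" and G
    by (rule trilinI; intro lin_smult_vec lin_smult_scalar lin_times_l lin_times_r h k that lin_closed[OF that(1)]; assumption)
  have G: "G (lam h (rho k a)) = sweedler H V (\<lambda>y c. sweedler H V (\<lambda>a b. (h a * k c) \<odot>\<^bsub>V\<^esub> G b) y) a"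
    if G: "G \<in> linear_maps H V" and V: "vs V" for V :: "('k, 'z, 'y) module_scheme" and G
  proof -
    note t = t[OF G V] and GL = lin_comp[OF lam_linear[OF h] G]
    have "G (lam h (rho k a)) = sweedler H V (\<lambda>x y. G (lam h (k y \<odot> x))) a"
      unfolding rho_def[of k] by (rule sw_comp[OF rho_bilin[OF k] vs_axioms V GL a])
    also have "\<dots> = sweedler H V (\<lambda>y c. sweedler H V (\<lambda>a b. (h a * k c) \<odot>\<^bsub>V\<^esub> G b) y) a"
    proof (rule sw_cong[OF sw_lin12(1)[OF t V] V a, symmetric])
      fix y c assume yc: "y \<in> carrier H" "c \<in> carrier H"
      have "G (lam h (k c \<odot> y)) = G (k c \<odot> lam h y)" by (simp only: lin_smult[OF lam_linear[OF h] yc(1)])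
      also have "\<dots> = sweedler H V (\<lambda>a b. G (k c \<odot> (h a \<odot> b))) y"
        unfolding lam_def
        by (rule sw_comp[OF lam_bilin[OF h] vs_axioms V lin_comp[OF lin_smult_vec[OF lin_id vs_axioms] G] yc(1)])
      also have "\<dots> = sweedler H V (\<lambda>a b. (h a * k c) \<odot>\<^bsub>V\<^esub> G b) y"
        by (rule sw_cong[OF trilin_bilin(3)[OF t yc(2)] V yc(1), symmetric])
          (simp add: smult_smult lin_smult[OF G] mult.commute)
      finally show "sweedler H V (\<lambda>a b. (h a * k c) \<odot>\<^bsub>V\<^esub> G b) y = G (lam h (k c \<odot> y))" by simp
    qed
    finally show ?thesis .
  qed
  note t' = t[OF lin_id vs_axioms]
  have "rho k (lam h a) = sweedler H H (\<lambda>x y. rho k (h x \<odot> y)) a"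
    unfolding lam_def[of h] by (rule sw_comp[OF lam_bilin[OF h] vs_axioms vs_axioms rho_linear[OF k] a])
  also have "\<dots> = sweedler H H (\<lambda>x y. sweedler H H (\<lambda>b c. (h x * k c) \<odot> b) y) a"
  proof (rule sw_cong[OF sw_lin12(2)[OF t' vs_axioms] vs_axioms a, symmetric])
    fix x y assume xy: "x \<in> carrier H" "y \<in> carrier H"
    have "rho k (h x \<odot> y) = h x \<odot> rho k y" by (rule lin_smult[OF rho_linear[OF k] xy(2)])
    also have "\<dots> = sweedler H H (\<lambda>b c. h x \<odot> (k c \<odot> b)) y"
      unfolding rho_def
      by (rule sw_comp[OF rho_bilin[OF k] vs_axioms vs_axioms lin_smult_vec[OF lin_id vs_axioms] xy(2)])
    also have "\<dots> = sweedler H H (\<lambda>b c. (h x * k c) \<odot> b) y"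
      by (rule sw_cong[OF trilin_bilin(1)[OF t' xy(1)] vs_axioms xy(2), symmetric]) (simp add: smult_smult)
    finally show "sweedler H H (\<lambda>b c. (h x * k c) \<odot> b) y = rho k (h x \<odot> y)" by simp
  qed
  also have "\<dots> = sweedler H H (\<lambda>y c. sweedler H H (\<lambda>a b. (h a * k c) \<odot> b) y) a"
    by (rule sw_coassoc[OF t' vs_axioms a, symmetric])
  also have "\<dots> = lam h (rho k a)" by (rule G[OF lin_id vs_axioms, symmetric])
  finally show 1: "rho k (lam h a) = lam h (rho k a)" .
  show "G (rho k (lam h a)) = sweedler3 H V (\<lambda>x y z. (h x * k z) \<odot>\<^bsub>V\<^esub> G y) a" if "G \<in> linear_maps H V" "vs V"
    unfolding 1 sweedler3_def by (rule G[OF that])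
qed

text \<open>The module algebra property: on a product \<open>h\<close> acts through its own
  coproduct, which is described by the splitting of \<open>h\<close> on products.\<close>

lemma
  assumes h: "h \<in> linear_maps H scalars" "k1 \<in> linear_maps H scalars" "k1' \<in> linear_maps H scalars"
      "k2 \<in> linear_maps H scalars" "k2' \<in> linear_maps H scalars"
    and a: "a \<in> carrier H" "a' \<in> carrier H"
    and eq: "\<And>y y'. y \<in> carrier H \<Longrightarrow> y' \<in> carrier H \<Longrightarrow> h (y \<otimes> y') = k1 y * k1' y' + k2 y * k2' y'"
  shows rho_mult2: "rho h (a \<otimes> a') = rho k1 a \<otimes> rho k1' a' \<oplus> rho k2 a \<otimes> rho k2' a'"
    and lam_mult2: "lam h (a \<otimes> a') = lam k1 a \<otimes> lam k1' a' \<oplus> lam k2 a \<otimes> lam k2' a'"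
  unfolding rho_def lam_def
  by (rule sw_mult_split2[OF kalg_axioms] ; (intro rho_bilin lam_bilin h a)?;
      (simp add: eq smult_add_l mult_smult_l mult_smult_r smult_smult mult.commute)?)+

lemma
  assumes h: "h \<in> linear_maps H scalars" and a: "a \<in> carrier H" "a' \<in> carrier H"
    and eq: "\<And>y y'. y \<in> carrier H \<Longrightarrow> y' \<in> carrier H \<Longrightarrow> h (y \<otimes> y') = h y * h y'"
  shows rho_mult: "rho h (a \<otimes> a') = rho h a \<otimes> rho h a'" and lam_mult: "lam h (a \<otimes> a') = lam h a \<otimes> lam h a'"
  unfolding rho_def lam_def
  by (rule sw_mult_split[OF kalg_axioms] ; (intro rho_bilin lam_bilin h a)?;
      (simp add: eq mult_smult_l mult_smult_r smult_smult mult.commute)?)+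

lemma
  assumes h: "h \<in> linear_maps H scalars" and a: "comult H a = pure_tensor H H a a" "a \<in> carrier H"
  shows rho_grouplike: "rho h a = h a \<odot> a" and lam_grouplike: "lam h a = h a \<odot> a"
  unfolding rho_def lam_def using sw_pure[OF a(1) rho_bilin[OF h] vs_axioms a(2,2)] sw_pure[OF a(1) lam_bilin[OF h] vs_axioms a(2,2)] by simp_all

lemma
  assumes h: "h \<in> linear_maps H scalars" and x: "comult H x = pure_tensor H H x s \<oplus>\<^bsub>tensor_module H H\<^esub> pure_tensor H H t x"
    and c: "x \<in> carrier H" "s \<in> carrier H" "t \<in> carrier H"
  shows rho_skew: "rho h x = h s \<odot> x \<oplus> h x \<odot> t" and lam_skew: "lam h x = h x \<odot> s \<oplus> h t \<odot> x"
  unfolding rho_def lam_def using sw_pure2[OF x rho_bilin[OF h] vs_axioms c(1,2,3,1)] sw_pure2[OF x lam_bilin[OF h] vs_axioms c(1,2,3,1)] by simp_all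

end

lemma linear_maps_EndI:
  assumes "vs Y" "vs V" "\<And>y. y \<in> carrier Y \<Longrightarrow> f y \<in> carrier (End_alg V)"
    "\<And>v. v \<in> carrier V \<Longrightarrow> (\<lambda>y. f y v) \<in> linear_maps Y V"
  shows "f \<in> linear_maps Y (End_alg V)"
proof (rule linear_mapsI)
  interpret Y: vs Y by fact
  interpret En: kalg "End_alg V" by (rule kalg_End) fact
  fix x assume x: "x \<in> carrier Y"
  show "f (k \<odot>\<^bsub>Y\<^esub> x) = k \<odot>\<^bsub>End_alg V\<^esub> f x" for k
    by (rule End_alg_eqI[where V = V]) (use x in \<open>simp_all add: assms(3) End_alg_apply lin_smult[OF assms(4)]\<close>)
  fix y assume y: "y \<in> carrier Y"
  show "f (x \<oplus>\<^bsub>Y\<^esub> y) = f x \<oplus>\<^bsub>End_alg V\<^esub> f y"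
    by (rule End_alg_eqI[where V = V]) (use x y in \<open>simp_all add: assms(3) End_alg_apply lin_add[OF assms(4)]\<close>)
qed (rule assms(3))

subsection \<open>The action of the double on the tensor product\<close>

text \<open>The compatibility of \<open>p\<close> with units is no part of
  \<open>skew_dual_pairing\<close>; for the Borel subalgebras it is derived from the values on
  generators. Of the antipode of \<open>B\<close> only antimultiplicativity and compatibility with
  unit and counit are recorded.\<close>

locale skew_pairing = A: bialg A + B: bialg B
  for A :: "('k::field, 'a, 'm) hopf_scheme" and B :: "('k, 'b, 'n) hopf_scheme" +
  fixes p :: "'b \<Rightarrow> 'a \<Rightarrow> 'k"
  assumes pairing: "skew_dual_pairing A B p"
    and p_one_l: "a \<in> carrier A \<Longrightarrow> p \<one>\<^bsub>B\<^esub> a = counit A a" and p_one_r: "b \<in> carrier B \<Longrightarrow> p b \<one>\<^bsub>A\<^esub> = counit B b"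
    and S_linear: "antipode B \<in> linear_maps B B" and S_one: "antipode B \<one>\<^bsub>B\<^esub> = \<one>\<^bsub>B\<^esub>"
    and S_mult: "b \<in> carrier B \<Longrightarrow> b' \<in> carrier B \<Longrightarrow> antipode B (b \<otimes>\<^bsub>B\<^esub> b') = antipode B b' \<otimes>\<^bsub>B\<^esub> antipode B b"
    and S_counit: "b \<in> carrier B \<Longrightarrow> counit B (antipode B b) = counit B b"
begin

sublocale AB: tensor A B ..

abbreviation "T \<equiv> tensor_module A B"
abbreviation "En \<equiv> End_alg T"
abbreviation "pt \<equiv> pure_tensor A B"
abbreviation "S\<^sub>B \<equiv> antipode B"

sublocale En: kalg En by (rule kalg_End[OF AB.vs_tensor])

lemma S_closed: "b \<in> carrier B \<Longrightarrow> S\<^sub>B b \<in> carrier B" by (rule lin_closed[OF S_linear])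

lemma p_lin_1: "b \<in> carrier B \<Longrightarrow> p b \<in> linear_maps A scalars"
  and p_lin_2: "a \<in> carrier A \<Longrightarrow> (\<lambda>b. p b a) \<in> linear_maps B scalars"
  and p_mult_l: "b \<in> carrier B \<Longrightarrow> a \<in> carrier A \<Longrightarrow> a' \<in> carrier A \<Longrightarrow>
    p b (a \<otimes>\<^bsub>A\<^esub> a') = sweedler B scalars (\<lambda>b1 b2. p b1 a' * p b2 a) b"
  and p_mult_r: "b \<in> carrier B \<Longrightarrow> b' \<in> carrier B \<Longrightarrow> a \<in> carrier A \<Longrightarrow> p (b \<otimes>\<^bsub>B\<^esub> b') a = A.conv (p b) (p b') a"
  using pairing by (auto simp: skew_dual_pairing_def A.conv_def)

lemma p_bilin: "a \<in> carrier A \<Longrightarrow> a' \<in> carrier A \<Longrightarrow> bilin B B scalars (\<lambda>b1 b2. p b1 a' * p b2 a)"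
  by (rule bilinI; intro lin_times_l lin_times_r p_lin_2; assumption)

text \<open>For \<open>b\<close> and \<open>c\<close> the outer legs of an element of
  \<open>B\<close>, this is
  \<open>\<Sum> \<langle>S(b), a1\<rangle> \<langle>c, a3\<rangle> a2\<close>, the part in
  \<open>A\<close> of the commutation rule.\<close>

definition "theta b c a = A.rho (p c) (A.lam (p (S\<^sub>B b)) a)"

lemma theta_linear: "b \<in> carrier B \<Longrightarrow> c \<in> carrier B \<Longrightarrow> theta b c \<in> linear_maps A A"
  unfolding theta_def[abs_def]
  by (rule lin_comp[OF A.lam_linear A.rho_linear]) (simp_all add: p_lin_1 S_closed)

lemma theta_closed: "b \<in> carrier B \<Longrightarrow> c \<in> carrier B \<Longrightarrow> a \<in> carrier A \<Longrightarrow> theta b c a \<in> carrier A"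
  by (rule lin_closed[OF theta_linear])

lemma theta_lin_1: "c \<in> carrier B \<Longrightarrow> a \<in> carrier A \<Longrightarrow> (\<lambda>b. theta b c a) \<in> linear_maps B A"
  unfolding theta_def
  by (rule lin_comp[OF A.lin_lam[OF B.vs_axioms] A.rho_linear])
    (simp_all add: p_lin_1 S_closed lin_comp[OF S_linear p_lin_2])

lemma theta_lin_2: "b \<in> carrier B \<Longrightarrow> a \<in> carrier A \<Longrightarrow> (\<lambda>c. theta b c a) \<in> linear_maps B A"
  unfolding theta_def
  by (rule A.lin_rho[OF B.vs_axioms A.lam_closed]) (simp_all add: p_lin_1 S_closed p_lin_2)

text \<open>\<open>rho\<close> is a left action, and \<open>lam\<close> composed with the antipode
  becomes one; since the two commute, their composites multiply in the same order.\<close>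

lemma theta_mult:
  assumes c: "b \<in> carrier B" "b' \<in> carrier B" "c \<in> carrier B" "c' \<in> carrier B" "a \<in> carrier A"
  shows "theta (b \<otimes>\<^bsub>B\<^esub> b') (c \<otimes>\<^bsub>B\<^esub> c') a = theta b c (theta b' c' a)"
proof -
  note s = S_closed[OF c(1)] S_closed[OF c(2)]
  note lin = p_lin_1[OF s(1)] p_lin_1[OF s(2)] p_lin_1[OF c(3)] p_lin_1[OF c(4)]
  have "A.lam (p (S\<^sub>B (b \<otimes>\<^bsub>B\<^esub> b'))) a = A.lam (p (S\<^sub>B b)) (A.lam (p (S\<^sub>B b')) a)"
    unfolding S_mult[OF c(1,2)] A.lam_conv[OF lin(2,1) c(5), symmetric]
    by (rule A.lam_cong) (simp_all add: c s p_lin_1 p_mult_r)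
  moreover have "A.rho (p (c \<otimes>\<^bsub>B\<^esub> c')) x = A.rho (p c) (A.rho (p c') x)" if "x \<in> carrier A" for x
    unfolding A.rho_conv[OF lin(3,4) that, symmetric]
    by (rule A.rho_cong) (simp_all add: c that p_lin_1 p_mult_r)
  ultimately show ?thesis
    unfolding theta_def by (simp add: A.lam_closed lin c A.rho_lam A.rho_closed)
qed

lemma theta_one: "a \<in> carrier A \<Longrightarrow> theta \<one>\<^bsub>B\<^esub> \<one>\<^bsub>B\<^esub> a = a"
proof -
  assume a: "a \<in> carrier A"
  have "A.lam (p \<one>\<^bsub>B\<^esub>) a = A.lam (counit A) a" "A.rho (p \<one>\<^bsub>B\<^esub>) a = A.rho (counit A) a"
    by (rule A.lam_cong A.rho_cong; simp add: a p_lin_1 p_one_l)+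
  then show ?thesis by (simp add: theta_def S_one a A.lam_counit A.rho_counit)
qed

text \<open>The operator of the commutation rule with the three legs of an element of
  \<open>B\<close> made independent. In this generality multiplicativity is a direct check on pure
  tensors (\<open>Th_mult\<close>), before any coproduct is taken.\<close>

definition "Th a b c = restrict (tensor_lift T (\<lambda>x y. pt (theta a c x) (b \<otimes>\<^bsub>B\<^esub> y))) (carrier T)"

lemma Th_bilin: "a \<in> carrier B \<Longrightarrow> b \<in> carrier B \<Longrightarrow> c \<in> carrier B \<Longrightarrow> bilin A B T (\<lambda>x y. pt (theta a c x) (b \<otimes>\<^bsub>B\<^esub> y))"
  by (rule bilinI; intro AB.lin_pure_l AB.lin_pure_r theta_linear[THEN lin_comp[OF lin_id]] B.lin_mult_r lin_id theta_closed B.m_closed; assumption)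

lemma Th_closed: "a \<in> carrier B \<Longrightarrow> b \<in> carrier B \<Longrightarrow> c \<in> carrier B \<Longrightarrow> Th a b c \<in> carrier En"
  unfolding Th_def by (rule End_alg_carrierI[OF AB.vs_tensor AB.tensor_lift_linear[OF Th_bilin AB.vs_tensor]])

lemma Th_pure: "a \<in> carrier B \<Longrightarrow> b \<in> carrier B \<Longrightarrow> c \<in> carrier B \<Longrightarrow> x \<in> carrier A \<Longrightarrow> y \<in> carrier B \<Longrightarrow>
    Th a b c (pt x y) = pt (theta a c x) (b \<otimes>\<^bsub>B\<^esub> y)"
  by (simp add: Th_def AB.tensor_lift_pure[OF Th_bilin])

lemma Th_trilin: "trilin B B B En Th"
proof (rule trilinI; rule linear_maps_EndI[OF B.vs_axioms AB.vs_tensor])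
  fix \<xi> assume \<xi>: "\<xi> \<in> carrier T"
  note P = AB.tensor_lift_param[OF B.vs_axioms AB.vs_tensor \<xi>]
  fix a b c
  show "(\<lambda>a. Th a b c \<xi>) \<in> linear_maps B T" if "b \<in> carrier B" "c \<in> carrier B"
    using P[of "\<lambda>a x y. pt (theta a c x) (b \<otimes>\<^bsub>B\<^esub> y)"] that \<xi>
    by (simp add: Th_def Th_bilin AB.lin_pure_l theta_lin_1)
  show "(\<lambda>b. Th a b c \<xi>) \<in> linear_maps B T" if "a \<in> carrier B" "c \<in> carrier B"
    using P[of "\<lambda>b x y. pt (theta a c x) (b \<otimes>\<^bsub>B\<^esub> y)"] that \<xi>
    by (simp add: Th_def Th_bilin AB.lin_pure_r B.lin_mult_l lin_id theta_closed)
  show "(\<lambda>c. Th a b c \<xi>) \<in> linear_maps B T" if "a \<in> carrier B" "b \<in> carrier B"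
    using P[of "\<lambda>c x y. pt (theta a c x) (b \<otimes>\<^bsub>B\<^esub> y)"] that \<xi>
    by (simp add: Th_def Th_bilin AB.lin_pure_l theta_lin_2)
qed (rule Th_closed; assumption)+

lemma End_eq_pureI:
  assumes "f \<in> carrier En" "h \<in> carrier En" "\<And>x y. x \<in> carrier A \<Longrightarrow> y \<in> carrier B \<Longrightarrow> f (pt x y) = h (pt x y)"
  shows "f = h"
  by (rule End_alg_eqI[OF assms(1,2)])
    (rule AB.linear_maps_tensor_eqI[OF End_alg_linear[OF assms(1)] End_alg_linear[OF assms(2)] assms(3)])

lemma Th_mult:
  assumes "a \<in> carrier B" "b \<in> carrier B" "c \<in> carrier B" "a' \<in> carrier B" "b' \<in> carrier B" "c' \<in> carrier B"
  shows "Th (a \<otimes>\<^bsub>B\<^esub> a') (b \<otimes>\<^bsub>B\<^esub> b') (c \<otimes>\<^bsub>B\<^esub> c') = Th a b c \<otimes>\<^bsub>En\<^esub> Th a' b' c'"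
  by (rule End_eq_pureI)
    (use assms in \<open>simp_all add: Th_closed Th_pure End_alg_apply theta_mult theta_closed B.m_assoc\<close>)

lemma Th_one: "Th \<one>\<^bsub>B\<^esub> \<one>\<^bsub>B\<^esub> \<one>\<^bsub>B\<^esub> = \<one>\<^bsub>En\<^esub>"
  by (rule End_eq_pureI) (simp_all add: Th_closed Th_pure End_alg_apply theta_one)

definition "R b = sweedler3 B En Th b"
definition "L a = restrict (tensor_lift T (\<lambda>x y. pt (a \<otimes>\<^bsub>A\<^esub> x) y)) (carrier T)"

lemmas En_vs = En.vs_axioms
lemmas Th_F = B.sw_lin12(1)[OF Th_trilin En_vs]

text \<open>\<open>R\<close> is the threefold coproduct followed by \<open>Th\<close>. Both are
  multiplicative, so two applications of \<open>sw_mult_split\<close> suffice, one for each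
  coproduct.\<close>

lemma R_hom: "R \<in> algebra_homs B En"
proof (rule algebra_homsI)
  show "R \<in> linear_maps B En" unfolding R_def[abs_def] sweedler3_def by (rule B.sw_linear[OF Th_F En_vs])
  show "R \<one>\<^bsub>B\<^esub> = \<one>\<^bsub>En\<^esub>" unfolding R_def sweedler3_def
    by (simp add: B.sw_one[OF Th_F En_vs] B.sw_one[OF trilin_bilin(3)[OF Th_trilin] En_vs] Th_one)
  fix x y assume xy: "x \<in> carrier B" "y \<in> carrier B"
  show "R (x \<otimes>\<^bsub>B\<^esub> y) = R x \<otimes>\<^bsub>En\<^esub> R y" unfolding R_def sweedler3_def
  proof (rule B.sw_mult_split[OF En.kalg_axioms Th_F Th_F Th_F xy])
    fix u c u' c' assume c: "u \<in> carrier B" "c \<in> carrier B" "u' \<in> carrier B" "c' \<in> carrier B"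
    show "sweedler B En (\<lambda>a b. Th a b (c \<otimes>\<^bsub>B\<^esub> c')) (u \<otimes>\<^bsub>B\<^esub> u') =
        sweedler B En (\<lambda>a b. Th a b c) u \<otimes>\<^bsub>En\<^esub> sweedler B En (\<lambda>a b. Th a b c') u'"
      by (rule B.sw_mult_split[OF En.kalg_axioms trilin_bilin(3)[OF Th_trilin] trilin_bilin(3)[OF Th_trilin] trilin_bilin(3)[OF Th_trilin]])
        (use c in \<open>simp_all add: Th_mult\<close>)
  qed
qed

lemma L_bilin: "a \<in> carrier A \<Longrightarrow> bilin A B T (\<lambda>x y. pt (a \<otimes>\<^bsub>A\<^esub> x) y)"
  by (rule bilinI; intro AB.lin_pure_l AB.lin_pure_r A.lin_mult_r lin_id A.m_closed; assumption)

lemma L_closed: "a \<in> carrier A \<Longrightarrow> L a \<in> carrier En"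
  unfolding L_def by (rule End_alg_carrierI[OF AB.vs_tensor AB.tensor_lift_linear[OF L_bilin AB.vs_tensor]])

lemma L_pure: "a \<in> carrier A \<Longrightarrow> x \<in> carrier A \<Longrightarrow> y \<in> carrier B \<Longrightarrow> L a (pt x y) = pt (a \<otimes>\<^bsub>A\<^esub> x) y"
  by (simp add: L_def AB.tensor_lift_pure[OF L_bilin])

lemma L_hom: "L \<in> algebra_homs A En"
proof (rule algebra_homsI)
  show "L \<in> linear_maps A En"
  proof (rule linear_maps_EndI[OF A.vs_axioms AB.vs_tensor L_closed])
    show "(\<lambda>a. L a \<xi>) \<in> linear_maps A T" if "\<xi> \<in> carrier T" for \<xi>
      using AB.tensor_lift_param[OF A.vs_axioms AB.vs_tensor that, of "\<lambda>a x y. pt (a \<otimes>\<^bsub>A\<^esub> x) y"] that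
      by (simp add: L_def L_bilin AB.lin_pure_l A.lin_mult_l lin_id)
  qed
  show "L \<one>\<^bsub>A\<^esub> = \<one>\<^bsub>En\<^esub>" by (rule End_eq_pureI) (simp_all add: L_closed L_pure End_alg_apply)
  show "L (x \<otimes>\<^bsub>A\<^esub> y) = L x \<otimes>\<^bsub>En\<^esub> L y" if "x \<in> carrier A" "y \<in> carrier A" for x y
    by (rule End_eq_pureI) (use that in \<open>simp_all add: L_closed L_pure End_alg_apply A.m_assoc\<close>)
qed

lemma R_closed: "b \<in> carrier B \<Longrightarrow> R b \<in> carrier En" by (rule alg_closed[OF R_hom])

lemma R_linear: "b \<in> carrier B \<Longrightarrow> R b \<in> linear_maps T T" by (rule End_alg_linear[OF R_closed])

lemma L_linear: "a \<in> carrier A \<Longrightarrow> L a \<in> linear_maps T T" by (rule End_alg_linear[OF L_closed])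

text \<open>Evaluation at a pure tensor followed by \<open>G\<close> is linear on operators and so
  passes under the threefold sum. Besides the identity, \<open>G\<close> will be the operator
  \<open>L a\<close>.\<close>

lemma R_pure_comp:
  assumes b: "b \<in> carrier B" and x: "x \<in> carrier A" and y: "y \<in> carrier B" and G: "G \<in> linear_maps T V" "vs V"
  shows "G (R b (pt x y)) = sweedler3 B V (\<lambda>b1 b2 b3. G (pt (theta b1 b3 x) (b2 \<otimes>\<^bsub>B\<^esub> y))) b"
proof -
  let ?e = "\<lambda>f. G (f (pt x y))"
  have xy: "pt x y \<in> carrier T" using x y by simp
  have e: "?e \<in> linear_maps En V"
    by (rule lin_comp[OF _ G(1)], rule linear_mapsI)
      (use xy in \<open>simp_all add: End_alg_apply lin_closed[OF End_alg_linear]\<close>)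
  have inner: "sweedler B V (\<lambda>a b. ?e (Th a b c)) u = sweedler B V (\<lambda>b1 b2. G (pt (theta b1 c x) (b2 \<otimes>\<^bsub>B\<^esub> y))) u"
    if "u \<in> carrier B" "c \<in> carrier B" for u c
    by (rule B.sw_cong[OF _ G(2) that(1)], rule bilinI;
        (rule lin_comp[OF trilin_linear(1)[OF Th_trilin] e] lin_comp[OF trilin_linear(2)[OF Th_trilin] e])?)
      (use that x y in \<open>simp_all add: Th_pure\<close>)
  have bl: "bilin B B V (\<lambda>u c. ?e (sweedler B En (\<lambda>a b. Th a b c) u))"
    by (rule bilinI; rule lin_comp[OF bilin_1[OF Th_F] e] lin_comp[OF bilin_2[OF Th_F] e]; assumption)
  have "G (R b (pt x y)) = sweedler B V (\<lambda>u c. ?e (sweedler B En (\<lambda>a b. Th a b c) u)) b"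
    unfolding R_def sweedler3_def by (rule B.sw_comp[OF Th_F En_vs G(2) e b])
  also have "\<dots> = sweedler3 B V (\<lambda>b1 b2 b3. G (pt (theta b1 b3 x) (b2 \<otimes>\<^bsub>B\<^esub> y))) b"
    unfolding sweedler3_def
    by (rule B.sw_cong[OF bl G(2) b])
      (simp add: B.sw_comp[OF trilin_bilin(3)[OF Th_trilin] En_vs G(2) e] inner)
  finally show ?thesis .
qed

text \<open>The link to the double: its product by \<open>a \<otimes> b\<close> from the left is the
  operator \<open>L a\<close> after \<open>R b\<close>. The innermost sum over the legs of
  \<open>a'\<close> is \<open>theta\<close>, by \<open>rho_lam_sweedler3\<close>.\<close>

lemma double_mult_eq:
  assumes \<xi>: "\<xi> \<in> carrier T" and \<eta>: "\<eta> \<in> carrier T"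
  shows "double_mult A B p \<xi> \<eta> = tensor_lift T (\<lambda>a b. L a (R b \<eta>)) \<xi>"
proof -
  have inner: "sweedler3 B T (\<lambda>b1 b2 b3. sweedler3 A T (\<lambda>a1 a2 a3.
          (p (S\<^sub>B b1) a1 * p b3 a3) \<odot>\<^bsub>T\<^esub> pt (a \<otimes>\<^bsub>A\<^esub> a2) (b2 \<otimes>\<^bsub>B\<^esub> b')) a') b = L a (R b (pt a' b'))"
    if c: "a \<in> carrier A" "b \<in> carrier B" "a' \<in> carrier A" "b' \<in> carrier B" for a b a' b'
  proof -
    let ?G = "\<lambda>b1 b2 b3. pt (a \<otimes>\<^bsub>A\<^esub> theta b1 b3 a') (b2 \<otimes>\<^bsub>B\<^esub> b')"
    have eq: "sweedler3 A T (\<lambda>a1 a2 a3. (p (S\<^sub>B b1) a1 * p b3 a3) \<odot>\<^bsub>T\<^esub> pt (a \<otimes>\<^bsub>A\<^esub> a2) (b2 \<otimes>\<^bsub>B\<^esub> b')) a' = ?G b1 b2 b3"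
      if d: "b1 \<in> carrier B" "b2 \<in> carrier B" "b3 \<in> carrier B" for b1 b2 b3
      unfolding theta_def
      by (rule A.rho_lam_sweedler3[symmetric, OF p_lin_1[OF S_closed[OF d(1)]] p_lin_1[OF d(3)] c(3) _ AB.vs_tensor])
        (intro AB.lin_pure_l A.lin_mult_r lin_id c B.m_closed d)
    have t: "trilin B B B T ?G"
      by (rule trilinI; intro AB.lin_pure_l AB.lin_pure_r A.lin_mult_r B.lin_mult_l lin_id theta_lin_1 theta_lin_2
          c A.m_closed B.m_closed theta_closed; assumption)
    have G: "L a (pt (theta b1 b3 a') (b2 \<otimes>\<^bsub>B\<^esub> b')) = ?G b1 b2 b3"
      if "b1 \<in> carrier B" "b2 \<in> carrier B" "b3 \<in> carrier B" for b1 b2 b3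
      using that c by (simp add: L_pure theta_closed)
    have cg: "sweedler3 B T h b = sweedler3 B T ?G b" if h: "\<And>b1 b2 b3. b1 \<in> carrier B \<Longrightarrow> b2 \<in> carrier B \<Longrightarrow> b3 \<in> carrier B \<Longrightarrow>
      h b1 b2 b3 = ?G b1 b2 b3" for h
      unfolding sweedler3_def
      by (rule B.sw_cong[OF B.sw_lin12(1)[OF t AB.vs_tensor] AB.vs_tensor c(2), symmetric],
          rule B.sw_cong[OF trilin_bilin(3)[OF t] AB.vs_tensor]) (simp_all add: h)
    show ?thesis
      unfolding R_pure_comp[OF c(2,3,4) L_linear[OF c(1)] AB.vs_tensor]
      using cg[of "\<lambda>b1 b2 b3. L a (pt (theta b1 b3 a') (b2 \<otimes>\<^bsub>B\<^esub> b'))", OF G]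
        cg[of "\<lambda>b1 b2 b3. sweedler3 A T (\<lambda>a1 a2 a3. (p (S\<^sub>B b1) a1 * p b3 a3) \<odot>\<^bsub>T\<^esub> pt (a \<otimes>\<^bsub>A\<^esub> a2) (b2 \<otimes>\<^bsub>B\<^esub> b')) a'", OF eq]
      by simp
  qed
  have lr: "(\<lambda>\<eta>. L a (R b \<eta>)) \<in> linear_maps T T" if "a \<in> carrier A" "b \<in> carrier B" for a b
    by (rule lin_comp[OF R_linear L_linear]) fact+
  have mid: "tensor_lift T (\<lambda>a' b'. sweedler3 B T (\<lambda>b1 b2 b3. sweedler3 A T (\<lambda>a1 a2 a3.
          (p (S\<^sub>B b1) a1 * p b3 a3) \<odot>\<^bsub>T\<^esub> pt (a \<otimes>\<^bsub>A\<^esub> a2) (b2 \<otimes>\<^bsub>B\<^esub> b')) a') b) \<eta> = L a (R b \<eta>)"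
    if c: "a \<in> carrier A" "b \<in> carrier B" for a b
  proof -
    have bp: "bilin A B T (\<lambda>a' b'. L a (R b (pt a' b')))"
      by (rule bilinI; rule lin_comp[OF _ lr[OF c]]; intro AB.lin_pure_l AB.lin_pure_r lin_id; assumption)
    have "tensor_lift T (\<lambda>a' b'. L a (R b (pt a' b'))) \<eta> = L a (R b \<eta>)"
      by (rule AB.linear_maps_tensor_eqI[OF AB.tensor_lift_linear[OF bp AB.vs_tensor] lr[OF c] _ \<eta>])
        (simp add: AB.tensor_lift_pure[OF bp])
    moreover have "tensor_lift T (\<lambda>a' b'. L a (R b (pt a' b'))) \<eta> = tensor_lift T (\<lambda>a' b'. sweedler3 B T (\<lambda>b1 b2 b3. sweedler3 A T (\<lambda>a1 a2 a3.
          (p (S\<^sub>B b1) a1 * p b3 a3) \<odot>\<^bsub>T\<^esub> pt (a \<otimes>\<^bsub>A\<^esub> a2) (b2 \<otimes>\<^bsub>B\<^esub> b')) a') b) \<eta>"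
      by (rule AB.tensor_lift_cong[OF bp AB.vs_tensor _ \<eta>]) (rule inner[OF c, symmetric])
    ultimately show ?thesis by simp
  qed
  have bLR: "bilin A B T (\<lambda>a b. L a (R b \<eta>))"
  proof (rule bilinI)
    show "(\<lambda>b. L a (R b \<eta>)) \<in> linear_maps B T" if "a \<in> carrier A" for a
      by (rule lin_comp[OF _ L_linear[OF that]], rule linear_mapsI)
        (simp_all add: \<eta> lin_closed[OF R_linear] alg_add[OF R_hom] alg_smult[OF R_hom] End_alg_apply)
    show "(\<lambda>a. L a (R b \<eta>)) \<in> linear_maps A T" if "b \<in> carrier B" for b
      by (rule linear_mapsI)
        (simp_all add: \<eta> lin_closed[OF R_linear[OF that]] lin_closed[OF L_linear] alg_add[OF L_hom] alg_smult[OF L_hom] End_alg_apply)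
  qed
  show ?thesis unfolding double_mult_def Let_def
    by (rule AB.tensor_lift_cong[OF bLR AB.vs_tensor _ \<xi>, symmetric]) (rule mid[symmetric])
qed

text \<open>Pairing with the unit of \<open>A\<close> is the counit, so both outer legs of
  \<open>b\<close> are contracted and the middle one becomes \<open>b\<close>. This value lets the
  action invert the multiplication map.\<close>

lemma R_one_one: "b \<in> carrier B \<Longrightarrow> R b (pt \<one>\<^bsub>A\<^esub> \<one>\<^bsub>B\<^esub>) = pt \<one>\<^bsub>A\<^esub> b"
proof -
  assume b: "b \<in> carrier B"
  note V = AB.vs_tensor and e = B.counit_linear
  have th: "theta b1 b3 \<one>\<^bsub>A\<^esub> = (counit B b1 * counit B b3) \<odot>\<^bsub>A\<^esub> \<one>\<^bsub>A\<^esub>" if "b1 \<in> carrier B" "b3 \<in> carrier B" for b1 b3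
    using that unfolding theta_def A.lam_def A.rho_def
    by (simp add: A.sw_one[OF A.lam_bilin A.vs_axioms] A.sw_one[OF A.rho_bilin A.vs_axioms]
        lin_smult[OF A.sw_linear[OF A.rho_bilin A.vs_axioms]] p_lin_1 S_closed p_one_r S_counit A.smult_smult)
  have l1: "(\<lambda>b. counit B c \<odot>\<^bsub>T\<^esub> pt \<one>\<^bsub>A\<^esub> b) \<in> linear_maps B T" for c
    by (intro lin_smult_vec AB.lin_pure_r lin_id V) simp
  have bl: "bilin B B T (\<lambda>a b. (counit B a * counit B c) \<odot>\<^bsub>T\<^esub> pt \<one>\<^bsub>A\<^esub> b)" for c
    by (rule bilinI; intro lin_smult_vec lin_smult_scalar lin_times_l e AB.lin_pure_r lin_id V AB.pure_closed A.one_closed; assumption)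
  have inner: "sweedler B T (\<lambda>b1 b2. pt (theta b1 c \<one>\<^bsub>A\<^esub>) (b2 \<otimes>\<^bsub>B\<^esub> \<one>\<^bsub>B\<^esub>)) y = counit B c \<odot>\<^bsub>T\<^esub> pt \<one>\<^bsub>A\<^esub> y"
    if "y \<in> carrier B" "c \<in> carrier B" for y c
  proof -
    have "sweedler B T (\<lambda>b1 b2. pt (theta b1 c \<one>\<^bsub>A\<^esub>) (b2 \<otimes>\<^bsub>B\<^esub> \<one>\<^bsub>B\<^esub>)) y =
        sweedler B T (\<lambda>a b. (counit B a * counit B c) \<odot>\<^bsub>T\<^esub> pt \<one>\<^bsub>A\<^esub> b) y"
      by (rule B.sw_cong[OF bl V that(1), symmetric]) (simp add: th that AB.pure_smult_l)
    also have "\<dots> = sweedler B T (\<lambda>a b. counit B a \<odot>\<^bsub>T\<^esub> (counit B c \<odot>\<^bsub>T\<^esub> pt \<one>\<^bsub>A\<^esub> b)) y"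
      by (rule B.sw_cong[OF bl V that(1)]) (simp add: vs.smult_smult[OF V])
    also have "\<dots> = counit B c \<odot>\<^bsub>T\<^esub> pt \<one>\<^bsub>A\<^esub> y" by (rule B.sw_counit_left[OF l1 V that(1)])
    finally show ?thesis .
  qed
  have l2: "(\<lambda>b. pt \<one>\<^bsub>A\<^esub> b) \<in> linear_maps B T" by (intro AB.lin_pure_r lin_id) simp
  have bl2: "bilin B B T (\<lambda>y c. counit B c \<odot>\<^bsub>T\<^esub> pt \<one>\<^bsub>A\<^esub> y)"
    by (rule bilinI; intro lin_smult_vec lin_smult_scalar e l2 V AB.pure_closed A.one_closed; assumption)
  have "R b (pt \<one>\<^bsub>A\<^esub> \<one>\<^bsub>B\<^esub>) = sweedler B T (\<lambda>y c. sweedler B T (\<lambda>b1 b2. pt (theta b1 c \<one>\<^bsub>A\<^esub>) (b2 \<otimes>\<^bsub>B\<^esub> \<one>\<^bsub>B\<^esub>)) y) b"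
    using R_pure_comp[OF b A.one_closed B.one_closed lin_id V] by (simp add: sweedler3_def)
  also have "\<dots> = sweedler B T (\<lambda>y c. counit B c \<odot>\<^bsub>T\<^esub> pt \<one>\<^bsub>A\<^esub> y) b"
    by (rule B.sw_cong[OF bl2 V b, symmetric]) (simp only: inner)
  also have "\<dots> = pt \<one>\<^bsub>A\<^esub> b" by (rule B.sw_counit_right[OF l2 V b])
  finally show ?thesis .
qed

end

section \<open>Commutation of the two actions on group-like and skew-primitive elements\<close>

context skew_pairing begin

lemma p_grouplike:
  assumes "w \<in> carrier B" "comult B w = pure_tensor B B w w" "a \<in> carrier A" "a' \<in> carrier A"
  shows "p w (a \<otimes>\<^bsub>A\<^esub> a') = p w a * p w a'"
  using B.sw_pure[OF assms(2) p_bilin[OF assms(3,4)] vs_scalars assms(1,1)] assms by (simp add: p_mult_l)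

lemma R_grouplike: "w \<in> carrier B \<Longrightarrow> comult B w = pure_tensor B B w w \<Longrightarrow> R w = Th w w w"
  by (simp add: R_def sweedler3_def B.sw_pure[OF _ Th_F En_vs] B.sw_pure[OF _ trilin_bilin(3)[OF Th_trilin] En_vs])

text \<open>The threefold coproduct of \<open>f\<close> has the terms
  \<open>f \<otimes> w \<otimes> w\<close>, \<open>1 \<otimes> f \<otimes> w\<close> and
  \<open>1 \<otimes> 1 \<otimes> f\<close>.\<close>

lemma R_skew:
  assumes f: "f \<in> carrier B" "w \<in> carrier B" "comult B f = pure_tensor B B f w \<oplus>\<^bsub>tensor_module B B\<^esub> pure_tensor B B \<one>\<^bsub>B\<^esub> f"
  shows "R f = (Th f w w \<oplus>\<^bsub>En\<^esub> Th \<one>\<^bsub>B\<^esub> f w) \<oplus>\<^bsub>En\<^esub> Th \<one>\<^bsub>B\<^esub> \<one>\<^bsub>B\<^esub> f"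
  unfolding R_def sweedler3_def B.sw_pure2[OF f(3) Th_F En_vs f(1,2) B.one_closed f(1)]
    B.sw_pure2[OF f(3) trilin_bilin(3)[OF Th_trilin f(2)] En_vs f(1,2) B.one_closed f(1)]
    B.sw_one[OF trilin_bilin(3)[OF Th_trilin f(1)] En_vs] ..

lemma theta_one_l: "c \<in> carrier B \<Longrightarrow> a \<in> carrier A \<Longrightarrow> theta \<one>\<^bsub>B\<^esub> c a = A.rho (p c) a"
proof -
  assume c: "c \<in> carrier B" "a \<in> carrier A"
  have "A.lam (p \<one>\<^bsub>B\<^esub>) a = A.lam (counit A) a" by (rule A.lam_cong) (simp_all add: c p_lin_1 p_one_l)
  then show ?thesis using c by (simp add: theta_def S_one A.lam_counit)
qed

text \<open>In the application \<open>w\<close> and \<open>w'\<close> are \<open>\<omega>'_i\<close>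
  and its inverse, in either order, and \<open>t\<close> is some \<open>\<omega>_j\<close> or its
  inverse. Further on, \<open>e\<close> is \<open>e_j\<close> and \<open>f\<close> is
  \<open>f_i\<close>.\<close>

context
  fixes w w' :: 'b and t :: 'a
  assumes w: "w \<in> carrier B" "comult B w = pure_tensor B B w w" and w': "w' \<in> carrier B" "comult B w' = pure_tensor B B w' w'"
    and ww': "w \<otimes>\<^bsub>B\<^esub> w' = \<one>\<^bsub>B\<^esub>" and Sw: "antipode B w = w'"
    and t: "t \<in> carrier A" "comult A t = pure_tensor A A t t" "counit A t = 1"
begin

lemma p_w_w': "p w t * p w' t = 1"
proof -
  have "p w t * p w' t = A.conv (p w) (p w') t"
    unfolding A.conv_def using A.sw_pure[OF t(2) A.conv_bilin[OF p_lin_1[OF w(1)] p_lin_1[OF w'(1)]] vs_scalars t(1,1)] by simp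
  also have "\<dots> = p \<one>\<^bsub>B\<^esub> t" using p_mult_r[OF w(1) w'(1) t(1)] ww' by simp
  finally show ?thesis by (simp add: p_one_l t)
qed

lemmas lin = p_lin_1[OF w(1)] p_lin_1[OF w'(1)]

lemma rho_t: "x \<in> carrier A \<Longrightarrow> A.rho (p w) (t \<otimes>\<^bsub>A\<^esub> x) = p w t \<odot>\<^bsub>A\<^esub> (t \<otimes>\<^bsub>A\<^esub> A.rho (p w) x)"
  by (subst A.rho_mult[OF lin(1) t(1)])
    (simp_all add: p_grouplike w A.rho_grouplike[OF lin(1) t(2,1)] t A.mult_smult_l A.rho_closed[OF lin(1)])

lemma lam_t: "x \<in> carrier A \<Longrightarrow> A.lam (p w') (t \<otimes>\<^bsub>A\<^esub> x) = p w' t \<odot>\<^bsub>A\<^esub> (t \<otimes>\<^bsub>A\<^esub> A.lam (p w') x)"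
  by (subst A.lam_mult[OF lin(2) t(1)])
    (simp_all add: p_grouplike w' A.lam_grouplike[OF lin(2) t(2,1)] t A.mult_smult_l A.lam_closed[OF lin(2)])

text \<open>The functional of \<open>w\<close> on one side contributes \<open>p w t\<close> and that
  of \<open>w'\<close> on the other side \<open>p w' t\<close>; they cancel by
  \<open>p_w_w'\<close>.\<close>

lemma R_w_L_t: "R w \<otimes>\<^bsub>En\<^esub> L t = L t \<otimes>\<^bsub>En\<^esub> R w"
proof -
  have "theta w w (t \<otimes>\<^bsub>A\<^esub> x) = t \<otimes>\<^bsub>A\<^esub> theta w w x" if x: "x \<in> carrier A" for x
    using x p_w_w' by (simp add: theta_def Sw lam_t lin_smult[OF A.rho_linear[OF lin(1)]] rho_t
        A.lam_closed[OF lin(2)] A.rho_closed[OF lin(1)] t A.smult_smult mult.commute)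
  then show ?thesis unfolding R_grouplike[OF w]
    by (intro End_eq_pureI) (simp_all add: Th_closed L_closed w t End_alg_apply L_pure Th_pure theta_closed)
qed

context
  fixes e
  assumes e: "e \<in> carrier A" "comult A e = pure_tensor A A e \<one>\<^bsub>A\<^esub> \<oplus>\<^bsub>tensor_module A A\<^esub> pure_tensor A A t e"
    and we: "p w e = 0" "p w' e = 0" and w_one: "counit B w = 1" "counit B w' = 1"
begin

lemma rho_e: "x \<in> carrier A \<Longrightarrow> A.rho (p w) (e \<otimes>\<^bsub>A\<^esub> x) = e \<otimes>\<^bsub>A\<^esub> A.rho (p w) x"
  by (subst A.rho_mult[OF lin(1) e(1)])
    (simp_all add: p_grouplike w A.rho_skew[OF lin(1) e(2,1) A.one_closed t(1)] we p_one_r w_one e t A.rho_closed[OF lin(1)])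

lemma lam_e: "x \<in> carrier A \<Longrightarrow> A.lam (p w') (e \<otimes>\<^bsub>A\<^esub> x) = p w' t \<odot>\<^bsub>A\<^esub> (e \<otimes>\<^bsub>A\<^esub> A.lam (p w') x)"
  by (subst A.lam_mult[OF lin(2) e(1)])
    (simp_all add: p_grouplike w' A.lam_skew[OF lin(2) e(2,1) A.one_closed t(1)] we e t A.mult_smult_l A.lam_closed[OF lin(2)])

text \<open>Because \<open>p w\<close> and \<open>p w'\<close> vanish on \<open>e\<close>, only one
  term of the coproduct of \<open>e\<close> counts on each side. \<open>rho\<close> meets the unit
  and leaves \<open>e\<close> unchanged, while \<open>lam\<close> meets \<open>t\<close> and gives
  the scalar.\<close>

lemma R_w_L_e: "R w \<otimes>\<^bsub>En\<^esub> L e = p w' t \<odot>\<^bsub>En\<^esub> (L e \<otimes>\<^bsub>En\<^esub> R w)"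
proof -
  have "theta w w (e \<otimes>\<^bsub>A\<^esub> x) = p w' t \<odot>\<^bsub>A\<^esub> (e \<otimes>\<^bsub>A\<^esub> theta w w x)" if x: "x \<in> carrier A" for x
    using x by (simp add: theta_def Sw lam_e lin_smult[OF A.rho_linear[OF lin(1)]] rho_e
        A.lam_closed[OF lin(2)] A.rho_closed[OF lin(1)] e)
  then show ?thesis unfolding R_grouplike[OF w]
    by (intro End_eq_pureI)
      (simp_all add: Th_closed L_closed w e End_alg_apply L_pure Th_pure theta_closed AB.pure_smult_l)
qed

end

context
  fixes f
  assumes f: "f \<in> carrier B" "comult B f = pure_tensor B B f w \<oplus>\<^bsub>tensor_module B B\<^esub> pure_tensor B B \<one>\<^bsub>B\<^esub> f"
    and Sf: "antipode B f = (- 1) \<odot>\<^bsub>B\<^esub> (f \<otimes>\<^bsub>B\<^esub> w')" and ft: "p f t = 0"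
begin

lemma Sf_closed: "S\<^sub>B f \<in> carrier B" by (rule S_closed[OF f(1)])

text \<open>The antipode exchanges the types of skew-primitive elements: multiplying the coproduct
  of \<open>f\<close> by \<open>w' \<otimes> w'\<close> turns \<open>w\<close> into the unit and the
  unit into \<open>w'\<close>.\<close>

lemma comult_Sf: "comult B (S\<^sub>B f) = pure_tensor B B (S\<^sub>B f) \<one>\<^bsub>B\<^esub> \<oplus>\<^bsub>tensor_module B B\<^esub> pure_tensor B B w' (S\<^sub>B f)"
proof -
  have "comult B (f \<otimes>\<^bsub>B\<^esub> w') = pure_tensor B B (f \<otimes>\<^bsub>B\<^esub> w') \<one>\<^bsub>B\<^esub> \<oplus>\<^bsub>tensor_module B B\<^esub> pure_tensor B B w' (f \<otimes>\<^bsub>B\<^esub> w')"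
    unfolding alg_mult[OF B.comult_hom f(1) w'(1)] f(2) w'(2) using f(1) w(1) w'(1)
    by (simp add: B.T2.tm_simps ww')
  then show ?thesis using f(1) w'(1)
    by (simp add: Sf lin_smult[OF B.comult_linear] vs.smult_add_r[OF B.T2.vs_tensor] B.T2.pure_smult_l B.T2.pure_smult_r)
qed

lemma p_f_mult: "y \<in> carrier A \<Longrightarrow> y' \<in> carrier A \<Longrightarrow> p f (y \<otimes>\<^bsub>A\<^esub> y') = p w y * p f y' + p f y * counit A y'"
  using B.sw_pure2[OF f(2) p_bilin[of y y'] vs_scalars f(1) w(1) B.one_closed f(1)] f
  by (simp add: p_mult_l p_one_l mult.commute)

lemma p_Sf_mult: "y \<in> carrier A \<Longrightarrow> y' \<in> carrier A \<Longrightarrow> p (S\<^sub>B f) (y \<otimes>\<^bsub>A\<^esub> y') = counit A y * p (S\<^sub>B f) y' + p (S\<^sub>B f) y * p w' y'"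
  using B.sw_pure2[OF comult_Sf p_bilin[of y y'] vs_scalars Sf_closed B.one_closed w'(1) Sf_closed] Sf_closed
  by (simp add: p_mult_l p_one_l mult.commute)

lemmas lin_f = p_lin_1[OF f(1)] p_lin_1[OF Sf_closed]

lemma p_Sf: "a \<in> carrier A \<Longrightarrow> p (S\<^sub>B f) a = - A.conv (p f) (p w') a"
  using lin_smult[OF p_lin_2[of a], of "f \<otimes>\<^bsub>B\<^esub> w'" "- 1"] f(1) w'(1) by (simp add: Sf p_mult_r)

lemma p_Sf_t: "p (S\<^sub>B f) t = 0"
  using A.sw_pure[OF t(2) A.conv_bilin[OF lin_f(1) lin(2)] vs_scalars t(1,1)] t by (simp add: p_Sf A.conv_def ft)

lemma R_f_pure: "x \<in> carrier A \<Longrightarrow> y \<in> carrier B \<Longrightarrow> R f (pt x y) =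
    (pt (A.rho (p w) (A.lam (p (S\<^sub>B f)) x)) (w \<otimes>\<^bsub>B\<^esub> y) \<oplus>\<^bsub>T\<^esub> pt (A.rho (p w) x) (f \<otimes>\<^bsub>B\<^esub> y)) \<oplus>\<^bsub>T\<^esub> pt (A.rho (p f) x) y"
  unfolding R_skew[OF f(1) w(1) f(2)]
  using f(1) w(1) by (simp add: End_alg_apply Th_pure theta_one_l) (simp add: theta_def)

text \<open>Each of the three terms in \<open>R_f_pure\<close> picks up the same factor
  \<open>p w t\<close>: the first two through \<open>rho (p w)\<close>, the third through
  \<open>rho (p f)\<close>. The functional of \<open>S f\<close> passes \<open>t\<close> without a
  scalar.\<close>

lemma R_f_L_t: "R f \<otimes>\<^bsub>En\<^esub> L t = p w t \<odot>\<^bsub>En\<^esub> (L t \<otimes>\<^bsub>En\<^esub> R f)"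
proof (rule End_eq_pureI)
  interpret TT: vs T by simp
  fix x y assume x: "x \<in> carrier A" and y: "y \<in> carrier B"
  note rc = A.rho_closed[OF lin(1)] A.lam_closed[OF lin(2)] A.rho_closed[OF lin_f(1)] A.lam_closed[OF lin_f(2)]
  have 1: "A.lam (p (S\<^sub>B f)) (t \<otimes>\<^bsub>A\<^esub> x) = t \<otimes>\<^bsub>A\<^esub> A.lam (p (S\<^sub>B f)) x"
    by (subst A.lam_mult2[OF lin_f(2) A.counit_linear lin_f(2) lin_f(2) lin(2) t(1) x p_Sf_mult])
      (use x in \<open>simp_all add: A.lam_counit A.lam_grouplike[OF lin_f(2) t(2,1)] p_Sf_t t rc\<close>)
  have 2: "A.rho (p f) (t \<otimes>\<^bsub>A\<^esub> x) = p w t \<odot>\<^bsub>A\<^esub> (t \<otimes>\<^bsub>A\<^esub> A.rho (p f) x)"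
    by (subst A.rho_mult2[OF lin_f(1) lin(1) lin_f(1) lin_f(1) A.counit_linear t(1) x p_f_mult])
      (use x in \<open>simp_all add: A.rho_counit A.rho_grouplike[OF lin(1) t(2,1)] A.rho_grouplike[OF lin_f(1) t(2,1)] ft t rc A.mult_smult_l\<close>)
  show "(R f \<otimes>\<^bsub>En\<^esub> L t) (pt x y) = (p w t \<odot>\<^bsub>En\<^esub> (L t \<otimes>\<^bsub>En\<^esub> R f)) (pt x y)"
    using x y t(1) f(1) w(1)
    by (simp add: End_alg_apply L_pure R_f_pure rc lin_add[OF L_linear] 1 2 rho_t AB.pure_smult_l TT.smult_add_r)
qed (use t(1) f(1) in \<open>simp_all add: R_closed L_closed\<close>)

context
  fixes e
  assumes e: "e \<in> carrier A" "comult A e = pure_tensor A A e \<one>\<^bsub>A\<^esub> \<oplus>\<^bsub>tensor_module A A\<^esub> pure_tensor A A t e"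
    and we: "p w e = 0" "p w' e = 0" and w_one: "counit B w = 1" "counit B w' = 1"
begin

lemma p_Sf_e: "p (S\<^sub>B f) e = - p f e"
  using A.sw_pure2[OF e(2) A.conv_bilin[OF lin_f(1) lin(2)] vs_scalars e(1) A.one_closed t(1) e(1)] e t
  by (simp add: p_Sf A.conv_def ft p_one_r w' w_one)

text \<open>Moving \<open>e\<close> past the operator of \<open>f\<close> leaves two correction
  terms. The leg with the antipode contributes \<open>-p f e\<close> times the action of
  \<open>w\<close>, and the last leg contributes \<open>p f e\<close> times multiplication by
  \<open>t\<close>; these form the right-hand side.\<close>

lemma R_f_L_e: "L e \<otimes>\<^bsub>En\<^esub> R f \<ominus>\<^bsub>En\<^esub> R f \<otimes>\<^bsub>En\<^esub> L e = (- p f e) \<odot>\<^bsub>En\<^esub> (L t \<ominus>\<^bsub>En\<^esub> R w)"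
proof -
  interpret TT: vs T by simp
  \<comment> \<open>Applying \<open>p_f_mult\<close> to \<open>1 = 1 \<otimes> 1\<close> in the
    sense of the product of \<open>A\<close> shows that \<open>p f 1\<close> is twice
    itself.\<close>
  have fone: "p f \<one>\<^bsub>A\<^esub> = 0"
  proof -
    have 1: "counit A \<one>\<^bsub>A\<^esub> = 1" "p w \<one>\<^bsub>A\<^esub> = 1"
      using alg_one[OF A.counit_hom] p_one_r[OF w(1)] w_one by simp_all
    have "p f \<one>\<^bsub>A\<^esub> = p f \<one>\<^bsub>A\<^esub> + p f \<one>\<^bsub>A\<^esub>"
      using p_f_mult[OF A.one_closed A.one_closed] by (simp only: 1 mult_1_left mult_1_right A.l_one[OF A.one_closed])
    then show ?thesis by (simp only: add_cancel_right_right)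
  qed
  have "R f \<otimes>\<^bsub>En\<^esub> L e = L e \<otimes>\<^bsub>En\<^esub> R f \<oplus>\<^bsub>En\<^esub> p f e \<odot>\<^bsub>En\<^esub> (L t \<ominus>\<^bsub>En\<^esub> R w)"
  proof (rule End_eq_pureI)
    fix x y assume x: "x \<in> carrier A" and y: "y \<in> carrier B"
    note rc = A.rho_closed[OF lin(1)] A.lam_closed[OF lin(2)] A.rho_closed[OF lin_f(1)] A.lam_closed[OF lin_f(2)]
    let ?k = "p f e" and ?u = "A.lam (p (S\<^sub>B f)) x" and ?v = "A.lam (p w') x" and ?r = "A.rho (p w)"
    have 1: "A.lam (p (S\<^sub>B f)) (e \<otimes>\<^bsub>A\<^esub> x) = e \<otimes>\<^bsub>A\<^esub> ?u \<oplus>\<^bsub>A\<^esub> (- ?k) \<odot>\<^bsub>A\<^esub> ?v"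
      by (subst A.lam_mult2[OF lin_f(2) A.counit_linear lin_f(2) lin_f(2) lin(2) e(1) x p_Sf_mult])
        (use x in \<open>simp_all add: A.lam_counit A.lam_skew[OF lin_f(2) e(2,1) A.one_closed t(1)] p_Sf_t p_Sf_e t e rc A.mult_smult_l\<close>)
    have 2: "A.rho (p f) (e \<otimes>\<^bsub>A\<^esub> x) = e \<otimes>\<^bsub>A\<^esub> A.rho (p f) x \<oplus>\<^bsub>A\<^esub> ?k \<odot>\<^bsub>A\<^esub> (t \<otimes>\<^bsub>A\<^esub> x)"
      by (subst A.rho_mult2[OF lin_f(1) lin(1) lin_f(1) lin_f(1) A.counit_linear e(1) x p_f_mult])
        (use x in \<open>simp_all add: A.rho_counit A.rho_skew[OF lin(1) e(2,1) A.one_closed t(1)]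
          A.rho_skew[OF lin_f(1) e(2,1) A.one_closed t(1)] fone we p_one_r w_one w t e rc A.mult_smult_l\<close>)
    have 3: "?r (A.lam (p (S\<^sub>B f)) (e \<otimes>\<^bsub>A\<^esub> x)) = e \<otimes>\<^bsub>A\<^esub> ?r ?u \<oplus>\<^bsub>A\<^esub> (- ?k) \<odot>\<^bsub>A\<^esub> ?r ?v"
      unfolding 1 using x e(1) by (simp add: lin_add[OF A.rho_linear[OF lin(1)]] lin_smult[OF A.rho_linear[OF lin(1)]] rc rho_e[OF e we w_one])
    let ?P = "pt (e \<otimes>\<^bsub>A\<^esub> ?r ?u) (w \<otimes>\<^bsub>B\<^esub> y)" and ?Q = "pt (e \<otimes>\<^bsub>A\<^esub> ?r x) (f \<otimes>\<^bsub>B\<^esub> y)" and ?Z = "pt (e \<otimes>\<^bsub>A\<^esub> A.rho (p f) x) y"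
      and ?X = "pt (?r ?v) (w \<otimes>\<^bsub>B\<^esub> y)" and ?Y = "pt (t \<otimes>\<^bsub>A\<^esub> x) y"
    have cl: "?P \<in> carrier T" "?Q \<in> carrier T" "?Z \<in> carrier T" "?X \<in> carrier T" "?Y \<in> carrier T"
      using x y e(1) f(1) w(1) t(1) by (simp_all add: rc)
    have Rw: "R w (pt x y) = ?X" using x y w(1) by (simp add: R_grouplike[OF w] Th_pure theta_def Sw)
    have "(R f \<otimes>\<^bsub>En\<^esub> L e) (pt x y) = ((?P \<oplus>\<^bsub>T\<^esub> (- ?k) \<odot>\<^bsub>T\<^esub> ?X) \<oplus>\<^bsub>T\<^esub> ?Q) \<oplus>\<^bsub>T\<^esub> (?Z \<oplus>\<^bsub>T\<^esub> ?k \<odot>\<^bsub>T\<^esub> ?Y)"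
      using x y e(1) f(1) w(1) t(1)
      by (simp add: End_alg_apply L_pure R_f_pure 3 2 rho_e[OF e we w_one] rc AB.pure_add_l AB.pure_smult_l)
    also have "\<dots> = ((?P \<oplus>\<^bsub>T\<^esub> ?Q) \<oplus>\<^bsub>T\<^esub> ?Z) \<oplus>\<^bsub>T\<^esub> (?k \<odot>\<^bsub>T\<^esub> ?Y \<oplus>\<^bsub>T\<^esub> (- ?k) \<odot>\<^bsub>T\<^esub> ?X)"
      using cl by (simp add: TT.M.a_ac)
    also have "\<dots> = (L e \<otimes>\<^bsub>En\<^esub> R f \<oplus>\<^bsub>En\<^esub> ?k \<odot>\<^bsub>En\<^esub> (L t \<ominus>\<^bsub>En\<^esub> R w)) (pt x y)"
      using x y e(1) f(1) w(1) t(1) cl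
      by (simp add: End_alg_apply L_pure R_f_pure rc lin_add[OF L_linear] R_closed L_closed En.minus_smult1
          TT.smult_add_r TT.smult_smult Rw)
    finally show "(R f \<otimes>\<^bsub>En\<^esub> L e) (pt x y) = (L e \<otimes>\<^bsub>En\<^esub> R f \<oplus>\<^bsub>En\<^esub> ?k \<odot>\<^bsub>En\<^esub> (L t \<ominus>\<^bsub>En\<^esub> R w)) (pt x y)" .
  qed (use e(1) f(1) w(1) t(1) in \<open>simp_all add: R_closed L_closed\<close>)
  moreover have "a \<ominus>\<^bsub>En\<^esub> (a \<oplus>\<^bsub>En\<^esub> b) = \<ominus>\<^bsub>En\<^esub> b" if "a \<in> carrier En" "b \<in> carrier En" for a b
    using that by (simp add: En.minus_eq En.minus_add En.r_neg flip: En.a_assoc)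
  ultimately show ?thesis using e(1) f(1) w(1) t(1) by (simp add: R_closed L_closed En.smult_minus_l)
qed

end

end

end

end

subsection \<open>Recognising a Drinfeld double\<close>

lemma drinfeld_double_simps [simp]:
  "carrier (drinfeld_double A B p) = carrier (tensor_module A B)"
  "monoid.mult (drinfeld_double A B p) = double_mult A B p"
  "\<one>\<^bsub>drinfeld_double A B p\<^esub> = pure_tensor A B \<one>\<^bsub>A\<^esub> \<one>\<^bsub>B\<^esub>"
  "\<zero>\<^bsub>drinfeld_double A B p\<^esub> = \<zero>\<^bsub>tensor_module A B\<^esub>"
  "add (drinfeld_double A B p) = add (tensor_module A B)"
  "module.smult (drinfeld_double A B p) = module.smult (tensor_module A B)"
  "comult (drinfeld_double A B p) = double_comult A B"
  "counit (drinfeld_double A B p) = tensor_lift scalars (\<lambda>a b. counit A a * counit B b)"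
  "antipode (drinfeld_double A B p) = tensor_lift (tensor_module A B) (\<lambda>a b.
     double_mult A B p (pure_tensor A B \<one>\<^bsub>A\<^esub> (antipode B b)) (pure_tensor A B (antipode A a) \<one>\<^bsub>B\<^esub>))"
  by (simp_all add: drinfeld_double_def module.defs hopf.defs)

lemma vs_drinfeld_double:
  assumes "vs (tensor_module A B)" shows "vs (drinfeld_double A B p)"
proof -
  interpret T: vs "tensor_module A B" by fact
  have "abelian_group (drinfeld_double A B p)"
  proof (rule abelian_groupI)
    show "\<exists>y\<in>carrier (drinfeld_double A B p). y \<oplus>\<^bsub>drinfeld_double A B p\<^esub> x = \<zero>\<^bsub>drinfeld_double A B p\<^esub>"
      if "x \<in> carrier (drinfeld_double A B p)" for x
      using that T.M.l_neg[of x] T.M.a_inv_closed[of x] by auto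
  qed (simp_all add: T.M.a_ac)
  then show ?thesis
    by (rule vsI) (simp_all add: T.smult_add_l T.smult_add_r T.smult_smult)
qed

text \<open>If the action of \<open>C\<close> by left multiplication and that of \<open>D\<close> on \<open>C \<otimes> D\<close> combine to one of the
  whole of \<open>H\<close>, then evaluating it at \<open>1 \<otimes> 1\<close> inverts the multiplication map \<open>C \<otimes> D \<rightarrow> H\<close>.\<close>

theorem hopf_isomorphic_drinfeld_double:
  fixes H :: "('k::field, 'a, 'm) hopf_scheme" and A B :: "('k, 'a, 'm) hopf_scheme"
  assumes A_def: "A = restrict_hopf H C" and B_def: "B = restrict_hopf H D" and H: "hopf_algebra H" and C: "sub_bialg H C" and D: "sub_bialg H D" and sp: "skew_pairing A B p"
    and anti: "\<And>x y. x \<in> carrier H \<Longrightarrow> y \<in> carrier H \<Longrightarrow> antipode H (x \<otimes>\<^bsub>H\<^esub> y) = antipode H y \<otimes>\<^bsub>H\<^esub> antipode H x"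
    and SC: "\<And>x. x \<in> C \<Longrightarrow> antipode H x \<in> C" and SD: "\<And>x. x \<in> D \<Longrightarrow> antipode H x \<in> D"
    and \<Phi>: "\<Phi> \<in> algebra_homs H (End_alg (tensor_module A B))"
    and \<Phi>_C: "\<And>a. a \<in> C \<Longrightarrow> \<Phi> a = skew_pairing.L A B a" and \<Phi>_D: "\<And>b. b \<in> D \<Longrightarrow> \<Phi> b = skew_pairing.R A B p b"
    and surj: "carrier H \<subseteq> tensor_lift H (monoid.mult H) ` carrier (tensor_module A B)"
  shows "hopf_isomorphic H (drinfeld_double A B p)"
proof -
  interpret skew_pairing A B p by (rule sp)
  interpret H: bialg H by (rule hopf_bialg[OF H])
  note SL = hopf_algebra.antipode_linear[OF H]
  have car [simp]: "carrier A = C" "carrier B = D" by (simp_all add: A_def B_def)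
  have ops: "x \<otimes>\<^bsub>A\<^esub> y = x \<otimes>\<^bsub>H\<^esub> y" "x \<otimes>\<^bsub>B\<^esub> y = x \<otimes>\<^bsub>H\<^esub> y" "\<one>\<^bsub>A\<^esub> = \<one>\<^bsub>H\<^esub>" "\<one>\<^bsub>B\<^esub> = \<one>\<^bsub>H\<^esub>"
    "counit A = counit H" "counit B = counit H" "antipode A = antipode H" "antipode B = antipode H" for x y
    by (simp_all add: A_def B_def)
  have CH: "a \<in> carrier H" if "a \<in> C" for a using that sub_alg.sub_carrier[OF sub_bialg.axioms(2)[OF C]] by blast
  have DH: "a \<in> carrier H" if "a \<in> D" for a using that sub_alg.sub_carrier[OF sub_bialg.axioms(2)[OF D]] by blast
  have lA: "f \<in> linear_maps A V" if "f \<in> linear_maps H V" for f and V :: "('k, 'x, 'y) module_scheme"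
    unfolding A_def by (rule lin_restrict[OF that]) (use CH in blast)
  have lB: "f \<in> linear_maps B V" if "f \<in> linear_maps H V" for f and V :: "('k, 'x, 'y) module_scheme"
    unfolding B_def by (rule lin_restrict[OF that]) (use DH in blast)
  have swA: "sweedler A V f x = sweedler H V f' x"
    if "bilin H H V f'" "vs V" "x \<in> C" "\<And>a b. a \<in> C \<Longrightarrow> b \<in> C \<Longrightarrow> f a b = f' a b" for V :: "('k, 'x, 'y) module_scheme" and f f' x
    unfolding A_def by (rule sub_bialg.sw_sub[OF C that])
  have swB: "sweedler B V f x = sweedler H V f' x"
    if "bilin H H V f'" "vs V" "x \<in> D" "\<And>a b. a \<in> D \<Longrightarrow> b \<in> D \<Longrightarrow> f a b = f' a b" for V :: "('k, 'x, 'y) module_scheme" and f f' x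
    unfolding B_def by (rule sub_bialg.sw_sub[OF D that])
  have oneC: "\<one>\<^bsub>H\<^esub> \<in> C" using A.one_closed by (simp add: ops)
  have oneD: "\<one>\<^bsub>H\<^esub> \<in> D" using B.one_closed by (simp add: ops)
  note V = AB.vs_tensor
  let ?e = "pt \<one>\<^bsub>H\<^esub> \<one>\<^bsub>H\<^esub>"
  have e: "?e \<in> carrier T" using oneC oneD by simp
  define \<phi> where "\<phi> u = \<Phi> u ?e" for u
  have bm: "bilin A B H (monoid.mult H)"
    by (rule bilinI; intro lA lB H.lin_mult_l H.lin_mult_r lin_id; simp add: CH DH)
  let ?\<psi> = "tensor_lift H (monoid.mult H)"
  note \<psi> = AB.tensor_lift_linear[OF bm H.vs_axioms] and \<psi>_pure = AB.tensor_lift_pure[OF bm H.vs_axioms]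
  have \<Phi>l: "\<Phi> u \<in> linear_maps T T" if "u \<in> carrier H" for u
    by (rule End_alg_linear[OF alg_closed[OF \<Phi> that]])
  have \<phi>: "\<phi> \<in> linear_maps H T"
    by (rule linear_mapsI) (simp_all add: \<phi>_def e lin_closed[OF \<Phi>l] alg_add[OF \<Phi>] alg_smult[OF \<Phi>] End_alg_apply)
  have \<phi>_mult: "\<phi> (u \<otimes>\<^bsub>H\<^esub> u') = \<Phi> u (\<phi> u')" if "u \<in> carrier H" "u' \<in> carrier H" for u u'
    using that e by (simp add: \<phi>_def alg_mult[OF \<Phi>] End_alg_apply)
  have \<phi>_D: "\<phi> b = pt \<one>\<^bsub>H\<^esub> b" if "b \<in> D" for b
    using R_one_one[of b] that by (simp add: \<phi>_def \<Phi>_D ops)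
  have \<phi>_pure: "\<phi> (a \<otimes>\<^bsub>H\<^esub> b) = pt a b" if "a \<in> C" "b \<in> D" for a b
    using that L_pure[of a "\<one>\<^bsub>A\<^esub>" b] oneC by (simp add: \<phi>_mult CH DH \<phi>_D \<Phi>_C ops)
  have \<phi>_C: "\<phi> a = pt a \<one>\<^bsub>H\<^esub>" if "a \<in> C" for a
    using \<phi>_pure[OF that oneD] that by (simp add: CH)
  have \<phi>\<psi>: "\<phi> (?\<psi> \<xi>) = \<xi>" if "\<xi> \<in> carrier T" for \<xi>
    by (rule AB.linear_maps_tensor_eqI[OF lin_comp[OF \<psi> \<phi>] lin_id _ that]) (simp add: \<psi>_pure \<phi>_pure)
  have ex: "\<exists>\<xi>\<in>carrier T. u = ?\<psi> \<xi>" if "u \<in> carrier H" for u using surj that by blast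
  have \<psi>\<phi>: "?\<psi> (\<phi> u) = u" if "u \<in> carrier H" for u using ex[OF that] \<phi>\<psi> by auto
  have bij: "bij_betw \<phi> (carrier H) (carrier T)"
    by (rule bij_betw_byWitness[of _ ?\<psi>]) (use \<psi>\<phi> \<phi>\<psi> lin_closed[OF \<phi>] lin_closed[OF \<psi>] in auto)
  \<comment> \<open>Each structure map of the double is induced by a bilinear map on
    \<open>C\<close> and \<open>D\<close>. If that map depends on the product \<open>a b\<close>
    only, through a linear \<open>G\<close> on \<open>H\<close>, then read through
    \<open>\<phi>\<close> it is \<open>G\<close>. Product, counit, antipode and coproduct are all
    compared in this way.\<close>
  have lift: "tensor_lift V f (\<phi> u) = G u" if G: "G \<in> linear_maps H V" "vs V"
    and f: "\<And>a b. a \<in> C \<Longrightarrow> b \<in> D \<Longrightarrow> f a b = G (a \<otimes>\<^bsub>H\<^esub> b)" and u: "u \<in> carrier H"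
    for V :: "('k, 'x, 'y) module_scheme" and f G u
  proof -
    have b: "bilin A B V (\<lambda>a b. G (a \<otimes>\<^bsub>H\<^esub> b))"
      by (rule bilinI; rule lin_comp[OF _ G(1)]; intro bilin_1[OF bm] bilin_2[OF bm]; assumption)
    have "tensor_lift V f (\<phi> u) = tensor_lift V (\<lambda>a b. G (a \<otimes>\<^bsub>H\<^esub> b)) (\<phi> u)"
      by (rule AB.tensor_lift_cong[OF b G(2) _ lin_closed[OF \<phi> u], symmetric]) (simp add: f)
    also have "\<dots> = G (?\<psi> (\<phi> u))"
      by (rule AB.tensor_lift_comp[OF bm H.vs_axioms G(2,1) lin_closed[OF \<phi> u], symmetric])
    finally show ?thesis by (simp add: \<psi>\<phi> u)
  qed
  have mult: "double_mult A B p (\<phi> u) \<eta> = \<Phi> u \<eta>" if u: "u \<in> carrier H" and \<eta>: "\<eta> \<in> carrier T" for u \<eta>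
    unfolding double_mult_eq[OF lin_closed[OF \<phi> u] \<eta>]
  proof (rule lift[OF _ V _ u])
    show "(\<lambda>u. \<Phi> u \<eta>) \<in> linear_maps H T"
      by (rule linear_mapsI) (simp_all add: \<eta> lin_closed[OF \<Phi>l] alg_add[OF \<Phi>] alg_smult[OF \<Phi>] End_alg_apply)
    show "L a (R b \<eta>) = \<Phi> (a \<otimes>\<^bsub>H\<^esub> b) \<eta>" if "a \<in> C" "b \<in> D" for a b
      using that \<eta> by (simp add: alg_mult[OF \<Phi>] CH DH End_alg_apply \<Phi>_C \<Phi>_D)
  qed
  let ?DD = "drinfeld_double A B p" and ?TT = "tensor_module T T" and ?pp = "pure_tensor T T"
  interpret TT: tensor T T by (simp add: tensor_def V)
  have b2: "bilin H H ?TT (\<lambda>a b. ?pp (\<phi> a) (\<phi> b))"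
    by (rule bilinI; intro TT.lin_pure_l TT.lin_pure_r \<phi> lin_closed[OF \<phi>]; assumption)
  have tt: "tensor_module ?DD ?DD = ?TT" "pure_tensor ?DD ?DD = ?pp"
    by (rule tensor_module_cong; simp)+
  show ?thesis
  proof (rule hopf_transport[OF H, of _ \<phi>])
    show "vs ?DD" by (rule vs_drinfeld_double[OF V])
    show "\<one>\<^bsub>?DD\<^esub> \<in> carrier ?DD" using e by (simp add: ops)
    show "\<phi> \<in> linear_maps H ?DD" using \<phi> by (simp add: linear_maps_def)
    show "bij_betw \<phi> (carrier H) (carrier ?DD)" using bij by simp
    show "\<phi> \<one>\<^bsub>H\<^esub> = \<one>\<^bsub>?DD\<^esub>" using \<phi>_C[OF oneC] by (simp add: ops)
    show "\<phi> (x \<otimes>\<^bsub>H\<^esub> y) = \<phi> x \<otimes>\<^bsub>?DD\<^esub> \<phi> y" if "x \<in> carrier H" "y \<in> carrier H" for x y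
      using that by (simp add: mult lin_closed[OF \<phi>] \<phi>_mult)
    show "x \<otimes>\<^bsub>?DD\<^esub> y \<in> carrier ?DD" if xy: "x \<in> carrier ?DD" "y \<in> carrier ?DD" for x y
      using xy mult[of "?\<psi> x" y] by (simp add: \<phi>\<psi> lin_closed[OF \<psi>] lin_closed[OF \<Phi>l])
    show "counit ?DD (\<phi> x) = counit H x" if "x \<in> carrier H" for x
      unfolding drinfeld_double_simps
      by (rule lift[OF alg_lin[OF H.counit_hom] vs_scalars _ that])
        (simp add: ops alg_mult[OF H.counit_hom] CH DH)
    show "antipode ?DD (\<phi> x) = \<phi> (antipode H x)" if "x \<in> carrier H" for x
      unfolding drinfeld_double_simps
    proof (rule lift[OF lin_comp[OF SL \<phi>] V _ that])
      fix a b assume ab: "a \<in> C" "b \<in> D"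
      \<comment> \<open>The formula \<open>S(ab) = S(b) S(a)\<close>: under \<open>\<phi>\<close>
        the two factors become \<open>1 \<otimes> S(b)\<close> and \<open>S(a) \<otimes> 1\<close>,
        as in the antipode of the double.\<close>
      have "\<phi> (antipode H (a \<otimes>\<^bsub>H\<^esub> b)) = double_mult A B p (\<phi> (antipode H b)) (\<phi> (antipode H a))"
        using ab by (simp add: anti CH DH SC SD \<phi>_mult mult lin_closed[OF \<phi>])
      then show "double_mult A B p (pt \<one>\<^bsub>A\<^esub> (antipode B b)) (pt (antipode A a) \<one>\<^bsub>B\<^esub>) = \<phi> (antipode H (a \<otimes>\<^bsub>H\<^esub> b))"
        using ab by (simp add: ops \<phi>_C \<phi>_D SC SD)
    qed
    show "comult ?DD (\<phi> x) = sweedler H (tensor_module ?DD ?DD) (\<lambda>a b. pure_tensor ?DD ?DD (\<phi> a) (\<phi> b)) x"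
      if x: "x \<in> carrier H" for x
      unfolding drinfeld_double_simps tt double_comult_def Let_def
    proof (rule lift[OF H.sw_linear[OF b2 TT.vs_tensor] TT.vs_tensor _ x])
      fix a b assume ab: "a \<in> C" "b \<in> D"
      let ?f = "\<lambda>a1 a2 b1 b2. ?pp (\<phi> (a1 \<otimes>\<^bsub>H\<^esub> b1)) (\<phi> (a2 \<otimes>\<^bsub>H\<^esub> b2))"
      \<comment> \<open>The coproducts of the subalgebras are first replaced by that of
        \<open>H\<close>; afterwards \<open>\<Delta>(ab) = \<Delta>(a) \<Delta>(b)\<close> merges
        the two sums.\<close>
      have "sweedler A ?TT (\<lambda>a1 a2. sweedler B ?TT (\<lambda>b1 b2. ?pp (pt a1 b1) (pt a2 b2)) b) a =
          sweedler H ?TT (\<lambda>a1 a2. sweedler H ?TT (?f a1 a2) b) a"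
      proof (rule swA[OF H.bilin_sw_mult[OF b2 TT.vs_tensor DH[OF ab(2)]] TT.vs_tensor ab(1)])
        fix a1 a2 assume a: "a1 \<in> C" "a2 \<in> C"
        show "sweedler B ?TT (\<lambda>b1 b2. pure_tensor T T (pure_tensor A B a1 b1) (pure_tensor A B a2 b2)) b = sweedler H ?TT (?f a1 a2) b"
          by (rule swB[OF H.bilin_mult_l[OF b2] TT.vs_tensor ab(2)])
            (use a in \<open>simp_all add: CH \<phi>_pure\<close>)
      qed
      also have "\<dots> = sweedler H ?TT (\<lambda>a b. ?pp (\<phi> a) (\<phi> b)) (a \<otimes>\<^bsub>H\<^esub> b)"
        by (rule H.sw_mult[OF b2 TT.vs_tensor CH[OF ab(1)] DH[OF ab(2)], symmetric])
      finally show "sweedler A ?TT (\<lambda>a1 a2. sweedler B ?TT (\<lambda>b1 b2. ?pp (pt a1 b1) (pt a2 b2)) b) a =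
          sweedler H ?TT (\<lambda>a b. ?pp (\<phi> a) (\<phi> b)) (a \<otimes>\<^bsub>H\<^esub> b)" .
    qed
  qed
qed

subsection \<open>The triangular decomposition\<close>

context uq begin

abbreviation "UA \<equiv> restrict_hopf UH GE"
abbreviation "UB \<equiv> restrict_hopf UH LE"

lemma GE_carrier: "x \<in> GE \<Longrightarrow> x \<in> carrier U" and LE_carrier: "x \<in> LE \<Longrightarrow> x \<in> carrier U"
  using sub_alg.sub_carrier[OF sub_bialg.axioms(2)[OF sub_bialg_ge]] sub_alg.sub_carrier[OF sub_bialg.axioms(2)[OF sub_bialg_le]] by auto

lemma kalg_UA: "kalg UA" and kalg_UB: "kalg UB"
  by (rule sub_alg.sub_kalg[OF sub_bialg.axioms(2)[OF sub_bialg_ge]], rule sub_alg.sub_kalg[OF sub_bialg.axioms(2)[OF sub_bialg_le]])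

lemma zero_GE: "\<zero>\<^bsub>U\<^esub> \<in> GE" using gen_U(2)[OF gens_in(4), of 0] by simp

lemma GE_induct [consumes 1, case_names one E Om OmInv add mult smult]:
  assumes "x \<in> GE" "P \<one>\<^bsub>U\<^esub>" "\<And>i. P (g (E i))" "\<And>i. P (g (Om i))" "\<And>i. P (g (OmInv i))"
    "\<And>x y. x \<in> GE \<Longrightarrow> y \<in> GE \<Longrightarrow> P x \<Longrightarrow> P y \<Longrightarrow> P (x \<oplus>\<^bsub>U\<^esub> y)"
    "\<And>x y. x \<in> GE \<Longrightarrow> y \<in> GE \<Longrightarrow> P x \<Longrightarrow> P y \<Longrightarrow> P (x \<otimes>\<^bsub>U\<^esub> y)" "\<And>k x. x \<in> GE \<Longrightarrow> P x \<Longrightarrow> P (k \<odot>\<^bsub>U\<^esub> x)"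
  shows "P x"
  using assms(1) by (induction rule: gen_subalgebra.induct) (use assms(2-) in auto)

lemma LE_induct [consumes 1, case_names one F Om' Om'Inv add mult smult]:
  assumes "x \<in> LE" "P \<one>\<^bsub>U\<^esub>" "\<And>i. P (g (F i))" "\<And>i. P (g (Om' i))" "\<And>i. P (g (Om'Inv i))"
    "\<And>x y. x \<in> LE \<Longrightarrow> y \<in> LE \<Longrightarrow> P x \<Longrightarrow> P y \<Longrightarrow> P (x \<oplus>\<^bsub>U\<^esub> y)"
    "\<And>x y. x \<in> LE \<Longrightarrow> y \<in> LE \<Longrightarrow> P x \<Longrightarrow> P y \<Longrightarrow> P (x \<otimes>\<^bsub>U\<^esub> y)" "\<And>k x. x \<in> LE \<Longrightarrow> P x \<Longrightarrow> P (k \<odot>\<^bsub>U\<^esub> x)"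
  shows "P x"
  using assms(1) by (induction rule: gen_subalgebra.induct) (use assms(2-) in auto)

text \<open>The coefficient \<open>a\<close> depends on \<open>x\<close>: passing \<open>w\<close>
  through a product rescales the weight components separately, and only membership in
  \<open>GE\<close> is kept.\<close>

lemma torus_straighten:
  assumes "w \<in> carrier U" and "\<And>i. \<exists>a\<in>GE. w \<otimes>\<^bsub>U\<^esub> g (E i) = a \<otimes>\<^bsub>U\<^esub> w"
    and "\<And>i. w \<otimes>\<^bsub>U\<^esub> g (Om i) = g (Om i) \<otimes>\<^bsub>U\<^esub> w" "\<And>i. w \<otimes>\<^bsub>U\<^esub> g (OmInv i) = g (OmInv i) \<otimes>\<^bsub>U\<^esub> w"
    and "x \<in> GE"
  shows "\<exists>a\<in>GE. w \<otimes>\<^bsub>U\<^esub> x = a \<otimes>\<^bsub>U\<^esub> w"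
  using assms(5)
proof (induction rule: GE_induct)
  case (add x y)
  then show ?case
    by (metis GE_carrier U.l_distr U.r_distr assms(1) gen_U(3))
next
  case (mult x y)
  then obtain a b where "a \<in> GE" "b \<in> GE" "w \<otimes>\<^bsub>U\<^esub> x = a \<otimes>\<^bsub>U\<^esub> w" "w \<otimes>\<^bsub>U\<^esub> y = b \<otimes>\<^bsub>U\<^esub> w" by blast
  then show ?case using mult(1,2) assms(1)
    by (intro bexI[of _ "a \<otimes>\<^bsub>U\<^esub> b"] gen_U(1)) (simp_all add: GE_carrier U.m_assoc flip: U.m_assoc[of w])
next
  case (smult k x)
  then show ?case
    by (metis GE_carrier U.mult_smult_l U.mult_smult_r assms(1) gen_U(2))
qed (use assms(1-4) gens_in in \<open>auto intro: bexI[of _ "\<one>\<^bsub>U\<^esub>"]\<close>)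

lemma smult_solve: "c \<noteq> 0 \<Longrightarrow> x \<in> carrier U \<Longrightarrow> y \<in> carrier U \<Longrightarrow> x = c \<odot>\<^bsub>U\<^esub> y \<Longrightarrow> y = inverse c \<odot>\<^bsub>U\<^esub> x"
  by (simp add: U.smult_smult)

lemma Om'_straighten: "x \<in> GE \<Longrightarrow> \<exists>a\<in>GE. g (Om' i) \<otimes>\<^bsub>U\<^esub> x = a \<otimes>\<^bsub>U\<^esub> g (Om' i)"
proof (erule torus_straighten[rotated -1])
  show "\<exists>a\<in>GE. g (Om' i) \<otimes>\<^bsub>U\<^esub> g (E j) = a \<otimes>\<^bsub>U\<^esub> g (Om' i)" for j
    using U.Om'_E[of i j] gens_in by (intro bexI[of _ "inverse (q j i) \<odot>\<^bsub>U\<^esub> g (E j)"] gen_U(2)) (simp_all add: U.mult_smult_l)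
qed (simp_all add: U.torus)

lemma Om'Inv_straighten: "x \<in> GE \<Longrightarrow> \<exists>a\<in>GE. g (Om'Inv i) \<otimes>\<^bsub>U\<^esub> x = a \<otimes>\<^bsub>U\<^esub> g (Om'Inv i)"
proof (erule torus_straighten[rotated -1])
  show "\<exists>a\<in>GE. g (Om'Inv i) \<otimes>\<^bsub>U\<^esub> g (E j) = a \<otimes>\<^bsub>U\<^esub> g (Om'Inv i)" for j
    using smult_solve[OF _ _ _ U.E_Om'Inv[of j i]] q_nz gens_in
    by (intro bexI[of _ "q j i \<odot>\<^bsub>U\<^esub> g (E j)"] gen_U(2)) (simp_all add: U.mult_smult_l)
qed (simp_all add: U.torus)

text \<open>The three-term shape is the smallest one closed under the induction. The commutator with
  \<open>e_i\<close> yields both \<open>\<omega>_i\<close>, which is absorbed into \<open>a\<close>,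
  and \<open>\<omega>'_i\<close>, which lies outside the positive half and needs a coefficient
  \<open>c\<close> of its own.\<close>

lemma F_straighten:
  assumes "x \<in> GE"
  shows "\<exists>a\<in>GE. \<exists>b\<in>GE. \<exists>c\<in>GE. g (F i) \<otimes>\<^bsub>U\<^esub> x = (a \<oplus>\<^bsub>U\<^esub> b \<otimes>\<^bsub>U\<^esub> g (F i)) \<oplus>\<^bsub>U\<^esub> c \<otimes>\<^bsub>U\<^esub> g (Om' i)"
proof -
  let ?P = "\<lambda>a b c x. g (F i) \<otimes>\<^bsub>U\<^esub> x = (a \<oplus>\<^bsub>U\<^esub> b \<otimes>\<^bsub>U\<^esub> g (F i)) \<oplus>\<^bsub>U\<^esub> c \<otimes>\<^bsub>U\<^esub> g (Om' i)"
  have wit: "\<exists>a\<in>GE. \<exists>b\<in>GE. \<exists>c\<in>GE. ?P a b c x" if "?P a b c x" "a \<in> GE" "b \<in> GE" "c \<in> GE" for a b c x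
    using that by blast
  show ?thesis using assms
  proof (induction rule: GE_induct)
    case one
    show ?case by (rule wit[of _ "\<zero>\<^bsub>U\<^esub>" "\<one>\<^bsub>U\<^esub>" "\<zero>\<^bsub>U\<^esub>"]) (simp_all add: zero_GE gens_in)
  next
    case (E j)
    show ?case
    proof (cases "i = j")
      case True
      let ?k = "q i i / (q i i - 1)"
      have "g (F i) \<otimes>\<^bsub>U\<^esub> g (E i) = g (E i) \<otimes>\<^bsub>U\<^esub> g (F i) \<ominus>\<^bsub>U\<^esub> (g (E i) \<otimes>\<^bsub>U\<^esub> g (F i) \<ominus>\<^bsub>U\<^esub> g (F i) \<otimes>\<^bsub>U\<^esub> g (E i))"
        by (simp add: U.minus_eq U.minus_add U.r_neg flip: U.a_assoc)
      also have "\<dots> = ((- ?k) \<odot>\<^bsub>U\<^esub> g (Om i) \<oplus>\<^bsub>U\<^esub> g (E i) \<otimes>\<^bsub>U\<^esub> g (F i)) \<oplus>\<^bsub>U\<^esub> (?k \<odot>\<^bsub>U\<^esub> \<one>\<^bsub>U\<^esub>) \<otimes>\<^bsub>U\<^esub> g (Om' i)"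
        unfolding U.E_F by (simp add: U.minus_smult1 U.smult_add_r U.smult_smult U.mult_smult_l U.a_ac)
      finally have "?P ((- ?k) \<odot>\<^bsub>U\<^esub> g (Om i)) (g (E i)) (?k \<odot>\<^bsub>U\<^esub> \<one>\<^bsub>U\<^esub>) (g (E i))" .
      then show ?thesis unfolding True[symmetric] by (rule wit) (intro gens_in gen_U)+
    next
      case False
      have "g (F i) \<otimes>\<^bsub>U\<^esub> g (E j) = g (E j) \<otimes>\<^bsub>U\<^esub> g (F i) \<ominus>\<^bsub>U\<^esub> (g (E j) \<otimes>\<^bsub>U\<^esub> g (F i) \<ominus>\<^bsub>U\<^esub> g (F i) \<otimes>\<^bsub>U\<^esub> g (E j))"
        by (simp add: U.minus_eq U.minus_add U.r_neg flip: U.a_assoc)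
      also have "\<dots> = (\<zero>\<^bsub>U\<^esub> \<oplus>\<^bsub>U\<^esub> g (E j) \<otimes>\<^bsub>U\<^esub> g (F i)) \<oplus>\<^bsub>U\<^esub> \<zero>\<^bsub>U\<^esub> \<otimes>\<^bsub>U\<^esub> g (Om' i)"
        unfolding U.E_F using False by (simp add: U.minus_eq)
      finally show ?thesis by (rule wit) (intro gens_in zero_GE)+
    qed
  next
    case (Om j)
    have "g (F i) \<otimes>\<^bsub>U\<^esub> g (Om j) = (\<zero>\<^bsub>U\<^esub> \<oplus>\<^bsub>U\<^esub> (q j i \<odot>\<^bsub>U\<^esub> g (Om j)) \<otimes>\<^bsub>U\<^esub> g (F i)) \<oplus>\<^bsub>U\<^esub> \<zero>\<^bsub>U\<^esub> \<otimes>\<^bsub>U\<^esub> g (Om' i)"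
      using smult_solve[OF _ _ _ U.Om_F[of j i]] q_nz by (simp add: U.mult_smult_l)
    then show ?case by (rule wit) (intro gens_in gen_U(2) zero_GE)+
  next
    case (OmInv j)
    have "g (F i) \<otimes>\<^bsub>U\<^esub> g (OmInv j) = (\<zero>\<^bsub>U\<^esub> \<oplus>\<^bsub>U\<^esub> (inverse (q j i) \<odot>\<^bsub>U\<^esub> g (OmInv j)) \<otimes>\<^bsub>U\<^esub> g (F i)) \<oplus>\<^bsub>U\<^esub> \<zero>\<^bsub>U\<^esub> \<otimes>\<^bsub>U\<^esub> g (Om' i)"
      using U.F_OmInv[of i j] by (simp add: U.mult_smult_l)
    then show ?case by (rule wit) (intro gens_in gen_U(2) zero_GE)+
  next
    case (add x y)
    obtain a b c where G: "a \<in> GE" "b \<in> GE" "c \<in> GE" and P: "?P a b c x"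
      using add(3) by (elim bexE) (rule that, assumption+)
    obtain a' b' c' where G': "a' \<in> GE" "b' \<in> GE" "c' \<in> GE" and P': "?P a' b' c' y"
      using add(4) by (elim bexE) (rule that, assumption+)
    have "?P (a \<oplus>\<^bsub>U\<^esub> a') (b \<oplus>\<^bsub>U\<^esub> b') (c \<oplus>\<^bsub>U\<^esub> c') (x \<oplus>\<^bsub>U\<^esub> y)"
      using G G' add(1,2) by (simp add: P P' GE_carrier U.l_distr U.r_distr U.a_ac)
    then show ?case by (rule wit) (intro gen_U(3) G G')+
  next
    case (mult x y)
    obtain a b c where G: "a \<in> GE" "b \<in> GE" "c \<in> GE" and P: "?P a b c x"
      using mult(3) by (elim bexE) (rule that, assumption+)
    obtain a' b' c' where G': "a' \<in> GE" "b' \<in> GE" "c' \<in> GE" and P': "?P a' b' c' y"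
      using mult(4) by (elim bexE) (rule that, assumption+)
    \<comment> \<open>Besides \<open>f_i\<close>, the \<open>\<omega>'_i\<close> left over from
      \<open>x\<close> has to be moved past \<open>y\<close>.\<close>
    obtain d where d: "d \<in> GE" "g (Om' i) \<otimes>\<^bsub>U\<^esub> y = d \<otimes>\<^bsub>U\<^esub> g (Om' i)" using Om'_straighten[OF mult(2)] by blast
    have "g (F i) \<otimes>\<^bsub>U\<^esub> (x \<otimes>\<^bsub>U\<^esub> y) = (a \<otimes>\<^bsub>U\<^esub> y \<oplus>\<^bsub>U\<^esub> b \<otimes>\<^bsub>U\<^esub> (g (F i) \<otimes>\<^bsub>U\<^esub> y)) \<oplus>\<^bsub>U\<^esub> c \<otimes>\<^bsub>U\<^esub> (g (Om' i) \<otimes>\<^bsub>U\<^esub> y)"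
      using G G' mult(1,2) by (simp add: GE_carrier P U.l_distr U.m_assoc flip: U.m_assoc[of "g (F i)" x])
    also have "\<dots> = (a \<otimes>\<^bsub>U\<^esub> y \<oplus>\<^bsub>U\<^esub> b \<otimes>\<^bsub>U\<^esub> a') \<oplus>\<^bsub>U\<^esub> (b \<otimes>\<^bsub>U\<^esub> b') \<otimes>\<^bsub>U\<^esub> g (F i) \<oplus>\<^bsub>U\<^esub> (b \<otimes>\<^bsub>U\<^esub> c' \<oplus>\<^bsub>U\<^esub> c \<otimes>\<^bsub>U\<^esub> d) \<otimes>\<^bsub>U\<^esub> g (Om' i)"
      unfolding P' d(2) using G G' mult(1,2) d(1) by (simp add: GE_carrier U.l_distr U.r_distr U.m_assoc U.a_ac)
    finally show ?case by (rule wit) (intro gen_U(1,3) G G' d(1) mult(1,2))+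
  next
    case (smult k x)
    obtain a b c where G: "a \<in> GE" "b \<in> GE" "c \<in> GE" and P: "?P a b c x"
      using smult(2) by (elim bexE) (rule that, assumption+)
    have "?P (k \<odot>\<^bsub>U\<^esub> a) (k \<odot>\<^bsub>U\<^esub> b) (k \<odot>\<^bsub>U\<^esub> c) (k \<odot>\<^bsub>U\<^esub> x)"
      using G smult(1) by (simp add: P GE_carrier U.mult_smult_r U.mult_smult_l U.smult_add_r)
    then show ?case by (rule wit) (intro gen_U(2) G)+
  qed
qed

text \<open>The image \<open>N\<close> of the multiplication map contains 1 and is stable under left
  multiplication by every generator: by the positive ones trivially, by the others through
  straightening. Hence it is all of \<open>U\<close>.\<close>

lemma mult_surjective: "carrier UH \<subseteq> tensor_lift UH (monoid.mult UH) ` carrier (tensor_module UA UB)"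
proof
  interpret A: kalg UA by (rule kalg_UA)
  interpret B: kalg UB by (rule kalg_UB)
  interpret AB: tensor UA UB ..
  interpret TT: vs "tensor_module UA UB" by (rule AB.vs_tensor)
  have bm: "bilin UA UB U (monoid.mult U)"
    by (intro bilinI linear_mapsI)
      (simp_all add: GE_carrier LE_carrier U.l_distr U.r_distr U.mult_smult_l U.mult_smult_r)
  let ?\<psi> = "tensor_lift U (monoid.mult U)"
  note \<psi> = AB.tensor_lift_linear[OF bm U.vs_axioms] and \<psi>_pure = AB.tensor_lift_pure[OF bm U.vs_axioms]
  define N where "N = ?\<psi> ` carrier (tensor_module UA UB)"
  have mU: "monoid.mult UH = monoid.mult U" by (intro ext) simp
  have eq: "tensor_lift UH (monoid.mult UH) \<xi> = ?\<psi> \<xi>" if "\<xi> \<in> carrier (tensor_module UA UB)" for \<xi>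
  proof (rule AB.linear_maps_tensor_eqI[OF _ \<psi> _ that])
    interpret UH: kalg UH by (rule kalg_UH)
    have bm': "bilin UA UB UH (monoid.mult UH)" using bm by (simp add: bilin_def algebra_homs_Uq mU)
    show "tensor_lift UH (monoid.mult UH) \<in> linear_maps (tensor_module UA UB) U"
      using AB.tensor_lift_linear[OF bm' UH.vs_axioms] by (simp add: algebra_homs_Uq)
    show "tensor_lift UH (monoid.mult UH) (pure_tensor UA UB a b) = ?\<psi> (pure_tensor UA UB a b)"
      if "a \<in> carrier UA" "b \<in> carrier UB" for a b
      using AB.tensor_lift_pure[OF bm' UH.vs_axioms that] \<psi>_pure[OF that] by (simp only: Uq_simps)
  qed
  have Np: "a \<otimes>\<^bsub>U\<^esub> b \<in> N" if "a \<in> GE" "b \<in> LE" for a b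
    unfolding N_def by (rule image_eqI[of _ _ "pure_tensor UA UB a b"]) (use that in \<open>simp_all add: \<psi>_pure\<close>)
  have Na: "x \<oplus>\<^bsub>U\<^esub> y \<in> N" if "x \<in> N" "y \<in> N" for x y
    using that lin_add[OF \<psi>, symmetric] by (auto simp: N_def)
  have Ns: "k \<odot>\<^bsub>U\<^esub> x \<in> N" if "x \<in> N" for x k
    using that lin_smult[OF \<psi>, symmetric] by (auto simp: N_def)
  have Nc: "x \<in> carrier U" if "x \<in> N" for x using that lin_closed[OF \<psi>] by (auto simp: N_def)
  have stable: "u \<otimes>\<^bsub>U\<^esub> n \<in> N" if u: "u \<in> carrier U" "n \<in> N"
    and h: "\<And>a b. a \<in> GE \<Longrightarrow> b \<in> LE \<Longrightarrow> u \<otimes>\<^bsub>U\<^esub> (a \<otimes>\<^bsub>U\<^esub> b) \<in> N" for u n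
  proof -
    obtain \<xi> where "\<xi> \<in> carrier (tensor_module UA UB)" "n = ?\<psi> \<xi>" using u(2) by (auto simp: N_def)
    from this(1) have "u \<otimes>\<^bsub>U\<^esub> ?\<psi> \<xi> \<in> N"
    proof (induction rule: AB.tensor_induct)
      case (pure a b)
      then show ?case using h[of a b] by (simp add: \<psi>_pure)
    next
      case (add x y)
      then show ?case using Na u(1) by (simp add: lin_add[OF \<psi>] lin_closed[OF \<psi>] U.r_distr)
    qed
    then show ?thesis by (simp add: \<open>n = ?\<psi> \<xi>\<close>)
  qed
  have ge: "u \<otimes>\<^bsub>U\<^esub> n \<in> N" if "u \<in> GE" "n \<in> N" for u n
  proof (rule stable[OF GE_carrier[OF that(1)] that(2)])
    show "u \<otimes>\<^bsub>U\<^esub> (a \<otimes>\<^bsub>U\<^esub> b) \<in> N" if "a \<in> GE" "b \<in> LE" for a b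
      using Np[OF gen_U(1)[OF \<open>u \<in> GE\<close> that(1)] that(2)] that \<open>u \<in> GE\<close> by (simp add: U.m_assoc GE_carrier LE_carrier)
  qed
  have tor: "w \<otimes>\<^bsub>U\<^esub> n \<in> N" if w: "w \<in> LE" "\<And>x. x \<in> GE \<Longrightarrow> \<exists>a\<in>GE. w \<otimes>\<^bsub>U\<^esub> x = a \<otimes>\<^bsub>U\<^esub> w" and n: "n \<in> N" for w n
  proof (rule stable[OF LE_carrier[OF w(1)] n])
    fix a b assume ab: "a \<in> GE" "b \<in> LE"
    then obtain c where c: "c \<in> GE" "w \<otimes>\<^bsub>U\<^esub> a = c \<otimes>\<^bsub>U\<^esub> w" using w by blast
    have "w \<otimes>\<^bsub>U\<^esub> (a \<otimes>\<^bsub>U\<^esub> b) = c \<otimes>\<^bsub>U\<^esub> (w \<otimes>\<^bsub>U\<^esub> b)"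
      using ab w(1) c by (simp add: GE_carrier LE_carrier U.m_assoc flip: U.m_assoc[of w])
    then show "w \<otimes>\<^bsub>U\<^esub> (a \<otimes>\<^bsub>U\<^esub> b) \<in> N" using Np[OF c(1) gen_U(1)[OF w(1) ab(2)]] by simp
  qed
  have f: "g (F i) \<otimes>\<^bsub>U\<^esub> n \<in> N" if n: "n \<in> N" for i n
  proof (rule stable[OF _ n])
    fix a b assume ab: "a \<in> GE" "b \<in> LE"
    then obtain x y z where c: "x \<in> GE" "y \<in> GE" "z \<in> GE"
      and eq: "g (F i) \<otimes>\<^bsub>U\<^esub> a = (x \<oplus>\<^bsub>U\<^esub> y \<otimes>\<^bsub>U\<^esub> g (F i)) \<oplus>\<^bsub>U\<^esub> z \<otimes>\<^bsub>U\<^esub> g (Om' i)"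
      using F_straighten[OF ab(1), of i] by blast
    have "g (F i) \<otimes>\<^bsub>U\<^esub> (a \<otimes>\<^bsub>U\<^esub> b) = (x \<otimes>\<^bsub>U\<^esub> b \<oplus>\<^bsub>U\<^esub> y \<otimes>\<^bsub>U\<^esub> (g (F i) \<otimes>\<^bsub>U\<^esub> b)) \<oplus>\<^bsub>U\<^esub> z \<otimes>\<^bsub>U\<^esub> (g (Om' i) \<otimes>\<^bsub>U\<^esub> b)"
      using ab c by (simp add: eq GE_carrier LE_carrier U.l_distr U.m_assoc flip: U.m_assoc[of "g (F i)" a])
    also have "\<dots> \<in> N" using c ab by (intro Na Np gen_U(1) gens_in)
    finally show "g (F i) \<otimes>\<^bsub>U\<^esub> (a \<otimes>\<^bsub>U\<^esub> b) \<in> N" .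
  qed simp
  have letters: "g y \<otimes>\<^bsub>U\<^esub> n \<in> N" if "n \<in> N" for y n
    using that by (cases y) (simp_all add: ge gens_in f tor[OF _ Om'_straighten] tor[OF _ Om'Inv_straighten])
  fix u assume "u \<in> carrier UH"
  then have "u \<in> gen_subalgebra UH (range g)" by (simp add: U_generated)
  then have "u \<in> carrier U \<and> (\<forall>n\<in>N. u \<otimes>\<^bsub>U\<^esub> n \<in> N)"
    by (induction rule: gen_subalgebra.induct)
      (auto simp: letters U.l_distr Na Nc U.mult_smult_l Ns U.m_assoc)
  moreover have "\<one>\<^bsub>U\<^esub> \<in> N" using Np[OF gens_in(4,8)] by simp
  ultimately have "u \<in> N" using \<open>u \<in> carrier UH\<close> by force
  then show "u \<in> tensor_lift UH (monoid.mult UH) ` carrier (tensor_module UA UB)"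
    using eq by (auto simp: N_def image_iff)
qed

end

subsection \<open>The pairing of the Borel subalgebras\<close>

lemma distinct_index_list: "distinct (index_list :: 'i::finite list)" and set_index_list: "set (index_list :: 'i::finite list) = UNIV"
proof -
  have "\<exists>xs :: 'i list. distinct xs \<and> set xs = UNIV" using finite_distinct_list[of "UNIV :: 'i set"] by auto
  from someI_ex[OF this] show "distinct (index_list :: 'i list)" "set (index_list :: 'i list) = UNIV"
    by (simp_all add: index_list_def)
qed

lemma mult_list_delta:
  assumes "monoid M" "x \<in> carrier M" "distinct is"
  shows "mult_list M (map (\<lambda>j. if j = i then x else \<one>\<^bsub>M\<^esub>) is) = (if i \<in> set is then x else \<one>\<^bsub>M\<^esub>)"
  using assms(3) by (induction "is") (auto simp: mult_list_def monoid.l_one[OF assms(1)] monoid.r_one[OF assms(1)] monoid.one_closed[OF assms(1)] assms(2))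

text \<open>The simple root \<open>\<alpha>_i\<close> in the coordinates of the root
  lattice.\<close>

definition "root_delta i = (\<lambda>j. of_bool (j = i) :: int)"

lemma q_lattice_delta: "q_lattice q (root_delta a) (root_delta b) = q a b"
  and q_lattice_zero: "q_lattice q (\<lambda>_. 0) \<mu> = 1" "q_lattice q \<mu> (\<lambda>_. 0) = 1"
proof -
  have "(\<Prod>j\<in>UNIV. q i j powi (root_delta a i * root_delta b j)) = (if i = a then q a b else 1)" for i
  proof -
    have "(\<Prod>j\<in>UNIV. q i j powi (root_delta a i * root_delta b j)) = (\<Prod>j\<in>UNIV. if j = b then (if i = a then q a b else 1) else 1)"
      by (rule prod.cong) (auto simp: root_delta_def)
    then show ?thesis by (simp add: prod.delta)
  qed
  then show "q_lattice q (root_delta a) (root_delta b) = q a b" by (simp add: q_lattice_def prod.delta)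
qed (simp_all add: q_lattice_def)

context
  fixes A :: "'i::finite \<Rightarrow> 'i \<Rightarrow> int" and q :: "'i \<Rightarrow> 'i \<Rightarrow> 'k::field"
  assumes UH: "monoid (Uq A q)" and g_closed: "\<And>x. Uq_gen A q x \<in> carrier (Uq A q)"
begin

lemma Uq_omega_zero: "Uq_omega A q (\<lambda>_. 0) = \<one>\<^bsub>Uq A q\<^esub>" "Uq_omega' A q (\<lambda>_. 0) = \<one>\<^bsub>Uq A q\<^esub>"
proof -
  have "mult_list (Uq A q) (map (\<lambda>i. \<one>\<^bsub>Uq A q\<^esub>) xs) = \<one>\<^bsub>Uq A q\<^esub>" for xs :: "'i list"
    by (induction xs) (simp_all add: mult_list_def monoid.l_one[OF UH] monoid.one_closed[OF UH])
  then show "Uq_omega A q (\<lambda>_. 0) = \<one>\<^bsub>Uq A q\<^esub>" "Uq_omega' A q (\<lambda>_. 0) = \<one>\<^bsub>Uq A q\<^esub>"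
    by (simp_all add: Uq_omega_def Uq_omega'_def int_pow_def2)
qed

lemma Uq_omega_delta: "Uq_omega A q (root_delta i) = Uq_gen A q (Om i)" "Uq_omega' A q (root_delta i) = Uq_gen A q (Om' i)"
proof -
  have "Uq_gen A q (c j) [^]\<^bsub>Uq A q\<^esub> root_delta i j = (if j = i then Uq_gen A q (c i) else \<one>\<^bsub>Uq A q\<^esub>)" for c j
    by (simp add: root_delta_def int_pow_def2 monoid.l_one[OF UH] g_closed)
  then show "Uq_omega A q (root_delta i) = Uq_gen A q (Om i)" "Uq_omega' A q (root_delta i) = Uq_gen A q (Om' i)"
    by (simp_all add: Uq_omega_def Uq_omega'_def mult_list_delta[OF UH] g_closed distinct_index_list set_index_list)
qed

end

context uq begin

lemma restrict_comult:
  "comult UA (g (E i)) = pure_tensor UA UA (g (E i)) \<one>\<^bsub>UA\<^esub> \<oplus>\<^bsub>tensor_module UA UA\<^esub> pure_tensor UA UA (g (Om i)) (g (E i))"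
  "comult UA (g (Om i)) = pure_tensor UA UA (g (Om i)) (g (Om i))"
  "comult UA (g (OmInv i)) = pure_tensor UA UA (g (OmInv i)) (g (OmInv i))"
  "comult UB (g (F i)) = pure_tensor UB UB (g (F i)) (g (Om' i)) \<oplus>\<^bsub>tensor_module UB UB\<^esub> pure_tensor UB UB \<one>\<^bsub>UB\<^esub> (g (F i))"
  "comult UB (g (Om' i)) = pure_tensor UB UB (g (Om' i)) (g (Om' i))"
  "comult UB (g (Om'Inv i)) = pure_tensor UB UB (g (Om'Inv i)) (g (Om'Inv i))"
  unfolding restrict_hopf_simps Uq_simps
  by (rule sub_bialg.comult_sub_pure2[OF sub_bialg_ge comult_UH(1)[unfolded Uq_simps]]
      sub_bialg.comult_sub_pure2[OF sub_bialg_le comult_UH(2)[unfolded Uq_simps]]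
      sub_bialg.comult_sub_pure[OF sub_bialg_ge comult_UH(3)] sub_bialg.comult_sub_pure[OF sub_bialg_le comult_UH(3)];
      (rule gens_in | simp; fail))+

lemma antipode_sub: "x \<in> GE \<Longrightarrow> antipode UH x \<in> GE" "x \<in> LE \<Longrightarrow> antipode UH x \<in> LE"
  using hopf_sub_ge hopf_sub_le by (auto simp: hopf_subalgebra_def)

lemma counit_antipode:
  assumes "x \<in> LE" shows "counit UH (antipode UH x) = counit UH x"
proof -
  note c = counit_hom_U and S = antipode_hom_U
  have sc: "antipode UH x \<in> carrier U" if "x \<in> LE" for x using antipode_sub(2)[OF that] by (rule LE_carrier)
  show ?thesis using assms
    by (induction rule: LE_induct)
      (simp_all add: antipode_g S_simps counit_g alg_one[OF S] alg_add[OF S] alg_smult[OF S] alg_mult[OF S]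
        alg_one[OF c] alg_add[OF c] alg_smult[OF c] alg_mult[OF c] LE_carrier sc)
qed

end

locale uq_pairing = uq A q for A :: "'i::finite \<Rightarrow> 'i \<Rightarrow> int" and q :: "'i \<Rightarrow> 'i \<Rightarrow> 'k::field" +
  fixes p
  assumes Uq_pairing: "Uq_pairing A q p"
begin

lemma skew: "skew_dual_pairing UA UB p" using Uq_pairing by (simp add: Uq_pairing_def Uq_ge_eq Uq_le_eq)

lemma monoid_UH: "monoid UH" by (intro ring.is_monoid kalg.axioms(2) kalg_UH)

text \<open>The pairing is prescribed on whole lattices of torus elements. Taking simple roots and
  zero for the lattice elements gives generators and the unit.\<close>

lemma p_gens:
  "p (g (F i)) (g (E j)) = (if i = j then q i i / (1 - q i i) else 0)"
  "p (g (Om' i)) (g (Om j)) = q j i" "p (g (Om' i)) \<one>\<^bsub>U\<^esub> = 1" "p \<one>\<^bsub>U\<^esub> (g (Om i)) = 1" "p \<one>\<^bsub>U\<^esub> \<one>\<^bsub>U\<^esub> = 1"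
  "p (g (Om' i)) (g (E j)) = 0" "p \<one>\<^bsub>U\<^esub> (g (E j)) = 0" "p (g (F i)) (g (Om j)) = 0" "p (g (F i)) \<one>\<^bsub>U\<^esub> = 0"
proof -
  have gc: "g x \<in> carrier UH" for x by simp
  note z = Uq_omega_zero[OF monoid_UH gc] and d = Uq_omega_delta[OF monoid_UH gc]
  have a: "p (Uq_omega' A q \<mu>) (Uq_omega A q \<nu>) = q_lattice q \<nu> \<mu>" "p (Uq_omega' A q \<mu>) (g (E j)) = 0"
    "p (g (F i)) (Uq_omega A q \<mu>) = 0" for \<mu> \<nu> i j
    using Uq_pairing by (simp_all add: Uq_pairing_def)
  show "p (g (F i)) (g (E j)) = (if i = j then q i i / (1 - q i i) else 0)"
    using Uq_pairing by (simp add: Uq_pairing_def)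
  show "p (g (Om' i)) (g (Om j)) = q j i" "p (g (Om' i)) \<one>\<^bsub>U\<^esub> = 1" "p \<one>\<^bsub>U\<^esub> (g (Om i)) = 1" "p \<one>\<^bsub>U\<^esub> \<one>\<^bsub>U\<^esub> = 1"
    using a(1)[of "root_delta i" "root_delta j"] a(1)[of "root_delta i" "\<lambda>_. 0"] a(1)[of "\<lambda>_. 0" "root_delta i"] a(1)[of "\<lambda>_. 0" "\<lambda>_. 0"]
    by (simp_all add: z d q_lattice_delta q_lattice_zero)
  show "p (g (Om' i)) (g (E j)) = 0" "p \<one>\<^bsub>U\<^esub> (g (E j)) = 0" "p (g (F i)) (g (Om j)) = 0" "p (g (F i)) \<one>\<^bsub>U\<^esub> = 0"
    using a(2)[of "root_delta i" j] a(2)[of "\<lambda>_. 0" j] a(3)[of i "root_delta j"] a(3)[of i "\<lambda>_. 0"] by (simp_all add: z d)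
qed

text \<open>The unit is group-like, so pairing with it is multiplicative (\<open>o1\<close>,
  \<open>o2\<close>). It agrees with the counit on generators and therefore everywhere on the
  respective half.\<close>

lemma skew_pairing: "skew_pairing UA UB p"
proof -
  interpret UA: bialg UA by (rule sub_bialg.sub_bialg[OF sub_bialg_ge])
  interpret UB: bialg UB by (rule sub_bialg.sub_bialg[OF sub_bialg_le])
  have l1: "p b \<in> linear_maps UA scalars" if "b \<in> LE" for b
    using skew that by (simp add: skew_dual_pairing_def)
  have l2: "(\<lambda>b. p b a) \<in> linear_maps UB scalars" if "a \<in> GE" for a
    using skew that by (simp add: skew_dual_pairing_def)
  have m1: "p b (a \<otimes>\<^bsub>U\<^esub> a') = sweedler UB scalars (\<lambda>b1 b2. p b1 a' * p b2 a) b" if "b \<in> LE" "a \<in> GE" "a' \<in> GE" for a a' b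
    using skew that by (simp add: skew_dual_pairing_def)
  have m2: "p (b \<otimes>\<^bsub>U\<^esub> b') a = sweedler UA scalars (\<lambda>a1 a2. p b a1 * p b' a2) a" if "b \<in> LE" "b' \<in> LE" "a \<in> GE" for a b b'
    using skew that by (simp add: skew_dual_pairing_def)
  have b1: "bilin UB UB scalars (\<lambda>b1 b2. p b1 a' * p b2 a)" if "a \<in> GE" "a' \<in> GE" for a a'
    by (rule bilinI; intro lin_times_l lin_times_r l2 that)
  have b2: "bilin UA UA scalars (\<lambda>a1 a2. p b a1 * p b' a2)" if "b \<in> LE" "b' \<in> LE" for b b'
    by (rule bilinI; intro lin_times_l lin_times_r l1 that)
  have o1: "p \<one>\<^bsub>U\<^esub> (a \<otimes>\<^bsub>U\<^esub> a') = p \<one>\<^bsub>U\<^esub> a' * p \<one>\<^bsub>U\<^esub> a" if "a \<in> GE" "a' \<in> GE" for a a'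
    using m1[OF gens_in(8) that] UB.sw_one[OF b1[OF that] vs_scalars] by simp
  have o2: "p (b \<otimes>\<^bsub>U\<^esub> b') \<one>\<^bsub>U\<^esub> = p b \<one>\<^bsub>U\<^esub> * p b' \<one>\<^bsub>U\<^esub>" if "b \<in> LE" "b' \<in> LE" for b b'
    using m2[OF that gens_in(4)] UA.sw_one[OF b2[OF that] vs_scalars] by simp
  note c = counit_hom_U
  \<comment> \<open>The values on inverse torus elements follow from those on the torus elements by
    multiplicativity.\<close>
  have inv1: "p \<one>\<^bsub>U\<^esub> (g (OmInv i)) = 1" for i
    using o1[OF gens_in(2)[of i] gens_in(3)[of i]] by (simp add: U.Om_inv p_gens)
  have inv2: "p (g (Om'Inv i)) \<one>\<^bsub>U\<^esub> = 1" for i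
    using o2[OF gens_in(6)[of i] gens_in(7)[of i]] by (simp add: U.Om'_inv p_gens)
  have 1: "p \<one>\<^bsub>U\<^esub> a = counit UH a" if "a \<in> GE" for a
    using that
    by (induction rule: GE_induct)
      (use lin_add[OF l1[OF gens_in(8)]] lin_smult[OF l1[OF gens_in(8)]] in
        \<open>simp_all add: p_gens inv1 o1 counit_g alg_one[OF c] alg_add[OF c] alg_smult[OF c] alg_mult[OF c] GE_carrier mult.commute\<close>)
  have 2: "p b \<one>\<^bsub>U\<^esub> = counit UH b" if "b \<in> LE" for b
    using that
    by (induction rule: LE_induct)
      (use lin_add[OF l2[OF gens_in(4)]] lin_smult[OF l2[OF gens_in(4)]] in
        \<open>simp_all add: p_gens inv2 o2 counit_g alg_one[OF c] alg_add[OF c] alg_smult[OF c] alg_mult[OF c] LE_carrier\<close>)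
  have SU: "antipode UH (x \<otimes>\<^bsub>U\<^esub> y) = antipode UH y \<otimes>\<^bsub>U\<^esub> antipode UH x"
    if "x \<in> carrier U" "y \<in> carrier U" for x y
    using antipode_UH(3)[of x y] that by simp
  have S1: "antipode UH \<one>\<^bsub>U\<^esub> = \<one>\<^bsub>U\<^esub>" using antipode_UH(2) by simp
  have SL: "antipode UH \<in> linear_maps UB UB"
    using lin_add[OF antipode_UH(1)] lin_smult[OF antipode_UH(1)]
    by (intro linear_mapsI) (simp_all add: antipode_sub LE_carrier)
  show ?thesis
    by (intro skew_pairing.intro skew_pairing_axioms.intro UA.bialg_axioms UB.bialg_axioms skew)
      (simp_all add: 1 2 SL S1 SU LE_carrier counit_antipode)
qed

end

section \<open>The action of the whole algebra on the tensor product of its halves\<close>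

context uq_pairing begin

text \<open>The Borel subalgebras are abstracted to variables only to keep terms small.\<close>

context
  fixes A' B'
  assumes A'_def: "A' = UA" and B'_def: "B' = UB"
begin

interpretation K: skew_pairing A' B' p unfolding A'_def B'_def by (rule skew_pairing)

lemma ops [simp]:
  "carrier A' = GE" "carrier B' = LE" "\<one>\<^bsub>A'\<^esub> = \<one>\<^bsub>U\<^esub>" "\<one>\<^bsub>B'\<^esub> = \<one>\<^bsub>U\<^esub>"
  "x \<otimes>\<^bsub>A'\<^esub> y = x \<otimes>\<^bsub>U\<^esub> y" "x \<otimes>\<^bsub>B'\<^esub> y = x \<otimes>\<^bsub>U\<^esub> y" "x \<oplus>\<^bsub>A'\<^esub> y = x \<oplus>\<^bsub>U\<^esub> y" "x \<oplus>\<^bsub>B'\<^esub> y = x \<oplus>\<^bsub>U\<^esub> y"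
  "k \<odot>\<^bsub>A'\<^esub> x = k \<odot>\<^bsub>U\<^esub> x" "k \<odot>\<^bsub>B'\<^esub> x = k \<odot>\<^bsub>U\<^esub> x" "\<zero>\<^bsub>A'\<^esub> = \<zero>\<^bsub>U\<^esub>" "\<zero>\<^bsub>B'\<^esub> = \<zero>\<^bsub>U\<^esub>"
  "counit A' = counit UH" "counit B' = counit UH" "antipode A' = antipode UH" "antipode B' = antipode UH"
  by (simp_all add: A'_def B'_def)

lemmas comult' = restrict_comult[folded A'_def B'_def]

lemma L_alg:
  "K.L \<one>\<^bsub>U\<^esub> = \<one>\<^bsub>K.En\<^esub>" "x \<in> GE \<Longrightarrow> y \<in> GE \<Longrightarrow> K.L (x \<otimes>\<^bsub>U\<^esub> y) = K.L x \<otimes>\<^bsub>K.En\<^esub> K.L y"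
  "x \<in> GE \<Longrightarrow> K.L (k \<odot>\<^bsub>U\<^esub> x) = k \<odot>\<^bsub>K.En\<^esub> K.L x" "x \<in> GE \<Longrightarrow> y \<in> GE \<Longrightarrow> K.L (x \<oplus>\<^bsub>U\<^esub> y) = K.L x \<oplus>\<^bsub>K.En\<^esub> K.L y"
  using alg_one[OF K.L_hom] alg_mult[OF K.L_hom, of x y] alg_smult[OF K.L_hom, of x k] alg_add[OF K.L_hom, of x y] by simp_all

lemma R_alg:
  "K.R \<one>\<^bsub>U\<^esub> = \<one>\<^bsub>K.En\<^esub>" "x \<in> LE \<Longrightarrow> y \<in> LE \<Longrightarrow> K.R (x \<otimes>\<^bsub>U\<^esub> y) = K.R x \<otimes>\<^bsub>K.En\<^esub> K.R y"
  "x \<in> LE \<Longrightarrow> K.R (k \<odot>\<^bsub>U\<^esub> x) = k \<odot>\<^bsub>K.En\<^esub> K.R x" "x \<in> LE \<Longrightarrow> y \<in> LE \<Longrightarrow> K.R (x \<oplus>\<^bsub>U\<^esub> y) = K.R x \<oplus>\<^bsub>K.En\<^esub> K.R y"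
  using alg_one[OF K.R_hom] alg_mult[OF K.R_hom, of x y] alg_smult[OF K.R_hom, of x k] alg_add[OF K.R_hom, of x y] by simp_all

lemma LR_closed: "x \<in> GE \<Longrightarrow> K.L x \<in> carrier K.En" "x \<in> LE \<Longrightarrow> K.R x \<in> carrier K.En"
  using K.L_closed K.R_closed by simp_all

lemma w_facts:
  "g (Om' i) \<in> carrier B'" "comult B' (g (Om' i)) = pure_tensor B' B' (g (Om' i)) (g (Om' i))"
  "g (Om'Inv i) \<in> carrier B'" "comult B' (g (Om'Inv i)) = pure_tensor B' B' (g (Om'Inv i)) (g (Om'Inv i))"
  "g (Om' i) \<otimes>\<^bsub>B'\<^esub> g (Om'Inv i) = \<one>\<^bsub>B'\<^esub>" "antipode B' (g (Om' i)) = g (Om'Inv i)"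
  by (simp_all add: gens_in comult' U.Om'_inv antipode_g)

lemma w_facts_inv:
  "g (Om'Inv i) \<in> carrier B'" "comult B' (g (Om'Inv i)) = pure_tensor B' B' (g (Om'Inv i)) (g (Om'Inv i))"
  "g (Om' i) \<in> carrier B'" "comult B' (g (Om' i)) = pure_tensor B' B' (g (Om' i)) (g (Om' i))"
  "g (Om'Inv i) \<otimes>\<^bsub>B'\<^esub> g (Om' i) = \<one>\<^bsub>B'\<^esub>" "antipode B' (g (Om'Inv i)) = g (Om' i)"
  by (simp_all add: gens_in comult' U.Om'_inv' antipode_g)

lemma t_facts:
  "g (Om i) \<in> carrier A'" "comult A' (g (Om i)) = pure_tensor A' A' (g (Om i)) (g (Om i))" "counit A' (g (Om i)) = 1"
  by (simp_all add: gens_in comult' counit_g)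

lemma t_facts_inv:
  "g (OmInv i) \<in> carrier A'" "comult A' (g (OmInv i)) = pure_tensor A' A' (g (OmInv i)) (g (OmInv i))" "counit A' (g (OmInv i)) = 1"
  by (simp_all add: gens_in comult' counit_g)

lemma f_facts:
  "g (F i) \<in> carrier B'"
  "comult B' (g (F i)) = pure_tensor B' B' (g (F i)) (g (Om' i)) \<oplus>\<^bsub>tensor_module B' B'\<^esub> pure_tensor B' B' \<one>\<^bsub>B'\<^esub> (g (F i))"
  "antipode B' (g (F i)) = (- 1) \<odot>\<^bsub>B'\<^esub> (g (F i) \<otimes>\<^bsub>B'\<^esub> g (Om'Inv i))" "p (g (F i)) (g (Om j)) = 0"
  by (simp_all add: gens_in comult' antipode_g S_simps p_gens)

lemma p_Om'Inv_Om: "p (g (Om'Inv i)) (g (Om j)) = inverse (q j i)"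
  using K.p_w_w'[OF w_facts[of i] t_facts[of j]] q_nz by (simp add: p_gens field_simps)

lemma e_facts:
  "g (E j) \<in> carrier A'"
  "comult A' (g (E j)) = pure_tensor A' A' (g (E j)) \<one>\<^bsub>A'\<^esub> \<oplus>\<^bsub>tensor_module A' A'\<^esub> pure_tensor A' A' (g (Om j)) (g (E j))"
  "p (g (Om' i)) (g (E j)) = 0" "p (g (Om'Inv i)) (g (E j)) = 0" "counit B' (g (Om' i)) = 1" "counit B' (g (Om'Inv i)) = 1"
proof -
  show e: "g (E j) \<in> carrier A'"
    "comult A' (g (E j)) = pure_tensor A' A' (g (E j)) \<one>\<^bsub>A'\<^esub> \<oplus>\<^bsub>tensor_module A' A'\<^esub> pure_tensor A' A' (g (Om j)) (g (E j))"
    "p (g (Om' i)) (g (E j)) = 0" "counit B' (g (Om' i)) = 1" "counit B' (g (Om'Inv i)) = 1"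
    by (simp_all add: gens_in comult' counit_g p_gens)
  \<comment> \<open>The pairing of \<open>\<omega>'_i\<close> times its inverse with
    \<open>e_j\<close> is zero. Expanding by the coproduct of \<open>e_j\<close>, one term vanishes
    and the other is \<open>q j i\<close> times the value in question.\<close>
  have "K.A.conv (p (g (Om' i))) (p (g (Om'Inv i))) (g (E j)) = p \<one>\<^bsub>B'\<^esub> (g (E j))"
    using K.p_mult_r[OF w_facts(1)[of i] w_facts(3)[of i] e(1)] by (simp only: w_facts(5))
  then have "q j i * p (g (Om'Inv i)) (g (E j)) = 0"
    unfolding K.A.conv_def K.A.sw_pure2[OF e(2) K.A.conv_bilin[OF K.p_lin_1[OF w_facts(1)] K.p_lin_1[OF w_facts(3)]] vs_scalars
        e(1) K.A.one_closed t_facts(1) e(1)]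
    by (simp add: p_gens)
  then show "p (g (Om'Inv i)) (g (E j)) = 0" using q_nz by simp
qed

definition "v x = (case x of F _ \<Rightarrow> K.R (g x) | Om' _ \<Rightarrow> K.R (g x) | Om'Inv _ \<Rightarrow> K.R (g x) | _ \<Rightarrow> K.L (g x))"

lemma v_simps [simp]:
  "v (E i) = K.L (g (E i))" "v (Om i) = K.L (g (Om i))" "v (OmInv i) = K.L (g (OmInv i))"
  "v (F i) = K.R (g (F i))" "v (Om' i) = K.R (g (Om' i))" "v (Om'Inv i) = K.R (g (Om'Inv i))"
  by (simp_all add: v_def)

lemma torus_cross: "K.R (g s) \<otimes>\<^bsub>K.En\<^esub> K.L (g t) = K.L (g t) \<otimes>\<^bsub>K.En\<^esub> K.R (g s)"
  if "s \<in> range Om' \<union> range Om'Inv" "t \<in> range Om \<union> range OmInv"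
  using that K.R_w_L_t[OF w_facts t_facts] K.R_w_L_t[OF w_facts t_facts_inv]
    K.R_w_L_t[OF w_facts_inv t_facts] K.R_w_L_t[OF w_facts_inv t_facts_inv]
  by (elim UnE imageE) (simp_all only:)

lemma En_smult_solve: "c \<noteq> 0 \<Longrightarrow> y \<in> carrier K.En \<Longrightarrow> x = c \<odot>\<^bsub>K.En\<^esub> y \<Longrightarrow> y = inverse c \<odot>\<^bsub>K.En\<^esub> x"
  by (simp add: K.En.smult_smult)

text \<open>Relations inside one half are images of those in \<open>U\<close> under the
  homomorphisms \<open>K.L\<close> and \<open>K.R\<close>. The mixed ones are the abstract
  commutation rules with the scalars of the pairing inserted.\<close>

lemma uq_rep_End: "uq_rep A q K.En v"
proof (intro uq_rep.intro uq_rep_axioms.intro uq_axioms)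
  show "kalg0 K.En" unfolding kalg0_def by (rule K.En.kalg_axioms)
  show "v x \<in> carrier K.En" for x by (cases x) (simp_all add: LR_closed gens_in)
  show "v s \<otimes>\<^bsub>K.En\<^esub> v t = v t \<otimes>\<^bsub>K.En\<^esub> v s" if st: "s \<in> torus" "t \<in> torus" for s t
  proof -
    have l: "v y = K.L (g y)" "g y \<in> GE" if "y \<in> range Om \<union> range OmInv" for y
      using that by (auto simp: gens_in)
    have r: "v y = K.R (g y)" "g y \<in> LE" if "y \<in> range Om' \<union> range Om'Inv" for y
      using that by (auto simp: gens_in)
    have c: "g s \<otimes>\<^bsub>U\<^esub> g t = g t \<otimes>\<^bsub>U\<^esub> g s" by (rule U.torus[OF st])
    consider "s \<in> range Om \<union> range OmInv" "t \<in> range Om \<union> range OmInv" | "s \<in> range Om \<union> range OmInv" "t \<in> range Om' \<union> range Om'Inv"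
      | "s \<in> range Om' \<union> range Om'Inv" "t \<in> range Om \<union> range OmInv" | "s \<in> range Om' \<union> range Om'Inv" "t \<in> range Om' \<union> range Om'Inv"
      using st by blast
    then show ?thesis
    proof cases
      case 1
      then show ?thesis using arg_cong[OF c, of K.L] l[OF 1(1)] l[OF 1(2)] by (simp add: L_alg)
    next
      case 2
      then show ?thesis using torus_cross[of t s] l[OF 2(1)] r[OF 2(2)] by simp
    next
      case 3
      then show ?thesis using torus_cross[of s t] l[OF 3(2)] r[OF 3(1)] by simp
    next
      case 4
      then show ?thesis using arg_cong[OF c, of K.R] r[OF 4(1)] r[OF 4(2)] by (simp add: R_alg)
    qed
  qed
  show "v (Om i) \<otimes>\<^bsub>K.En\<^esub> v (OmInv i) = \<one>\<^bsub>K.En\<^esub>" for i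
    using arg_cong[OF U.Om_inv[of i], of K.L] by (simp add: L_alg gens_in)
  show "v (Om' i) \<otimes>\<^bsub>K.En\<^esub> v (Om'Inv i) = \<one>\<^bsub>K.En\<^esub>" for i
    using arg_cong[OF U.Om'_inv[of i], of K.R] by (simp add: R_alg gens_in)
  show "v (Om i) \<otimes>\<^bsub>K.En\<^esub> v (E j) = q i j \<odot>\<^bsub>K.En\<^esub> (v (E j) \<otimes>\<^bsub>K.En\<^esub> v (Om i))" for i j
    using arg_cong[OF U.Om_E[of i j], of K.L] by (simp add: L_alg gens_in gen_U(1))
  show "v (Om' i) \<otimes>\<^bsub>K.En\<^esub> v (F j) = q j i \<odot>\<^bsub>K.En\<^esub> (v (F j) \<otimes>\<^bsub>K.En\<^esub> v (Om' i))" for i j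
    using arg_cong[OF U.Om'_F[of i j], of K.R] by (simp add: R_alg gens_in gen_U(1))
  show "v (Om' i) \<otimes>\<^bsub>K.En\<^esub> v (E j) = inverse (q j i) \<odot>\<^bsub>K.En\<^esub> (v (E j) \<otimes>\<^bsub>K.En\<^esub> v (Om' i))" for i j
    using K.R_w_L_e[OF w_facts[of i] t_facts[of j] e_facts] by (simp add: p_Om'Inv_Om)
  show "v (Om i) \<otimes>\<^bsub>K.En\<^esub> v (F j) = inverse (q i j) \<odot>\<^bsub>K.En\<^esub> (v (F j) \<otimes>\<^bsub>K.En\<^esub> v (Om i))" for i j
    using En_smult_solve[OF _ _ K.R_f_L_t[OF w_facts[of j] t_facts[of i] f_facts]] q_nz
    by (simp add: p_gens LR_closed gens_in)
  show "v (E i) \<otimes>\<^bsub>K.En\<^esub> v (F j) \<ominus>\<^bsub>K.En\<^esub> v (F j) \<otimes>\<^bsub>K.En\<^esub> v (E i) =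
      (if i = j then (q i i / (q i i - 1)) \<odot>\<^bsub>K.En\<^esub> (v (Om i) \<ominus>\<^bsub>K.En\<^esub> v (Om' i)) else \<zero>\<^bsub>K.En\<^esub>)" for i j
  proof -
    \<comment> \<open>The normalisation of the pairing is minus the coefficient in the commutator of
      \<open>e_i\<close> and \<open>f_i\<close>; this sign is the one in
      \<open>K.R_f_L_e\<close>.\<close>
    have "- p (g (F j)) (g (E i)) = (if i = j then q i i / (q i i - 1) else 0)"
      by (simp add: p_gens minus_divide_right)
    then show ?thesis
      using K.R_f_L_e[OF w_facts[of j] t_facts[of i] f_facts e_facts] by (simp add: LR_closed gens_in)
  qed
qed

lemma serre_L: "i \<noteq> j \<Longrightarrow> qad K.En (v (E i)) (cs i j) (v (E j)) = \<zero>\<^bsub>K.En\<^esub>"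
proof -
  assume ij: "i \<noteq> j"
  have id: "(\<lambda>x. x) \<in> algebra_homs A' U"
    by (rule algebra_homsI) (auto intro!: linear_mapsI simp: GE_carrier)
  have "K.L (qad A' (g (E i)) (cs i j) (g (E j))) = qad K.En (v (E i)) (cs i j) (v (E j))"
    using qad_hom[OF K.L_hom K.A.kalg_axioms K.En.kalg_axioms, of "g (E i)" "g (E j)"] by (simp add: gens_in)
  moreover have "qad A' (g (E i)) (cs i j) (g (E j)) = \<zero>\<^bsub>A'\<^esub>"
    using qad_hom[OF id K.A.kalg_axioms U.kalg_axioms, of "g (E i)" "g (E j)" "cs i j"] by (simp add: gens_in serre_E_U[OF ij])
  ultimately show ?thesis using lin_zero[OF alg_lin[OF K.L_hom] K.A.vs_axioms K.En.vs_axioms] by simp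
qed

text \<open>The commutators are taken in opposite algebras, and \<open>opposite\<close> is defined
  for plain algebra records only, not for the Hopf algebra \<open>B'\<close>. Instead of using
  \<open>qad_hom\<close>, \<open>K.R\<close> is pulled through the commutators one coefficient at a
  time.\<close>

lemma serre_R: "i \<noteq> j \<Longrightarrow> qad (opposite K.En) (v (F i)) (cs i j) (v (F j)) = \<zero>\<^bsub>K.En\<^esub>"
proof -
  assume ij: "i \<noteq> j"
  interpret O: kalg0 K.En unfolding kalg0_def by (rule K.En.kalg_axioms)
  \<comment> \<open>Membership in \<open>LE\<close> is part of the induction, since
    \<open>K.R\<close> is multiplicative on this half only.\<close>
  have "qad (opposite U) x ds z \<in> LE \<and> qad (opposite K.En) (K.R x) ds (K.R z) = K.R (qad (opposite U) x ds z)"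
    if x: "x \<in> LE" "z \<in> LE" for x z ds
  proof (induction ds)
    case (Cons d ds)
    let ?y = "qad (opposite U) x ds z"
    have y: "?y \<in> LE" and eq: "qad (opposite K.En) (K.R x) ds (K.R z) = K.R ?y" using Cons by auto
    note c = y x gen_U(1)[OF y x(1)] gen_U(1)[OF x(1) y] gen_U(2)[OF gen_U(1)[OF x(1) y]]
    have "qad (opposite U) x (d # ds) z = ?y \<otimes>\<^bsub>U\<^esub> x \<oplus>\<^bsub>U\<^esub> (- 1) \<odot>\<^bsub>U\<^esub> (d \<odot>\<^bsub>U\<^esub> (x \<otimes>\<^bsub>U\<^esub> ?y))"
      using c by (simp add: qad_Cons U.opposite_minus LE_carrier U.minus_smult1)
    moreover have "qad (opposite K.En) (K.R x) (d # ds) (K.R z) =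
        K.R ?y \<otimes>\<^bsub>K.En\<^esub> K.R x \<oplus>\<^bsub>K.En\<^esub> (- 1) \<odot>\<^bsub>K.En\<^esub> (d \<odot>\<^bsub>K.En\<^esub> (K.R x \<otimes>\<^bsub>K.En\<^esub> K.R ?y))"
      using c by (simp add: qad_Cons eq O.opposite_minus LR_closed K.En.minus_smult1)
    ultimately show ?case using c by (simp add: R_alg gen_U(2,3))
  qed (simp add: x)
  from this[OF gens_in(5) gens_in(5), of i "cs i j" j]
  have "qad (opposite K.En) (v (F i)) (cs i j) (v (F j)) = K.R \<zero>\<^bsub>B'\<^esub>" by (simp add: serre_F_U[OF ij])
  then show ?thesis using lin_zero[OF alg_lin[OF K.R_hom] K.B.vs_axioms K.En.vs_axioms] by simp
qed

lemma hopf_isomorphic_double: "hopf_isomorphic UH (drinfeld_double A' B' p)"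
proof -
  interpret V: uq_rep A q K.En v by (rule uq_rep_End)
  let ?\<Phi> = "quot_free_lift K.En v"
  have h: "?\<Phi> \<in> algebra_homs U K.En" by (rule V.Uq_lift_hom[OF serre_L serre_R])
  have gen: "?\<Phi> (g x) = v x" for x by (rule V.Uq_lift_gen[OF serre_L serre_R])
  note hs = alg_one[OF h] alg_mult[OF h] alg_add[OF h] alg_smult[OF h]
  show ?thesis
  proof (rule hopf_isomorphic_drinfeld_double[OF A'_def B'_def hopf_Uq sub_bialg_ge sub_bialg_le K.skew_pairing_axioms
        antipode_UH(3) antipode_sub])
    show "?\<Phi> \<in> algebra_homs UH K.En" using h by (simp add: algebra_homs_Uq)
    show "?\<Phi> a = K.L a" if "a \<in> GE" for a
      using that by (induction rule: GE_induct) (simp_all add: gen hs L_alg GE_carrier)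
    show "?\<Phi> a = K.R a" if "a \<in> LE" for a
      using that by (induction rule: LE_induct) (simp_all add: gen hs R_alg LE_carrier)
    show "carrier UH \<subseteq> tensor_lift UH (monoid.mult UH) ` carrier (tensor_module A' B')"
      unfolding A'_def B'_def by (rule mult_surjective)
  qed
qed

end

end

theorem corollary21:
  fixes A :: "'i::finite \<Rightarrow> 'i \<Rightarrow> int"
    and q :: "'i \<Rightarrow> 'i \<Rightarrow> 'k::field_char_0"
    and pairing :: "('i, 'k) Uq_elem \<Rightarrow> ('i, 'k) Uq_elem \<Rightarrow> 'k"
  assumes "symmetrizable_gcm A"
    and "constrained_indeterminates A q"
    and "\<And>i m. m > 0 \<Longrightarrow> \<exists>r. r ^ m = q i i"
    and "\<And>i m. m > 0 \<Longrightarrow> q i i ^ m \<noteq> 1"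
    and "Uq_pairing A q pairing"
  shows "hopf_isomorphic (Uq A q) (drinfeld_double (Uq_ge A q) (Uq_le A q) pairing)"
proof -
  interpret uq_pairing A q pairing
    using assms by (auto simp: uq_pairing_def uq_pairing_axioms_def uq_def symmetrizable_gcm_def constrained_indeterminates_def)
  show ?thesis unfolding Uq_ge_eq Uq_le_eq by (rule hopf_isomorphic_double[OF refl refl])
qed

end
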